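(* Let $d\ge1$, $\alpha\in(0,1]$, $\sigma\in[0,1)$ with $\sigma<\alpha$, and assume that $(K,m)$ satisfies the conditions of Case (I) (see context). Let $\theta_0\in L^\infty(\mathbb{R}^d)$ and, for $\epsilon>0$, let $\theta^\epsilon\in C([0,\infty);H^s(\mathbb{R}^d))$, $s>1+\frac d2$, be a smooth solution of the regularized drift-diffusion equation $$\partial_t\theta^\epsilon+u^\epsilon\cdot\nabla\theta^\epsilon+\mathcal{L}\theta^\epsilon-\epsilon\Delta\theta^\epsilon=0,\quad u^\epsilon=\mathcal{P}(\theta^\epsilon),\quad\theta^\epsilon|_{t=0}=\phi_\epsilon*(\theta_01_{B_{1/\epsilon}}).$$ Then there exists a time $t_1>0$ independent of $\epsilon$ such that for every $\beta\in(1-\alpha+\sigma,1)$, $$\sup_{t\in[t_1,\infty)}\|\theta^\epsilon(t)\|_{\dot C^\beta(\mathbb{R}^d)}\le C(\|\theta_0\|_{L^\infty},d,\alpha,\beta,\sigma),$$ with $C$ independent of $\epsilon$. Moreover, if $\alpha\in(0,1)$ and $\sigma=0$ in the condition that $(\alpha-\sigma)\frac{m(|y|)}{|y|}\le m'(|y|)\le\alpha\frac{m(|y|)}{|y|}$ for all $|y|>0$, then one has the following explicit estimates: there are constants $C,C',C''>0$ depending only on $d$ such that, for every $\beta\in(1-\alpha,1)$, setting $$\gamma=\frac1C\min\{(1-\beta)^3\alpha,\ \beta(1-\beta)^2\},$$ the time $t_1$ (chosen for this $\beta$) satisfies $$t_1\le\frac{C'}{1-\beta}\left(\frac{4(1-\alpha)}{\alpha\gamma}\right)^{\frac{\alpha}{1-\alpha}}\|\theta_0\|_{L^\infty}^{\frac{\alpha}{1-\alpha}}$$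 and $$\sup_{t\in[t_1,\infty)}\|\theta^\epsilon(t)\|_{\dot C^\beta(\mathbb{R}^d)}\le\frac{(1-\beta)^2}{C''}\left(\frac{1-\alpha}{\alpha\gamma}\right)^{-\frac{\beta-1+\alpha}{1-\alpha}}\|\theta_0\|_{L^\infty}^{-\frac{\beta-1+\alpha}{1-\alpha}}.$$
   Context: Velocity operator: $$\mathcal{P}(\theta)(x)=a\,\theta(x)+\mathrm{p.v.}\int_{\mathbb{R}^d}S(y)\,\theta(x+y)\,dy,$$ with $a\in\mathbb{R}^d$ and $S(x)=\Psi(x/|x|)/|x|^d\in C(\mathbb{R}^d\setminus\{0\};\mathbb{R}^d)$, whose components are Calderón–Zygmund kernels in the standard sense (in particular $\Psi$ has zero average on the unit sphere). Diffusion: $\mathcal{L}f(x)=\mathrm{p.v.}\int_{\mathbb{R}^d}(f(x)-f(x+y))K(y)\,dy$ with $K(y)=K(|y|)$ radial on $\mathbb{R}^d\setminus\{0\}$. Case (I): there is $c_1\ge1$ with $$c_1^{-1}\frac{m(|y|^{-1})}{|y|^d}\le K(y)\le c_1\frac{m(|y|^{-1})}{|y|^d}\quad\text{for all }|y|>0,$$ where $m(y)=m(|y|)$ is radial and satisfies: (A1) $m(|y|)$ is smooth away from zero, non-decreasing, $m(0)=0$, $\lim_{|y|\to\infty}m(|y|)=\infty$; (A3) with the constant $\sigma\in[0,\alpha)$, $(\alpha-\sigma)\frac{m(|y|)}{|y|}\le m'(|y|)\le\alpha\frac{m(|y|)}{|y|}$ for all $|y|>0$. (When $\sigma=0$ this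 means $m(y)=C_0|y|^\alpha$ for a constant $C_0>0$.) Regularization: $\phi\in C_c^\infty(\mathbb{R}^d)$ is the standard mollifier, $\phi_\epsilon(x)=\epsilon^{-d}\phi(x/\epsilon)$, $1_{B_{1/\epsilon}}$ is the indicator of the ball $B_{1/\epsilon}$ of radius $1/\epsilon$ centred at $0$. The seminorm is $\|f\|_{\dot C^\beta}=\sup_{x\ne y}|f(x)-f(y)|/|x-y|^\beta$. The operators $\mathcal{L}$ and $\mathcal{P}$ (i.e. $K$, $m$, $c_1$, $C_0$, $a$, $\Psi$) are regarded as fixed, and the dependence of constants on them is not displayed. *)

theory Defs
  imports "HOL-Analysis.Analysis" "HOL-Probability.Essential_Supremum"
begin

(* Intended for open S only: the derivative is taken at x, not within S.  All directional
   derivatives of order at most k exist, are differentiable below order k, and are continuous. *)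

fun Ck_on :: "nat \<Rightarrow> 'a::real_normed_vector set \<Rightarrow> ('a \<Rightarrow> 'b::real_normed_vector) \<Rightarrow> bool" where
  "Ck_on 0 S f \<longleftrightarrow> continuous_on S f"
| "Ck_on (Suc k) S f \<longleftrightarrow>
     f differentiable_on S \<and> (\<forall>v. Ck_on k S (\<lambda>x. frechet_derivative f (at x) v))"

definition smooth_on :: "'a::real_normed_vector set \<Rightarrow> ('a \<Rightarrow> 'b::real_normed_vector) \<Rightarrow> bool" where
  "smooth_on S f \<longleftrightarrow> (\<forall>k. Ck_on k S f)"

definition partial :: "'d::finite \<Rightarrow> (real^'d \<Rightarrow> real) \<Rightarrow> real^'d \<Rightarrow> real" where
  "partial i f x = frechet_derivative f (at x) (axis i 1)"

definition gradient :: "(real^'d::finite \<Rightarrow> real) \<Rightarrow> real^'d \<Rightarrow> real^'d" where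
  "gradient f x = (\<chi> i. partial i f x)"

definition laplacian :: "(real^'d::finite \<Rightarrow> real) \<Rightarrow> real^'d \<Rightarrow> real" where
  "laplacian f x = (\<Sum>i\<in>UNIV. partial i (partial i f) x)"

definition Linf_enorm :: "('a::euclidean_space \<Rightarrow> real) \<Rightarrow> ereal" where
  "Linf_enorm f = esssup lebesgue (\<lambda>x. ereal \<bar>f x\<bar>)"

definition Linf :: "('a::euclidean_space \<Rightarrow> real) set" where
  "Linf = {f. f \<in> borel_measurable lebesgue \<and> Linf_enorm f < \<infinity>}"

definition Linf_norm :: "('a::euclidean_space \<Rightarrow> real) \<Rightarrow> real" where
  "Linf_norm f = real_of_ereal (Linf_enorm f)"

definition holder_seminorm :: "real \<Rightarrow> ('a::euclidean_space \<Rightarrow> real) \<Rightarrow> ereal" where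
  "holder_seminorm \<beta> f =
     (SUP (x, y)\<in>{(x, y). x \<noteq> y}. ereal (\<bar>f x - f y\<bar> / norm (x - y) powr \<beta>))"

(* The Fourier transform on L^2 is the L^2-limit (Plancherel) of the Fourier integrals of the
   truncations f * 1_{B_R}, so it is determined only up to null sets.  The normalisation is
   irrelevant for the Sobolev spaces below. *)

definition fourier_trunc :: "('a::euclidean_space \<Rightarrow> real) \<Rightarrow> real \<Rightarrow> 'a \<Rightarrow> complex" where
  "fourier_trunc f R \<xi> =
     (LINT x:ball 0 R|lebesgue. complex_of_real (f x) * exp (- (\<i> * complex_of_real (x \<bullet> \<xi>))))"

definition is_L2_fourier :: "('a::euclidean_space \<Rightarrow> real) \<Rightarrow> ('a \<Rightarrow> complex) \<Rightarrow> bool" where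
  "is_L2_fourier f g \<longleftrightarrow> g \<in> borel_measurable lebesgue \<and>
     ((\<lambda>R. \<integral>\<^sup>+ \<xi>. ennreal ((cmod (g \<xi> - fourier_trunc f R \<xi>))\<^sup>2) \<partial>lebesgue) \<longlongrightarrow> 0) at_top"

definition L2_fourier :: "('a::euclidean_space \<Rightarrow> real) \<Rightarrow> 'a \<Rightarrow> complex" where
  "L2_fourier f = (SOME g. is_L2_fourier f g)"

definition L2 :: "('a::euclidean_space \<Rightarrow> real) set" where
  "L2 = {f. f \<in> borel_measurable lebesgue \<and> (\<integral>\<^sup>+ x. ennreal ((f x)\<^sup>2) \<partial>lebesgue) < \<infinity>}"

definition sobolev_sqnorm :: "real \<Rightarrow> ('a::euclidean_space \<Rightarrow> real) \<Rightarrow> ennreal" where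
  "sobolev_sqnorm s f =
     (\<integral>\<^sup>+ \<xi>. ennreal ((1 + (norm \<xi>)\<^sup>2) powr s * (cmod (L2_fourier f \<xi>))\<^sup>2) \<partial>lebesgue)"

definition sobolev :: "real \<Rightarrow> ('a::euclidean_space \<Rightarrow> real) set" where
  "sobolev s = {f \<in> L2. sobolev_sqnorm s f < \<infinity>}"

definition continuous_into_sobolev :: "real \<Rightarrow> (real \<Rightarrow> 'a::euclidean_space \<Rightarrow> real) \<Rightarrow> bool" where
  "continuous_into_sobolev s \<theta> \<longleftrightarrow>
     (\<forall>t\<ge>0. \<theta> t \<in> sobolev s) \<and>
     (\<forall>t\<^sub>0\<ge>0. ((\<lambda>t. sobolev_sqnorm s (\<lambda>x. \<theta> t x - \<theta> t\<^sub>0 x)) \<longlongrightarrow> 0) (at t\<^sub>0 within {0..}))"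

definition pv_integral :: "('a::euclidean_space \<Rightarrow> 'b::euclidean_space) \<Rightarrow> 'b" where
  "pv_integral f = Lim (at_right 0) (\<lambda>r. LINT y:{y. r < norm y}|lebesgue. f y)"

definition velocity_kernel :: "(real^'d::finite \<Rightarrow> real^'d) \<Rightarrow> real^'d \<Rightarrow> real^'d" where
  "velocity_kernel \<Psi> x = (1 / norm x ^ CARD('d)) *\<^sub>R \<Psi> ((1 / norm x) *\<^sub>R x)"

(* Convolution-type Calderon-Zygmund kernels: size, Hoermander smoothness and cancellation.
   For velocity_kernel the cancellation says that Psi has zero average on the unit sphere
   (polar coordinates). *)
definition cz_kernel :: "(real^'d::finite \<Rightarrow> real) \<Rightarrow> bool" where
  "cz_kernel k \<longleftrightarrow> (\<exists>B.
     (\<forall>x. x \<noteq> 0 \<longrightarrow> \<bar>k x\<bar> \<le> B / norm x ^ CARD('d)) \<and>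
     (\<forall>y. y \<noteq> 0 \<longrightarrow>
        (\<integral>\<^sup>+ x\<in>{x. 2 * norm y < norm x}. ennreal \<bar>k x - k (x - y)\<bar> \<partial>lebesgue) \<le> ennreal B) \<and>
     (\<forall>r s. 0 < r \<and> r < s \<longrightarrow> (LINT x:{x. r < norm x \<and> norm x < s}|lebesgue. k x) = 0))"

definition admissible_velocity :: "(real^'d::finite \<Rightarrow> real^'d) \<Rightarrow> bool" where
  "admissible_velocity \<Psi> \<longleftrightarrow> continuous_on (- {0}) (velocity_kernel \<Psi>) \<and>
     (\<forall>i. cz_kernel (\<lambda>x. velocity_kernel \<Psi> x $ i))"

definition velocity_op ::
  "real^'d \<Rightarrow> (real^'d \<Rightarrow> real^'d) \<Rightarrow> (real^'d::finite \<Rightarrow> real) \<Rightarrow> real^'d \<Rightarrow> real^'d" where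
  "velocity_op a \<Psi> \<theta> x = \<theta> x *\<^sub>R a + pv_integral (\<lambda>y. \<theta> (x + y) *\<^sub>R velocity_kernel \<Psi> y)"

definition diffusion_op ::
  "(real^'d \<Rightarrow> real) \<Rightarrow> (real^'d::finite \<Rightarrow> real) \<Rightarrow> real^'d \<Rightarrow> real" where
  "diffusion_op K f x = pv_integral (\<lambda>y. (f x - f (x + y)) * K y)"

(* m is given by its radial profile on [0,\<infinity>); its values on negative reals play no role. *)
definition case_I ::
  "(real^'d::finite \<Rightarrow> real) \<Rightarrow> (real \<Rightarrow> real) \<Rightarrow> real \<Rightarrow> real \<Rightarrow> real \<Rightarrow> bool" where
  "case_I K m c\<^sub>1 \<alpha> \<sigma> \<longleftrightarrow>
     K \<in> borel_measurable lebesgue \<and>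
     (\<forall>x y. x \<noteq> 0 \<and> norm x = norm y \<longrightarrow> K x = K y) \<and>
     1 \<le> c\<^sub>1 \<and>
     (\<forall>y. y \<noteq> 0 \<longrightarrow>
        inverse c\<^sub>1 * (m (inverse (norm y)) / norm y ^ CARD('d)) \<le> K y \<and>
        K y \<le> c\<^sub>1 * (m (inverse (norm y)) / norm y ^ CARD('d))) \<and>
     smooth_on {0<..} m \<and> mono_on {0..} m \<and> m 0 = 0 \<and> filterlim m at_top at_top \<and>
     (\<forall>r>0. (\<alpha> - \<sigma>) * (m r / r) \<le> deriv m r \<and> deriv m r \<le> \<alpha> * (m r / r))"

definition bump :: "'a::euclidean_space \<Rightarrow> real" where
  "bump x = (if norm x < 1 then exp (1 / ((norm x)\<^sup>2 - 1)) else 0)"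

definition standard_mollifier :: "'a::euclidean_space \<Rightarrow> real" where
  "standard_mollifier x = bump x / (LINT y|lebesgue. bump (y :: 'a))"

definition mollifier :: "real \<Rightarrow> 'a::euclidean_space \<Rightarrow> real" where
  "mollifier \<epsilon> x = standard_mollifier ((1 / \<epsilon>) *\<^sub>R x) / \<epsilon> ^ DIM('a)"

definition regularized_datum :: "real \<Rightarrow> ('a::euclidean_space \<Rightarrow> real) \<Rightarrow> 'a \<Rightarrow> real" where
  "regularized_datum \<epsilon> \<theta>\<^sub>0 x =
     (LINT y|lebesgue. mollifier \<epsilon> (x - y) * (\<theta>\<^sub>0 y * indicator (ball 0 (1 / \<epsilon>)) y))"

definition regularized_solution ::
  "real^'d \<Rightarrow> (real^'d \<Rightarrow> real^'d) \<Rightarrow> (real^'d \<Rightarrow> real) \<Rightarrow> (real^'d::finite \<Rightarrow> real) \<Rightarrow> real \<Rightarrow>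
   (real \<Rightarrow> real^'d \<Rightarrow> real) \<Rightarrow> bool" where
  "regularized_solution a \<Psi> K \<theta>\<^sub>0 \<epsilon> \<theta> \<longleftrightarrow>
     (\<exists>s > 1 + real CARD('d) / 2. continuous_into_sobolev s \<theta>) \<and>
     smooth_on ({0<..} \<times> UNIV) (\<lambda>(t, x). \<theta> t x) \<and>
     (\<forall>t>0. \<forall>x.
        deriv (\<lambda>\<tau>. \<theta> \<tau> x) t + velocity_op a \<Psi> (\<theta> t) x \<bullet> gradient (\<theta> t) x
          + diffusion_op K (\<theta> t) x - \<epsilon> * laplacian (\<theta> t) x = 0) \<and>
     \<theta> 0 = regularized_datum \<epsilon> \<theta>\<^sub>0"

end

theory Submission
  imports Defs "HOL-Probability.Probability" "HOL-Real_Asymp.Real_Asymp"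
begin

text \<open>
  The proof follows a modulus of continuity through the evolution. Given a concave \<open>\<omega>\<close> with slope \<open>p\<close>,
  let \<open>W\<^sub>r\<close> agree with \<open>\<omega>\<close> on \<open>[r, \<infinity>)\<close> and with its tangent at \<open>r\<close> on \<open>[0, r]\<close>. Since \<open>W\<^sub>r(0) > 0\<close>,
  every bounded function satisfies \<open>\<theta>(x) - \<theta>(y) < W\<^sub>r(|x - y|)\<close> for large \<open>r\<close>, so the initial datum does.
  Let \<open>r\<close> decrease in time. At a first time and point of touching \<open>\<theta>(x) - \<theta>(y) = W\<^sub>r(|x - y|)\<close> the gradients
  at \<open>x\<close> and \<open>y\<close> both equal \<open>p\<close> times the direction of \<open>x - y\<close>, the Laplacian helps, and the dissipation
  \<open>D = L\<theta>(x) - L\<theta>(y)\<close> is at least a multiple of \<open>m(1/r) (\<omega>(r) - r p(r))\<close>. The difference of the drift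
  velocities is bounded near the diagonal by \<open>D\<close> itself, because the kernel \<open>S\<close> is dominated there by \<open>K\<close>,
  and away from it by \<open>\<Sum>j. \<omega>(2\<^sup>j r) / 2\<^sup>j\<close>. If \<open>p\<close> is small compared with \<open>m(1/r)\<close>, dissipation wins as long as
  \<open>r\<close> does not decrease too fast, and \<open>r\<close> reaches \<open>0\<close> in a time independent of \<open>\<epsilon>\<close>. From then on \<open>\<omega>\<close> itself
  is a modulus of continuity of the solution.
\<close>

subsection \<open>Fourier inversion and the Sobolev embedding\<close>

text \<open>A first touching exists only if violations cannot escape to infinity, so each solution
  must decay in space uniformly on bounded time intervals and be continuous in time in the sup norm.
  Both come from continuity in H^s through the Sobolev embedding. Since \<open>L2_fourier\<close> is
  an arbitrary choice among L^2 limits, the embedding rests on an inversion formula valid for every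
  such limit. The dissipation D is spent as follows: one half absorbs the drift near the diagonal,
  one quarter the drift away from it, and the last quarter pays for the decrease of
  \<open>r\<close>. For a modulus with \<open>s * p s \<le> b * \<omega> s\<close> the second demand
  takes the form \<open>p r \<le> c * (1 - b)^2 * m (1 / r)\<close>: one factor \<open>1 - b\<close>
  comes from \<open>\<omega> r - r * p r\<close>, the other from the dyadic sum. Two moduli are
  used. The explicit estimate allows the time to depend on \<beta>, so a modulus of exponent \<beta>
  near the origin serves. The general statement fixes the time before \<beta> and needs one modulus
  below a multiple of every admissible power.\<close>

lemma gauss_fourier_real:
  assumes "\<delta> > 0"
  shows "integrable lborel (\<lambda>x::real. exp (- \<delta> * x\<^sup>2 / 2))"
    and "(LINT x|lborel. complex_of_real (exp (- \<delta> * x\<^sup>2 / 2)) * exp (\<i> * complex_of_real (t * x)))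
       = complex_of_real (sqrt (2 * pi / \<delta>) * exp (- t\<^sup>2 / (2 * \<delta>)))"
proof -
  \<comment> \<open>Rescaling by \<open>c\<close> turns the integrand into the standard normal
    density, whose characteristic function is known.\<close>
  define c where "c = sqrt \<delta>"
  have c: "c > 0" "c\<^sup>2 = \<delta>" using assms by (auto simp: c_def)
  have std: "(\<lambda>x. exp (- \<delta> * x\<^sup>2 / 2)) = (\<lambda>x. sqrt (2 * pi) * std_normal_density (0 + c * x))"
    by (auto simp: std_normal_density_def power_mult_distrib c(2))
  show "integrable lborel (\<lambda>x::real. exp (- \<delta> * x\<^sup>2 / 2))"
    unfolding std using c by (intro integrable_mult_right lborel_integrable_real_affine) auto
  have "char std_normal_distribution (t / c) = complex_of_real (exp (- ((t/c)^2) / 2))"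
    by (simp add: char_std_normal_distribution)
  also have "char std_normal_distribution (t / c) = (LINT x|lborel. std_normal_density x *\<^sub>R iexp (t / c * x))"
    unfolding char_def by (subst integral_density) auto
  also have "\<dots> = c *\<^sub>R (LINT x|lborel. std_normal_density (0 + c * x) *\<^sub>R iexp (t / c * (0 + c * x)))"
    using c by (subst lborel_integral_real_affine[where c=c and t=0]) auto
  also have "(LINT x|lborel. std_normal_density (0 + c * x) *\<^sub>R iexp (t / c * (0 + c * x)))
     = (LINT x|lborel. (1 / sqrt (2 * pi)) *\<^sub>R (complex_of_real (exp (- \<delta> * x\<^sup>2 / 2)) * exp (\<i> * complex_of_real (t * x))))"
    using c by (intro Bochner_Integration.integral_cong refl)
      (simp add: std_normal_density_def power_mult_distrib scaleR_conv_of_real field_simps)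
  also have "\<dots> = (1 / sqrt (2 * pi)) *\<^sub>R (LINT x|lborel. (complex_of_real (exp (- \<delta> * x\<^sup>2 / 2)) * exp (\<i> * complex_of_real (t * x))))"
    by (rule integral_scaleR_right)
  finally have "(LINT x|lborel. (complex_of_real (exp (- \<delta> * x\<^sup>2 / 2)) * exp (\<i> * complex_of_real (t * x))))
     = complex_of_real (sqrt (2 * pi) / c * exp (- ((t/c)^2) / 2))"
    using c by (simp add: scaleR_conv_of_real field_simps)
  also have "sqrt (2 * pi) / c * exp (- ((t/c)^2) / 2) = sqrt (2 * pi / \<delta>) * exp (- t\<^sup>2 / (2 * \<delta>))"
    using c by (simp add: c_def real_sqrt_divide power_divide)
  finally show "(LINT x|lborel. complex_of_real (exp (- \<delta> * x\<^sup>2 / 2)) * exp (\<i> * complex_of_real (t * x)))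
       = complex_of_real (sqrt (2 * pi / \<delta>) * exp (- t\<^sup>2 / (2 * \<delta>)))" .
qed

text \<open>The Fourier transform of the weight \<open>exp (- \<delta> * (norm x)^2 / 2)\<close>. In
  the convention of \<open>ft\<close> its mass is \<open>(2 * pi) ^ DIM('a)\<close> for every
  \<delta>, and it concentrates at 0 as \<delta> tends to 0.\<close>

definition gauss_kernel :: "real \<Rightarrow> 'a::euclidean_space \<Rightarrow> real" where
  "gauss_kernel \<delta> v = sqrt (2 * pi / \<delta>) ^ DIM('a) * exp (- (norm v)\<^sup>2 / (2 * \<delta>))"

lemma gauss_kernel_pos: "\<delta> > 0 \<Longrightarrow> gauss_kernel \<delta> v > 0"
  by (simp add: gauss_kernel_def)

lemma gauss_kernel_measurable[measurable]: "gauss_kernel \<delta> \<in> borel_measurable borel"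
  unfolding gauss_kernel_def[abs_def] by measurable

text \<open>Lebesgue measure is the image of a product of one-dimensional Lebesgue measures, and
  both the Gaussian and the exponential factor over the coordinates.\<close>

lemma gauss_fourier:
  fixes v :: "'a::euclidean_space"
  assumes "\<delta> > 0"
  shows "integrable lborel (\<lambda>x::'a. exp (- \<delta> * (norm x)\<^sup>2 / 2))"
    and "(LINT x|lborel. complex_of_real (exp (- \<delta> * (norm x)\<^sup>2 / 2)) * exp (\<i> * complex_of_real (v \<bullet> x)))
       = complex_of_real (gauss_kernel \<delta> v)"
proof -
  interpret product_sigma_finite "\<lambda>_::'a. lborel :: real measure" ..
  have norm_eq: "(norm (\<Sum>b\<in>Basis. f b *\<^sub>R b :: 'a))\<^sup>2 = (\<Sum>b\<in>Basis. (f b)\<^sup>2)" for f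
    by (subst power2_norm_eq_inner, subst euclidean_inner)
       (auto simp: power2_eq_square intro!: sum.cong)
  have inner_eq: "v \<bullet> (\<Sum>b\<in>Basis. f b *\<^sub>R b :: 'a) = (\<Sum>b\<in>Basis. (v \<bullet> b) * f b)" for f
    by (simp add: inner_sum_right mult.commute)
  let ?g = "\<lambda>x. complex_of_real (exp (- \<delta> * (norm x)\<^sup>2 / 2)) * exp (\<i> * complex_of_real (v \<bullet> x))"
  let ?h = "\<lambda>b x. complex_of_real (exp (- \<delta> * x\<^sup>2 / 2)) * exp (\<i> * complex_of_real ((v \<bullet> b) * x))"
  have [measurable]: "(\<lambda>f. \<Sum>b\<in>Basis. f b *\<^sub>R b :: 'a) \<in> measurable (\<Pi>\<^sub>M b\<in>Basis. lborel) borel"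
    by measurable
  have g_eq: "?g (\<Sum>b\<in>Basis. f b *\<^sub>R b) = (\<Prod>b\<in>Basis. ?h b (f b))" for f
    unfolding norm_eq inner_eq prod.distrib
    by (simp add: sum_distrib_left exp_sum[symmetric] sum_negf[symmetric] sum_divide_distrib
        flip: of_real_prod)
  have h_int: "integrable lborel (?h b)" for b
    by (rule Bochner_Integration.integrable_bound[OF gauss_fourier_real(1)[OF assms]])
       (auto simp: norm_mult)
  have r_eq: "exp (- \<delta> * (norm (\<Sum>b\<in>Basis. f b *\<^sub>R b :: 'a))\<^sup>2 / 2) = (\<Prod>b\<in>Basis. exp (- \<delta> * (f b)\<^sup>2 / 2))" for f
    unfolding norm_eq
    by (simp add: sum_distrib_left exp_sum[symmetric] sum_negf[symmetric] sum_divide_distrib)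
  show "integrable lborel (\<lambda>x::'a. exp (- \<delta> * (norm x)\<^sup>2 / 2))"
  proof -
    have "integrable (\<Pi>\<^sub>M b\<in>Basis. lborel) (\<lambda>f. \<Prod>b\<in>(Basis::'a set). exp (- \<delta> * (f b)\<^sup>2 / 2))"
      by (rule product_integrable_prod) (auto simp del: integrable_mult_left_iff intro: gauss_fourier_real(1)[OF assms, simplified])
    then have "integrable (\<Pi>\<^sub>M b\<in>Basis. lborel) (\<lambda>f. exp (- \<delta> * (norm (\<Sum>b\<in>Basis. f b *\<^sub>R b :: 'a))\<^sup>2 / 2))"
      by (simp only: r_eq)
    then show ?thesis
      by (subst lborel_eq, subst integrable_distr_eq) auto
  qed
  have "(LINT x|lborel. ?g x) = (LINT f|(\<Pi>\<^sub>M b\<in>Basis. lborel). ?g (\<Sum>b\<in>Basis. f b *\<^sub>R b))"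
    by (subst lborel_eq, subst integral_distr) auto
  also have "\<dots> = (\<Prod>b\<in>Basis. LINT x|lborel. ?h b x)"
    unfolding g_eq by (rule product_integral_prod[OF finite_Basis h_int])
  also have "\<dots> = (\<Prod>b\<in>(Basis::'a set). complex_of_real (sqrt (2 * pi / \<delta>) * exp (- (v \<bullet> b)\<^sup>2 / (2 * \<delta>))))"
    by (intro prod.cong refl gauss_fourier_real(2)[OF assms])
  also have "\<dots> = complex_of_real (\<Prod>b\<in>(Basis::'a set). (sqrt (2 * pi / \<delta>) * exp (- (v \<bullet> b)\<^sup>2 / (2 * \<delta>))))"
    by simp
  also have "(\<Prod>b\<in>(Basis::'a set). (sqrt (2 * pi / \<delta>) * exp (- (v \<bullet> b)\<^sup>2 / (2 * \<delta>)))) = gauss_kernel \<delta> v"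
  proof -
    have "(norm v)\<^sup>2 = (\<Sum>b\<in>Basis. (v \<bullet> b)\<^sup>2)"
      by (subst power2_norm_eq_inner, subst euclidean_inner) (simp add: power2_eq_square)
    then show ?thesis
      unfolding gauss_kernel_def prod.distrib
      by (simp add: exp_sum[symmetric] sum_negf[symmetric] sum_divide_distrib)
  qed
  finally show "(LINT x|lborel. ?g x) = complex_of_real (gauss_kernel \<delta> v)" .
qed

text \<open>The kernel is a multiple of the Gaussian weight with parameter
  \<open>1 / \<delta>\<close>, so its mass is a value of the Fourier formula at frequency 0; in each
  coordinate the two square roots multiply to \<open>2 * pi\<close>.\<close>

lemma gauss_kernel_integral:
  assumes "\<delta> > 0"
  shows "integrable lborel (gauss_kernel \<delta> :: 'a::euclidean_space \<Rightarrow> real)"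
    and "(LINT v|lborel. gauss_kernel \<delta> (v::'a)) = (2 * pi) ^ DIM('a)"
proof -
  have e: "gauss_kernel \<delta> = (\<lambda>v::'a. sqrt (2 * pi / \<delta>) ^ DIM('a) * exp (- (1/\<delta>) * (norm v)\<^sup>2 / 2))"
    by (auto simp: gauss_kernel_def)
  have p: "1 / \<delta> > 0" using assms by simp
  show "integrable lborel (gauss_kernel \<delta> :: 'a \<Rightarrow> real)"
    unfolding e by (intro integrable_mult_right gauss_fourier(1)[OF p])
  have "(LINT v|lborel. complex_of_real (exp (- (1/\<delta>) * (norm (v::'a))\<^sup>2 / 2))) = complex_of_real (gauss_kernel (1/\<delta>) (0::'a))"
    using gauss_fourier(2)[OF p, of "0::'a"] by simp
  then have "(LINT v|lborel. (exp (- (1/\<delta>) * (norm (v::'a))\<^sup>2 / 2))) = (gauss_kernel (1/\<delta>) (0::'a))"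
    by (simp only: integral_complex_of_real of_real_eq_iff)
  then have "(LINT v|lborel. gauss_kernel \<delta> (v::'a)) = sqrt (2 * pi / \<delta>) ^ DIM('a) * gauss_kernel (1/\<delta>) (0::'a)"
    unfolding e by simp
  also have "\<dots> = (sqrt (2 * pi / \<delta>) * sqrt (2 * pi * \<delta>)) ^ DIM('a)"
    by (simp add: gauss_kernel_def power_mult_distrib)
  also have "sqrt (2 * pi / \<delta>) * sqrt (2 * pi * \<delta>) = 2 * pi"
  proof -
    have "sqrt (2 * pi / \<delta>) * sqrt (2 * pi * \<delta>) = sqrt ((2 * pi)\<^sup>2)"
      using assms by (simp add: power2_eq_square flip: real_sqrt_mult)
    also have "\<dots> = 2 * pi" by (simp only: real_sqrt_abs) simp
    finally show ?thesis .
  qed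
  finally show "(LINT v|lborel. gauss_kernel \<delta> (v::'a)) = (2 * pi) ^ DIM('a)" .
qed


section \<open>Fourier integrals of integrable functions, Bessel's inequality and the L^2
  transform\<close>

lemma nn_integral_translate:
  fixes f :: "'a::euclidean_space \<Rightarrow> ennreal"
  assumes [measurable]: "f \<in> borel_measurable borel"
  shows "(\<integral>\<^sup>+y. f (x + y) \<partial>lborel) = (\<integral>\<^sup>+y. f y \<partial>lborel)"
    and "(\<integral>\<^sup>+y. f (x - y) \<partial>lborel) = (\<integral>\<^sup>+y. f y \<partial>lborel)"
proof -
  show "(\<integral>\<^sup>+y. f (x + y) \<partial>lborel) = (\<integral>\<^sup>+y. f y \<partial>lborel)"
    by (subst (2) lborel_distr_plus[of x, symmetric]) (simp add: nn_integral_distr)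
  show "(\<integral>\<^sup>+y. f (x - y) \<partial>lborel) = (\<integral>\<^sup>+y. f y \<partial>lborel)"
    by (subst (2) lborel_affine[of "-1" x]) (simp_all add: nn_integral_density nn_integral_distr)
qed

lemma integral_translate:
  fixes f :: "'a::euclidean_space \<Rightarrow> 'b::{banach, second_countable_topology}"
  assumes [measurable]: "f \<in> borel_measurable borel"
  shows "(LINT y|lborel. f (x + y)) = (LINT y|lborel. f y)"
    and "(LINT y|lborel. f (x - y)) = (LINT y|lborel. f y)"
    and "integrable lborel (\<lambda>y. f (x + y)) \<longleftrightarrow> integrable lborel f"
    and "integrable lborel (\<lambda>y. f (x - y)) \<longleftrightarrow> integrable lborel f"
proof -
  show "(LINT y|lborel. f (x + y)) = (LINT y|lborel. f y)"
    by (subst (2) lborel_distr_plus[of x, symmetric]) (simp add: integral_distr)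
  show "(LINT y|lborel. f (x - y)) = (LINT y|lborel. f y)"
    by (subst (2) lborel_affine[of "-1" x]) (simp_all add: integral_density integral_distr density_1)
  show "integrable lborel (\<lambda>y. f (x + y)) \<longleftrightarrow> integrable lborel f"
    by (subst (2) lborel_distr_plus[of x, symmetric]) (simp add: integrable_distr_eq)
  show "integrable lborel (\<lambda>y. f (x - y)) \<longleftrightarrow> integrable lborel f"
    by (subst (2) lborel_affine[of "-1" x]) (simp_all add: integrable_density integrable_distr_eq density_1)
qed

definition ft :: "('a::euclidean_space \<Rightarrow> real) \<Rightarrow> 'a \<Rightarrow> complex" where
  "ft h \<xi> = (LINT x|lborel. complex_of_real (h x) * exp (- (\<i> * complex_of_real (x \<bullet> \<xi>))))"

lemma norm_exp_ii[simp]: "norm (exp (\<i> * complex_of_real r)) = 1" "norm (exp (- (\<i> * complex_of_real r))) = 1"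
  using norm_exp_i_times[of r] norm_exp_i_times[of "-r"] by simp_all

lemma ft_measurable[measurable]:
  assumes [measurable]: "h \<in> borel_measurable borel"
  shows "ft h \<in> borel_measurable borel"
proof -
  have "(\<lambda>\<xi>. LINT x|lborel. complex_of_real (h x) * exp (- (\<i> * complex_of_real (x \<bullet> \<xi>)))) \<in> borel_measurable lborel"
    by (rule lborel.borel_measurable_lebesgue_integral) measurable
  then show ?thesis by (simp add: ft_def[abs_def])
qed

lemma ft_bound:
  assumes "integrable lborel h"
  shows "cmod (ft h \<xi>) \<le> (LINT x|lborel. \<bar>h x\<bar>)"
  unfolding ft_def using integral_norm_bound[of lborel "\<lambda>x. complex_of_real (h x) * exp (- (\<i> * complex_of_real (x \<bullet> \<xi>)))"]
  by (simp add: norm_mult)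

lemma ft_diff:
  assumes "integrable lborel h" "integrable lborel k"
  shows "ft (\<lambda>x. h x - k x) \<xi> = ft h \<xi> - ft k \<xi>"
proof -
  have *: "integrable lborel (\<lambda>x. complex_of_real (u x) * exp (- (\<i> * complex_of_real (x \<bullet> \<xi>))))"
    if "integrable lborel u" for u :: "'a \<Rightarrow> real"
    using that by (rule Bochner_Integration.integrable_bound) (use that in \<open>auto simp: norm_mult\<close>)
  show ?thesis unfolding ft_def
    by (subst Bochner_Integration.integral_diff[symmetric, OF *[OF assms(1)] *[OF assms(2)]])
       (simp add: algebra_simps)
qed

lemma integrable_tensor:
  fixes F :: "'a::euclidean_space \<Rightarrow> 'a \<Rightarrow> complex"
  assumes [measurable]: "(\<lambda>(x, y). F x y) \<in> borel_measurable (borel \<Otimes>\<^sub>M borel)"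
    and u: "integrable lborel u" and v: "integrable lborel v"
    and b: "\<And>x y. norm (F x y) \<le> \<bar>u x\<bar> * \<bar>v y\<bar>"
  shows "integrable (lborel \<Otimes>\<^sub>M lborel) (\<lambda>(x, y). F x y)"
proof (rule lborel_pair.Fubini_integrable)
  show "(\<lambda>(x, y). F x y) \<in> borel_measurable (lborel \<Otimes>\<^sub>M lborel)" by measurable
  have uv: "integrable lborel (\<lambda>x. \<bar>u x\<bar>)" "integrable lborel (\<lambda>x. \<bar>v x\<bar>)" using u v by auto
  have Fi: "integrable lborel (\<lambda>y. F x y)" for x
    by (rule Bochner_Integration.integrable_bound[of _ "\<lambda>y. \<bar>u x\<bar> * \<bar>v y\<bar>"]) (use uv b in auto)
  then show "AE x in lborel. integrable lborel (\<lambda>y. (\<lambda>(x, y). F x y) (x, y))" by simp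
  show "integrable lborel (\<lambda>x. LINT y|lborel. norm ((\<lambda>(x, y). F x y) (x, y)))"
  proof (rule Bochner_Integration.integrable_bound[of _ "\<lambda>x. \<bar>u x\<bar> * (LINT y|lborel. \<bar>v y\<bar>)"])
    show "AE x in lborel. norm (LINT y|lborel. norm ((\<lambda>(x, y). F x y) (x, y))) \<le> norm (\<bar>u x\<bar> * (LINT y|lborel. \<bar>v y\<bar>))"
    proof (rule AE_I2)
      fix x
      have "(LINT y|lborel. norm (F x y)) \<le> (LINT y|lborel. \<bar>u x\<bar> * \<bar>v y\<bar>)"
        using Fi uv b by (intro integral_mono) auto
      then show "norm (LINT y|lborel. norm ((\<lambda>(x, y). F x y) (x, y))) \<le> norm (\<bar>u x\<bar> * (LINT y|lborel. \<bar>v y\<bar>))"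
        by (simp add: abs_mult)
    qed
  qed (use uv in auto)
qed

text \<open>Fourier inversion for a function smoothed at scale \<open>sqrt \<delta>\<close>: the
  Gaussian weight makes the double integral absolutely convergent, and after Fubini the inner
  integral is \<open>gauss_fourier\<close> at \<open>x - y\<close>.\<close>

lemma ft_gauss:
  fixes h :: "'a::euclidean_space \<Rightarrow> real"
  assumes h: "integrable lborel h" and d: "\<delta> > 0"
  shows "(LINT \<xi>|lborel. ft h \<xi> * (exp (\<i> * complex_of_real (x \<bullet> \<xi>)) * complex_of_real (exp (- \<delta> * (norm \<xi>)\<^sup>2 / 2))))
      = complex_of_real (LINT y|lborel. h y * gauss_kernel \<delta> (x - y))"
proof -
  have [measurable]: "h \<in> borel_measurable borel" using h by auto
  define F where "F \<xi> y = complex_of_real (h y) * exp (- (\<i> * complex_of_real (y \<bullet> \<xi>))) *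
      (exp (\<i> * complex_of_real (x \<bullet> \<xi>)) * complex_of_real (exp (- \<delta> * (norm \<xi>)\<^sup>2 / 2)))" for \<xi> y
  have [measurable]: "(\<lambda>(\<xi>, y). F \<xi> y) \<in> borel_measurable (borel \<Otimes>\<^sub>M borel)"
    unfolding F_def by measurable
  have FI: "integrable (lborel \<Otimes>\<^sub>M lborel) (\<lambda>(\<xi>, y). F \<xi> y)"
    by (rule integrable_tensor[OF _ gauss_fourier(1)[OF d] h]) (auto simp: F_def norm_mult)
  have "(LINT \<xi>|lborel. ft h \<xi> * (exp (\<i> * complex_of_real (x \<bullet> \<xi>)) * complex_of_real (exp (- \<delta> * (norm \<xi>)\<^sup>2 / 2))))
     = (LINT \<xi>|lborel. LINT y|lborel. F \<xi> y)"
    unfolding ft_def F_def by simp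
  also have "\<dots> = (LINT y|lborel. LINT \<xi>|lborel. F \<xi> y)"
    by (rule lborel_pair.Fubini_integral[OF FI, symmetric])
  also have "\<dots> = (LINT y|lborel. complex_of_real (h y * gauss_kernel \<delta> (x - y)))"
  proof (rule Bochner_Integration.integral_cong[OF refl])
    fix y
    have "F \<xi> y = complex_of_real (h y) * (complex_of_real (exp (- \<delta> * (norm \<xi>)\<^sup>2 / 2)) * exp (\<i> * complex_of_real ((x - y) \<bullet> \<xi>)))" for \<xi>
      unfolding F_def by (simp add: inner_diff_left algebra_simps exp_diff exp_minus) (simp add: field_simps)
    then show "(LINT \<xi>|lborel. F \<xi> y) = complex_of_real (h y * gauss_kernel \<delta> (x - y))"
      using gauss_fourier(2)[OF d, of "x - y"] by simp
  qed
  also have "\<dots> = complex_of_real (LINT y|lborel. h y * gauss_kernel \<delta> (x - y))"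
    by (rule integral_complex_of_real)
  finally show ?thesis .
qed

lemma cnj_ft: "cnj (ft h \<xi>) = (LINT x|lborel. complex_of_real (h x) * exp (\<i> * complex_of_real (x \<bullet> \<xi>)))"
proof -
  have "cnj (ft h \<xi>) = (LINT x|lborel. cnj (complex_of_real (h x) * exp (- (\<i> * complex_of_real (x \<bullet> \<xi>)))))"
    unfolding ft_def by (rule Bochner_Integration.integral_cnj[symmetric])
  then show ?thesis by (simp add: exp_cnj del: Bochner_Integration.integral_cnj)
qed

lemma ennreal_integral_le: "ennreal (integral\<^sup>L M f) \<le> (\<integral>\<^sup>+x. ennreal (norm (f x)) \<partial>M)" for f :: "_ \<Rightarrow> real"
proof (cases "integrable M f")
  case True
  have "ennreal (integral\<^sup>L M f) \<le> ennreal (norm (integral\<^sup>L M f))" by (intro ennreal_leI) simp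
  also have "\<dots> \<le> (\<integral>\<^sup>+x. ennreal (norm (f x)) \<partial>M)" by (rule integral_norm_bound_ennreal[OF True])
  finally show ?thesis .
qed (simp add: not_integrable_integral_eq)

lemma ennreal_halves: "a / 2 + a / 2 = (a::ennreal)"
proof -
  have "a / 2 + a / 2 = (a + a) / 2" by (simp add: add_divide_distrib_ennreal)
  also have "a + a = a * 2" by (simp add: mult_2_right)
  also have "a * 2 / 2 = a" by (rule mult_divide_eq_ennreal) auto
  finally show ?thesis .
qed

text \<open>Only the inequality half of Plancherel's theorem is needed. With a Gaussian weight both sides are
  double integrals over \<open>h(x) h(y)\<close>, and the weight is removed by Fatou's lemma.\<close>

lemma bessel_gauss:
  fixes h :: "'a::euclidean_space \<Rightarrow> real"
  assumes h: "integrable lborel h" and h2: "integrable lborel (\<lambda>x. (h x)\<^sup>2)" and d: "\<delta> > 0"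
  shows "(\<integral>\<^sup>+\<xi>. ennreal ((cmod (ft h \<xi>))\<^sup>2 * exp (- \<delta> * (norm \<xi>)\<^sup>2 / 2)) \<partial>lborel)
    \<le> ennreal ((2 * pi) ^ DIM('a) * (LINT x|lborel. (h x)\<^sup>2))"
proof -
  have [measurable]: "h \<in> borel_measurable borel" using h by auto
  let ?e = "\<lambda>\<xi>::'a. exp (- \<delta> * (norm \<xi>)\<^sup>2 / 2)"
  define I where "I = (LINT x|lborel. \<bar>h x\<bar>)"
  have ftI: "cmod (ft h \<xi>) \<le> I" for \<xi> using ft_bound[OF h] by (simp add: I_def)
  have I0: "I \<ge> 0" by (simp add: I_def)
  define F where "F \<xi> x = complex_of_real (h x) * (ft h \<xi> * (exp (\<i> * complex_of_real (x \<bullet> \<xi>)) * complex_of_real (?e \<xi>)))" for \<xi> x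
  have [measurable]: "(\<lambda>(\<xi>, y). F \<xi> y) \<in> borel_measurable (borel \<Otimes>\<^sub>M borel)"
    unfolding F_def by measurable
  have eI: "integrable lborel (\<lambda>\<xi>. I * ?e \<xi>)"
    using gauss_fourier(1)[OF d] by (rule integrable_mult_right)
  have FI: "integrable (lborel \<Otimes>\<^sub>M lborel) (\<lambda>(\<xi>, y). F \<xi> y)"
    using ftI I0 by (intro integrable_tensor[OF _ eI h])
      (auto simp: F_def norm_mult abs_mult mult.commute intro!: mult_left_mono)
  have int: "integrable lborel (\<lambda>\<xi>. (cmod (ft h \<xi>))\<^sup>2 * ?e \<xi>)"
    by (rule Bochner_Integration.integrable_bound[OF integrable_mult_right[OF gauss_fourier(1)[OF d], of "I\<^sup>2"]])
       (use ftI I0 in \<open>auto intro!: mult_right_mono power_mono\<close>)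
  have "complex_of_real (LINT \<xi>|lborel. (cmod (ft h \<xi>))\<^sup>2 * ?e \<xi>) = (LINT \<xi>|lborel. complex_of_real ((cmod (ft h \<xi>))\<^sup>2 * ?e \<xi>))"
    by (rule integral_complex_of_real[symmetric])
  also have "\<dots> = (LINT \<xi>|lborel. LINT x|lborel. F \<xi> x)"
  proof (rule Bochner_Integration.integral_cong[OF refl])
    fix \<xi>
    have "(LINT x|lborel. F \<xi> x) = (LINT x|lborel. (complex_of_real (h x) * exp (\<i> * complex_of_real (x \<bullet> \<xi>))) * (ft h \<xi> * complex_of_real (?e \<xi>)))"
      by (simp add: F_def algebra_simps)
    also have "\<dots> = cnj (ft h \<xi>) * (ft h \<xi> * complex_of_real (?e \<xi>))"
      unfolding cnj_ft by simp
    also have "\<dots> = complex_of_real ((cmod (ft h \<xi>))\<^sup>2 * ?e \<xi>)"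
      using complex_norm_square[of "ft h \<xi>"] by (simp add: mult.commute mult.left_commute)
    finally show "complex_of_real ((cmod (ft h \<xi>))\<^sup>2 * ?e \<xi>) = (LINT x|lborel. F \<xi> x)" by simp
  qed
  also have "\<dots> = (LINT x|lborel. LINT \<xi>|lborel. F \<xi> x)"
    by (rule lborel_pair.Fubini_integral[OF FI, symmetric])
  also have "\<dots> = (LINT x|lborel. complex_of_real (h x * (LINT y|lborel. h y * gauss_kernel \<delta> (x - y))))"
    unfolding F_def using ft_gauss[OF h d] by simp
  also have "\<dots> = complex_of_real (LINT x|lborel. h x * (LINT y|lborel. h y * gauss_kernel \<delta> (x - y)))"
    by (rule integral_complex_of_real)
  finally have eq: "(LINT \<xi>|lborel. (cmod (ft h \<xi>))\<^sup>2 * ?e \<xi>) = (LINT x|lborel. h x * (LINT y|lborel. h y * gauss_kernel \<delta> (x - y)))"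
    by (simp only: of_real_eq_iff)
  let ?G = "\<lambda>v::'a. ennreal (gauss_kernel \<delta> v)"
  have G0: "gauss_kernel \<delta> v \<ge> 0" for v :: 'a using gauss_kernel_pos[OF d, of v] by simp
  have GN: "(\<integral>\<^sup>+v. ?G v \<partial>lborel) = ennreal ((2 * pi) ^ DIM('a))"
    using gauss_kernel_integral[OF d, where 'a='a] G0 by (simp add: nn_integral_eq_integral)
  have sym: "gauss_kernel \<delta> (x - y) = gauss_kernel \<delta> (y - x)" for x y :: 'a
    by (simp add: gauss_kernel_def norm_minus_commute)
  have H: "(\<integral>\<^sup>+x. ennreal ((h x)\<^sup>2) \<partial>lborel) = ennreal (LINT x|lborel. (h x)\<^sup>2)"
    using h2 by (simp add: nn_integral_eq_integral)
  have "ennreal (LINT x|lborel. h x * (LINT y|lborel. h y * gauss_kernel \<delta> (x - y)))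
     \<le> (\<integral>\<^sup>+x. ennreal (norm (h x * (LINT y|lborel. h y * gauss_kernel \<delta> (x - y)))) \<partial>lborel)"
    by (rule ennreal_integral_le)
  also have "\<dots> \<le> (\<integral>\<^sup>+x. \<integral>\<^sup>+y. ennreal (\<bar>h x\<bar> * \<bar>h y\<bar> * gauss_kernel \<delta> (x - y)) \<partial>lborel \<partial>lborel)"
  proof (rule nn_integral_mono)
    fix x
    have "ennreal (norm (LINT y|lborel. h y * gauss_kernel \<delta> (x - y))) \<le> (\<integral>\<^sup>+y. ennreal (norm (h y * gauss_kernel \<delta> (x - y))) \<partial>lborel)"
      by (cases "integrable lborel (\<lambda>y. h y * gauss_kernel \<delta> (x - y))")
         (auto intro!: integral_norm_bound_ennreal simp: not_integrable_integral_eq simp del: real_norm_def)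
    then have "ennreal (norm (h x)) * ennreal (norm (LINT y|lborel. h y * gauss_kernel \<delta> (x - y))) \<le> ennreal (norm (h x)) * (\<integral>\<^sup>+y. ennreal (norm (h y * gauss_kernel \<delta> (x - y))) \<partial>lborel)"
      by (rule mult_left_mono) simp
    then show "ennreal (norm (h x * (LINT y|lborel. h y * gauss_kernel \<delta> (x - y)))) \<le> (\<integral>\<^sup>+y. ennreal (\<bar>h x\<bar> * \<bar>h y\<bar> * gauss_kernel \<delta> (x - y)) \<partial>lborel)"
      using G0 by (simp add: abs_mult ennreal_mult' mult.assoc nn_integral_cmult)
  qed
  \<comment> \<open>Young's inequality splits \<open>\<bar>h x\<bar> * \<bar>h y\<bar>\<close> into
    halves of the squares. The kernel is symmetric, so the two halves have the same double integral,
    and each is half the mass of the kernel times the L^2 mass of \<open>h\<close>.\<close>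
  also have "\<dots> \<le> (\<integral>\<^sup>+x. \<integral>\<^sup>+y. (ennreal ((h x)\<^sup>2) * ?G (x - y) / 2 + ennreal ((h y)\<^sup>2) * ?G (x - y) / 2) \<partial>lborel \<partial>lborel)"
  proof (intro nn_integral_mono)
    fix x y
    have "\<bar>h x\<bar> * \<bar>h y\<bar> \<le> (h x)\<^sup>2 / 2 + (h y)\<^sup>2 / 2"
      using zero_le_power2[of "\<bar>h x\<bar> - \<bar>h y\<bar>"] by (simp add: power2_diff)
    then have "\<bar>h x\<bar> * \<bar>h y\<bar> * gauss_kernel \<delta> (x - y) \<le> ((h x)\<^sup>2 / 2 + (h y)\<^sup>2 / 2) * gauss_kernel \<delta> (x - y)"
      by (rule mult_right_mono[OF _ G0])
    also have "\<dots> = (h x)\<^sup>2 * gauss_kernel \<delta> (x - y) / 2 + (h y)\<^sup>2 * gauss_kernel \<delta> (x - y) / 2"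
      by (simp add: field_simps)
    finally have "ennreal (\<bar>h x\<bar> * \<bar>h y\<bar> * gauss_kernel \<delta> (x - y)) \<le> ennreal ((h x)\<^sup>2 * gauss_kernel \<delta> (x - y) / 2 + (h y)\<^sup>2 * gauss_kernel \<delta> (x - y) / 2)"
      by (rule ennreal_leI)
    also have "\<dots> = ennreal ((h x)\<^sup>2) * ?G (x - y) / 2 + ennreal ((h y)\<^sup>2) * ?G (x - y) / 2"
      using G0 by (simp add: ennreal_mult' divide_ennreal[symmetric])
    finally show "ennreal (\<bar>h x\<bar> * \<bar>h y\<bar> * gauss_kernel \<delta> (x - y)) \<le> ennreal ((h x)\<^sup>2) * ?G (x - y) / 2 + ennreal ((h y)\<^sup>2) * ?G (x - y) / 2" .
  qed
  also have "\<dots> = (\<integral>\<^sup>+x. \<integral>\<^sup>+y. ennreal ((h x)\<^sup>2) * ?G (x - y) / 2 \<partial>lborel \<partial>lborel) + (\<integral>\<^sup>+x. \<integral>\<^sup>+y. ennreal ((h y)\<^sup>2) * ?G (x - y) / 2 \<partial>lborel \<partial>lborel)"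
    by (subst nn_integral_add[symmetric]) (auto intro!: nn_integral_cong nn_integral_add)
  also have "(\<integral>\<^sup>+x. \<integral>\<^sup>+y. ennreal ((h y)\<^sup>2) * ?G (x - y) / 2 \<partial>lborel \<partial>lborel) = (\<integral>\<^sup>+y. \<integral>\<^sup>+x. ennreal ((h y)\<^sup>2) * ?G (x - y) / 2 \<partial>lborel \<partial>lborel)"
    by (rule lborel_pair.Fubini') measurable
  also have "\<dots> = (\<integral>\<^sup>+x. \<integral>\<^sup>+y. ennreal ((h x)\<^sup>2) * ?G (x - y) / 2 \<partial>lborel \<partial>lborel)"
    by (simp add: sym)
  also have "(\<integral>\<^sup>+x. \<integral>\<^sup>+y. ennreal ((h x)\<^sup>2) * ?G (x - y) / 2 \<partial>lborel \<partial>lborel) = (\<integral>\<^sup>+x. ennreal ((h x)\<^sup>2) * ennreal ((2 * pi) ^ DIM('a)) / 2 \<partial>lborel)"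
    using nn_integral_translate(2)[of "?G"] GN
    by (simp add: nn_integral_divide nn_integral_cmult)
  also have "\<dots> = ennreal (LINT x|lborel. (h x)\<^sup>2) * ennreal ((2 * pi) ^ DIM('a)) / 2"
    by (simp add: nn_integral_divide nn_integral_multc H)
  finally have "ennreal (LINT \<xi>|lborel. (cmod (ft h \<xi>))\<^sup>2 * ?e \<xi>) \<le> ennreal (LINT x|lborel. (h x)\<^sup>2) * ennreal ((2 * pi) ^ DIM('a)) / 2 + ennreal (LINT x|lborel. (h x)\<^sup>2) * ennreal ((2 * pi) ^ DIM('a)) / 2"
    unfolding eq .
  also have "\<dots> = ennreal ((2 * pi) ^ DIM('a) * (LINT x|lborel. (h x)\<^sup>2))"
    by (simp only: ennreal_halves) (simp add: ennreal_mult' mult.commute)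
  finally show ?thesis
    using int by (simp add: nn_integral_eq_integral)
qed

lemma bessel:
  fixes h :: "'a::euclidean_space \<Rightarrow> real"
  assumes h: "integrable lborel h" and h2: "integrable lborel (\<lambda>x. (h x)\<^sup>2)"
  shows "(\<integral>\<^sup>+\<xi>. ennreal ((cmod (ft h \<xi>))\<^sup>2) \<partial>lborel) \<le> ennreal ((2 * pi) ^ DIM('a) * (LINT x|lborel. (h x)\<^sup>2))"
proof -
  have [measurable]: "h \<in> borel_measurable borel" using h by auto
  let ?u = "\<lambda>n \<xi>. ennreal ((cmod (ft h \<xi>))\<^sup>2 * exp (- (1 / real (Suc n)) * (norm \<xi>)\<^sup>2 / 2))"
  have "(\<integral>\<^sup>+\<xi>. ennreal ((cmod (ft h \<xi>))\<^sup>2) \<partial>lborel) = (\<integral>\<^sup>+\<xi>. liminf (\<lambda>n. ?u n \<xi>) \<partial>lborel)"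
  proof (rule nn_integral_cong)
    fix \<xi>
    have "(\<lambda>n. (cmod (ft h \<xi>))\<^sup>2 * exp (- (1 / real (Suc n)) * (norm \<xi>)\<^sup>2 / 2)) \<longlonglongrightarrow> (cmod (ft h \<xi>))\<^sup>2 * exp (- 0 * (norm \<xi>)\<^sup>2 / 2)"
      using LIMSEQ_Suc[OF lim_inverse_n'] by (intro tendsto_intros) (simp_all add: inverse_eq_divide)
    then have "(\<lambda>n. ?u n \<xi>) \<longlonglongrightarrow> ennreal ((cmod (ft h \<xi>))\<^sup>2)"
      by (intro tendsto_ennrealI) simp
    then show "ennreal ((cmod (ft h \<xi>))\<^sup>2) = liminf (\<lambda>n. ?u n \<xi>)"
      by (intro lim_imp_Liminf[symmetric]) auto
  qed
  also have "\<dots> \<le> liminf (\<lambda>n. \<integral>\<^sup>+\<xi>. ?u n \<xi> \<partial>lborel)"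
    by (rule nn_integral_liminf) measurable
  also have "\<dots> \<le> limsup (\<lambda>n. \<integral>\<^sup>+\<xi>. ?u n \<xi> \<partial>lborel)"
    by (rule Liminf_le_Limsup) simp
  also have "\<dots> \<le> ennreal ((2 * pi) ^ DIM('a) * (LINT x|lborel. (h x)\<^sup>2))"
    by (rule Limsup_bounded, rule always_eventually, rule allI, rule bessel_gauss[OF h h2]) simp
  finally show ?thesis .
qed

lemma pred_mem_ball[measurable]: "Measurable.pred borel (\<lambda>x. x \<in> ball (c::'a::euclidean_space) R)"
  unfolding mem_ball by measurable

lemma fourier_trunc_eq_ft:
  assumes [measurable]: "f \<in> borel_measurable borel"
  shows "fourier_trunc f R = ft (\<lambda>x. f x * indicator (ball 0 R) x)"
proof -
  show ?thesis
  unfolding fourier_trunc_def ft_def set_lebesgue_integral_def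
    by (rule ext, subst integral_completion, measurable)
      (auto intro!: Bochner_Integration.integral_cong simp: indicator_def)
qed

lemma integral_tail_tendsto:
  fixes F :: "'a::euclidean_space \<Rightarrow> real"
  assumes F: "integrable lborel F"
  shows "((\<lambda>R. LINT x|lborel. F x * indicator {x. R \<le> norm x} x) \<longlongrightarrow> 0) at_top"
proof -
  have [measurable]: "F \<in> borel_measurable borel" using F by auto
  have "((\<lambda>R. LINT x|lborel. F x * indicator {x. R \<le> norm x} x) \<longlongrightarrow> (LINT x|(lborel::'a measure). (0::real))) at_top"
  proof (rule integral_dominated_convergence_at_top[where w="\<lambda>x. \<bar>F x\<bar>"])
    show "\<forall>\<^sub>F R in at_top. AE x in lborel. norm (F x * indicator {x. R \<le> norm x} x) \<le> \<bar>F x\<bar>"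
      by (auto simp: indicator_def)
    show "AE x in lborel. ((\<lambda>R. F x * indicator {x. R \<le> norm x} x) \<longlongrightarrow> 0) at_top"
    proof (rule AE_I2)
      fix x
      have "\<forall>\<^sub>F R in at_top. F x * indicator {x. R \<le> norm x} x = 0"
        using eventually_gt_at_top[of "norm x"] by eventually_elim auto
      then show "((\<lambda>R. F x * indicator {x. R \<le> norm x} x) \<longlongrightarrow> 0) at_top"
        by (rule tendsto_eventually)
    qed
  qed (use F in auto)
  then show ?thesis by simp
qed

text \<open>\<open>L2_fourier\<close> is a \<open>SOME\<close>, so a witness is needed. By Bessel's
  inequality the transforms of the truncations are Cauchy in L^2 with distance controlled by the L^2
  tail of \<open>f\<close>. A rapidly converging subsequence converges almost everywhere, and
  Fatou's lemma bounds the distance of its limit to all truncations, not only to the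
  subsequence.\<close>

lemma L2_fourier_exists:
  fixes f :: "'a::euclidean_space \<Rightarrow> real"
  assumes [measurable]: "f \<in> borel_measurable borel" and f2: "integrable lborel (\<lambda>x. (f x)\<^sup>2)"
  shows "\<exists>g\<in>borel_measurable borel. is_L2_fourier f g"
proof -
  define c where "c = (2 * pi) ^ DIM('a)"
  have c: "c > 0" by (simp add: c_def)
  define h where "h R x = f x * indicator (ball 0 R) x" for R x
  have [measurable]: "h R \<in> borel_measurable borel" for R unfolding h_def by measurable
  define tail where "tail R = (LINT x|lborel. (f x)\<^sup>2 * indicator {x. R \<le> norm x} x)" for R :: real
  have tI: "integrable lborel (\<lambda>x. (f x)\<^sup>2 * indicator {x. R \<le> norm x} x)" for R
    by (rule Bochner_Integration.integrable_bound[OF f2]) (auto simp: indicator_def)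
  have tlim: "(tail \<longlongrightarrow> 0) at_top" unfolding tail_def by (rule integral_tail_tendsto[OF f2])
  have h1: "integrable lborel (h R)" for R
  proof (rule Bochner_Integration.integrable_bound)
    show "integrable lborel (\<lambda>x. (f x)\<^sup>2 + indicator (ball (0::'a) R) x :: real)"
      using f2 by (intro Bochner_Integration.integrable_add integrable_real_indicator) (auto simp: emeasure_lborel_ball_finite[simplified])
    have "\<bar>r\<bar> \<le> r\<^sup>2 + 1" for r :: real
      using zero_le_power2[of "\<bar>r\<bar> - 1/2"] by (simp add: power2_diff power_divide)
    then show "AE x in lborel. norm (h R x) \<le> norm ((f x)\<^sup>2 + indicator (ball (0::'a) R) x :: real)"
      by (auto simp: h_def indicator_def)
  qed auto
  have h2: "integrable lborel (\<lambda>x. (h R x - h S x)\<^sup>2)" for R S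
    by (rule Bochner_Integration.integrable_bound[OF f2]) (auto simp: h_def indicator_def)
  have dist: "(\<integral>\<^sup>+\<xi>. ennreal ((cmod (ft (h R) \<xi> - ft (h S) \<xi>))\<^sup>2) \<partial>lborel) \<le> ennreal (c * tail T)"
    if "T \<le> R" "T \<le> S" for R S T
  proof -
    have "(\<integral>\<^sup>+\<xi>. ennreal ((cmod (ft (h R) \<xi> - ft (h S) \<xi>))\<^sup>2) \<partial>lborel) = (\<integral>\<^sup>+\<xi>. ennreal ((cmod (ft (\<lambda>x. h R x - h S x) \<xi>))\<^sup>2) \<partial>lborel)"
      by (simp add: ft_diff h1)
    also have "\<dots> \<le> ennreal (c * (LINT x|lborel. (h R x - h S x)\<^sup>2))"
      unfolding c_def by (rule bessel) (use h1 h2 in auto)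
    also have "\<dots> \<le> ennreal (c * tail T)"
      unfolding tail_def using c that by (intro ennreal_leI mult_left_mono integral_mono h2 tI) (auto simp: h_def indicator_def)
    finally show ?thesis .
  qed
  \<comment> \<open>The rate \<open>8 ^ n\<close> leaves room for the weight \<open>2 ^ n\<close>
    below: the weighted squared increments have integrals of order \<open>1 / 4 ^ n\<close>. Where
    their sum is finite, the increments themselves decay like
    \<open>sqrt (1 / 2) ^ n\<close>.\<close>
  have "\<exists>N. \<forall>R\<ge>N. tail R < 1 / 8 ^ n" for n :: nat
    using order_tendstoD(2)[OF tlim, of "1 / 8 ^ n"] by (simp add: eventually_at_top_linorder)
  then obtain N0 where N0: "\<And>n R. R \<ge> N0 n \<Longrightarrow> tail R < 1 / 8 ^ n" by metis
  \<comment> \<open>The sum makes the radii monotone, so that both truncations in the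
    \<open>n\<close>-th increment lie beyond \<open>N0 n\<close>; the summand \<open>real n\<close>
    sends them to infinity.\<close>
  define N where "N n = real n + (\<Sum>i\<le>n. \<bar>N0 i\<bar>)" for n
  have NN0: "N n \<ge> N0 n" for n
  proof -
    have "N0 n \<le> \<bar>N0 n\<bar>" by simp
    also have "\<dots> \<le> (\<Sum>i\<le>n. \<bar>N0 i\<bar>)" by (rule member_le_sum) auto
    finally show ?thesis by (simp add: N_def)
  qed
  have NS: "N n \<le> N (Suc n)" and Nn: "N n \<ge> real n" for n by (auto simp: N_def sum_nonneg)
  define F where "F n = ft (h (N n))" for n
  have [measurable]: "F n \<in> borel_measurable borel" for n unfolding F_def by measurable
  define g where "g \<xi> = lim (\<lambda>n. F n \<xi>)" for \<xi>
  have gm[measurable]: "g \<in> borel_measurable borel" unfolding g_def[abs_def] by measurable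
  have "(\<integral>\<^sup>+\<xi>. (\<Sum>n. ennreal (2 ^ n * (cmod (F (Suc n) \<xi> - F n \<xi>))\<^sup>2)) \<partial>lborel)
      = (\<Sum>n. \<integral>\<^sup>+\<xi>. ennreal (2 ^ n * (cmod (F (Suc n) \<xi> - F n \<xi>))\<^sup>2) \<partial>lborel)"
    by (rule nn_integral_suminf) measurable
  also have "\<dots> \<le> (\<Sum>n. ennreal (c * (1/4) ^ n))"
  proof (intro suminf_le summableI)
    fix n
    have "(\<integral>\<^sup>+\<xi>. ennreal (2 ^ n * (cmod (F (Suc n) \<xi> - F n \<xi>))\<^sup>2) \<partial>lborel) = ennreal (2 ^ n) * (\<integral>\<^sup>+\<xi>. ennreal ((cmod (F (Suc n) \<xi> - F n \<xi>))\<^sup>2) \<partial>lborel)"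
      by (simp add: ennreal_mult' nn_integral_cmult)
    also have "\<dots> \<le> ennreal (2 ^ n) * ennreal (c * tail (N n))"
      unfolding F_def using NS by (intro mult_left_mono dist) auto
    also have "\<dots> \<le> ennreal (2 ^ n) * ennreal (c * (1 / 8 ^ n))"
      using c N0[OF NN0, of n] by (intro mult_left_mono ennreal_leI) (auto intro: less_imp_le)
    also have "\<dots> = ennreal (c * (1/4) ^ n)"
      using c by (simp add: ennreal_mult'[symmetric] power_divide flip: power_mult_distrib) (simp add: field_simps flip: power_mult_distrib)
    finally show "(\<integral>\<^sup>+\<xi>. ennreal (2 ^ n * (cmod (F (Suc n) \<xi> - F n \<xi>))\<^sup>2) \<partial>lborel) \<le> ennreal (c * (1/4) ^ n)" .
  qed
  also have "\<dots> < \<infinity>"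
    using c by (subst suminf_ennreal2) (auto intro!: summable_mult summable_geometric)
  finally have "AE \<xi> in lborel. (\<Sum>n. ennreal (2 ^ n * (cmod (F (Suc n) \<xi> - F n \<xi>))\<^sup>2)) \<noteq> \<infinity>"
    by (intro nn_integral_PInf_AE) auto
  then have lim: "AE \<xi> in lborel. (\<lambda>n. F n \<xi>) \<longlonglongrightarrow> g \<xi>"
  proof eventually_elim
    case (elim \<xi>)
    have "summable (\<lambda>n. 2 ^ n * (cmod (F (Suc n) \<xi> - F n \<xi>))\<^sup>2)"
      using elim by (intro summable_suminf_not_top) auto
    then have "bounded (range (\<lambda>n. 2 ^ n * (cmod (F (Suc n) \<xi> - F n \<xi>))\<^sup>2))"
      by (intro convergent_imp_bounded[OF summable_LIMSEQ_zero])
    then obtain K where K: "\<And>n. 2 ^ n * (cmod (F (Suc n) \<xi> - F n \<xi>))\<^sup>2 \<le> K"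
      unfolding bounded_iff by auto
    have "summable (\<lambda>n. sqrt K * (sqrt (1/2)) ^ n)"
      by (intro summable_mult summable_geometric) (simp add: real_sqrt_divide real_less_rsqrt)
    then have "summable (\<lambda>n. F (Suc n) \<xi> - F n \<xi>)"
    proof (rule summable_comparison_test'[where N=0])
      fix n
      have "(cmod (F (Suc n) \<xi> - F n \<xi>))\<^sup>2 \<le> K * (1/2) ^ n"
        using K[of n] by (simp add: field_simps)
      then have "cmod (F (Suc n) \<xi> - F n \<xi>) \<le> sqrt (K * (1/2) ^ n)"
        by (rule real_le_rsqrt)
      then show "norm (F (Suc n) \<xi> - F n \<xi>) \<le> sqrt K * (sqrt (1/2)) ^ n"
        by (simp add: real_sqrt_mult real_sqrt_power)
    qed
    then have "convergent (\<lambda>n. \<Sum>i<n. (F (Suc i) \<xi> - F i \<xi>))"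
      by (simp add: summable_iff_convergent)
    then have "convergent (\<lambda>n. F n \<xi> - F 0 \<xi>)"
      by (simp add: sum_lessThan_telescope[of "\<lambda>n. F n \<xi>"])
    then have "convergent (\<lambda>n. F n \<xi>)"
      by (simp add: convergent_diff_const_right_iff)
    then show ?case unfolding g_def by (simp add: convergent_LIMSEQ_iff)
  qed
  have main: "(\<integral>\<^sup>+\<xi>. ennreal ((cmod (g \<xi> - ft (h R) \<xi>))\<^sup>2) \<partial>lborel) \<le> ennreal (c * tail R)" for R
  proof -
    have "(\<integral>\<^sup>+\<xi>. ennreal ((cmod (g \<xi> - ft (h R) \<xi>))\<^sup>2) \<partial>lborel) = (\<integral>\<^sup>+\<xi>. liminf (\<lambda>n. ennreal ((cmod (F n \<xi> - ft (h R) \<xi>))\<^sup>2)) \<partial>lborel)"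
    proof (rule nn_integral_cong_AE, use lim in eventually_elim)
      case (elim \<xi>)
      have "(\<lambda>n. ennreal ((cmod (F n \<xi> - ft (h R) \<xi>))\<^sup>2)) \<longlonglongrightarrow> ennreal ((cmod (g \<xi> - ft (h R) \<xi>))\<^sup>2)"
        by (intro tendsto_intros tendsto_ennrealI elim)
      then show ?case by (intro lim_imp_Liminf[symmetric]) auto
    qed
    also have "\<dots> \<le> liminf (\<lambda>n. \<integral>\<^sup>+\<xi>. ennreal ((cmod (F n \<xi> - ft (h R) \<xi>))\<^sup>2) \<partial>lborel)"
      by (rule nn_integral_liminf) measurable
    also have "\<dots> \<le> limsup (\<lambda>n. \<integral>\<^sup>+\<xi>. ennreal ((cmod (F n \<xi> - ft (h R) \<xi>))\<^sup>2) \<partial>lborel)"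
      by (rule Liminf_le_Limsup) simp
    also have "\<dots> \<le> ennreal (c * tail R)"
    proof (rule Limsup_bounded)
      show "\<forall>\<^sub>F n in sequentially. (\<integral>\<^sup>+\<xi>. ennreal ((cmod (F n \<xi> - ft (h R) \<xi>))\<^sup>2) \<partial>lborel) \<le> ennreal (c * tail R)"
        using eventually_ge_at_top[of "nat \<lceil>R\<rceil>"]
      proof eventually_elim
        case (elim n)
        then have "R \<le> N n" using Nn[of n] by linarith
        then show ?case unfolding F_def by (intro dist) auto
      qed
    qed
    finally show ?thesis .
  qed
  have "((\<lambda>R. ennreal (c * tail R)) \<longlongrightarrow> ennreal (c * 0)) at_top"
    by (intro tendsto_ennrealI tendsto_intros tlim)
  then have "((\<lambda>R. ennreal (c * tail R)) \<longlongrightarrow> 0) at_top" by simp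
  then have "((\<lambda>R. \<integral>\<^sup>+\<xi>. ennreal ((cmod (g \<xi> - ft (h R) \<xi>))\<^sup>2) \<partial>lborel) \<longlongrightarrow> 0) at_top"
    by (rule tendsto_sandwich[OF always_eventually always_eventually tendsto_const, rotated -1])
       (simp_all add: main)
  moreover have ft_h: "fourier_trunc f = (\<lambda>R. ft (h R))"
    unfolding h_def[abs_def] by (rule ext, rule fourier_trunc_eq_ft) simp
  moreover have "g \<in> borel_measurable lebesgue"
    by (rule measurable_completion) (use gm in simp)
  ultimately have "is_L2_fourier f g"
    unfolding is_L2_fourier_def nn_integral_completion ft_h by blast
  then show ?thesis using gm by blast
qed

section \<open>Dyadic integrability, approximate identity, Fourier inversion and embedding\<close>

lemma dyadic_annulus_ex:
  assumes "0 < r" "r < (t::real)"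
  shows "\<exists>n::nat. 2 ^ n * r < t \<and> t \<le> 2 ^ Suc n * r"
proof -
  obtain n0 :: nat where "t / r < 2 ^ n0" using real_arch_pow[of 2 "t / r"] by auto
  then have ex: "t \<le> 2 ^ n0 * r" using assms by (simp add: field_simps)
  define n where "n = (LEAST n. t \<le> 2 ^ n * r)"
  have n: "t \<le> 2 ^ n * r" unfolding n_def by (rule LeastI[of _ n0]) (rule ex)
  have "n \<noteq> 0" using n assms by (intro notI) auto
  then obtain k where k: "n = Suc k" by (cases n) auto
  have "\<not> t \<le> 2 ^ k * r" unfolding n_def by (rule not_less_Least) (use k n_def in simp)
  then show ?thesis using n k by (intro exI[of _ k]) auto
qed

lemma term_le_suminf: "f n \<le> suminf f" for f :: "nat \<Rightarrow> ennreal"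
  using sum_le_suminf[of f "{n}"] by (simp add: summableI)

lemma pred_mem_cball[measurable]: "Measurable.pred borel (\<lambda>x. x \<in> cball (c::'a::euclidean_space) R)"
  unfolding mem_cball by measurable

text \<open>A substitute for polar coordinates: on each dyadic annulus the integrand is bounded by
  its value at the inner radius and the volume by that of the outer ball, which gives a geometric
  series of ratio \<open>(1 / 2) powr \<epsilon>\<close>.\<close>

lemma nn_integral_far_finite:
  assumes "0 < \<epsilon>" "0 < r"
  shows "(\<integral>\<^sup>+y. ennreal (norm (y::'a::euclidean_space) powr (- (real DIM('a) + \<epsilon>)) * indicator {y. r < norm y} y) \<partial>lborel) < \<infinity>"
proof -
  define e where "e = real DIM('a) + \<epsilon>"
  have e: "e > 0" using assms by (simp add: e_def)
  let ?V = "unit_ball_vol (real DIM('a))"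
  have "(\<integral>\<^sup>+y. ennreal (norm (y::'a) powr (- e) * indicator {y. r < norm y} y) \<partial>lborel)
    \<le> (\<integral>\<^sup>+y. (\<Sum>n. ennreal ((2 ^ n * r) powr (- e)) * indicator (cball 0 (2 ^ Suc n * r)) (y::'a)) \<partial>lborel)"
  proof (rule nn_integral_mono)
    fix y :: 'a
    show "ennreal (norm y powr (- e) * indicator {y. r < norm y} y) \<le> (\<Sum>n. ennreal ((2 ^ n * r) powr (- e)) * indicator (cball 0 (2 ^ Suc n * r)) y)"
    proof (cases "r < norm y")
      case True
      obtain n where n: "2 ^ n * r < norm y" "norm y \<le> 2 ^ Suc n * r" using dyadic_annulus_ex[OF assms(2) True] by auto
      have "ennreal (norm y powr (- e) * indicator {y. r < norm y} y) \<le> ennreal ((2 ^ n * r) powr (- e)) * indicator (cball 0 (2 ^ Suc n * r)) y"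
        using n e assms True by (auto intro!: ennreal_leI powr_mono2')
      also have "\<dots> \<le> (\<Sum>n. ennreal ((2 ^ n * r) powr (- e)) * indicator (cball 0 (2 ^ Suc n * r)) y)"
        by (rule term_le_suminf)
      finally show ?thesis .
    qed simp
  qed
  also have "\<dots> = (\<Sum>n. \<integral>\<^sup>+y. ennreal ((2 ^ n * r) powr (- e)) * indicator (cball 0 (2 ^ Suc n * r)) (y::'a) \<partial>lborel)"
    by (rule nn_integral_suminf) measurable
  also have "\<dots> = (\<Sum>n. ennreal ((2 ^ DIM('a) * ?V * r powr (- \<epsilon>)) * ((1/2) powr \<epsilon>) ^ n))"
  proof (rule arg_cong[where f=suminf], rule ext)
    fix n
    have "(\<integral>\<^sup>+y. ennreal ((2 ^ n * r) powr (- e)) * indicator (cball 0 (2 ^ Suc n * r)) (y::'a) \<partial>lborel)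
      = ennreal ((2 ^ n * r) powr (- e)) * ennreal (?V * (2 ^ Suc n * r) ^ DIM('a))"
      using assms by (subst nn_integral_cmult_indicator) (auto simp: emeasure_cball)
    also have "\<dots> = ennreal ((2 ^ n * r) powr (- e) * (?V * (2 ^ Suc n * r) ^ DIM('a)))"
      using assms by (simp add: ennreal_mult')
    also have "(2 ^ n * r) powr (- e) * (?V * (2 ^ Suc n * r) ^ DIM('a)) = (2 ^ DIM('a) * ?V * r powr (- \<epsilon>)) * ((1/2) powr \<epsilon>) ^ n"
    proof -
      have p: "2 ^ n * r > 0" using assms by simp
      have "(2 ^ Suc n * r) ^ DIM('a) = 2 ^ DIM('a) * (2 ^ n * r) powr (real DIM('a))"
        using p by (simp add: powr_realpow power_mult_distrib)
      moreover have "(2 ^ n * r) powr (- e) * (2 ^ n * r) powr (real DIM('a)) = (2 ^ n * r) powr (- \<epsilon>)"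
        by (simp add: e_def flip: powr_add)
      moreover have "(2 ^ n * r) powr (- \<epsilon>) = ((1/2) powr \<epsilon>) ^ n * r powr (- \<epsilon>)"
        using assms by (simp add: powr_mult powr_divide powr_minus powr_realpow[symmetric] powr_powr inverse_eq_divide mult.commute)
      moreover have "x * (V * (D * P)) = D * V * (x * P)" for x V D P :: real by (simp only: ac_simps)
      ultimately show ?thesis by (simp only: ac_simps)
    qed
    finally show "(\<integral>\<^sup>+y. ennreal ((2 ^ n * r) powr (- e)) * indicator (cball 0 (2 ^ Suc n * r)) (y::'a) \<partial>lborel) = ennreal ((2 ^ DIM('a) * ?V * r powr (- \<epsilon>)) * ((1/2) powr \<epsilon>) ^ n)" .
  qed
  also have "\<dots> < \<infinity>"
  proof (subst suminf_ennreal2)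
    have "(1/2::real) powr \<epsilon> < 1" using assms powr_less_mono2[of \<epsilon> "1/2" 1] by simp
    then show "summable (\<lambda>n. (2 ^ DIM('a) * ?V * r powr (- \<epsilon>)) * ((1/2) powr \<epsilon>) ^ n)"
      by (intro summable_mult summable_geometric) simp
  qed auto
  finally show ?thesis by (simp add: e_def)
qed

lemma nn_integral_near_finite:
  assumes "0 < r"
  shows "(\<integral>\<^sup>+y. ennreal (norm (y::'a::euclidean_space) / norm y ^ DIM('a) * indicator {y. norm y \<le> r} y) \<partial>lborel) < \<infinity>"
proof -
  let ?V = "unit_ball_vol (real DIM('a))" and ?d = "DIM('a)"
  \<comment> \<open>With \<open>DIM('a) = Suc k\<close> the integrand is
    \<open>1 / norm y ^ k\<close> away from 0, and 0 at the origin. Annuli shrinking to the origin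
    then contribute a geometric series of ratio 1/2.\<close>
  obtain k where k: "?d = Suc k" by (metis DIM_positive gr0_implies_Suc)
  have "(\<integral>\<^sup>+y. ennreal (norm (y::'a) / norm y ^ ?d * indicator {y. norm y \<le> r} y) \<partial>lborel)
    \<le> (\<integral>\<^sup>+y. (\<Sum>n. ennreal (1 / (r / 2 ^ n) ^ k) * indicator (cball 0 (2 * r / 2 ^ n)) (y::'a)) \<partial>lborel)"
  proof (rule nn_integral_mono)
    fix y :: 'a
    show "ennreal (norm y / norm y ^ ?d * indicator {y. norm y \<le> r} y) \<le> (\<Sum>n. ennreal (1 / (r / 2 ^ n) ^ k) * indicator (cball 0 (2 * r / 2 ^ n)) y)"
    proof (cases "y \<noteq> 0 \<and> norm y \<le> r")
      case True
      have "1 / 2 < r / norm y" using True assms by (auto simp: field_simps)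
      from dyadic_annulus_ex[OF _ this]
      obtain n where n: "2 ^ n * (1 / 2) < r / norm y" "r / norm y \<le> 2 ^ Suc n * (1 / 2)" by auto
      have n1: "r / 2 ^ n \<le> norm y" "norm y \<le> 2 * r / 2 ^ n"
        using n True by (auto simp: field_simps)
      have "norm y / norm y ^ ?d = 1 / norm y ^ k" using True by (simp add: k)
      also have "\<dots> \<le> 1 / (r / 2 ^ n) ^ k"
        using n1 assms True by (intro divide_left_mono power_mono) auto
      finally have "ennreal (norm y / norm y ^ ?d * indicator {y. norm y \<le> r} y) \<le> ennreal (1 / (r / 2 ^ n) ^ k) * indicator (cball 0 (2 * r / 2 ^ n)) y"
        using n1 True by (auto intro!: ennreal_leI)
      also have "\<dots> \<le> (\<Sum>n. ennreal (1 / (r / 2 ^ n) ^ k) * indicator (cball 0 (2 * r / 2 ^ n)) y)"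
        by (rule term_le_suminf)
      finally show ?thesis .
    qed (auto simp: indicator_def)
  qed
  also have "\<dots> = (\<Sum>n. \<integral>\<^sup>+y. ennreal (1 / (r / 2 ^ n) ^ k) * indicator (cball 0 (2 * r / 2 ^ n)) (y::'a) \<partial>lborel)"
    by (rule nn_integral_suminf) measurable
  also have "\<dots> = (\<Sum>n. ennreal ((2 ^ ?d * ?V * r) * (1/2) ^ n))"
  proof (rule arg_cong[where f=suminf], rule ext)
    fix n
    have "(\<integral>\<^sup>+y. ennreal (1 / (r / 2 ^ n) ^ k) * indicator (cball 0 (2 * r / 2 ^ n)) (y::'a) \<partial>lborel)
      = ennreal (1 / (r / 2 ^ n) ^ k) * ennreal (?V * (2 * r / 2 ^ n) ^ ?d)"
      using assms by (subst nn_integral_cmult_indicator) (auto simp: emeasure_cball)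
    also have "\<dots> = ennreal (1 / (r / 2 ^ n) ^ k * (?V * (2 * r / 2 ^ n) ^ ?d))"
      by (rule ennreal_mult'[symmetric]) (use assms in simp)
    also have "(2 * r / 2 ^ n) ^ ?d = 2 ^ ?d * ((r / 2 ^ n) * (r / 2 ^ n) ^ k)"
      unfolding times_divide_eq_right[symmetric] power_mult_distrib k by simp
    also have "1 / (r / 2 ^ n) ^ k * (?V * (2 ^ ?d * ((r / 2 ^ n) * (r / 2 ^ n) ^ k))) = (2 ^ ?d * ?V * r) * (1/2) ^ n"
    proof -
      have *: "1 / q * (V * (D * (x * q))) = V * D * x" if "q \<noteq> 0" for q V D x :: real using that by simp
      have "(r / 2 ^ n) ^ k \<noteq> 0" using assms by simp
      then have "1 / (r / 2 ^ n) ^ k * (?V * (2 ^ ?d * ((r / 2 ^ n) * (r / 2 ^ n) ^ k))) = ?V * 2 ^ ?d * (r / 2 ^ n)"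
        using * by blast
      then show ?thesis by (simp add: power_divide)
    qed
    finally show "(\<integral>\<^sup>+y. ennreal (1 / (r / 2 ^ n) ^ k) * indicator (cball 0 (2 * r / 2 ^ n)) (y::'a) \<partial>lborel) = ennreal ((2 ^ ?d * ?V * r) * (1/2) ^ n)" .
  qed
  also have "\<dots> < \<infinity>"
    using assms by (subst suminf_ennreal2) (auto intro!: summable_mult summable_geometric)
  finally show ?thesis .
qed

text \<open>Integrates \<open>a b \<le> l a^2 / 2 + b^2 / (2 l)\<close>. The choice
  \<open>l = sqrt (B / A)\<close> makes the two terms equal, and \<open>A, B > 0\<close> keeps
  \<open>l\<close> positive.\<close>

lemma nn_integral_Cauchy_Schwarz:
  fixes a b :: "'a \<Rightarrow> real"
  assumes [measurable]: "a \<in> borel_measurable M" "b \<in> borel_measurable M"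
    and nn: "\<And>x. a x \<ge> 0" "\<And>x. b x \<ge> 0" and AB: "A > 0" "B > 0"
    and a: "(\<integral>\<^sup>+x. ennreal ((a x)\<^sup>2) \<partial>M) \<le> ennreal A" and b: "(\<integral>\<^sup>+x. ennreal ((b x)\<^sup>2) \<partial>M) \<le> ennreal B"
  shows "(\<integral>\<^sup>+x. ennreal (a x * b x) \<partial>M) \<le> ennreal (sqrt (A * B))"
proof -
  define l where "l = sqrt (B / A)"
  have l: "l > 0" "l * A = sqrt (A * B)" "B / l = sqrt (A * B)"
    using AB by (auto simp: l_def real_sqrt_divide real_sqrt_mult field_simps)
  have "(\<integral>\<^sup>+x. ennreal (a x * b x) \<partial>M) \<le> (\<integral>\<^sup>+x. ennreal (l / 2) * ennreal ((a x)\<^sup>2) + ennreal (1 / (2 * l)) * ennreal ((b x)\<^sup>2) \<partial>M)"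
  proof (rule nn_integral_mono)
    fix x
    have "0 \<le> (l * a x - b x)\<^sup>2 / (2 * l)" using l by simp
    also have "\<dots> = l / 2 * (a x)\<^sup>2 + 1 / (2 * l) * (b x)\<^sup>2 - a x * b x"
      using l(1) by (simp add: power2_eq_square field_simps)
    finally have "a x * b x \<le> l / 2 * (a x)\<^sup>2 + 1 / (2 * l) * (b x)\<^sup>2" by simp
    then have "ennreal (a x * b x) \<le> ennreal (l / 2 * (a x)\<^sup>2 + 1 / (2 * l) * (b x)\<^sup>2)" by (rule ennreal_leI)
    also have "\<dots> = ennreal (l / 2) * ennreal ((a x)\<^sup>2) + ennreal (1 / (2 * l)) * ennreal ((b x)\<^sup>2)"
      using l(1) by (subst ennreal_plus) (auto simp: ennreal_mult'[symmetric])
    finally show "ennreal (a x * b x) \<le> ennreal (l / 2) * ennreal ((a x)\<^sup>2) + ennreal (1 / (2 * l)) * ennreal ((b x)\<^sup>2)" .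
  qed
  also have "\<dots> = ennreal (l / 2) * (\<integral>\<^sup>+x. ennreal ((a x)\<^sup>2) \<partial>M) + ennreal (1 / (2 * l)) * (\<integral>\<^sup>+x. ennreal ((b x)\<^sup>2) \<partial>M)"
    by (subst nn_integral_add) (auto simp: nn_integral_cmult)
  also have "\<dots> \<le> ennreal (l / 2) * ennreal A + ennreal (1 / (2 * l)) * ennreal B"
    by (intro add_mono mult_left_mono a b) auto
  also have "\<dots> = ennreal (l / 2 * A + 1 / (2 * l) * B)"
    using l(1) AB by (subst ennreal_plus) (auto simp: ennreal_mult'[symmetric])
  also have "l / 2 * A + 1 / (2 * l) * B = sqrt (A * B)"
  proof -
    have "l / 2 * A + 1 / (2 * l) * B = (l * A) / 2 + (B / l) / 2" by simp
    then show ?thesis using l by simp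
  qed
  finally show ?thesis .
qed

text \<open>Half of the exponent is given up for smallness. The other half is either kept, leaving a
  Gaussian with parameter \<open>2 * \<delta>\<close> and the same mass, or bounded by 1, leaving a
  sup bound.\<close>

lemma gauss_kernel_tail:
  assumes r: "r > 0" and d: "\<delta> > 0" and v: "r \<le> norm (v::'a::euclidean_space)"
  shows "gauss_kernel \<delta> v \<le> sqrt 2 ^ DIM('a) * exp (- r\<^sup>2 / (4 * \<delta>)) * gauss_kernel (2 * \<delta>) v"
    and "gauss_kernel \<delta> v \<le> sqrt (2 * pi / \<delta>) ^ DIM('a) * exp (- r\<^sup>2 / (4 * \<delta>))"
proof -
  have rv: "r\<^sup>2 \<le> (norm v)\<^sup>2" using r v by (intro power_mono) auto
  have e: "exp (- (norm v)\<^sup>2 / (2 * \<delta>)) = exp (- (norm v)\<^sup>2 / (4 * \<delta>)) * exp (- (norm v)\<^sup>2 / (4 * \<delta>))"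
    using d by (simp flip: exp_add)
  have e1: "exp (- (norm v)\<^sup>2 / (4 * \<delta>)) \<le> exp (- r\<^sup>2 / (4 * \<delta>))"
    using rv d by (simp add: field_simps)
  have e2: "exp (- (norm v)\<^sup>2 / (4 * \<delta>)) \<le> 1" using d by simp
  have s: "sqrt (2 * pi / \<delta>) = sqrt 2 * sqrt (2 * pi / (2 * \<delta>))"
    by (simp flip: real_sqrt_mult)
  have "exp (- (norm v)\<^sup>2 / (2 * \<delta>)) \<le> exp (- r\<^sup>2 / (4 * \<delta>)) * exp (- (norm v)\<^sup>2 / (4 * \<delta>))"
    unfolding e by (intro mult_right_mono e1) auto
  then have "gauss_kernel \<delta> v \<le> sqrt (2 * pi / \<delta>) ^ DIM('a) * (exp (- r\<^sup>2 / (4 * \<delta>)) * exp (- (norm v)\<^sup>2 / (4 * \<delta>)))"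
    unfolding gauss_kernel_def using d by (intro mult_left_mono) auto
  also have "\<dots> = sqrt 2 ^ DIM('a) * exp (- r\<^sup>2 / (4 * \<delta>)) * gauss_kernel (2 * \<delta>) v"
    unfolding gauss_kernel_def s power_mult_distrib by simp
  finally show "gauss_kernel \<delta> v \<le> sqrt 2 ^ DIM('a) * exp (- r\<^sup>2 / (4 * \<delta>)) * gauss_kernel (2 * \<delta>) v" .
  have "exp (- (norm v)\<^sup>2 / (2 * \<delta>)) \<le> exp (- r\<^sup>2 / (4 * \<delta>)) * 1"
    unfolding e by (intro mult_mono e1 e2) auto
  then show "gauss_kernel \<delta> v \<le> sqrt (2 * pi / \<delta>) ^ DIM('a) * exp (- r\<^sup>2 / (4 * \<delta>))"
    unfolding gauss_kernel_def using d by (intro mult_left_mono) auto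
qed

text \<open>The height of the kernel outside the ball of radius \<open>r\<close> for \<delta> =
  1/(n+1): the exponential beats the power. The exponent \<open>k\<close> is free because the
  approximate identity uses it both with \<open>k = DIM('a)\<close> and with
  \<open>k = 0\<close>.\<close>

lemma gauss_height_tendsto:
  assumes r: "r > 0"
  shows "(\<lambda>n. sqrt (2 * pi * real (Suc n)) ^ k * exp (- r\<^sup>2 * real (Suc n) / 4)) \<longlonglongrightarrow> 0"
proof (rule tendsto_sandwich[where f="\<lambda>_. 0"])
  define c where "c = sqrt (8 * pi / r\<^sup>2)"
  define X where "X n = r\<^sup>2 * real (Suc n) / 4" for n
  have X: "filterlim X at_top sequentially"
    unfolding X_def using r by real_asymp
  have "(\<lambda>n. c ^ k * (X n ^ k / exp (X n))) \<longlonglongrightarrow> c ^ k * 0"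
    by (intro tendsto_intros filterlim_compose[OF tendsto_power_div_exp_0 X])
  then show "(\<lambda>n. c ^ k * (X n ^ k / exp (X n))) \<longlonglongrightarrow> 0" by simp
  show "\<forall>\<^sub>F n in sequentially. sqrt (2 * pi * real (Suc n)) ^ k * exp (- r\<^sup>2 * real (Suc n) / 4) \<le> c ^ k * (X n ^ k / exp (X n))"
    using X[unfolded filterlim_at_top, rule_format, of 1]
  proof eventually_elim
    case (elim n)
    have "2 * pi * real (Suc n) = (8 * pi / r\<^sup>2) * X n" using r by (simp add: X_def)
    then have "sqrt (2 * pi * real (Suc n)) = c * sqrt (X n)" by (simp only: c_def real_sqrt_mult[symmetric])
    also have "\<dots> \<le> c * X n"
      using elim r by (intro mult_left_mono) (auto simp: c_def intro!: real_le_lsqrt simp: power2_eq_square)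
    finally have "sqrt (2 * pi * real (Suc n)) ^ k \<le> (c * X n) ^ k"
      by (intro power_mono) auto
    then have "sqrt (2 * pi * real (Suc n)) ^ k * exp (- X n) \<le> (c * X n) ^ k * exp (- X n)" by (intro mult_right_mono) auto
    moreover have "exp (- r\<^sup>2 * real (Suc n) / 4) = exp (- X n)" by (simp add: X_def)
    moreover have "(c * X n) ^ k * exp (- X n) = c ^ k * (X n ^ k / exp (X n))"
      by (simp add: exp_minus power_mult_distrib divide_inverse)
    ultimately show ?case by metis
  qed
qed (auto intro!: always_eventually)

text \<open>Near \<open>x\<close> continuity suffices. Away from \<open>x\<close> the function is
  controlled only in L^2, so \<open>\<bar>f y - f x\<bar>\<close> is bounded by
  \<open>(f y)^2 + (1 + \<bar>f x\<bar>)\<close>. The square is integrated against the small height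
  of the kernel, the constant against its small tail mass.\<close>

lemma gauss_approx_identity:
  fixes f :: "'a::euclidean_space \<Rightarrow> real"
  assumes c: "isCont f x" and [measurable]: "f \<in> borel_measurable borel" and f2: "integrable lborel (\<lambda>x. (f x)\<^sup>2)"
  shows "(\<lambda>n. LINT y|lborel. f y * gauss_kernel (1 / real (Suc n)) (x - y)) \<longlonglongrightarrow> (2 * pi) ^ DIM('a) * f x"
    and "\<delta> > 0 \<Longrightarrow> integrable lborel (\<lambda>y. \<bar>f y\<bar> * gauss_kernel \<delta> (x - y))"
proof -
  define N where "N = (2 * pi) ^ DIM('a)"
  have N: "N > 0" by (simp add: N_def)
  have abs1: "\<bar>r\<bar> \<le> r\<^sup>2 + 1" for r :: real
    using zero_le_power2[of "\<bar>r\<bar> - 1/2"] by (simp add: power2_diff power_divide)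
  have GI: "integrable lborel (\<lambda>y. gauss_kernel \<delta> (x - y))" "(LINT y|lborel. gauss_kernel \<delta> (x - y)) = N" if "\<delta> > 0" for \<delta>
    using gauss_kernel_integral[OF that, where 'a='a] by (simp_all add: integral_translate N_def)
  have G0: "\<delta> > 0 \<Longrightarrow> gauss_kernel \<delta> v \<ge> 0" for \<delta> and v :: 'a using gauss_kernel_pos[of \<delta> v] by simp
  have Gb: "gauss_kernel \<delta> v \<le> sqrt (2 * pi / \<delta>) ^ DIM('a)" if "\<delta> > 0" for \<delta> and v :: 'a
    unfolding gauss_kernel_def using that by (intro mult_left_le) auto
  have fGI: "integrable lborel (\<lambda>y. (f y)\<^sup>2 * gauss_kernel \<delta> (x - y))" if "\<delta> > 0" for \<delta>
    by (rule Bochner_Integration.integrable_bound[OF integrable_mult_left[OF f2, of "sqrt (2 * pi / \<delta>) ^ DIM('a)"]])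
       (use that G0[OF that] Gb[OF that] in \<open>auto simp: abs_mult intro!: mult_left_mono\<close>)
  show i: "integrable lborel (\<lambda>y. \<bar>f y\<bar> * gauss_kernel \<delta> (x - y))" if "\<delta> > 0" for \<delta>
  proof (rule Bochner_Integration.integrable_bound[OF Bochner_Integration.integrable_add[OF fGI[OF that] GI(1)[OF that]]])
    show "AE y in lborel. norm (\<bar>f y\<bar> * gauss_kernel \<delta> (x - y)) \<le> norm ((f y)\<^sup>2 * gauss_kernel \<delta> (x - y) + gauss_kernel \<delta> (x - y))"
    proof (rule AE_I2)
      fix y
      have "\<bar>f y\<bar> * gauss_kernel \<delta> (x - y) \<le> ((f y)\<^sup>2 + 1) * gauss_kernel \<delta> (x - y)"
        by (intro mult_right_mono abs1 G0 that)
      then show "norm (\<bar>f y\<bar> * gauss_kernel \<delta> (x - y)) \<le> norm ((f y)\<^sup>2 * gauss_kernel \<delta> (x - y) + gauss_kernel \<delta> (x - y))"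
        using G0[OF that, of "x - y"] by (simp add: abs_mult algebra_simps)
    qed
  qed measurable
  have fi: "integrable lborel (\<lambda>y. f y * gauss_kernel \<delta> (x - y))" if "\<delta> > 0" for \<delta>
    by (rule Bochner_Integration.integrable_bound[OF i[OF that]]) (use G0[OF that] in \<open>auto simp: abs_mult\<close>)
  show "(\<lambda>n. LINT y|lborel. f y * gauss_kernel (1 / real (Suc n)) (x - y)) \<longlonglongrightarrow> (2 * pi) ^ DIM('a) * f x"
  proof (rule LIMSEQ_I)
    fix e :: real assume e: "e > 0"
    define \<eta> where "\<eta> = e / (2 * N)"
    have \<eta>: "\<eta> > 0" using e N by (simp add: \<eta>_def)
    obtain r where r: "r > 0" "\<And>y. dist y x < r \<Longrightarrow> \<bar>f y - f x\<bar> < \<eta>"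
      using c[unfolded continuous_at_eps_delta] \<eta> by (auto simp: dist_real_def)
    define a1 where "a1 n = sqrt (2 * pi * real (Suc n)) ^ DIM('a) * exp (- r\<^sup>2 * real (Suc n) / 4)" for n
    define a2 where "a2 n = sqrt (2 * pi * real (Suc n)) ^ 0 * exp (- r\<^sup>2 * real (Suc n) / 4)" for n
    let ?I = "LINT x|lborel. (f x)\<^sup>2"
    let ?K = "(1 + \<bar>f x\<bar>) * sqrt 2 ^ DIM('a) * N"
    have "(\<lambda>n. a1 n * ?I + a2 n * ?K) \<longlonglongrightarrow> 0 * ?I + 0 * ?K"
      unfolding a1_def a2_def by (intro tendsto_intros gauss_height_tendsto r)
    then have "\<forall>\<^sub>F n in sequentially. a1 n * ?I + a2 n * ?K < e / 2"
      using e by (intro order_tendstoD) auto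
    then obtain n0 where n0: "\<And>n. n \<ge> n0 \<Longrightarrow> a1 n * ?I + a2 n * ?K < e / 2" by (auto simp: eventually_sequentially)
    show "\<exists>no. \<forall>n\<ge>no. norm ((LINT y|lborel. f y * gauss_kernel (1 / real (Suc n)) (x - y)) - (2 * pi) ^ DIM('a) * f x) < e"
    proof (intro exI allI impI)
      fix n assume n: "n \<ge> n0"
      define d where "d = 1 / real (Suc n)"
      have d: "d > 0" by (simp add: d_def)
      have "(LINT y|lborel. f y * gauss_kernel d (x - y)) - N * f x = (LINT y|lborel. f y * gauss_kernel d (x - y)) - (LINT y|lborel. f x * gauss_kernel d (x - y))"
        using GI(2)[OF d] by simp
      also have "\<dots> = (LINT y|lborel. f y * gauss_kernel d (x - y) - f x * gauss_kernel d (x - y))"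
        by (rule Bochner_Integration.integral_diff[symmetric]) (use fi[OF d] GI(1)[OF d] in auto)
      finally have "norm ((LINT y|lborel. f y * gauss_kernel d (x - y)) - N * f x) = norm (LINT y|lborel. f y * gauss_kernel d (x - y) - f x * gauss_kernel d (x - y))" by simp
      also have "\<dots> \<le> (LINT y|lborel. \<eta> * gauss_kernel d (x - y) + a1 n * (f y)\<^sup>2 + a2 n * (1 + \<bar>f x\<bar>) * sqrt 2 ^ DIM('a) * gauss_kernel (2 * d) (x - y))"
      proof (rule Bochner_Integration.integral_norm_bound_integral)
        show "integrable lborel (\<lambda>y. f y * gauss_kernel d (x - y) - f x * gauss_kernel d (x - y))"
          using fi[OF d] GI(1)[OF d] by auto
        show "integrable lborel (\<lambda>y. \<eta> * gauss_kernel d (x - y) + a1 n * (f y)\<^sup>2 + a2 n * (1 + \<bar>f x\<bar>) * sqrt 2 ^ DIM('a) * gauss_kernel (2 * d) (x - y))"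
          using GI(1)[OF d] GI(1)[of "2 * d"] d f2 by auto
        fix y
        have a0: "a1 n \<ge> 0" "a2 n \<ge> 0" by (auto simp: a1_def a2_def)
        have eq: "norm (f y * gauss_kernel d (x - y) - f x * gauss_kernel d (x - y)) = \<bar>f y - f x\<bar> * gauss_kernel d (x - y)"
          using G0[OF d, of "x - y"] by (simp add: abs_mult flip: left_diff_distrib)
        show "norm (f y * gauss_kernel d (x - y) - f x * gauss_kernel d (x - y)) \<le> \<eta> * gauss_kernel d (x - y) + a1 n * (f y)\<^sup>2 + a2 n * (1 + \<bar>f x\<bar>) * sqrt 2 ^ DIM('a) * gauss_kernel (2 * d) (x - y)"
        proof (cases "dist y x < r")
          case True
          then have "\<bar>f y - f x\<bar> * gauss_kernel d (x - y) \<le> \<eta> * gauss_kernel d (x - y)"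
            using r(2)[OF True] by (intro mult_right_mono G0 d) auto
          moreover have "0 \<le> a1 n * (f y)\<^sup>2" "0 \<le> a2 n * (1 + \<bar>f x\<bar>) * sqrt 2 ^ DIM('a) * gauss_kernel (2 * d) (x - y)"
            using a0 d by (auto intro!: mult_nonneg_nonneg G0)
          ultimately show ?thesis unfolding eq by linarith
        next
          case False
          then have v: "r \<le> norm (x - y)" by (simp add: dist_norm norm_minus_commute)
          have ae: "exp (- r\<^sup>2 / (4 * d)) = a2 n" "sqrt (2 * pi / d) ^ DIM('a) * exp (- r\<^sup>2 / (4 * d)) = a1 n"
            by (simp_all add: a1_def a2_def d_def)
          have "\<bar>f y - f x\<bar> \<le> (f y)\<^sup>2 + (1 + \<bar>f x\<bar>)" using abs1[of "f y"] by linarith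
          then have "\<bar>f y - f x\<bar> * gauss_kernel d (x - y) \<le> ((f y)\<^sup>2 + (1 + \<bar>f x\<bar>)) * gauss_kernel d (x - y)"
            by (intro mult_right_mono G0 d)
          also have "\<dots> = (f y)\<^sup>2 * gauss_kernel d (x - y) + (1 + \<bar>f x\<bar>) * gauss_kernel d (x - y)"
            by (simp add: algebra_simps)
          also have "\<dots> \<le> (f y)\<^sup>2 * a1 n + (1 + \<bar>f x\<bar>) * (sqrt 2 ^ DIM('a) * a2 n * gauss_kernel (2 * d) (x - y))"
            using gauss_kernel_tail(1)[OF r(1) d v, unfolded ae(1)] gauss_kernel_tail(2)[OF r(1) d v, unfolded ae(2)]
            by (intro add_mono mult_left_mono) auto
          moreover have "0 \<le> \<eta> * gauss_kernel d (x - y)" using \<eta> G0[OF d] by simp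
          ultimately show ?thesis unfolding eq by (simp add: mult_ac)
        qed
      qed
      also have "\<dots> = \<eta> * N + a1 n * ?I + a2 n * (1 + \<bar>f x\<bar>) * sqrt 2 ^ DIM('a) * N"
        using GI[OF d] GI[of "2 * d"] d f2 by simp
      also have "\<dots> = e / 2 + (a1 n * ?I + a2 n * ?K)" using N by (simp add: \<eta>_def algebra_simps)
      also have "\<dots> < e" using n0[OF n] by linarith
      finally show "norm ((LINT y|lborel. f y * gauss_kernel (1 / real (Suc n)) (x - y)) - (2 * pi) ^ DIM('a) * f x) < e"
        by (simp add: d_def N_def)
    qed
  qed
qed

text \<open>The weight has exponent \<open>1 - s\<close> and not \<open>- s\<close> because one
  power of the frequency is spent on the Lipschitz bound. Integrability at infinity is the condition
  \<open>2 * (s - 1) > DIM('a)\<close>.\<close>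

lemma sobolev_weight_finite:
  assumes s: "s > 1 + real DIM('a::euclidean_space) / 2"
  shows "(\<integral>\<^sup>+\<xi>. ennreal ((1 + (norm (\<xi>::'a))\<^sup>2) powr (1 - s)) \<partial>lborel) < \<infinity>"
proof -
  define \<epsilon> where "\<epsilon> = 2 * (s - 1) - real DIM('a)"
  have e: "\<epsilon> > 0" using s by (simp add: \<epsilon>_def)
  have "(\<integral>\<^sup>+\<xi>. ennreal ((1 + (norm (\<xi>::'a))\<^sup>2) powr (1 - s)) \<partial>lborel)
    \<le> (\<integral>\<^sup>+\<xi>. indicator (cball 0 1) (\<xi>::'a) + ennreal (norm \<xi> powr (- (real DIM('a) + \<epsilon>)) * indicator {\<xi>. 1 < norm \<xi>} \<xi>) \<partial>lborel)"
  proof (rule nn_integral_mono)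
    fix \<xi> :: 'a
    show "ennreal ((1 + (norm \<xi>)\<^sup>2) powr (1 - s)) \<le> indicator (cball 0 1) \<xi> + ennreal (norm \<xi> powr (- (real DIM('a) + \<epsilon>)) * indicator {\<xi>. 1 < norm \<xi>} \<xi>)"
    proof (cases "norm \<xi> \<le> 1")
      case True
      have "(1 + (norm \<xi>)\<^sup>2) powr (1 - s) \<le> 1 powr (1 - s)"
        using s by (intro powr_mono2') auto
      then show ?thesis using True by (simp add: ennreal_leI[where y=1, simplified])
    next
      case False
      have "(1 + (norm \<xi>)\<^sup>2) powr (1 - s) \<le> ((norm \<xi>)\<^sup>2) powr (1 - s)"
        using s False by (intro powr_mono2') auto
      also have "(norm \<xi>)\<^sup>2 = norm \<xi> powr 2" using False by simp
      also have "(norm \<xi> powr 2) powr (1 - s) = norm \<xi> powr (- (real DIM('a) + \<epsilon>))"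
        unfolding powr_powr by (simp add: \<epsilon>_def algebra_simps)
      finally show ?thesis using False by (simp add: ennreal_leI)
    qed
  qed
  also have "\<dots> = emeasure lborel (cball (0::'a) 1) + (\<integral>\<^sup>+\<xi>. ennreal (norm (\<xi>::'a) powr (- (real DIM('a) + \<epsilon>)) * indicator {\<xi>. 1 < norm \<xi>} \<xi>) \<partial>lborel)"
    by (subst nn_integral_add) auto
  also have "\<dots> < \<infinity>"
    using nn_integral_far_finite[OF e, of 1, where 'a='a] emeasure_lborel_cball_finite[of "0::'a" 1] by (simp add: ennreal_add_less_top)
  finally show ?thesis .
qed

lemma norm_exp_ii_diff: "cmod (exp (\<i> * complex_of_real p) - exp (\<i> * complex_of_real q)) \<le> \<bar>p - q\<bar>"
proof -
  have "exp (\<i> * complex_of_real p) - exp (\<i> * complex_of_real q) = exp (\<i> * complex_of_real q) * (iexp (p - q) - 1)"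
    by (simp add: algebra_simps flip: exp_add)
  then have "cmod (exp (\<i> * complex_of_real p) - exp (\<i> * complex_of_real q)) = cmod (iexp (p - q) - 1)"
    by (simp add: norm_mult)
  also have "\<dots> \<le> \<bar>p - q\<bar>" using iexp_approx1[of "p - q" 0] by simp
  finally show ?thesis .
qed

text \<open>The identity \<open>ft_gauss\<close> holds for the truncations of \<open>f\<close>. On
  the frequency side it passes to the limit because the weight is square integrable and the
  transforms converge in L^2; on the other side by dominated convergence.\<close>

lemma fourier_inversion_gauss:
  fixes f :: "'a::euclidean_space \<Rightarrow> real"
  assumes cf: "continuous_on UNIV f" and f2: "integrable lborel (\<lambda>x. (f x)\<^sup>2)"
    and g: "is_L2_fourier f g" and gI: "integrable lebesgue g" and d: "\<delta> > 0"
  shows "(LINT \<xi>|lebesgue. g \<xi> * (exp (\<i> * complex_of_real (x \<bullet> \<xi>)) * complex_of_real (exp (- \<delta> * (norm \<xi>)\<^sup>2 / 2))))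
    = complex_of_real (LINT y|lborel. f y * gauss_kernel \<delta> (x - y))"
proof -
  have fm[measurable]: "f \<in> borel_measurable borel" using cf by (rule borel_measurable_continuous_onI)
  have gm[measurable]: "g \<in> borel_measurable lebesgue" using gI by auto
  have cx: "isCont f x" using cf by (simp add: continuous_on_eq_continuous_at)
  define E where "E \<xi> = exp (\<i> * complex_of_real (x \<bullet> \<xi>)) * complex_of_real (exp (- \<delta> * (norm \<xi>)\<^sup>2 / 2))" for \<xi>
  have Em[measurable]: "E \<in> borel_measurable borel" unfolding E_def by measurable
  have EmL[measurable]: "E \<in> borel_measurable lebesgue" by (rule measurable_completion) (use Em in simp)
  have nE: "cmod (E \<xi>) = exp (- \<delta> * (norm \<xi>)\<^sup>2 / 2)" for \<xi> by (simp add: E_def norm_mult)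
  define h where "h n y = f y * indicator (ball 0 (real n)) y" for n :: nat and y
  have hm[measurable]: "h n \<in> borel_measurable borel" for n unfolding h_def by measurable
  have hI: "integrable lborel (h n)" for n
  proof (rule Bochner_Integration.integrable_bound)
    show "integrable lborel (\<lambda>x. (f x)\<^sup>2 + indicator (ball (0::'a) (real n)) x :: real)"
      using f2 by (intro Bochner_Integration.integrable_add integrable_real_indicator) (auto simp: emeasure_lborel_ball_finite[simplified])
    have "\<bar>r\<bar> \<le> r\<^sup>2 + 1" for r :: real
      using zero_le_power2[of "\<bar>r\<bar> - 1/2"] by (simp add: power2_diff power_divide)
    then show "AE x in lborel. norm (h n x) \<le> norm ((f x)\<^sup>2 + indicator (ball (0::'a) (real n)) x :: real)"
      by (auto simp: h_def indicator_def)
  qed auto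
  define P where "P n = (LINT \<xi>|lebesgue. ft (h n) \<xi> * E \<xi>)" for n
  have ftm[measurable]: "ft (h n) \<in> borel_measurable lebesgue" for n by (rule measurable_completion) simp
  have P: "P n = complex_of_real (LINT y|lborel. h n y * gauss_kernel \<delta> (x - y))" for n
    unfolding P_def ft_gauss[OF hI d, symmetric] E_def[symmetric]
    by (rule integral_completion) measurable
  have "(\<lambda>n. LINT y|lborel. h n y * gauss_kernel \<delta> (x - y)) \<longlonglongrightarrow> (LINT y|lborel. f y * gauss_kernel \<delta> (x - y))"
  proof (rule integral_dominated_convergence[where w="\<lambda>y. \<bar>f y\<bar> * gauss_kernel \<delta> (x - y)"])
    show "integrable lborel (\<lambda>y. \<bar>f y\<bar> * gauss_kernel \<delta> (x - y))"
      by (rule gauss_approx_identity(2)[OF cx fm f2 d])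
    show "AE y in lborel. (\<lambda>n. h n y * gauss_kernel \<delta> (x - y)) \<longlonglongrightarrow> f y * gauss_kernel \<delta> (x - y)"
    proof (rule AE_I2)
      fix y
      have "\<forall>\<^sub>F n in sequentially. h n y * gauss_kernel \<delta> (x - y) = f y * gauss_kernel \<delta> (x - y)"
        using eventually_gt_at_top[of "nat \<lceil>norm y\<rceil>"]
      proof eventually_elim
        case (elim n)
        then have "norm y < real n" by linarith
        then show ?case by (simp add: h_def)
      qed
      then show "(\<lambda>n. h n y * gauss_kernel \<delta> (x - y)) \<longlonglongrightarrow> f y * gauss_kernel \<delta> (x - y)"
        by (rule tendsto_eventually)
    qed
    show "AE y in lborel. norm (h n y * gauss_kernel \<delta> (x - y)) \<le> \<bar>f y\<bar> * gauss_kernel \<delta> (x - y)" for n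
      using gauss_kernel_pos[OF d, where 'a='a] by (auto simp: h_def indicator_def abs_mult less_imp_le)
  qed measurable
  then have lim1: "P \<longlonglongrightarrow> complex_of_real (LINT y|lborel. f y * gauss_kernel \<delta> (x - y))"
    unfolding P by (rule tendsto_of_real)
  have EI: "integrable lborel (\<lambda>\<xi>. (cmod (E \<xi>))\<^sup>2)"
  proof -
    have "(cmod (E \<xi>))\<^sup>2 = exp (- (2 * \<delta>) * (norm \<xi>)\<^sup>2 / 2)" for \<xi>
      unfolding nE by (simp add: power2_eq_square flip: exp_add)
    then show ?thesis using gauss_fourier(1)[of "2 * \<delta>", where 'a='a] d by simp
  qed
  define B where "B = (LINT \<xi>|lborel. (cmod (E \<xi>))\<^sup>2) + 1"
  have B: "B > 0" "(\<integral>\<^sup>+\<xi>. ennreal ((cmod (E \<xi>))\<^sup>2) \<partial>lebesgue) \<le> ennreal B"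
    using EI by (auto simp: B_def nn_integral_completion nn_integral_eq_integral intro!: add_nonneg_pos)
  have gEI: "integrable lebesgue (\<lambda>\<xi>. g \<xi> * E \<xi>)"
    by (rule Bochner_Integration.integrable_bound[OF gI]) (use d in \<open>auto simp: norm_mult nE intro!: mult_left_le\<close>)
  have ftE: "integrable lebesgue (\<lambda>\<xi>. ft (h n) \<xi> * E \<xi>)" for n
  proof -
    have "integrable lborel (\<lambda>\<xi>. ft (h n) \<xi> * E \<xi>)"
      by (rule Bochner_Integration.integrable_bound[OF integrable_mult_right[OF gauss_fourier(1)[OF d], of "LINT x|lborel. \<bar>h n x\<bar>"]])
         (use ft_bound[OF hI] in \<open>auto simp: norm_mult nE abs_mult intro!: mult_right_mono\<close>)
    then show ?thesis by (subst integrable_completion) auto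
  qed
  have lim2: "P \<longlonglongrightarrow> (LINT \<xi>|lebesgue. g \<xi> * E \<xi>)"
  proof (rule LIMSEQ_I)
    fix e :: real assume e: "e > 0"
    define \<eta> where "\<eta> = (e / 2)\<^sup>2 / B"
    have \<eta>: "\<eta> > 0" using e B by (simp add: \<eta>_def)
    have "((\<lambda>R. \<integral>\<^sup>+ \<xi>. ennreal ((cmod (g \<xi> - fourier_trunc f R \<xi>))\<^sup>2) \<partial>lebesgue) \<longlongrightarrow> 0) at_top"
      using g by (simp add: is_L2_fourier_def)
    then have "(\<lambda>n. \<integral>\<^sup>+ \<xi>. ennreal ((cmod (g \<xi> - fourier_trunc f (real n) \<xi>))\<^sup>2) \<partial>lebesgue) \<longlonglongrightarrow> 0"
      by (rule filterlim_compose[OF _ filterlim_real_sequentially])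
    then have "\<forall>\<^sub>F n in sequentially. (\<integral>\<^sup>+ \<xi>. ennreal ((cmod (g \<xi> - fourier_trunc f (real n) \<xi>))\<^sup>2) \<partial>lebesgue) < ennreal \<eta>"
      by (rule order_tendstoD) (use \<eta> in simp)
    then obtain n0 where n0: "\<And>n. n \<ge> n0 \<Longrightarrow> (\<integral>\<^sup>+ \<xi>. ennreal ((cmod (g \<xi> - fourier_trunc f (real n) \<xi>))\<^sup>2) \<partial>lebesgue) < ennreal \<eta>"
      by (auto simp: eventually_sequentially)
    have tr: "fourier_trunc f (real n) = ft (h n)" for n
      unfolding h_def[abs_def] by (rule fourier_trunc_eq_ft) simp
    show "\<exists>no. \<forall>n\<ge>no. norm (P n - (LINT \<xi>|lebesgue. g \<xi> * E \<xi>)) < e"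
    proof (intro exI allI impI)
      fix n assume n: "n \<ge> n0"
      have "P n - (LINT \<xi>|lebesgue. g \<xi> * E \<xi>) = (LINT \<xi>|lebesgue. ft (h n) \<xi> * E \<xi> - g \<xi> * E \<xi>)"
        unfolding P_def by (rule Bochner_Integration.integral_diff[symmetric, OF ftE gEI])
      then have "ennreal (norm (P n - (LINT \<xi>|lebesgue. g \<xi> * E \<xi>))) \<le> (\<integral>\<^sup>+\<xi>. ennreal (norm (ft (h n) \<xi> * E \<xi> - g \<xi> * E \<xi>)) \<partial>lebesgue)"
        using integral_norm_bound_ennreal[OF Bochner_Integration.integrable_diff[OF ftE[of n] gEI]] by simp
      also have "\<dots> = (\<integral>\<^sup>+\<xi>. ennreal (cmod (g \<xi> - ft (h n) \<xi>) * cmod (E \<xi>)) \<partial>lebesgue)"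
        by (intro nn_integral_cong) (simp add: norm_mult norm_minus_commute flip: left_diff_distrib)
      also have "\<dots> \<le> ennreal (sqrt (\<eta> * B))"
        by (rule nn_integral_Cauchy_Schwarz) (use \<eta> B n0[OF n] in \<open>auto simp: tr less_imp_le\<close>)
      also have "sqrt (\<eta> * B) = e / 2" using e B by (simp add: \<eta>_def)
      finally have "norm (P n - (LINT \<xi>|lebesgue. g \<xi> * E \<xi>)) \<le> e / 2" using e by (simp add: ennreal_le_iff)
      then show "norm (P n - (LINT \<xi>|lebesgue. g \<xi> * E \<xi>)) < e" using e by linarith
    qed
  qed
  show ?thesis using LIMSEQ_unique[OF lim2 lim1] by (simp only: E_def)
qed

lemma fourier_inversion:
  fixes f :: "'a::euclidean_space \<Rightarrow> real"
  assumes cf: "continuous_on UNIV f" and f2: "integrable lborel (\<lambda>x. (f x)\<^sup>2)"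
    and g: "is_L2_fourier f g" and gI: "integrable lebesgue g"
  shows "(LINT \<xi>|lebesgue. g \<xi> * exp (\<i> * complex_of_real (x \<bullet> \<xi>))) = complex_of_real ((2 * pi) ^ DIM('a) * f x)"
proof -
  have fm[measurable]: "f \<in> borel_measurable borel" using cf by (rule borel_measurable_continuous_onI)
  have gm[measurable]: "g \<in> borel_measurable lebesgue" using gI by auto
  have cx: "isCont f x" using cf by (simp add: continuous_on_eq_continuous_at)
  define d where "d n = 1 / real (Suc n)" for n
  have d: "d n > 0" for n by (simp add: d_def)
  have d0: "d \<longlonglongrightarrow> 0" unfolding d_def using LIMSEQ_Suc[OF lim_inverse_n'] by simp
  let ?E = "\<lambda>n \<xi>. exp (\<i> * complex_of_real (x \<bullet> \<xi>)) * complex_of_real (exp (- d n * (norm \<xi>)\<^sup>2 / 2))"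
  have Em: "(\<lambda>\<xi>. ?E n \<xi>) \<in> borel_measurable lebesgue" for n by (rule measurable_completion) measurable
  have Em': "(\<lambda>\<xi>. exp (\<i> * complex_of_real (x \<bullet> \<xi>))) \<in> borel_measurable lebesgue" by (rule measurable_completion) measurable
  have "(\<lambda>n. LINT \<xi>|lebesgue. g \<xi> * ?E n \<xi>) \<longlonglongrightarrow> (LINT \<xi>|lebesgue. g \<xi> * exp (\<i> * complex_of_real (x \<bullet> \<xi>)))"
  proof (rule integral_dominated_convergence[where w="\<lambda>\<xi>. cmod (g \<xi>)"])
    show "integrable lebesgue (\<lambda>\<xi>. cmod (g \<xi>))" using gI by simp
    show "(\<lambda>\<xi>. g \<xi> * ?E n \<xi>) \<in> borel_measurable lebesgue" for n
      by (rule borel_measurable_times[OF gm Em])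
    show "(\<lambda>\<xi>. g \<xi> * exp (\<i> * complex_of_real (x \<bullet> \<xi>))) \<in> borel_measurable lebesgue"
      by (rule borel_measurable_times[OF gm Em'])
    show "AE \<xi> in lebesgue. (\<lambda>n. g \<xi> * ?E n \<xi>) \<longlonglongrightarrow> g \<xi> * exp (\<i> * complex_of_real (x \<bullet> \<xi>))"
    proof (rule AE_I2)
      fix \<xi>
      have "(\<lambda>n. g \<xi> * ?E n \<xi>) \<longlonglongrightarrow> g \<xi> * (exp (\<i> * complex_of_real (x \<bullet> \<xi>)) * complex_of_real (exp (- 0 * (norm \<xi>)\<^sup>2 / 2)))"
        by (intro tendsto_intros d0) simp
      then show "(\<lambda>n. g \<xi> * ?E n \<xi>) \<longlonglongrightarrow> g \<xi> * exp (\<i> * complex_of_real (x \<bullet> \<xi>))" by simp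
    qed
    show "AE \<xi> in lebesgue. norm (g \<xi> * ?E n \<xi>) \<le> cmod (g \<xi>)" for n
      using d[of n] by (auto simp: norm_mult intro!: mult_left_le)
  qed
  moreover have "(\<lambda>n. LINT \<xi>|lebesgue. g \<xi> * ?E n \<xi>) \<longlonglongrightarrow> complex_of_real ((2 * pi) ^ DIM('a) * f x)"
    unfolding fourier_inversion_gauss[OF cf f2 g gI d]
    unfolding d_def by (intro tendsto_of_real gauss_approx_identity(1)[OF cx fm f2])
  ultimately show ?thesis by (rule LIMSEQ_unique)
qed

text \<open>Both bounds follow by inversion from one estimate of the integral of
  \<open>(1 + norm \<xi>) * cmod (g \<xi>)\<close>: the summand 1 gives the sup bound and
  \<open>norm \<xi>\<close> the Lipschitz bound. Continuity of \<open>f\<close> singles out the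
  representative for which inversion holds at every point.\<close>

lemma sobolev_embedding:
  assumes s: "s > 1 + real DIM('a::euclidean_space) / 2"
  obtains C where "C > 0"
    "\<And>f A x. \<lbrakk>continuous_on UNIV (f::'a \<Rightarrow> real); f \<in> sobolev s; A > 0; sobolev_sqnorm s f \<le> ennreal A\<rbrakk> \<Longrightarrow> \<bar>f x\<bar> \<le> C * sqrt A"
    "\<And>f A x y. \<lbrakk>continuous_on UNIV (f::'a \<Rightarrow> real); f \<in> sobolev s; A > 0; sobolev_sqnorm s f \<le> ennreal A\<rbrakk> \<Longrightarrow> \<bar>f x - f y\<bar> \<le> C * sqrt A * norm (x - y)"
proof -
  define N where "N = (2 * pi) ^ DIM('a)"
  have N: "N > 0" by (simp add: N_def)
  \<comment> \<open>The factor 2 is that of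
    \<open>(1 + norm \<xi>)^2 \<le> 2 * (1 + (norm \<xi>)^2)\<close>; the added 1 makes
    \<open>B\<close> positive, as the Cauchy-Schwarz lemma requires.\<close>
  define B where "B = 2 * (enn2real (\<integral>\<^sup>+\<xi>. ennreal ((1 + (norm (\<xi>::'a))\<^sup>2) powr (1 - s)) \<partial>lborel) + 1)"
  have B: "B > 0" by (simp add: B_def add_nonneg_pos)
  have wB: "2 * (\<integral>\<^sup>+\<xi>. ennreal ((1 + (norm (\<xi>::'a))\<^sup>2) powr (1 - s)) \<partial>lebesgue) \<le> ennreal B"
  proof -
    define I where "I = (\<integral>\<^sup>+\<xi>. ennreal ((1 + (norm (\<xi>::'a))\<^sup>2) powr (1 - s)) \<partial>lborel)"
    have "I = ennreal (enn2real I)" using sobolev_weight_finite[OF s] by (simp add: I_def)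
    then have "2 * I = ennreal (2 * enn2real I)" by (simp add: ennreal_mult')
    also have "\<dots> \<le> ennreal B" unfolding B_def I_def[symmetric] by (rule ennreal_leI) simp
    finally show ?thesis by (simp add: I_def nn_integral_completion)
  qed
  define C where "C = sqrt B / N"
  have C: "C > 0" using B N by (simp add: C_def)
  have main: "\<exists>g. integrable lebesgue g \<and> (\<forall>x. (LINT \<xi>|lebesgue. g \<xi> * exp (\<i> * complex_of_real (x \<bullet> \<xi>))) = complex_of_real (N * f x))
      \<and> (\<integral>\<^sup>+\<xi>. ennreal ((1 + norm \<xi>) * cmod (g \<xi>)) \<partial>lebesgue) \<le> ennreal (sqrt B * sqrt A)"
    if f: "continuous_on UNIV f" "f \<in> sobolev s" "A > 0" "sobolev_sqnorm s f \<le> ennreal A" for f :: "'a \<Rightarrow> real" and A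
  proof -
    have fm[measurable]: "f \<in> borel_measurable borel" using f(1) by (rule borel_measurable_continuous_onI)
    have f2: "integrable lborel (\<lambda>x. (f x)\<^sup>2)"
      using f(2) by (intro integrableI_bounded) (auto simp: sobolev_def L2_def nn_integral_completion)
    define g where "g = L2_fourier f"
    have g: "is_L2_fourier f g"
      unfolding g_def L2_fourier_def using L2_fourier_exists[OF fm f2] by (metis someI_ex)
    then have gm[measurable]: "g \<in> borel_measurable lebesgue" by (simp add: is_L2_fourier_def)
    let ?a = "\<lambda>\<xi>::'a. sqrt 2 * (1 + (norm \<xi>)\<^sup>2) powr ((1 - s) / 2)"
    let ?b = "\<lambda>\<xi>. (1 + (norm \<xi>)\<^sup>2) powr (s / 2) * cmod (g \<xi>)"
    have am: "?a \<in> borel_measurable lebesgue" by (rule measurable_completion) measurable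
    have bm0: "(\<lambda>\<xi>::'a. (1 + (norm \<xi>)\<^sup>2) powr (s / 2)) \<in> borel_measurable lebesgue" by (rule measurable_completion) measurable
    have bm: "?b \<in> borel_measurable lebesgue"
      by (rule borel_measurable_times[OF bm0]) measurable
    have pp: "((1 + (norm (\<xi>::'a))\<^sup>2) powr p)\<^sup>2 = (1 + (norm \<xi>)\<^sup>2) powr (2 * p)" for \<xi> p
      by (simp add: power2_eq_square flip: powr_add)
    have "(\<integral>\<^sup>+\<xi>. ennreal ((1 + norm \<xi>) * cmod (g \<xi>)) \<partial>lebesgue) \<le> (\<integral>\<^sup>+\<xi>. ennreal (?a \<xi> * ?b \<xi>) \<partial>lebesgue)"
    proof (intro nn_integral_mono ennreal_leI)
      fix \<xi> :: 'a
      have pos: "1 + (norm \<xi>)\<^sup>2 > 0" by (simp add: add_pos_nonneg)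
      have "?a \<xi> * ?b \<xi> = sqrt 2 * ((1 + (norm \<xi>)\<^sup>2) powr ((1 - s) / 2) * (1 + (norm \<xi>)\<^sup>2) powr (s / 2)) * cmod (g \<xi>)" by simp
      also have "(1 + (norm \<xi>)\<^sup>2) powr ((1 - s) / 2) * (1 + (norm \<xi>)\<^sup>2) powr (s / 2) = (1 + (norm \<xi>)\<^sup>2) powr (1 / 2)"
        by (subst powr_add[symmetric]) (simp add: field_simps)
      also have "\<dots> = sqrt (1 + (norm \<xi>)\<^sup>2)" using pos by (simp add: powr_half_sqrt)
      finally have eq: "?a \<xi> * ?b \<xi> = sqrt (2 * (1 + (norm \<xi>)\<^sup>2)) * cmod (g \<xi>)" by (simp only: real_sqrt_mult)
      have "(1 + norm \<xi>)\<^sup>2 \<le> 2 * (1 + (norm \<xi>)\<^sup>2)"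
        using zero_le_power2[of "1 - norm \<xi>"] by (simp add: power2_eq_square algebra_simps)
      then have "1 + norm \<xi> \<le> sqrt (2 * (1 + (norm \<xi>)\<^sup>2))" by (rule real_le_rsqrt)
      then show "(1 + norm \<xi>) * cmod (g \<xi>) \<le> ?a \<xi> * ?b \<xi>" unfolding eq by (rule mult_right_mono) simp
    qed
    also have "\<dots> \<le> ennreal (sqrt (B * A))"
    proof (rule nn_integral_Cauchy_Schwarz[OF am bm])
      show "(\<integral>\<^sup>+\<xi>. ennreal ((?a \<xi>)\<^sup>2) \<partial>lebesgue) \<le> ennreal B"
      proof -
        have "(\<integral>\<^sup>+\<xi>. ennreal ((?a \<xi>)\<^sup>2) \<partial>lebesgue) = (\<integral>\<^sup>+\<xi>. 2 * ennreal ((1 + (norm (\<xi>::'a))\<^sup>2) powr (1 - s)) \<partial>lebesgue)"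
        proof (rule nn_integral_cong)
          fix \<xi> :: 'a
          have "(?a \<xi>)\<^sup>2 = 2 * (1 + (norm \<xi>)\<^sup>2) powr (2 * ((1 - s) / 2))"
            by (simp only: power_mult_distrib pp) simp
          also have "2 * ((1 - s) / 2) = 1 - s" by simp
          finally show "ennreal ((?a \<xi>)\<^sup>2) = 2 * ennreal ((1 + (norm \<xi>)\<^sup>2) powr (1 - s))"
            by (simp add: ennreal_mult')
        qed
        also have "\<dots> \<le> ennreal B"
          using wB by (simp add: nn_integral_completion nn_integral_cmult)
        finally show ?thesis .
      qed
      have "(?b \<xi>)\<^sup>2 = (1 + (norm \<xi>)\<^sup>2) powr s * (cmod (L2_fourier f \<xi>))\<^sup>2" for \<xi>
        by (simp add: power_mult_distrib pp g_def)
      then show "(\<integral>\<^sup>+\<xi>. ennreal ((?b \<xi>)\<^sup>2) \<partial>lebesgue) \<le> ennreal A"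
        using f(4) by (simp add: sobolev_sqnorm_def)
    qed (use B f in auto)
    finally have Q: "(\<integral>\<^sup>+\<xi>. ennreal ((1 + norm \<xi>) * cmod (g \<xi>)) \<partial>lebesgue) \<le> ennreal (sqrt B * sqrt A)"
      by (simp add: real_sqrt_mult)
    have gI: "integrable lebesgue g"
    proof (rule integrableI_bounded)
      have "(\<integral>\<^sup>+\<xi>. ennreal (norm (g \<xi>)) \<partial>lebesgue) \<le> (\<integral>\<^sup>+\<xi>. ennreal ((1 + norm \<xi>) * cmod (g \<xi>)) \<partial>lebesgue)"
        by (intro nn_integral_mono ennreal_leI) (simp add: algebra_simps)
      also have "\<dots> < \<infinity>" using Q by (rule order_le_less_trans) simp
      finally show "(\<integral>\<^sup>+\<xi>. ennreal (norm (g \<xi>)) \<partial>lebesgue) < \<infinity>" .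
    qed measurable
    show ?thesis using gI Q fourier_inversion[OF f(1) f2 g gI] unfolding N_def by blast
  qed
  show thesis
  proof (rule that[OF C])
    fix f :: "'a \<Rightarrow> real" and A x
    assume f: "continuous_on UNIV f" "f \<in> sobolev s" "A > 0" "sobolev_sqnorm s f \<le> ennreal A"
    obtain g where gI: "integrable lebesgue g" and e: "\<And>x. (LINT \<xi>|lebesgue. g \<xi> * exp (\<i> * complex_of_real (x \<bullet> \<xi>))) = complex_of_real (N * f x)"
      and Q: "(\<integral>\<^sup>+\<xi>. ennreal ((1 + norm \<xi>) * cmod (g \<xi>)) \<partial>lebesgue) \<le> ennreal (sqrt B * sqrt A)"
      using main[OF f] by blast
    have gm[measurable]: "g \<in> borel_measurable lebesgue" using gI by auto
    have Em: "(\<lambda>\<xi>. exp (\<i> * complex_of_real (x \<bullet> \<xi>))) \<in> borel_measurable lebesgue" for x :: 'a by (rule measurable_completion) measurable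
    have gE: "integrable lebesgue (\<lambda>\<xi>. g \<xi> * exp (\<i> * complex_of_real (x \<bullet> \<xi>)))" for x
      by (rule Bochner_Integration.integrable_bound[OF gI borel_measurable_times[OF gm Em]]) (simp add: norm_mult)
    have "ennreal (norm (complex_of_real (N * f x))) \<le> (\<integral>\<^sup>+\<xi>. ennreal (norm (g \<xi> * exp (\<i> * complex_of_real (x \<bullet> \<xi>)))) \<partial>lebesgue)"
      unfolding e[symmetric] by (rule integral_norm_bound_ennreal[OF gE])
    also have "\<dots> \<le> (\<integral>\<^sup>+\<xi>. ennreal ((1 + norm \<xi>) * cmod (g \<xi>)) \<partial>lebesgue)"
      by (intro nn_integral_mono ennreal_leI) (simp add: algebra_simps norm_mult)
    also note Q
    finally have "N * \<bar>f x\<bar> \<le> sqrt B * sqrt A" using N B f(3) by (simp add: ennreal_le_iff abs_mult norm_mult)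
    then show "\<bar>f x\<bar> \<le> C * sqrt A" using N by (simp add: C_def field_simps)
  next
    fix f :: "'a \<Rightarrow> real" and A x y
    assume f: "continuous_on UNIV f" "f \<in> sobolev s" "A > 0" "sobolev_sqnorm s f \<le> ennreal A"
    obtain g where gI: "integrable lebesgue g" and e: "\<And>x. (LINT \<xi>|lebesgue. g \<xi> * exp (\<i> * complex_of_real (x \<bullet> \<xi>))) = complex_of_real (N * f x)"
      and Q: "(\<integral>\<^sup>+\<xi>. ennreal ((1 + norm \<xi>) * cmod (g \<xi>)) \<partial>lebesgue) \<le> ennreal (sqrt B * sqrt A)"
      using main[OF f] by blast
    have gm[measurable]: "g \<in> borel_measurable lebesgue" using gI by auto
    have Em: "(\<lambda>\<xi>. exp (\<i> * complex_of_real (x \<bullet> \<xi>))) \<in> borel_measurable lebesgue" for x :: 'a by (rule measurable_completion) measurable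
    have gE: "integrable lebesgue (\<lambda>\<xi>. g \<xi> * exp (\<i> * complex_of_real (x \<bullet> \<xi>)))" for x
      by (rule Bochner_Integration.integrable_bound[OF gI borel_measurable_times[OF gm Em]]) (simp add: norm_mult)
    have "complex_of_real (N * (f x - f y)) = (LINT \<xi>|lebesgue. g \<xi> * exp (\<i> * complex_of_real (x \<bullet> \<xi>)) - g \<xi> * exp (\<i> * complex_of_real (y \<bullet> \<xi>)))"
      by (subst Bochner_Integration.integral_diff[OF gE gE]) (simp add: e algebra_simps)
    then have "ennreal (norm (complex_of_real (N * (f x - f y)))) \<le> (\<integral>\<^sup>+\<xi>. ennreal (norm (g \<xi> * exp (\<i> * complex_of_real (x \<bullet> \<xi>)) - g \<xi> * exp (\<i> * complex_of_real (y \<bullet> \<xi>)))) \<partial>lebesgue)"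
      using integral_norm_bound_ennreal[OF Bochner_Integration.integrable_diff[OF gE[of x] gE[of y]]] by simp
    also have "\<dots> \<le> (\<integral>\<^sup>+\<xi>. ennreal (norm (x - y)) * ennreal ((1 + norm \<xi>) * cmod (g \<xi>)) \<partial>lebesgue)"
    proof (rule nn_integral_mono)
      fix \<xi>
      have "norm (g \<xi> * exp (\<i> * complex_of_real (x \<bullet> \<xi>)) - g \<xi> * exp (\<i> * complex_of_real (y \<bullet> \<xi>))) = cmod (g \<xi>) * cmod (exp (\<i> * complex_of_real (x \<bullet> \<xi>)) - exp (\<i> * complex_of_real (y \<bullet> \<xi>)))"
        by (simp add: norm_mult flip: right_diff_distrib)
      also have "\<dots> \<le> cmod (g \<xi>) * \<bar>x \<bullet> \<xi> - y \<bullet> \<xi>\<bar>" by (intro mult_left_mono norm_exp_ii_diff) simp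
      also have "\<dots> \<le> cmod (g \<xi>) * (norm (x - y) * norm \<xi>)"
        by (intro mult_left_mono) (simp_all add: Cauchy_Schwarz_ineq2 flip: inner_diff_left)
      also have "\<dots> \<le> norm (x - y) * ((1 + norm \<xi>) * cmod (g \<xi>))" by (simp add: algebra_simps)
      finally show "ennreal (norm (g \<xi> * exp (\<i> * complex_of_real (x \<bullet> \<xi>)) - g \<xi> * exp (\<i> * complex_of_real (y \<bullet> \<xi>)))) \<le> ennreal (norm (x - y)) * ennreal ((1 + norm \<xi>) * cmod (g \<xi>))"
        by (simp add: ennreal_leI flip: ennreal_mult')
    qed
    also have "\<dots> = ennreal (norm (x - y)) * (\<integral>\<^sup>+\<xi>. ennreal ((1 + norm \<xi>) * cmod (g \<xi>)) \<partial>lebesgue)"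
    proof (rule nn_integral_cmult)
      have "(\<lambda>\<xi>::'a. 1 + norm \<xi>) \<in> borel_measurable lebesgue" by (rule measurable_completion) measurable
      then show "(\<lambda>\<xi>. ennreal ((1 + norm \<xi>) * cmod (g \<xi>))) \<in> borel_measurable lebesgue" by measurable
    qed
    also have "\<dots> \<le> ennreal (norm (x - y)) * ennreal (sqrt B * sqrt A)" by (intro mult_left_mono Q) simp
    also have "\<dots> = ennreal (norm (x - y) * (sqrt B * sqrt A))" by (rule ennreal_mult'[symmetric]) simp
    finally have "N * \<bar>f x - f y\<bar> \<le> norm (x - y) * (sqrt B * sqrt A)" using N B f(3) by (simp add: ennreal_le_iff abs_mult norm_mult del: of_real_mult of_real_diff)
    then show "\<bar>f x - f y\<bar> \<le> C * sqrt A * norm (x - y)" using N by (simp add: C_def field_simps)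
  qed
qed

subsection \<open>Decay at infinity and the regularised datum\<close>

text \<open>If \<open>\<bar>f x\<bar> \<ge> e\<close>, then \<open>\<bar>f\<bar> \<ge> e / 2\<close>
  on a ball around \<open>x\<close> whose radius does not depend on \<open>x\<close>. For distant
  \<open>x\<close> this ball would put the fixed amount \<open>k\<close> into an L^2 tail smaller
  than \<open>k\<close>.\<close>

lemma Lipschitz_L2_decay:
  fixes f :: "'a::euclidean_space \<Rightarrow> real"
  assumes L: "\<And>x y. \<bar>f x - f y\<bar> \<le> L * norm (x - y)" and f2: "integrable lborel (\<lambda>x. (f x)\<^sup>2)" and e: "e > 0"
  shows "\<exists>N. \<forall>x. norm x \<ge> N \<longrightarrow> \<bar>f x\<bar> < e"
proof -
  define r where "r = e / (2 * (\<bar>L\<bar> + 1))"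
  have r: "r > 0" using e by (simp add: r_def add_nonneg_pos)
  have Lr: "\<bar>L\<bar> * r \<le> e / 2" using e by (simp add: r_def field_simps)
  define k where "k = (e / 2)\<^sup>2 * (unit_ball_vol (real DIM('a)) * r ^ DIM('a))"
  have k: "k > 0" using e r by (simp add: k_def)
  have "\<forall>\<^sub>F R in at_top. (LINT x|lborel. (f x)\<^sup>2 * indicator {x. R \<le> norm x} x) < k"
    by (rule order_tendstoD(2)[OF integral_tail_tendsto[OF f2] k])
  then obtain N where N: "(LINT x|lborel. (f x)\<^sup>2 * indicator {x. N \<le> norm x} x) < k"
    by (auto simp: eventually_at_top_linorder)
  show ?thesis
  proof (intro exI allI impI)
    fix x :: 'a assume x: "norm x \<ge> N + r"
    show "\<bar>f x\<bar> < e"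
    proof (rule ccontr)
      assume "\<not> \<bar>f x\<bar> < e"
      then have fx: "\<bar>f x\<bar> \<ge> e" by simp
      have ball: "(e / 2)\<^sup>2 \<le> (f y)\<^sup>2 \<and> N \<le> norm y" if "y \<in> ball x r" for y
      proof -
        have d: "norm (x - y) < r" using that by (simp add: dist_norm)
        have "\<bar>f x - f y\<bar> \<le> \<bar>L\<bar> * r"
          by (rule order_trans[OF L]) (use d r in \<open>auto intro!: mult_mono\<close>)
        then have "\<bar>f y\<bar> \<ge> e / 2" using Lr fx by linarith
        then have "(e / 2)\<^sup>2 \<le> \<bar>f y\<bar>\<^sup>2" using e by (intro power_mono) auto
        moreover have "N \<le> norm y" using d x norm_triangle_ineq4[of x y] norm_triangle_ineq[of "x - y" y] by simp
        ultimately show ?thesis by simp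
      qed
      have "k = (LINT y|lborel. (e / 2)\<^sup>2 * indicator (ball x r) y)"
        using r by (simp add: k_def content_ball)
      also have "\<dots> \<le> (LINT y|lborel. (f y)\<^sup>2 * indicator {x. N \<le> norm x} y)"
      proof (rule integral_mono)
        show "integrable lborel (\<lambda>y. (e / 2)\<^sup>2 * indicator (ball x r) y :: real)"
          by (intro integrable_mult_right integrable_real_indicator) (auto simp: emeasure_lborel_ball_finite[simplified])
        show "integrable lborel (\<lambda>y. (f y)\<^sup>2 * indicator {x. N \<le> norm x} y)"
          by (rule Bochner_Integration.integrable_bound[OF f2]) (use f2 in \<open>auto simp: indicator_def\<close>)
        show "(e / 2)\<^sup>2 * indicator (ball x r) y \<le> (f y)\<^sup>2 * indicator {x. N \<le> norm x} y" for y
          using ball[of y] by (cases "y \<in> ball x r") (auto simp: indicator_def)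
      qed
      finally show False using N by simp
    qed
  qed
qed

section \<open>The mollifier and the regularised datum\<close>

lemma integral_rescale:
  fixes f :: "'a::euclidean_space \<Rightarrow> real"
  assumes [measurable]: "f \<in> borel_measurable borel" and c: "c \<noteq> 0"
  shows "(LINT y|lborel. f (t + c *\<^sub>R y)) = (LINT y|lborel. f y) / \<bar>c\<bar> ^ DIM('a)"
    and "integrable lborel (\<lambda>y. f (t + c *\<^sub>R y)) \<longleftrightarrow> integrable lborel f"
proof -
  have "(LINT y|lborel. f y) = \<bar>c\<bar> ^ DIM('a) * (LINT y|lborel. f (t + c *\<^sub>R y))"
    by (subst lborel_affine[OF c, of t]) (simp add: integral_density integral_distr)
  then show "(LINT y|lborel. f (t + c *\<^sub>R y)) = (LINT y|lborel. f y) / \<bar>c\<bar> ^ DIM('a)"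
    using c by simp
  show "integrable lborel (\<lambda>y. f (t + c *\<^sub>R y)) \<longleftrightarrow> integrable lborel f"
    using c by (subst (2) lborel_affine[OF c, of t]) (simp add: integrable_density integrable_distr_eq)
qed

text \<open>As a function of the squared norm only the value 1 is critical; there
  \<open>exp (1 / (u - 1))\<close> tends to 0 from the left.\<close>

lemma continuous_bump: "continuous_on UNIV (bump :: 'a::euclidean_space \<Rightarrow> real)"
proof -
  define g where "g u = (if u < 1 then exp (1 / (u - 1)) else 0)" for u :: real
  have "isCont g u" for u
  proof -
    consider "u < 1" | "u > 1" | "u = 1" by linarith
    then show ?thesis
    proof cases
      case 1
      have "isCont (\<lambda>u::real. exp (1 / (u - 1))) u" using 1 by (intro continuous_intros) auto
      moreover have "\<forall>\<^sub>F v in nhds u. g v = exp (1 / (v - 1))"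
        using eventually_nhds_in_open[of "{..<1}" u] 1 by (auto elim!: eventually_mono simp: g_def)
      ultimately show ?thesis by (simp add: isCont_cong)
    next
      case 2
      have "\<forall>\<^sub>F v in nhds u. g v = 0"
        using eventually_nhds_in_open[of "{1<..}" u] 2 by (auto elim!: eventually_mono simp: g_def)
      then show ?thesis by (simp add: isCont_cong)
    next
      case 3
      have "((\<lambda>u::real. exp (1 / (u - 1))) \<longlongrightarrow> 0) (at_left 1)" by real_asymp
      moreover have "\<forall>\<^sub>F v in at_left 1. exp (1 / (v - 1)) = g v"
        by (rule eventually_at_leftI[of 0]) (auto simp: g_def)
      ultimately have "(g \<longlongrightarrow> 0) (at_left 1)" by (rule Lim_transform_eventually)
      moreover have "(g \<longlongrightarrow> 0) (at_right 1)"
        by (rule tendsto_eventually, rule eventually_at_rightI[of _ 2]) (auto simp: g_def)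
      ultimately show ?thesis using 3 by (simp add: isCont_def filterlim_at_split g_def)
    qed
  qed
  then have cg: "continuous_on UNIV g" by (simp add: continuous_on_eq_continuous_at)
  have beq: "(bump :: 'a \<Rightarrow> real) = (\<lambda>x. g ((norm x)\<^sup>2))"
  proof
    fix x :: 'a
    have "(norm x)\<^sup>2 < 1 \<longleftrightarrow> norm x < 1" using power_less_one_iff[of "norm x" 2] by simp
    then show "bump x = g ((norm x)\<^sup>2)" by (simp add: bump_def g_def)
  qed
  show ?thesis
    unfolding beq by (rule continuous_on_compose2[OF cg]) (auto intro!: continuous_intros)
qed

lemma bump_bounds: "0 \<le> bump x" "bump x \<le> 1"
proof -
  have "norm x < 1 \<Longrightarrow> (norm x)\<^sup>2 < 1" using power_less_one_iff[of "norm x" 2] by simp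
  then show "0 \<le> bump x" "bump x \<le> 1" by (auto simp: bump_def divide_nonpos_neg)
qed

lemma bump_measurable[measurable]: "bump \<in> borel_measurable borel"
  by (rule borel_measurable_continuous_onI[OF continuous_bump])

lemma bump_integrable: "integrable lborel (bump :: 'a::euclidean_space \<Rightarrow> real)"
proof (rule Bochner_Integration.integrable_bound)
  show "integrable lborel (indicator (ball (0::'a) 1) :: 'a \<Rightarrow> real)"
    by (intro integrable_real_indicator) (auto simp: emeasure_lborel_ball_finite[simplified])
  show "AE x in lborel. norm (bump x) \<le> norm (indicator (ball (0::'a) 1) x :: real)"
  proof (rule AE_I2)
    fix x :: 'a
    show "norm (bump x) \<le> norm (indicator (ball (0::'a) 1) x :: real)"
      using bump_bounds[of x] by (cases "norm x < 1") (simp_all add: bump_def[of x])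
  qed
qed measurable

lemma bump_integral_pos: "(LINT y|lborel. bump (y::'a::euclidean_space)) > 0"
proof -
  \<comment> \<open>On the ball of radius 1/2 the exponent is at least -4/3, hence above -2.\<close>
  have "0 < exp (-2) * (unit_ball_vol (real DIM('a)) * (1/2) ^ DIM('a))" by simp
  also have "\<dots> = (LINT y|lborel. exp (-2) * indicator (ball (0::'a) (1/2)) y)"
    by (simp add: content_ball)
  also have "\<dots> \<le> (LINT y|lborel. bump (y::'a))"
  proof (rule integral_mono[OF _ bump_integrable])
    show "integrable lborel (\<lambda>y. exp (-2) * indicator (ball (0::'a) (1/2)) y :: real)"
      by (intro integrable_mult_right integrable_real_indicator) (auto simp: emeasure_lborel_ball_finite[simplified])
    show "exp (-2) * indicator (ball (0::'a) (1/2)) y \<le> bump y" for y :: 'a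
    proof (cases "y \<in> ball (0::'a) (1/2)")
      case True
      then have n: "norm y < 1/2" by simp
      then have "(norm y)\<^sup>2 \<le> (1/2)\<^sup>2" by (intro power_mono) auto
      then have "-2 \<le> 1 / ((norm y)\<^sup>2 - 1)" by (simp add: field_simps power2_eq_square)
      then show ?thesis using n True by (simp add: bump_def)
    qed (simp add: bump_bounds)
  qed
  finally show ?thesis .
qed

lemma lebesgue_integral_borel: "f \<in> borel_measurable borel \<Longrightarrow> (LINT x|lebesgue. f x) = (LINT x|lborel. f x)"
  for f :: "'a::euclidean_space \<Rightarrow> 'b::{banach, second_countable_topology}"
  by (rule integral_completion) simp

lemma mollifier_props:
  assumes e: "\<epsilon> > 0"
  shows "continuous_on UNIV (mollifier \<epsilon> :: 'a::euclidean_space \<Rightarrow> real)"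
    and "0 \<le> mollifier \<epsilon> (x::'a)"
    and "\<exists>K. \<forall>x. mollifier \<epsilon> (x::'a) \<le> K"
    and "integrable lborel (\<lambda>y. mollifier \<epsilon> (x - y))"
    and "(LINT y|lborel. mollifier \<epsilon> (x - y)) = 1"
proof -
  define J where "J = (LINT y|lborel. bump (y::'a))"
  have J: "J > 0" using bump_integral_pos by (simp add: J_def)
  have m: "mollifier \<epsilon> = (\<lambda>x::'a. bump ((1 / \<epsilon>) *\<^sub>R x) * (1 / (J * \<epsilon> ^ DIM('a))))"
    by (simp add: mollifier_def[abs_def] standard_mollifier_def J_def lebesgue_integral_borel)
  show "continuous_on UNIV (mollifier \<epsilon> :: 'a \<Rightarrow> real)"
    unfolding m by (intro continuous_intros continuous_on_compose2[OF continuous_bump]) auto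
  show "0 \<le> mollifier \<epsilon> x" unfolding m using J e by (simp add: bump_bounds)
  have "mollifier \<epsilon> x \<le> 1 / (J * \<epsilon> ^ DIM('a))" for x :: 'a
    unfolding m using J e bump_bounds by (intro mult_left_le_one_le) auto
  then show "\<exists>K. \<forall>x. mollifier \<epsilon> (x::'a) \<le> K" by blast
  have mm: "(\<lambda>y. mollifier \<epsilon> (x - y)) = (\<lambda>y. bump ((1 / \<epsilon>) *\<^sub>R x + (- 1 / \<epsilon>) *\<^sub>R y) * (1 / (J * \<epsilon> ^ DIM('a))))"
    unfolding m by (simp add: scaleR_diff_right)
  show "integrable lborel (\<lambda>y. mollifier \<epsilon> (x - y))"
    unfolding mm using e bump_integrable
    by (intro integrable_mult_left) (subst integral_rescale(2), auto)
  show "(LINT y|lborel. mollifier \<epsilon> (x - y)) = 1"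
    unfolding mm using e J
    by (subst integral_mult_left_zero, subst integral_rescale(1)) (auto simp: J_def power_divide)
qed

lemma Linf_AE_bound:
  fixes f :: "'a::euclidean_space \<Rightarrow> real"
  assumes "f \<in> Linf"
  shows "AE x in lebesgue. \<bar>f x\<bar> \<le> Linf_norm f" and "0 \<le> Linf_norm f"
proof -
  have fin: "Linf_enorm f < \<infinity>" using assms by (auto simp: Linf_def)
  have ae: "AE x in lebesgue. ereal \<bar>f x\<bar> \<le> Linf_enorm f"
    unfolding Linf_enorm_def by (rule esssup_AE)
  \<comment> \<open>Lebesgue measure is not zero, so a property that holds almost everywhere has a
    witness. It shows that the essential supremum is nonnegative, so that
    \<open>real_of_ereal\<close> loses nothing.\<close>
  have ex: "\<exists>x. P x" if "AE x in (lebesgue::'a measure). P x" for P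
  proof (rule ccontr)
    assume "\<nexists>x. P x"
    then have "AE x in (lebesgue::'a measure). False" using that by auto
    then have "emeasure lebesgue (space (lebesgue::'a measure)) = 0" by (simp only: AE_iff_null_sets[of "UNIV", simplified] eventually_False trivial_limit_def[symmetric] ae_filter_eq_bot_iff)
    then show False by simp
  qed
  obtain x where "ereal \<bar>f x\<bar> \<le> Linf_enorm f" using ex[OF ae] by blast
  then have "0 \<le> Linf_enorm f" by (rule order_trans[rotated]) simp
  then obtain r where r: "Linf_enorm f = ereal r" "r \<ge> 0" using fin by (cases "Linf_enorm f") auto
  show "AE x in lebesgue. \<bar>f x\<bar> \<le> Linf_norm f" using ae by (simp add: Linf_norm_def r)
  show "0 \<le> Linf_norm f" by (simp add: Linf_norm_def r)
qed

text \<open>The mollifier is nonnegative with mass one, and cutting off only decreases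
  \<open>\<bar>f\<bar>\<close>. The bound does not involve \<epsilon>, and through it the final
  times and constants are free of \<epsilon>.\<close>

lemma regularized_datum_bound:
  fixes f :: "'a::euclidean_space \<Rightarrow> real"
  assumes f: "f \<in> Linf" and e: "\<epsilon> > 0"
  shows "\<bar>regularized_datum \<epsilon> f x\<bar> \<le> Linf_norm f" and "continuous_on UNIV (regularized_datum \<epsilon> f)"
proof -
  have fm: "f \<in> borel_measurable lebesgue" using f by (auto simp: Linf_def)
  define w where "w y = f y * indicator (ball 0 (1 / \<epsilon>)) y" for y
  have wm: "w \<in> borel_measurable lebesgue" unfolding w_def[abs_def]
    by (intro borel_measurable_times fm borel_measurable_indicator) auto
  note mp = mollifier_props[OF e, where 'a='a]
  have mmb[measurable]: "(mollifier \<epsilon> :: 'a \<Rightarrow> real) \<in> borel_measurable borel" by (rule borel_measurable_continuous_onI[OF mp(1)])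
  have mm: "(\<lambda>y. mollifier \<epsilon> (x - y)) \<in> borel_measurable lebesgue" for x :: 'a
    by (rule measurable_completion) measurable
  have mI: "integrable lebesgue (\<lambda>y. mollifier \<epsilon> (x - y))" "(LINT y|lebesgue. mollifier \<epsilon> (x - y)) = 1" for x :: 'a
    using mp(4,5)[of x] by (auto simp: integrable_completion integral_completion)
  have wb: "AE y in lebesgue. \<bar>w y\<bar> \<le> Linf_norm f * indicator (ball 0 (1 / \<epsilon>)) y"
    using Linf_AE_bound(1)[OF f] by eventually_elim (auto simp: w_def indicator_def)
  have wb': "AE y in lebesgue. \<bar>w y\<bar> \<le> Linf_norm f"
    using Linf_AE_bound(1)[OF f] by eventually_elim (auto simp: w_def indicator_def)
  have wI: "integrable lebesgue w"
  proof (rule Bochner_Integration.integrable_bound[OF _ wm])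
    have "integrable lborel (\<lambda>y. Linf_norm f * indicator (ball (0::'a) (1 / \<epsilon>)) y :: real)"
      by (intro integrable_mult_right integrable_real_indicator) (auto simp: emeasure_lborel_ball_finite[simplified])
    then show "integrable lebesgue (\<lambda>y. Linf_norm f * indicator (ball (0::'a) (1 / \<epsilon>)) y :: real)"
      by (subst integrable_completion) auto
    show "AE y in lebesgue. norm (w y) \<le> norm (Linf_norm f * indicator (ball 0 (1 / \<epsilon>)) y :: real)"
      using wb by eventually_elim (use Linf_AE_bound(2)[OF f] in \<open>auto simp: abs_mult\<close>)
  qed
  have rd: "regularized_datum \<epsilon> f x = (LINT y|lebesgue. mollifier \<epsilon> (x - y) * w y)" for x
    by (simp add: regularized_datum_def w_def)
  show "\<bar>regularized_datum \<epsilon> f x\<bar> \<le> Linf_norm f"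
  proof -
    \<comment> \<open>A product that is not integrable has integral 0 by default, so the inequality
      holds in either case.\<close>
    have "ennreal \<bar>regularized_datum \<epsilon> f x\<bar> \<le> (\<integral>\<^sup>+y. ennreal (norm (mollifier \<epsilon> (x - y) * w y)) \<partial>lebesgue)"
      unfolding rd by (cases "integrable lebesgue (\<lambda>y. mollifier \<epsilon> (x - y) * w y)")
        (auto simp: not_integrable_integral_eq simp del: real_norm_def simp flip: real_norm_def intro!: integral_norm_bound_ennreal)
    also have "\<dots> \<le> (\<integral>\<^sup>+y. ennreal (Linf_norm f * mollifier \<epsilon> (x - y)) \<partial>lebesgue)"
      using wb' by (intro nn_integral_mono_AE, eventually_elim)
        (use mp(2) in \<open>auto simp: abs_mult mult.commute intro!: ennreal_leI mult_right_mono\<close>)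
    also have "\<dots> = ennreal (Linf_norm f)"
      using Linf_AE_bound(2)[OF f] mp(2) mI[of x] by (subst nn_integral_eq_integral) auto
    finally show ?thesis using Linf_AE_bound(2)[OF f] by (simp add: ennreal_le_iff)
  qed
  obtain K where K: "\<And>x::'a. mollifier \<epsilon> x \<le> K" using mp(3) by blast
  show "continuous_on UNIV (regularized_datum \<epsilon> f)"
  proof (rule continuous_on_sequentiallyI)
    fix u :: "nat \<Rightarrow> 'a" and a assume u: "u \<longlonglongrightarrow> a"
    show "(\<lambda>n. regularized_datum \<epsilon> f (u n)) \<longlonglongrightarrow> regularized_datum \<epsilon> f a"
      unfolding rd
    proof (rule integral_dominated_convergence[where w="\<lambda>y. K * \<bar>w y\<bar>"])
      show "AE y in lebesgue. (\<lambda>n. mollifier \<epsilon> (u n - y) * w y) \<longlonglongrightarrow> mollifier \<epsilon> (a - y) * w y"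
        by (intro AE_I2 tendsto_intros continuous_on_tendsto_compose[OF mp(1)] u) auto
      show "AE y in lebesgue. norm (mollifier \<epsilon> (u n - y) * w y) \<le> K * \<bar>w y\<bar>" for n
        using mp(2) K by (intro AE_I2) (auto simp: abs_mult intro!: mult_right_mono)
    qed (use wI wm mm in \<open>auto intro!: borel_measurable_times\<close>)
  qed
qed

subsection \<open>Averages over balls and truncated kernels\<close>

text \<open>A correlation rather than a convolution: the sign \<open>x + z\<close> is that of
  \<open>velocity_op\<close>.\<close>

definition conv :: "('a::euclidean_space \<Rightarrow> real) \<Rightarrow> ('a \<Rightarrow> real) \<Rightarrow> 'a \<Rightarrow> real" where
  "conv k g x = (LINT z|lborel. k z * g (x + z))"

lemma conv_measurable[measurable]:
  assumes [measurable]: "k \<in> borel_measurable borel" "g \<in> borel_measurable borel"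
  shows "conv k g \<in> borel_measurable borel"
proof -
  have "(\<lambda>x. LINT z|lborel. k z * g (x + z)) \<in> borel_measurable lborel"
    by (rule lborel.borel_measurable_lebesgue_integral) measurable
  then show ?thesis by (simp add: conv_def[abs_def])
qed

lemma integrable_L2_prod:
  fixes k g :: "'a::euclidean_space \<Rightarrow> real"
  assumes [measurable]: "k \<in> borel_measurable borel" "g \<in> borel_measurable borel"
    and k: "integrable lborel (\<lambda>z. (k z)\<^sup>2)" and g: "integrable lborel (\<lambda>z. (g z)\<^sup>2)"
  shows "integrable lborel (\<lambda>z. k z * g (x + z))"
    and "(LINT z|lborel. \<bar>k z * g (x + z)\<bar>) \<le> (LINT z|lborel. (k z)\<^sup>2) + (LINT z|lborel. (g z)\<^sup>2)"
proof -
  have g': "integrable lborel (\<lambda>z. (g (x + z))\<^sup>2)"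
    using g by (subst integral_translate(3)[of "\<lambda>z. (g z)\<^sup>2"]) auto
  have gi: "(LINT z|lborel. (g (x + z))\<^sup>2) = (LINT z|lborel. (g z)\<^sup>2)"
    by (subst integral_translate(1)[of "\<lambda>z. (g z)\<^sup>2"]) auto
  have ab: "\<bar>a * b\<bar> \<le> a\<^sup>2 + b\<^sup>2" for a b :: real
  proof -
    have "0 \<le> (\<bar>a\<bar> - \<bar>b\<bar>)\<^sup>2" by simp
    then have "2 * (\<bar>a\<bar> * \<bar>b\<bar>) \<le> a\<^sup>2 + b\<^sup>2" by (simp add: power2_diff)
    moreover have "0 \<le> \<bar>a\<bar> * \<bar>b\<bar>" by simp
    ultimately show ?thesis unfolding abs_mult by linarith
  qed
  show i: "integrable lborel (\<lambda>z. k z * g (x + z))"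
    by (rule Bochner_Integration.integrable_bound[OF Bochner_Integration.integrable_add[OF k g']]) (use ab in auto)
  have "(LINT z|lborel. \<bar>k z * g (x + z)\<bar>) \<le> (LINT z|lborel. (k z)\<^sup>2 + (g (x + z))\<^sup>2)"
    using i k g' ab by (intro integral_mono) auto
  then show "(LINT z|lborel. \<bar>k z * g (x + z)\<bar>) \<le> (LINT z|lborel. (k z)\<^sup>2) + (LINT z|lborel. (g z)\<^sup>2)"
    using k g' gi by simp
qed

definition ball_kernel :: "real \<Rightarrow> 'a::euclidean_space \<Rightarrow> real" where
  "ball_kernel r z = indicator (ball 0 r) z / (unit_ball_vol (real DIM('a)) * r ^ DIM('a))"

lemma ball_kernel_measurable[measurable]: "ball_kernel r \<in> borel_measurable borel"
  unfolding ball_kernel_def[abs_def] by measurable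

lemma ball_kernel:
  fixes z :: "'a::euclidean_space"
  assumes r: "r > 0"
  shows "ball_kernel r z \<ge> 0"
    and "integrable lborel (ball_kernel r :: 'a \<Rightarrow> real)"
    and "(LINT z|lborel. ball_kernel r (z::'a)) = 1"
    and "integrable lborel (\<lambda>z. (ball_kernel r (z::'a))\<^sup>2)"
    and "r \<le> norm z \<Longrightarrow> ball_kernel r z = 0"
proof -
  let ?V = "unit_ball_vol (real DIM('a)) * r ^ DIM('a)"
  have V: "?V > 0" using r by simp
  have bi: "integrable lborel (indicator (ball (0::'a) r) :: 'a \<Rightarrow> real)"
    by (intro integrable_real_indicator) (auto simp: emeasure_lborel_ball_finite[simplified])
  show "ball_kernel r z \<ge> 0" using r by (simp add: ball_kernel_def)
  show "integrable lborel (ball_kernel r :: 'a \<Rightarrow> real)"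
    unfolding ball_kernel_def[abs_def] by (intro integrable_divide bi)
  show "(LINT z|lborel. ball_kernel r (z::'a)) = 1"
    unfolding ball_kernel_def using V r unit_ball_vol_pos[of "real DIM('a)"] by (simp add: content_ball less_imp_le del: unit_ball_vol_pos)
  have "(\<lambda>z. (ball_kernel r (z::'a))\<^sup>2) = (\<lambda>z. indicator (ball 0 r) z / (?V * ?V))"
    by (auto simp: ball_kernel_def indicator_def power2_eq_square)
  then show "integrable lborel (\<lambda>z. (ball_kernel r (z::'a))\<^sup>2)"
    by (simp only:) (intro integrable_divide bi)
  show "r \<le> norm z \<Longrightarrow> ball_kernel r z = 0" by (simp add: ball_kernel_def)
qed

lemma power_diff_le:
  fixes r h :: real
  assumes "0 < r" "0 \<le> h" "h \<le> r"
  shows "(r + h) ^ n - r ^ n \<le> real n * 2 ^ n * r ^ n * (h / r)"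
proof (induction n)
  case (Suc n)
  have "(r + h) ^ Suc n - r ^ Suc n = (r + h) * ((r + h) ^ n - r ^ n) + h * r ^ n" by (simp add: algebra_simps)
  also have "\<dots> \<le> (2 * r) * (real n * 2 ^ n * r ^ n * (h / r)) + h * r ^ n"
  proof (intro add_mono mult_mono Suc)
    show "0 \<le> (r + h) ^ n - r ^ n" using assms by (simp add: power_mono)
  qed (use assms in auto)
  also have "h * r ^ n = 1 * (r ^ Suc n * (h / r))" using assms by simp
  also have "\<dots> \<le> 2 ^ Suc n * (r ^ Suc n * (h / r))"
    using assms by (intro mult_right_mono) (auto intro!: one_le_power[of 2 "Suc n", simplified])
  also have "(2 * r) * (real n * 2 ^ n * r ^ n * (h / r)) + 2 ^ Suc n * (r ^ Suc n * (h / r)) = real (Suc n) * 2 ^ Suc n * r ^ Suc n * (h / r)"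
    by (simp only: power_Suc of_nat_Suc) (simp only: algebra_simps mult_1)
  finally show ?case by simp
qed simp

text \<open>The part of the shifted ball outside the original one lies in a shell of width
  \<open>norm h\<close>, whose volume is a difference of powers.\<close>

lemma ball_diff_measure:
  fixes h :: "'a::euclidean_space"
  assumes r: "r > 0" and h: "norm h \<le> r"
  shows "measure lborel (ball h r - ball 0 r) \<le> unit_ball_vol (real DIM('a)) * (real DIM('a) * 2 ^ DIM('a) * r ^ DIM('a) * (norm h / r))"
proof -
  let ?V = "unit_ball_vol (real DIM('a))"
  have "ball h r - ball 0 r \<subseteq> ball 0 (r + norm h) - ball 0 r"
  proof -
    have "norm x < r + norm h" if "dist h x < r" for x
      using that norm_triangle_ineq[of "x - h" h] by (simp add: dist_norm norm_minus_commute)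
    then show ?thesis by auto
  qed
  then have "measure lborel (ball h r - ball 0 r) \<le> measure lborel (ball (0::'a) (r + norm h) - ball 0 r)"
  proof (rule measure_mono_fmeasurable)
    have "ball (0::'a) (r + norm h) \<in> fmeasurable lborel"
      by (intro fmeasurableI) (auto simp: emeasure_lborel_ball_finite[simplified])
    then show "ball (0::'a) (r + norm h) - ball 0 r \<in> fmeasurable lborel" by (rule fmeasurable_Diff) auto
  qed auto
  also have "\<dots> = measure lborel (ball (0::'a) (r + norm h)) - measure lborel (ball (0::'a) r)"
  proof (rule measure_Diff)
    show "ball (0::'a) r \<subseteq> ball 0 (r + norm h)" by (rule subset_ball) simp
  qed (use r in \<open>auto simp: emeasure_ball\<close>)
  also have "\<dots> = ?V * ((r + norm h) ^ DIM('a) - r ^ DIM('a))"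
    using r by (simp add: content_ball algebra_simps)
  also have "\<dots> \<le> ?V * (real DIM('a) * 2 ^ DIM('a) * r ^ DIM('a) * (norm h / r))"
    using r h by (intro mult_left_mono power_diff_le) auto
  finally show ?thesis .
qed

text \<open>The constant of the L^1 modulus of \<open>ball_kernel\<close>: a factor 2 for the two
  halves of the symmetric difference of the balls, and \<open>DIM * 2 ^ DIM\<close> from
  \<open>power_diff_le\<close>.\<close>

definition dim_const :: "'a::euclidean_space itself \<Rightarrow> real" where
  "dim_const _ = 2 * real DIM('a) * 2 ^ DIM('a)"

lemma dim_const_pos: "dim_const TYPE('a::euclidean_space) > 0"
  by (simp add: dim_const_def)

lemma ball_kernel_Lipschitz_L1:
  fixes h :: "'a::euclidean_space"
  assumes r: "r > 0" and h: "norm h \<le> r"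
  shows "(LINT z|lborel. \<bar>ball_kernel r (z - h) - ball_kernel r z\<bar>) \<le> dim_const TYPE('a) * (norm h / r)"
proof -
  let ?V = "unit_ball_vol (real DIM('a)) * r ^ DIM('a)"
  have V: "?V > 0" using r by simp
  have e: "\<bar>ball_kernel r (z - h) - ball_kernel r z\<bar> = indicator (ball h r - ball 0 r) z / ?V + indicator (ball 0 r - ball h r) z / ?V" for z
  proof -
    have "indicator (ball 0 r) (z - h) = (indicator (ball h r) z :: real)"
      by (simp add: indicator_def dist_norm norm_minus_commute)
    then show ?thesis using V by (auto simp: ball_kernel_def indicator_def)
  qed
  have i: "integrable lborel (indicator (ball p r - ball q r) :: 'a \<Rightarrow> real)" for p q :: 'a
  proof (intro integrable_real_indicator)
    have "emeasure lborel (ball p r - ball q r) \<le> emeasure lborel (ball p r)" by (intro emeasure_mono) auto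
    also have "\<dots> < \<infinity>" by (rule emeasure_lborel_ball_finite)
    finally show "emeasure lborel (ball p r - ball q r) < \<infinity>" .
  qed auto
  have sym: "measure lborel (ball 0 r - ball h r) = measure lborel (ball h r - ball (0::'a) r)"
  proof -
    have d: "measure lborel (ball p r - ball q r) = measure lborel (ball p r) - measure lborel (ball p r \<inter> ball q r)" for p q :: 'a
    proof -
      have "ball p r - ball q r = ball p r - (ball p r \<inter> ball q r)" by auto
      then show ?thesis
        by (simp only:) (rule measure_Diff, auto simp: emeasure_ball r less_imp_le)
    qed
    show ?thesis unfolding d using r by (simp add: content_ball Int_commute)
  qed
  have "(LINT z|lborel. \<bar>ball_kernel r (z - h) - ball_kernel r z\<bar>) = measure lborel (ball h r - ball 0 r) / ?V + measure lborel (ball 0 r - ball h r) / ?V"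
    unfolding e using i by simp
  also have "\<dots> = 2 * measure lborel (ball h r - ball 0 r) / ?V" unfolding sym by simp
  also have "\<dots> \<le> 2 * (unit_ball_vol (real DIM('a)) * (real DIM('a) * 2 ^ DIM('a) * r ^ DIM('a) * (norm h / r))) / ?V"
    using V by (intro divide_right_mono mult_left_mono ball_diff_measure r h) auto
  also have "\<dots> = dim_const TYPE('a) * (norm h / r)"
    using r unit_ball_vol_pos[of "real DIM('a)"] by (simp add: dim_const_def field_simps del: unit_ball_vol_pos)
  finally show ?thesis .
qed

section \<open>Averages of functions with a modulus of continuity\<close>

lemma norm_weighted_le:
  fixes b c p q :: real
  shows "0 \<le> b \<Longrightarrow> \<bar>p\<bar> \<le> c \<Longrightarrow> norm (b * p) \<le> c * b"
    and "0 \<le> b \<Longrightarrow> \<bar>p - q\<bar> \<le> c \<Longrightarrow> norm (b * p - b * q) \<le> c * b"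
proof -
  show 1: "norm (b * p) \<le> c * b" if "0 \<le> b" "\<bar>p\<bar> \<le> c" for p
    using mult_left_mono[OF that(2,1)] that(1) by (simp add: abs_mult mult.commute)
  show "0 \<le> b \<Longrightarrow> \<bar>p - q\<bar> \<le> c \<Longrightarrow> norm (b * p - b * q) \<le> c * b"
    using 1[of "p - q"] by (simp add: right_diff_distrib)
qed

lemma conv_diff_eq:
  fixes \<Phi> :: "'a::euclidean_space \<Rightarrow> real"
  assumes r: "r > 0" and [measurable]: "\<Phi> \<in> borel_measurable borel" and b: "\<And>w. \<bar>\<Phi> w\<bar> \<le> K"
  shows "integrable lborel (\<lambda>z. ball_kernel r z * \<Phi> (x + z))"
    and "integrable lborel (\<lambda>v. ball_kernel r (v - x) * \<Phi> v)"
    and "conv (ball_kernel r) \<Phi> x = (LINT v|lborel. ball_kernel r (v - x) * \<Phi> v)"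
proof -
  show 1: "integrable lborel (\<lambda>z. ball_kernel r z * \<Phi> (x + z))" for x
  proof (rule Bochner_Integration.integrable_bound[OF integrable_mult_left[OF ball_kernel(2)[OF r], of K]])
    show "AE z in lborel. norm (ball_kernel r z * \<Phi> (x + z)) \<le> norm (ball_kernel r z * K)"
      using b order_trans[OF abs_ge_zero b] by (auto simp: abs_mult intro!: mult_left_mono)
  qed measurable
  show "integrable lborel (\<lambda>v. ball_kernel r (v - x) * \<Phi> v)"
    by (subst integral_translate(3)[of "\<lambda>v. ball_kernel r (v - x) * \<Phi> v" x, symmetric]) (use 1 in auto)
  show "conv (ball_kernel r) \<Phi> x = (LINT v|lborel. ball_kernel r (v - x) * \<Phi> v)"
    unfolding conv_def by (subst integral_translate(1)[of "\<lambda>v. ball_kernel r (v - x) * \<Phi> v" x, symmetric]) auto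
qed

lemma ball_kernel_shift:
  fixes x :: "'a::euclidean_space"
  assumes r: "r > 0"
  shows "integrable lborel (\<lambda>v. ball_kernel r (v - x))" "(LINT v|lborel. ball_kernel r (v - x)) = 1"
  using conv_diff_eq[OF r, of "\<lambda>_. 1" 1 x] ball_kernel(3)[OF r, where 'a='a] by (auto simp: conv_def)

text \<open>The difference of two averages is \<Phi> integrated against a difference of shifted
  kernels. That difference has integral zero, so \<open>\<Phi> x\<close> may be subtracted, and it
  lives within distance \<open>2 * r\<close> of \<open>x\<close>. The result is the oscillation
  there times the L^1 modulus of the kernel.\<close>

lemma average_Lipschitz:
  fixes \<Phi> :: "'a::euclidean_space \<Rightarrow> real"
  assumes r: "r > 0" and m[measurable]: "\<Phi> \<in> borel_measurable borel" and b: "\<And>w. \<bar>\<Phi> w\<bar> \<le> K"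
    and osc: "\<And>v. norm (v - x) \<le> 2 * r \<Longrightarrow> \<bar>\<Phi> v - \<Phi> x\<bar> \<le> \<Omega>" and xy: "norm (x - y) \<le> r"
  shows "\<bar>conv (ball_kernel r) \<Phi> x - conv (ball_kernel r) \<Phi> y\<bar> \<le> dim_const TYPE('a) * (norm (x - y) / r) * \<Omega>"
proof -
  have \<Omega>: "\<Omega> \<ge> 0" using osc[of x] r by simp
  let ?D = "\<lambda>v. ball_kernel r (v - x) - ball_kernel r (v - y)"
  have DI: "integrable lborel ?D" by (intro Bochner_Integration.integrable_diff ball_kernel_shift r)
  have D0: "(LINT v|lborel. ?D v) = 0"
    by (subst Bochner_Integration.integral_diff) (auto intro: ball_kernel_shift r simp: ball_kernel_shift[OF r])
  have PI: "integrable lborel (\<lambda>v. ?D v * \<Phi> v)"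
    unfolding left_diff_distrib by (intro Bochner_Integration.integrable_diff conv_diff_eq(2)[OF r m b])
  have "conv (ball_kernel r) \<Phi> x - conv (ball_kernel r) \<Phi> y = (LINT v|lborel. ?D v * \<Phi> v)"
    unfolding conv_diff_eq(3)[OF r m b] left_diff_distrib
    by (rule Bochner_Integration.integral_diff[symmetric]; rule conv_diff_eq(2)[OF r m b])
  also have "\<dots> = (LINT v|lborel. ?D v * \<Phi> v) - (LINT v|lborel. ?D v * \<Phi> x)" using D0 by simp
  also have "\<dots> = (LINT v|lborel. ?D v * (\<Phi> v - \<Phi> x))"
    unfolding right_diff_distrib using PI DI by (subst Bochner_Integration.integral_diff) auto
  finally have "\<bar>conv (ball_kernel r) \<Phi> x - conv (ball_kernel r) \<Phi> y\<bar> = norm (LINT v|lborel. ?D v * (\<Phi> v - \<Phi> x))" by simp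
  also have "\<dots> \<le> (LINT v|lborel. \<Omega> * \<bar>?D v\<bar>)"
  proof (rule Bochner_Integration.integral_norm_bound_integral)
    show "integrable lborel (\<lambda>v. ?D v * (\<Phi> v - \<Phi> x))"
      unfolding right_diff_distrib using PI DI by auto
    show "integrable lborel (\<lambda>v. \<Omega> * \<bar>?D v\<bar>)" using DI by auto
    fix v
    show "norm (?D v * (\<Phi> v - \<Phi> x)) \<le> \<Omega> * \<bar>?D v\<bar>"
    proof (cases "norm (v - x) \<le> 2 * r")
      case True
      then show ?thesis using osc[OF True] by (simp add: abs_mult mult.commute mult_right_mono)
    next
      case False
      then have "r \<le> norm (v - x)" "r \<le> norm (v - y)"
        using xy r norm_triangle_ineq[of "v - y" "y - x"] by (auto simp: norm_minus_commute)
      then show ?thesis using ball_kernel(5)[OF r, of "v - x"] ball_kernel(5)[OF r, of "v - y"] by simp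
    qed
  qed
  also have "\<dots> = \<Omega> * (LINT z|lborel. \<bar>?D (x + z)\<bar>)"
    by (subst integral_translate(1)[of "\<lambda>v. \<bar>?D v\<bar>"]) auto
  also have "(\<lambda>z. \<bar>?D (x + z)\<bar>) = (\<lambda>z. \<bar>ball_kernel r (z - (y - x)) - ball_kernel r z\<bar>)"
    by (auto simp: abs_minus_commute algebra_simps)
  also have "\<Omega> * (LINT z|lborel. \<bar>ball_kernel r (z - (y - x)) - ball_kernel r z\<bar>) \<le> \<Omega> * (dim_const TYPE('a) * (norm (y - x) / r))"
    using xy by (intro mult_left_mono \<Omega> ball_kernel_Lipschitz_L1 r) (simp add: norm_minus_commute)
  finally show ?thesis by (simp add: norm_minus_commute mult.commute mult.left_commute)
qed

text \<open>The bounds that averaging over balls preserves with unchanged constants: a sup bound, a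
  modulus of continuity and an L^2 bound. They can therefore be iterated over all dyadic
  scales.\<close>

definition mod_class :: "(real \<Rightarrow> real) \<Rightarrow> real \<Rightarrow> real \<Rightarrow> ('a::euclidean_space \<Rightarrow> real) \<Rightarrow> bool" where
  "mod_class \<omega> K N g \<longleftrightarrow> g \<in> borel_measurable borel \<and> (\<forall>w. \<bar>g w\<bar> \<le> K) \<and>
     (\<forall>w w'. \<bar>g w - g w'\<bar> \<le> \<omega> (norm (w - w'))) \<and> (\<integral>\<^sup>+x. ennreal ((g x)\<^sup>2) \<partial>lborel) \<le> ennreal N"

lemma mod_class_L2: "mod_class \<omega> K N g \<Longrightarrow> integrable lborel (\<lambda>x. (g x)\<^sup>2)"
  unfolding mod_class_def by (intro integrableI_bounded) (auto intro: order_le_less_trans)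

lemma mod_class_average:
  fixes g :: "'a::euclidean_space \<Rightarrow> real"
  assumes r: "r > 0" and g: "mod_class \<omega> K N g"
  shows "mod_class \<omega> K N (conv (ball_kernel r) g)"
proof -
  have m[measurable]: "g \<in> borel_measurable borel" and b: "\<And>w. \<bar>g w\<bar> \<le> K"
    and o: "\<And>w w'. \<bar>g w - g w'\<bar> \<le> \<omega> (norm (w - w'))" and N: "(\<integral>\<^sup>+x. ennreal ((g x)\<^sup>2) \<partial>lborel) \<le> ennreal N"
    using g by (auto simp: mod_class_def)
  note bk = ball_kernel[OF r, where 'a='a]
  note gi = conv_diff_eq(1)[OF r m b]
  have "\<bar>conv (ball_kernel r) g w\<bar> \<le> K" for w
  proof -
    have "norm (conv (ball_kernel r) g w) \<le> (LINT z|lborel. K * ball_kernel r (z::'a))"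
      unfolding conv_def by (rule Bochner_Integration.integral_norm_bound_integral) (use gi bk in \<open>auto intro!: norm_weighted_le b simp del: real_norm_def\<close>)
    then show ?thesis using bk by simp
  qed
  moreover have "\<bar>conv (ball_kernel r) g w - conv (ball_kernel r) g w'\<bar> \<le> \<omega> (norm (w - w'))" for w w'
  proof -
    have "conv (ball_kernel r) g w - conv (ball_kernel r) g w' = (LINT z|lborel. ball_kernel r z * g (w + z) - ball_kernel r z * g (w' + z))"
      unfolding conv_def by (rule Bochner_Integration.integral_diff[symmetric, OF gi gi])
    then have "\<bar>conv (ball_kernel r) g w - conv (ball_kernel r) g w'\<bar> \<le> (LINT z|lborel. \<omega> (norm (w - w')) * ball_kernel r (z::'a))"
    proof (simp only: real_norm_def[symmetric], intro Bochner_Integration.integral_norm_bound_integral)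
      fix z
      have "\<bar>g (w + z) - g (w' + z)\<bar> \<le> \<omega> (norm (w - w'))" using o[of "w + z" "w' + z"] by simp
      then show "norm (ball_kernel r z * g (w + z) - ball_kernel r z * g (w' + z)) \<le> \<omega> (norm (w - w')) * ball_kernel r z"
        by (intro norm_weighted_le bk)
    qed (use gi bk in auto)
    then show ?thesis using bk by simp
  qed
  moreover have "(\<integral>\<^sup>+x. ennreal ((conv (ball_kernel r) g x)\<^sup>2) \<partial>lborel) \<le> ennreal N"
  proof -
    have "(\<integral>\<^sup>+x. ennreal ((conv (ball_kernel r) g x)\<^sup>2) \<partial>lborel) \<le> (\<integral>\<^sup>+x. \<integral>\<^sup>+z. ennreal (ball_kernel r (z::'a)) * ennreal ((g (x + z))\<^sup>2) \<partial>lborel \<partial>lborel)"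
    proof (rule nn_integral_mono)
      fix x
      define a where "a = conv (ball_kernel r) g x"
      have b2: "\<bar>(g w)\<^sup>2\<bar> \<le> K\<^sup>2" for w using power_mono[OF b[of w], of 2] by simp
      have g2: "integrable lborel (\<lambda>z. ball_kernel r z * (g (x + z))\<^sup>2)"
        by (rule conv_diff_eq(1)[where \<Phi>="\<lambda>w. (g w)\<^sup>2", OF r _ b2]) measurable
      \<comment> \<open>Jensen's inequality for the square, read off from the nonnegativity of the
        variance under the probability density \<open>ball_kernel r\<close>.\<close>
      have "0 \<le> (LINT z|lborel. ball_kernel r z * (g (x + z) - a)\<^sup>2)"
        using bk by (intro integral_nonneg_AE) auto
      also have "(\<lambda>z. ball_kernel r z * (g (x + z) - a)\<^sup>2) = (\<lambda>z. ball_kernel r z * (g (x + z))\<^sup>2 - 2 * a * (ball_kernel r z * g (x + z)) + a\<^sup>2 * ball_kernel r z)"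
        by (auto simp: power2_diff algebra_simps)
      also have "(LINT z|lborel. \<dots> z) = (LINT z|lborel. ball_kernel r z * (g (x + z))\<^sup>2) - 2 * a * a + a\<^sup>2"
        using g2 gi[of x] bk by (simp add: a_def conv_def)
      finally have "a\<^sup>2 \<le> (LINT z|lborel. ball_kernel r z * (g (x + z))\<^sup>2)" by (simp add: power2_eq_square)
      then have "ennreal (a\<^sup>2) \<le> (\<integral>\<^sup>+z. ennreal (ball_kernel r z * (g (x + z))\<^sup>2) \<partial>lborel)"
        using g2 bk by (subst nn_integral_eq_integral) (auto intro: ennreal_leI)
      then show "ennreal ((conv (ball_kernel r) g x)\<^sup>2) \<le> (\<integral>\<^sup>+z. ennreal (ball_kernel r (z::'a)) * ennreal ((g (x + z))\<^sup>2) \<partial>lborel)"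
        using bk by (simp add: a_def ennreal_mult')
    qed
    also have "\<dots> = (\<integral>\<^sup>+z. \<integral>\<^sup>+x. ennreal (ball_kernel r (z::'a)) * ennreal ((g (x + z))\<^sup>2) \<partial>lborel \<partial>lborel)"
      by (rule lborel_pair.Fubini') measurable
    also have "\<dots> = (\<integral>\<^sup>+z. ennreal (ball_kernel r (z::'a)) * (\<integral>\<^sup>+x. ennreal ((g x)\<^sup>2) \<partial>lborel) \<partial>lborel)"
      using nn_integral_translate(1)[of "\<lambda>x. ennreal ((g x)\<^sup>2)"] by (simp add: nn_integral_cmult add.commute)
    also have "\<dots> = (\<integral>\<^sup>+x. ennreal ((g x)\<^sup>2) \<partial>lborel)"
      using bk by (simp add: nn_integral_multc nn_integral_eq_integral)
    finally show ?thesis using N by (rule order_trans)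
  qed
  ultimately show ?thesis unfolding mod_class_def by auto
qed

lemma average_close:
  fixes g :: "'a::euclidean_space \<Rightarrow> real"
  assumes r: "r > 0" and g: "mod_class \<omega> K N g" and mono: "mono_on {0..} \<omega>"
  shows "\<bar>g w - conv (ball_kernel r) g w\<bar> \<le> \<omega> r"
proof -
  have m[measurable]: "g \<in> borel_measurable borel" and b: "\<And>w. \<bar>g w\<bar> \<le> K"
    and o: "\<And>w w'. \<bar>g w - g w'\<bar> \<le> \<omega> (norm (w - w'))"
    using g by (auto simp: mod_class_def)
  note bk = ball_kernel[OF r, where 'a='a]
  have "g w - conv (ball_kernel r) g w = (LINT z|lborel. ball_kernel r (z::'a) * g w) - (LINT z|lborel. ball_kernel r z * g (w + z))"
    using bk by (simp add: conv_def)
  also have "\<dots> = (LINT z|lborel. ball_kernel r z * g w - ball_kernel r z * g (w + z))"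
    by (rule Bochner_Integration.integral_diff[symmetric]) (use bk conv_diff_eq(1)[OF r m b] in auto)
  finally have "\<bar>g w - conv (ball_kernel r) g w\<bar> \<le> (LINT z|lborel. \<omega> r * ball_kernel r (z::'a))"
  proof (simp only: real_norm_def[symmetric], intro Bochner_Integration.integral_norm_bound_integral)
    fix z
    show "norm (ball_kernel r z * g w - ball_kernel r z * g (w + z)) \<le> \<omega> r * ball_kernel r z"
    proof (cases "norm z < r")
      case True
      have "\<bar>g w - g (w + z)\<bar> \<le> \<omega> (norm z)" using o[of w "w + z"] by simp
      also have "\<dots> \<le> \<omega> r" using True r by (intro mono_onD[OF mono]) auto
      finally show ?thesis by (intro norm_weighted_le bk)
    qed (use bk in auto)
  qed (use bk conv_diff_eq(1)[OF r m b] in auto)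
  then show ?thesis using bk by simp
qed

text \<open>Fubini. Absolute convergence holds because the inner integral is bounded uniformly in
  the shift by the two L^2 norms, while \<open>ball_kernel r\<close> is integrable.\<close>

lemma conv_commute:
  fixes k g :: "'a::euclidean_space \<Rightarrow> real"
  assumes r: "r > 0" and [measurable]: "k \<in> borel_measurable borel" "g \<in> borel_measurable borel"
    and k: "integrable lborel (\<lambda>z. (k z)\<^sup>2)" and g: "integrable lborel (\<lambda>z. (g z)\<^sup>2)"
  shows "conv k (conv (ball_kernel r) g) x = conv (ball_kernel r) (conv k g) x"
proof -
  note bk = ball_kernel[OF r, where 'a='a]
  define F where "F v z = k z * (ball_kernel r v * g (x + z + v))" for v z
  have [measurable]: "(\<lambda>(v, z). F v z) \<in> borel_measurable (lborel \<Otimes>\<^sub>M lborel)" unfolding F_def by measurable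
  have Fe: "F v z = ball_kernel r v * (k z * g (x + v + z))" for v z by (simp add: F_def algebra_simps)
  have FI: "integrable (lborel \<Otimes>\<^sub>M lborel) (\<lambda>(v, z). F v z)"
  proof (rule lborel_pair.Fubini_integrable)
    show "AE v in lborel. integrable lborel (\<lambda>z. (\<lambda>(v, z). F v z) (v, z))"
      using integrable_L2_prod(1)[OF _ _ k g] by (auto simp: Fe)
    show "integrable lborel (\<lambda>v. LINT z|lborel. norm ((\<lambda>(v, z). F v z) (v, z)))"
    proof (rule Bochner_Integration.integrable_bound[OF integrable_mult_left[OF bk(2), of "(LINT z|lborel. (k z)\<^sup>2) + (LINT z|lborel. (g z)\<^sup>2)"]])
      show "AE v in lborel. norm (LINT z|lborel. norm ((\<lambda>(v, z). F v z) (v, z))) \<le> norm (ball_kernel r v * ((LINT z|lborel. (k z)\<^sup>2) + (LINT z|lborel. (g z)\<^sup>2)))"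
      proof (rule AE_I2)
        fix v
        have "(LINT z|lborel. norm (F v z)) = ball_kernel r v * (LINT z|lborel. \<bar>k z * g (x + v + z)\<bar>)"
          using bk(1)[of v] by (simp add: Fe abs_mult)
        also have "\<dots> \<le> ball_kernel r v * ((LINT z|lborel. (k z)\<^sup>2) + (LINT z|lborel. (g z)\<^sup>2))"
          by (intro mult_left_mono integrable_L2_prod(2) k g bk) auto
        finally show "norm (LINT z|lborel. norm ((\<lambda>(v, z). F v z) (v, z))) \<le> norm (ball_kernel r v * ((LINT z|lborel. (k z)\<^sup>2) + (LINT z|lborel. (g z)\<^sup>2)))"
          by simp
      qed
    qed measurable
  qed measurable
  have "conv k (conv (ball_kernel r) g) x = (LINT z|lborel. LINT v|lborel. F v z)"
    by (simp add: conv_def F_def)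
  also have "\<dots> = (LINT v|lborel. LINT z|lborel. F v z)"
    by (rule lborel_pair.Fubini_integral[OF FI])
  also have "\<dots> = conv (ball_kernel r) (conv k g) x"
    by (simp add: conv_def Fe)
  finally show ?thesis .
qed

section \<open>Hoermander kernels cut off near the origin\<close>

definition truncate :: "('a::euclidean_space \<Rightarrow> real) \<Rightarrow> real \<Rightarrow> 'a \<Rightarrow> real" where
  "truncate k r z = k z * indicator {z. r < norm z} z"

lemma truncate_measurable[measurable]:
  assumes [measurable]: "k \<in> borel_measurable borel"
  shows "truncate k r \<in> borel_measurable (borel :: 'a::euclidean_space measure)"
proof -
  have [measurable]: "{z::'a. r < norm z} \<in> sets borel"
    by (intro borel_open open_Collect_less continuous_intros)
  show ?thesis unfolding truncate_def[abs_def] by measurable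
qed

text \<open>The size and smoothness conditions of \<open>cz_kernel\<close> with the constant exposed
  and the integral taken over \<open>lborel\<close>. Cancellation is kept apart as
  \<open>cancelling\<close>, where the principal values use it.\<close>

definition hormander_kernel :: "real \<Rightarrow> ('a::euclidean_space \<Rightarrow> real) \<Rightarrow> bool" where
  "hormander_kernel B k \<longleftrightarrow> 0 \<le> B \<and> k \<in> borel_measurable borel \<and> (\<forall>x. x \<noteq> 0 \<longrightarrow> \<bar>k x\<bar> \<le> B / norm x ^ DIM('a)) \<and>
     (\<forall>y. y \<noteq> 0 \<longrightarrow> (\<integral>\<^sup>+x\<in>{x. 2 * norm y < norm x}. ennreal \<bar>k x - k (x - y)\<bar> \<partial>lborel) \<le> ennreal B)"

text \<open>\<open>B\<close> is the Hoermander integral; the second term is twice the sup bound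
  \<open>B / r ^ DIM\<close> times the volume of the ball of radius \<open>2 * r\<close>. The powers
  of \<open>r\<close> cancel.\<close>

definition hormander_const :: "'a::euclidean_space itself \<Rightarrow> real \<Rightarrow> real" where
  "hormander_const _ B = B + 2 * 2 ^ DIM('a) * unit_ball_vol (real DIM('a)) * B"

lemma truncate_bound:
  fixes k :: "'a::euclidean_space \<Rightarrow> real"
  assumes k: "hormander_kernel B k" and r: "r > 0"
  shows "\<bar>truncate k r z\<bar> \<le> B / r ^ DIM('a)"
proof (cases "r < norm z")
  case True
  have "\<bar>truncate k r z\<bar> \<le> B / norm z ^ DIM('a)"
  proof -
    have "z \<noteq> 0" using True r by auto
    then show ?thesis using True k by (simp add: truncate_def hormander_kernel_def)
  qed
  also have "\<dots> \<le> B / r ^ DIM('a)"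
  proof -
    have "0 < norm z" using True r by linarith
    then show ?thesis
      using True k r by (intro divide_left_mono power_mono mult_pos_pos zero_less_power) (auto simp: hormander_kernel_def)
  qed
  finally show ?thesis .
qed (use k r in \<open>auto simp: truncate_def hormander_kernel_def\<close>)

text \<open>The sharp cut-off destroys smoothness only where \<open>norm z \<le> 2 * r\<close>, and
  there the sup bound on a ball of comparable size is enough. Outside, neither \<open>z\<close> nor
  \<open>z - h\<close> is cut off and the Hoermander condition applies. The result is independent of
  the scale \<open>r\<close>.\<close>

lemma truncate_hormander:
  fixes k :: "'a::euclidean_space \<Rightarrow> real"
  assumes k: "hormander_kernel B k" and r: "r > 0" and h: "norm h \<le> r"
  shows "(\<integral>\<^sup>+z. ennreal \<bar>truncate k r z - truncate k r (z - h)\<bar> \<partial>lborel) \<le> ennreal (hormander_const TYPE('a) B)"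
proof (cases "h = 0")
  case True
  then show ?thesis by simp
next
  case False
  have B: "B \<ge> 0" and km[measurable]: "k \<in> borel_measurable borel"
    and ho: "(\<integral>\<^sup>+x\<in>{x. 2 * norm h < norm x}. ennreal \<bar>k x - k (x - h)\<bar> \<partial>lborel) \<le> ennreal B"
    using k False by (auto simp: hormander_kernel_def)
  note tb = truncate_bound[OF k r]
  have "(\<integral>\<^sup>+z. ennreal \<bar>truncate k r z - truncate k r (z - h)\<bar> \<partial>lborel)
    \<le> (\<integral>\<^sup>+z. ennreal \<bar>k z - k (z - h)\<bar> * indicator {x. 2 * norm h < norm x} z + ennreal (2 * (B / r ^ DIM('a))) * indicator (cball 0 (2 * r)) z \<partial>lborel)"
  proof (rule nn_integral_mono)
    fix z
    show "ennreal \<bar>truncate k r z - truncate k r (z - h)\<bar> \<le> ennreal \<bar>k z - k (z - h)\<bar> * indicator {x. 2 * norm h < norm x} z + ennreal (2 * (B / r ^ DIM('a))) * indicator (cball 0 (2 * r)) z"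
    proof (cases "norm z \<le> 2 * r")
      case True
      have "\<bar>truncate k r z - truncate k r (z - h)\<bar> \<le> 2 * (B / r ^ DIM('a))"
        using tb[of z] tb[of "z - h"] by linarith
      then have "ennreal \<bar>truncate k r z - truncate k r (z - h)\<bar> \<le> ennreal (2 * (B / r ^ DIM('a))) * indicator (cball 0 (2 * r)) z"
        using True by (simp add: ennreal_leI)
      then show ?thesis by (rule order_trans) simp
    next
      case False
      then have "r < norm z" "r < norm (z - h)" "2 * norm h < norm z"
        using h r norm_triangle_ineq2[of z h] by auto
      then show ?thesis by (simp add: truncate_def)
    qed
  qed
  also have "\<dots> = (\<integral>\<^sup>+x\<in>{x. 2 * norm h < norm x}. ennreal \<bar>k x - k (x - h)\<bar> \<partial>lborel) + ennreal (2 * (B / r ^ DIM('a))) * emeasure lborel (cball (0::'a) (2 * r))"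
    by (subst nn_integral_add) (auto simp: nn_integral_cmult_indicator)
  also have "\<dots> \<le> ennreal B + ennreal (2 * (B / r ^ DIM('a))) * emeasure lborel (cball (0::'a) (2 * r))"
    by (rule add_right_mono[OF ho])
  also have "emeasure lborel (cball (0::'a) (2 * r)) = ennreal (unit_ball_vol (real DIM('a)) * (2 * r) ^ DIM('a))"
    using r by (simp add: emeasure_cball)
  also have "ennreal B + ennreal (2 * (B / r ^ DIM('a))) * \<dots> = ennreal (B + 2 * (B / r ^ DIM('a)) * (unit_ball_vol (real DIM('a)) * (2 * r) ^ DIM('a)))"
    using B r by (subst ennreal_mult'[symmetric]) (auto simp: ennreal_plus[symmetric] simp del: ennreal_plus)
  also have "B + 2 * (B / r ^ DIM('a)) * (unit_ball_vol (real DIM('a)) * (2 * r) ^ DIM('a)) = hormander_const TYPE('a) B"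
    using r by (simp add: hormander_const_def power_mult_distrib)
  finally show ?thesis .
qed

lemma truncate_L2:
  fixes k :: "'a::euclidean_space \<Rightarrow> real"
  assumes k: "hormander_kernel B k" and r: "r > 0"
  shows "integrable lborel (\<lambda>z. (truncate k r z)\<^sup>2)"
proof (rule integrableI_bounded)
  have km[measurable]: "k \<in> borel_measurable borel" using k by (auto simp: hormander_kernel_def)
  show "(\<lambda>z. (truncate k r z)\<^sup>2) \<in> borel_measurable lborel" by measurable
  have "(\<integral>\<^sup>+z. ennreal (norm ((truncate k r z)\<^sup>2)) \<partial>lborel) \<le> (\<integral>\<^sup>+z. ennreal (B\<^sup>2) * ennreal (norm (z::'a) powr (- (real DIM('a) + real DIM('a))) * indicator {z. r < norm z} z) \<partial>lborel)"
  proof (rule nn_integral_mono)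
    fix z
    show "ennreal (norm ((truncate k r z)\<^sup>2)) \<le> ennreal (B\<^sup>2) * ennreal (norm z powr (- (real DIM('a) + real DIM('a))) * indicator {z. r < norm z} z)"
    proof (cases "r < norm z")
      case True
      then have z: "norm z > 0" "z \<noteq> 0" using r by auto
      have "\<bar>k z\<bar>\<^sup>2 \<le> (B / norm z ^ DIM('a))\<^sup>2"
        using k z by (intro power_mono) (auto simp: hormander_kernel_def)
      also have "\<dots> = B\<^sup>2 * norm z powr (- (real DIM('a) + real DIM('a)))"
        using z unfolding powr_minus powr_add powr_realpow[OF z(1)] by (simp add: power2_eq_square divide_inverse)
      finally have "(k z)\<^sup>2 \<le> B\<^sup>2 * norm z powr (- (real DIM('a) + real DIM('a)))" by simp
      then show ?thesis using True by (simp add: truncate_def ennreal_leI flip: ennreal_mult')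
    qed (simp add: truncate_def)
  qed
  also have "\<dots> < \<infinity>"
    using nn_integral_far_finite[of "real DIM('a)" r, where 'a='a] r
    by (subst nn_integral_cmult) (auto simp: ennreal_mult_less_top)
  finally show "(\<integral>\<^sup>+z. ennreal (norm ((truncate k r z)\<^sup>2)) \<partial>lborel) < \<infinity>" .
qed

text \<open>The shift is moved from \<open>G\<close> to the kernel, so the oscillation is controlled
  by the size of \<open>G\<close> alone, with a constant that is the same at all scales.\<close>

lemma truncate_conv_osc:
  fixes k :: "'a::euclidean_space \<Rightarrow> real"
  assumes k: "hormander_kernel B k" and r: "r > 0" and [measurable]: "G \<in> borel_measurable borel"
    and G2: "integrable lborel (\<lambda>z. (G z)\<^sup>2)" and S: "\<And>w. \<bar>G w\<bar> \<le> S" and v: "norm (v - x) \<le> r"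
  shows "\<bar>conv (truncate k r) G v - conv (truncate k r) G x\<bar> \<le> hormander_const TYPE('a) B * S"
proof -
  have km[measurable]: "k \<in> borel_measurable borel" and B: "B \<ge> 0" using k by (auto simp: hormander_kernel_def)
  have S0: "S \<ge> 0" using order_trans[OF abs_ge_zero S] .
  have HB: "hormander_const TYPE('a) B \<ge> 0" using B by (simp add: hormander_const_def)
  have i: "integrable lborel (\<lambda>z. truncate k r z * G (x + z))" for x
    by (rule integrable_L2_prod(1)[OF _ _ truncate_L2[OF k r] G2]) auto
  have i': "integrable lborel (\<lambda>z. truncate k r (z - x) * G z)" and
    c: "conv (truncate k r) G x = (LINT z|lborel. truncate k r (z - x) * G z)" for x
  proof -
    show "integrable lborel (\<lambda>z. truncate k r (z - x) * G z)"
      by (subst integral_translate(3)[of "\<lambda>z. truncate k r (z - x) * G z" x, symmetric]) (use i in auto)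
    show "conv (truncate k r) G x = (LINT z|lborel. truncate k r (z - x) * G z)"
      unfolding conv_def by (subst integral_translate(1)[of "\<lambda>z. truncate k r (z - x) * G z" x, symmetric]) auto
  qed
  have "conv (truncate k r) G v - conv (truncate k r) G x = (LINT z|lborel. truncate k r (z - v) * G z - truncate k r (z - x) * G z)"
    unfolding c by (rule Bochner_Integration.integral_diff[symmetric, OF i' i'])
  then have "ennreal (norm (conv (truncate k r) G v - conv (truncate k r) G x)) \<le> (\<integral>\<^sup>+z. ennreal (norm (truncate k r (z - v) * G z - truncate k r (z - x) * G z)) \<partial>lborel)"
    using integral_norm_bound_ennreal[OF Bochner_Integration.integrable_diff[OF i'[of v] i'[of x]]] by simp
  also have "\<dots> \<le> (\<integral>\<^sup>+z. ennreal S * ennreal \<bar>truncate k r (z - x) - truncate k r (z - v)\<bar> \<partial>lborel)"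
  proof (rule nn_integral_mono)
    fix z
    have "norm (truncate k r (z - v) * G z - truncate k r (z - x) * G z) = \<bar>G z\<bar> * \<bar>truncate k r (z - x) - truncate k r (z - v)\<bar>"
      by (metis abs_minus_commute abs_mult left_diff_distrib mult.commute real_norm_def)
    also have "\<dots> \<le> S * \<bar>truncate k r (z - x) - truncate k r (z - v)\<bar>"
      by (rule mult_right_mono[OF S]) simp
    finally show "ennreal (norm (truncate k r (z - v) * G z - truncate k r (z - x) * G z)) \<le> ennreal S * ennreal \<bar>truncate k r (z - x) - truncate k r (z - v)\<bar>"
      using S0 by (simp add: ennreal_leI flip: ennreal_mult')
  qed
  also have "\<dots> = ennreal S * (\<integral>\<^sup>+z. ennreal \<bar>truncate k r (z - x) - truncate k r (z - v)\<bar> \<partial>lborel)"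
    by (rule nn_integral_cmult) measurable
  also have "(\<integral>\<^sup>+z. ennreal \<bar>truncate k r (z - x) - truncate k r (z - v)\<bar> \<partial>lborel) = (\<integral>\<^sup>+z. ennreal \<bar>truncate k r z - truncate k r (z - (v - x))\<bar> \<partial>lborel)"
    by (subst nn_integral_translate(1)[of "\<lambda>z. ennreal \<bar>truncate k r (z - x) - truncate k r (z - v)\<bar>" x, symmetric]) (auto simp: algebra_simps)
  also have "ennreal S * \<dots> \<le> ennreal S * ennreal (hormander_const TYPE('a) B)"
    by (intro mult_left_mono truncate_hormander k r v) simp
  also have "\<dots> = ennreal (hormander_const TYPE('a) B * S)"
    using S0 by (simp add: mult.commute flip: ennreal_mult')
  finally show ?thesis using S0 HB by (simp add: ennreal_le_iff)
qed

text \<open>The two truncations differ only on the annulus between \<open>r\<close> and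
  \<open>2 * r\<close>, where the size of \<open>k\<close> is at most \<open>B / r ^ DIM\<close> and
  the volume at most a multiple of \<open>r ^ DIM\<close>.\<close>

lemma annulus_conv_diff:
  fixes k :: "'a::euclidean_space \<Rightarrow> real"
  assumes k: "hormander_kernel B k" and r: "r > 0" and [measurable]: "g \<in> borel_measurable borel"
    and g2: "integrable lborel (\<lambda>z. (g z)\<^sup>2)" and \<Omega>: "\<And>z. \<bar>g (x + z) - g (y + z)\<bar> \<le> \<Omega>"
  shows "\<bar>(conv (truncate k r) g x - conv (truncate k (2 * r)) g x) - (conv (truncate k r) g y - conv (truncate k (2 * r)) g y)\<bar>
    \<le> B * unit_ball_vol (real DIM('a)) * 2 ^ DIM('a) * \<Omega>"
proof -
  have km[measurable]: "k \<in> borel_measurable borel" and B: "B \<ge> 0" using k by (auto simp: hormander_kernel_def)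
  have i: "integrable lborel (\<lambda>z. truncate k s z * g (x + z))" if "s > 0" for x s
    by (rule integrable_L2_prod(1)[OF _ _ truncate_L2[OF k that] g2]) auto
  have r2: "2 * r > 0" using r by simp
  have eq: "(conv (truncate k r) g x - conv (truncate k (2 * r)) g x) - (conv (truncate k r) g y - conv (truncate k (2 * r)) g y)
    = (LINT z|lborel. (truncate k r z * g (x + z) - truncate k (2 * r) z * g (x + z)) - (truncate k r z * g (y + z) - truncate k (2 * r) z * g (y + z)))"
    unfolding conv_def using i[OF r] i[OF r2] by simp
  have "norm (LINT z|lborel. (truncate k r z * g (x + z) - truncate k (2 * r) z * g (x + z)) - (truncate k r z * g (y + z) - truncate k (2 * r) z * g (y + z)))
    \<le> (LINT z|lborel. (B / r ^ DIM('a) * \<Omega>) * indicator (cball (0::'a) (2 * r)) z)"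
  proof (rule Bochner_Integration.integral_norm_bound_integral)
    show "integrable lborel (\<lambda>z. (truncate k r z * g (x + z) - truncate k (2 * r) z * g (x + z)) - (truncate k r z * g (y + z) - truncate k (2 * r) z * g (y + z)))"
      using i[OF r] i[OF r2] by simp
    show "integrable lborel (\<lambda>z. (B / r ^ DIM('a) * \<Omega>) * indicator (cball (0::'a) (2 * r)) z)"
      by (intro integrable_mult_right integrable_real_indicator) (auto simp: emeasure_lborel_cball_finite[simplified])
    fix z :: 'a
    have e: "(truncate k r z * g (x + z) - truncate k (2 * r) z * g (x + z)) - (truncate k r z * g (y + z) - truncate k (2 * r) z * g (y + z))
      = (truncate k r z - truncate k (2 * r) z) * (g (x + z) - g (y + z))" by (simp add: algebra_simps)
    show "norm ((truncate k r z * g (x + z) - truncate k (2 * r) z * g (x + z)) - (truncate k r z * g (y + z) - truncate k (2 * r) z * g (y + z)))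
      \<le> (B / r ^ DIM('a) * \<Omega>) * indicator (cball 0 (2 * r)) z"
    proof (cases "norm z \<le> 2 * r")
      case True
      have "\<bar>truncate k r z - truncate k (2 * r) z\<bar> \<le> B / r ^ DIM('a)"
        using truncate_bound[OF k r, of z] True by (simp add: truncate_def[of k "2 * r"])
      then have "\<bar>truncate k r z - truncate k (2 * r) z\<bar> * \<bar>g (x + z) - g (y + z)\<bar> \<le> B / r ^ DIM('a) * \<Omega>"
        using B r by (intro mult_mono \<Omega>) auto
      then show ?thesis unfolding e using True by (simp add: abs_mult)
    next
      case False
      then show ?thesis unfolding e using r by (simp add: truncate_def)
    qed
  qed
  also have "\<dots> = B * unit_ball_vol (real DIM('a)) * 2 ^ DIM('a) * \<Omega>"
    using r by (simp add: content_cball power_mult_distrib)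
  finally show ?thesis unfolding eq by simp
qed

text \<open>The first summand bounds the change of function at a fixed cut-off: \<open>1\<close>
  serves the initial scale, \<open>2 * dim_const\<close> all later ones. The second bounds the
  change of cut-off; its leading 2 comes from rewriting \<open>1 / 2 ^ j\<close> as
  \<open>2 / 2 ^ Suc j\<close> when the index is shifted.\<close>

definition far_const :: "'a::euclidean_space itself \<Rightarrow> real \<Rightarrow> real" where
  "far_const T B = (2 * dim_const T + 1) * hormander_const T B
     + 2 * (B * unit_ball_vol (real DIM('a)) * 2 ^ DIM('a) * dim_const T)"

text \<open>With \<open>r\<^sub>j = 2\<^sup>j \<rho>\<close> and \<open>g\<^sub>0 = \<theta>\<close>, let \<open>g\<^sub>j\<^sub>+\<^sub>1\<close> be the average of \<open>g\<^sub>j\<close> over balls of radius \<open>r\<^sub>j\<close>. The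
  truncated integrals of \<open>g\<^sub>j\<close> at scale \<open>r\<^sub>j\<close> telescope, and the \<open>j\<close>-th increment contributes
  \<open>\<omega>(r\<^sub>j) |x - y| / r\<^sub>j\<close>: averaging transfers the difference \<open>x - y\<close> to the kernel, where the Hoermander
  condition and the \<open>L\<^sup>1\<close> modulus of the ball kernel apply. This avoids pointwise regularity of \<open>k\<close>.\<close>

lemma truncate_conv_far:
  fixes k :: "'a::euclidean_space \<Rightarrow> real"
  assumes k: "hormander_kernel B k" and \<rho>: "\<rho> > 0" and xy: "norm (x - y) \<le> \<rho>"
    and th: "mod_class \<omega> K N \<theta>" and mono: "mono_on {0..} \<omega>" and \<omega>0: "\<omega> 0 \<ge> 0"
    and sm: "summable (\<lambda>j. \<omega> (2 ^ j * \<rho>) / 2 ^ j)"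
  shows "\<bar>conv (truncate k \<rho>) \<theta> x - conv (truncate k \<rho>) \<theta> y\<bar> \<le> far_const TYPE('a) B * (\<Sum>j. \<omega> (2 ^ j * \<rho>) / 2 ^ j)"
proof -
  have km[measurable]: "k \<in> borel_measurable borel" and B: "B \<ge> 0" using k by (auto simp: hormander_kernel_def)
  let ?C = "dim_const TYPE('a)" and ?H = "hormander_const TYPE('a) B" and ?V = "B * unit_ball_vol (real DIM('a)) * 2 ^ DIM('a)"
  have C0: "?C > 0" by (rule dim_const_pos)
  have H0: "?H \<ge> 0" using B by (simp add: hormander_const_def)
  have V0: "?V \<ge> 0" using B by simp
  have wpos: "\<omega> s \<ge> 0" if "s \<ge> 0" for s using mono_onD[OF mono, of 0 s] \<omega>0 that by simp
  define r where "r j = 2 ^ j * \<rho>" for j :: nat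
  have r: "r j > 0" and rS: "r (Suc j) = 2 * r j" for j using \<rho> by (auto simp: r_def)
  have xr: "norm (x - y) / r j \<le> 1 / 2 ^ j" for j using xy \<rho> by (simp add: r_def field_simps)
  have xr': "norm (x - y) \<le> r j" for j
  proof -
    have "1 * \<rho> \<le> 2 ^ j * \<rho>" using \<rho> by (intro mult_right_mono) auto
    then show ?thesis using xy by (simp add: r_def)
  qed
  \<comment> \<open>The averages are iterated, so that \<open>\<Theta> (Suc j)\<close> differs from
    \<open>\<Theta> j\<close> by at most \<open>\<omega> (r j)\<close> while still carrying all
    earlier averages.\<close>
  define \<Theta> where "\<Theta> j = rec_nat \<theta> (\<lambda>j g. conv (ball_kernel (r j)) g) j" for j
  have \<Theta>0: "\<Theta> 0 = \<theta>" and \<Theta>S: "\<Theta> (Suc j) = conv (ball_kernel (r j)) (\<Theta> j)" for j by (auto simp: \<Theta>_def)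
  have mc: "mod_class \<omega> K N (\<Theta> j)" for j
    by (induction j) (auto simp: \<Theta>0 \<Theta>S th intro!: mod_class_average r)
  have m[measurable]: "\<Theta> j \<in> borel_measurable borel" and bK: "\<And>w. \<bar>\<Theta> j w\<bar> \<le> K"
    and om: "\<And>w w'. \<bar>\<Theta> j w - \<Theta> j w'\<bar> \<le> \<omega> (norm (w - w'))" and
    N: "(\<integral>\<^sup>+x. ennreal ((\<Theta> j x)\<^sup>2) \<partial>lborel) \<le> ennreal N" for j
    using mc[of j] by (auto simp: mod_class_def)
  note L2 = mod_class_L2[OF mc]
  define F where "F j z = conv (truncate k (r j)) (\<Theta> j) z" for j z
  define \<Delta> where "\<Delta> j = F j x - F j y" for j
  \<comment> \<open>The gain \<open>1 / 2 ^ j\<close> is \<open>norm (x - y) / r j\<close>, supplied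
    by the last average.\<close>
  have lip: "\<bar>\<Theta> (Suc j) (x + z) - \<Theta> (Suc j) (y + z)\<bar> \<le> ?C * (1 / 2 ^ j) * \<omega> (2 * r j)" for j z
  proof -
    have "\<bar>\<Theta> (Suc j) (x + z) - \<Theta> (Suc j) (y + z)\<bar> \<le> ?C * (norm ((x + z) - (y + z)) / r j) * \<omega> (2 * r j)"
      unfolding \<Theta>S
    proof (rule average_Lipschitz[OF r m bK])
      fix v assume "norm (v - (x + z)) \<le> 2 * r j"
      then show "\<bar>\<Theta> j v - \<Theta> j (x + z)\<bar> \<le> \<omega> (2 * r j)"
        using r[of j] by (intro order_trans[OF om] mono_onD[OF mono]) auto
    qed (use xr' in simp)
    also have "\<dots> \<le> ?C * (1 / 2 ^ j) * \<omega> (2 * r j)"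
      using xr[of j] C0 wpos[of "2 * r j"] r[of j] by (intro mult_right_mono mult_left_mono) auto
    finally show ?thesis .
  qed
  have cd: "conv (truncate k (r j)) (\<lambda>w. \<Theta> j w - \<Theta> (Suc j) w) z = conv (truncate k (r j)) (\<Theta> j) z - conv (truncate k (r j)) (\<Theta> (Suc j)) z" for j z
    unfolding conv_def right_diff_distrib
    by (rule Bochner_Integration.integral_diff; rule integrable_L2_prod(1)[OF _ _ truncate_L2[OF k r] L2]) auto
  have close: "\<bar>\<Theta> j w - \<Theta> (Suc j) w\<bar> \<le> \<omega> (r j)" for j w
    unfolding \<Theta>S by (rule average_close[OF r mc mono])
  have dL2: "integrable lborel (\<lambda>z. (g z - h z)\<^sup>2)" if "integrable lborel (\<lambda>z. (g z)\<^sup>2)" "integrable lborel (\<lambda>z. (h z)\<^sup>2)"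
    "g \<in> borel_measurable borel" "h \<in> borel_measurable borel" for g h :: "'a \<Rightarrow> real"
  proof (rule Bochner_Integration.integrable_bound[OF integrable_mult_right[OF Bochner_Integration.integrable_add[OF that(1,2)], of 2]])
    have "(p - q)\<^sup>2 \<le> 2 * (p\<^sup>2 + q\<^sup>2)" for p q :: real using zero_le_power2[of "p + q"] by (simp add: power2_sum power2_diff)
    then show "AE z in lborel. norm ((g z - h z)\<^sup>2) \<le> norm (2 * ((g z)\<^sup>2 + (h z)\<^sup>2))" by auto
  qed (use that in measurable)
  have osc: "\<bar>conv (truncate k (r j)) (\<lambda>w. \<Theta> j w - \<Theta> (Suc j) w) x - conv (truncate k (r j)) (\<lambda>w. \<Theta> j w - \<Theta> (Suc j) w) y\<bar>
     \<le> (2 * ?C + 1) * ?H * (\<omega> (r j) / 2 ^ j)" for j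
  proof (cases j)
    case 0
    have "\<bar>conv (truncate k (r j)) (\<lambda>w. \<Theta> j w - \<Theta> (Suc j) w) x - conv (truncate k (r j)) (\<lambda>w. \<Theta> j w - \<Theta> (Suc j) w) y\<bar> \<le> ?H * \<omega> (r j)"
      by (rule truncate_conv_osc[OF k r _ dL2[OF L2 L2] close]) (use xr' in auto)
    also have "\<dots> \<le> (2 * ?C + 1) * ?H * \<omega> (r j)"
      using mult_right_mono[of 1 "2 * ?C + 1" ?H] C0 H0 wpos[of "r j"] r[of j] by (intro mult_right_mono) auto
    finally show ?thesis using 0 by simp
  next
    case (Suc i)
    define G where "G w = \<Theta> i w - conv (ball_kernel (r j)) (\<Theta> i) w" for w
    have Gm[measurable]: "G \<in> borel_measurable borel" unfolding G_def[abs_def] by measurable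
    have G2: "integrable lborel (\<lambda>z. (G z)\<^sup>2)"
      unfolding G_def by (rule dL2[OF L2 mod_class_L2[OF mod_class_average[OF r mc]]]) measurable
    have Gb: "\<bar>G w\<bar> \<le> \<omega> (r j)" for w unfolding G_def by (rule average_close[OF r mc mono])
    have eq: "(\<lambda>w. \<Theta> j w - \<Theta> (Suc j) w) = conv (ball_kernel (r i)) G"
    proof
      fix w
      have "conv (ball_kernel (r j)) (conv (ball_kernel (r i)) (\<Theta> i)) w = conv (ball_kernel (r i)) (conv (ball_kernel (r j)) (\<Theta> i)) w"
        by (rule conv_commute[OF r _ _ ball_kernel(4)[OF r] L2]) auto
      moreover have "conv (ball_kernel (r i)) G w = conv (ball_kernel (r i)) (\<Theta> i) w - conv (ball_kernel (r i)) (conv (ball_kernel (r j)) (\<Theta> i)) w"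
        unfolding G_def conv_def[of "ball_kernel (r i)"] right_diff_distrib
        by (rule Bochner_Integration.integral_diff; rule integrable_L2_prod(1)[OF _ _ ball_kernel(4)[OF r]]) (auto intro: L2 mod_class_L2[OF mod_class_average[OF r mc]])
      ultimately show "\<Theta> j w - \<Theta> (Suc j) w = conv (ball_kernel (r i)) G w"
        by (simp add: \<Theta>S Suc)
    qed
    define P where "P = conv (truncate k (r j)) G"
    have Pm[measurable]: "P \<in> borel_measurable borel" unfolding P_def by measurable
    have Pb: "\<bar>P w\<bar> \<le> (LINT z|lborel. (truncate k (r j) z)\<^sup>2) + (LINT z|lborel. (G z)\<^sup>2)" for w
    proof -
      have "\<bar>P w\<bar> \<le> (LINT z|lborel. \<bar>truncate k (r j) z * G (w + z)\<bar>)"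
        unfolding P_def conv_def by (rule integral_abs_bound)
      also have "\<dots> \<le> (LINT z|lborel. (truncate k (r j) z)\<^sup>2) + (LINT z|lborel. (G z)\<^sup>2)"
        by (rule integrable_L2_prod(2)[OF _ _ truncate_L2[OF k r] G2]) auto
      finally show ?thesis .
    qed
    have "conv (truncate k (r j)) (\<lambda>w. \<Theta> j w - \<Theta> (Suc j) w) z = conv (ball_kernel (r i)) P z" for z
      unfolding eq P_def by (rule conv_commute[OF r _ _ truncate_L2[OF k r] G2]) auto
    then have "\<bar>conv (truncate k (r j)) (\<lambda>w. \<Theta> j w - \<Theta> (Suc j) w) x - conv (truncate k (r j)) (\<lambda>w. \<Theta> j w - \<Theta> (Suc j) w) y\<bar>
       = \<bar>conv (ball_kernel (r i)) P x - conv (ball_kernel (r i)) P y\<bar>" by simp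
    also have "\<dots> \<le> ?C * (norm (x - y) / r i) * (?H * \<omega> (r j))"
    proof (rule average_Lipschitz[OF r Pm Pb _ xr'])
      fix v assume "norm (v - x) \<le> 2 * r i"
      then show "\<bar>P v - P x\<bar> \<le> ?H * \<omega> (r j)"
        unfolding P_def by (intro truncate_conv_osc[OF k r Gm G2 Gb]) (simp add: Suc rS)
    qed
    also have "\<dots> \<le> ?C * (1 / 2 ^ i) * (?H * \<omega> (r j))"
      using xr[of i] C0 H0 wpos[of "r j"] r[of j] by (intro mult_right_mono mult_left_mono) auto
    also have "\<dots> = 2 * ?C * ?H * (\<omega> (r j) / 2 ^ j)" by (simp add: Suc)
    also have "\<dots> \<le> (2 * ?C + 1) * ?H * (\<omega> (r j) / 2 ^ j)"
      using C0 H0 wpos[of "r j"] r[of j] by (intro mult_right_mono) auto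
    finally show ?thesis .
  qed
  \<comment> \<open>First \<open>\<Theta> j\<close> is replaced by \<open>\<Theta> (Suc j)\<close>
    at the cut-off \<open>r j\<close>, then the cut-off is doubled for the smoother
    function.\<close>
  have step: "\<bar>\<Delta> j - \<Delta> (Suc j)\<bar> \<le> (2 * ?C + 1) * ?H * (\<omega> (r j) / 2 ^ j) + 2 * (?V * ?C) * (\<omega> (r (Suc j)) / 2 ^ Suc j)" for j
  proof -
    let ?T = "conv (truncate k (r j)) (\<lambda>w. \<Theta> j w - \<Theta> (Suc j) w)"
    let ?A = "\<lambda>z. conv (truncate k (r j)) (\<Theta> (Suc j)) z - conv (truncate k (2 * r j)) (\<Theta> (Suc j)) z"
    have eq: "\<Delta> j - \<Delta> (Suc j) = (?T x - ?T y) + (?A x - ?A y)"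
      unfolding \<Delta>_def F_def cd rS by simp
    have "\<bar>\<Delta> j - \<Delta> (Suc j)\<bar> \<le> \<bar>?T x - ?T y\<bar> + \<bar>?A x - ?A y\<bar>" unfolding eq by (rule abs_triangle_ineq)
    also have "\<dots> \<le> (2 * ?C + 1) * ?H * (\<omega> (r j) / 2 ^ j) + ?V * (?C * (1 / 2 ^ j) * \<omega> (2 * r j))"
      by (intro add_mono osc annulus_conv_diff[OF k r m L2 lip])
    also have "?V * (?C * (1 / 2 ^ j) * \<omega> (2 * r j)) = 2 * (?V * ?C) * (\<omega> (r (Suc j)) / 2 ^ Suc j)"
      by (simp add: rS)
    finally show ?thesis .
  qed
  define a where "a j = \<omega> (r j) / 2 ^ j" for j
  have a0: "a j \<ge> 0" for j using wpos[of "r j"] r[of j] by (simp add: a_def)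
  have sa: "summable a" using sm by (simp add: a_def[abs_def] r_def)
  have part: "(\<Sum>j<n. a j) \<le> suminf a" for n by (rule sum_le_suminf[OF sa]) (use a0 in auto)
  have bound: "\<bar>\<Delta> 0\<bar> \<le> far_const TYPE('a) B * suminf a + \<bar>\<Delta> J\<bar>" for J
  proof -
    have tel: "\<Delta> 0 - \<Delta> J = (\<Sum>j<J. \<Delta> j - \<Delta> (Suc j))" by (simp add: sum_lessThan_telescope')
    have "\<bar>\<Delta> 0 - \<Delta> J\<bar> \<le> (\<Sum>j<J. \<bar>\<Delta> j - \<Delta> (Suc j)\<bar>)" unfolding tel by (rule sum_abs)
    also have "\<dots> \<le> (\<Sum>j<J. (2 * ?C + 1) * ?H * a j + 2 * (?V * ?C) * a (Suc j))"
      unfolding a_def by (intro sum_mono step)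
    also have "\<dots> = (2 * ?C + 1) * ?H * (\<Sum>j<J. a j) + 2 * (?V * ?C) * (\<Sum>j<J. a (Suc j))"
      by (simp add: sum.distrib sum_distrib_left)
    also have "(\<Sum>j<J. a (Suc j)) = (\<Sum>j<Suc J. a j) - a 0" by (simp add: sum.lessThan_Suc_shift del: sum.lessThan_Suc)
    also have "(2 * ?C + 1) * ?H * (\<Sum>j<J. a j) + 2 * (?V * ?C) * ((\<Sum>j<Suc J. a j) - a 0) \<le> (2 * ?C + 1) * ?H * suminf a + 2 * (?V * ?C) * suminf a"
      using C0 H0 V0 part[of J] part[of "Suc J"] a0[of 0] by (intro add_mono mult_left_mono) auto
    also have "\<dots> = far_const TYPE('a) B * suminf a" by (simp add: far_const_def algebra_simps)
    finally show ?thesis by linarith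
  qed
  \<comment> \<open>The remainder of the telescoping sum vanishes by Cauchy-Schwarz: the L^2 norm of
    the kernel beyond \<open>r J\<close> tends to 0, while that of \<open>\<Theta> J\<close> stays
    bounded by the class constant. No rate is involved.\<close>
  have lim: "\<exists>J. \<bar>\<Delta> J\<bar> < e" if e: "e > 0" for e
  proof -
    define M where "M = max N 0 + 1"
    have M: "M > 0" "N \<le> M" by (auto simp: M_def)
    define \<eta> where "\<eta> = (e / 4)\<^sup>2 / M"
    have \<eta>: "\<eta> > 0" using e M by (simp add: \<eta>_def)
    have "((\<lambda>R. LINT z|lborel. (truncate k \<rho> z)\<^sup>2 * indicator {z. R \<le> norm z} z) \<longlongrightarrow> 0) at_top"
      by (rule integral_tail_tendsto[OF truncate_L2[OF k \<rho>]])
    then have "\<forall>\<^sub>F R in at_top. (LINT z|lborel. (truncate k \<rho> z)\<^sup>2 * indicator {z. R \<le> norm z} z) < \<eta>"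
      by (rule order_tendstoD(2)[OF _ \<eta>])
    then obtain R where R: "(LINT z|lborel. (truncate k \<rho> z)\<^sup>2 * indicator {z. R \<le> norm z} z) < \<eta>"
      by (auto simp: eventually_at_top_linorder)
    obtain J :: nat where "R / \<rho> < 2 ^ J" using real_arch_pow[of 2 "R / \<rho>"] by auto
    then have J: "R \<le> r J" using \<rho> by (simp add: r_def field_simps)
    have Jr: "\<rho> \<le> r J"
    proof -
      have "1 * \<rho> \<le> 2 ^ J * \<rho>" using \<rho> by (intro mult_right_mono) auto
      then show ?thesis by (simp add: r_def)
    qed
    have "(LINT z|lborel. (truncate k (r J) z)\<^sup>2) \<le> (LINT z|lborel. (truncate k \<rho> z)\<^sup>2 * indicator {z. R \<le> norm z} z)"
    proof (rule integral_mono[OF truncate_L2[OF k r]])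
      show "integrable lborel (\<lambda>z. (truncate k \<rho> z)\<^sup>2 * indicator {z. R \<le> norm z} z)"
        by (rule Bochner_Integration.integrable_bound[OF truncate_L2[OF k \<rho>]]) (auto simp: indicator_def)
      show "(truncate k (r J) z)\<^sup>2 \<le> (truncate k \<rho> z)\<^sup>2 * indicator {z. R \<le> norm z} z" for z
        using J Jr by (auto simp: truncate_def indicator_def)
    qed
    then have "(LINT z|lborel. (truncate k (r J) z)\<^sup>2) \<le> \<eta>" using R by simp
    then have kJ: "(\<integral>\<^sup>+z. ennreal (\<bar>truncate k (r J) z\<bar>\<^sup>2) \<partial>lborel) \<le> ennreal \<eta>"
      using truncate_L2[OF k r[of J]] by (simp add: nn_integral_eq_integral ennreal_leI)
    have Fb: "\<bar>F J z\<bar> \<le> e / 4" for z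
    proof -
      have "ennreal (norm (F J z)) \<le> (\<integral>\<^sup>+v. ennreal (norm (truncate k (r J) v * \<Theta> J (z + v))) \<partial>lborel)"
        unfolding F_def conv_def by (rule integral_norm_bound_ennreal[OF integrable_L2_prod(1)[OF _ _ truncate_L2[OF k r] L2]]) auto
      also have "\<dots> = (\<integral>\<^sup>+v. ennreal (\<bar>truncate k (r J) v\<bar> * \<bar>\<Theta> J (z + v)\<bar>) \<partial>lborel)" by (simp add: abs_mult)
      also have "\<dots> \<le> ennreal (sqrt (\<eta> * M))"
      proof (rule nn_integral_Cauchy_Schwarz[OF _ _ _ _ \<eta> M(1) kJ])
        have "(\<integral>\<^sup>+v. ennreal (\<bar>\<Theta> J (z + v)\<bar>\<^sup>2) \<partial>lborel) = (\<integral>\<^sup>+v. ennreal ((\<Theta> J v)\<^sup>2) \<partial>lborel)"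
          by (subst nn_integral_translate(1)[of "\<lambda>v. ennreal ((\<Theta> J v)\<^sup>2)" z, symmetric]) auto
        also have "\<dots> \<le> ennreal M" by (rule order_trans[OF N ennreal_leI[OF M(2)]])
        finally show "(\<integral>\<^sup>+v. ennreal (\<bar>\<Theta> J (z + v)\<bar>\<^sup>2) \<partial>lborel) \<le> ennreal M" .
      qed auto
      also have "sqrt (\<eta> * M) = e / 4" using e M by (simp add: \<eta>_def)
      finally show ?thesis using e by (simp add: ennreal_le_iff)
    qed
    have "\<bar>\<Delta> J\<bar> \<le> e / 4 + e / 4" unfolding \<Delta>_def using Fb[of x] Fb[of y] by linarith
    then show ?thesis using e by (intro exI[of _ J]) linarith
  qed
  have "\<bar>\<Delta> 0\<bar> \<le> far_const TYPE('a) B * suminf a"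
  proof (rule field_le_epsilon)
    fix e :: real assume "e > 0"
    then obtain J where "\<bar>\<Delta> J\<bar> < e" using lim by blast
    then show "\<bar>\<Delta> 0\<bar> \<le> far_const TYPE('a) B * suminf a + e" using bound[of J] by linarith
  qed
  then show ?thesis by (simp add: \<Delta>_def F_def \<Theta>0 a_def[abs_def] r_def)
qed

subsection \<open>Principal values\<close>

lemma norm_gt_sets: "{z::'a::euclidean_space. r < norm z} \<in> sets borel" "{z::'a::euclidean_space. r < norm z} \<in> sets lebesgue"
proof -
  show "{z::'a. r < norm z} \<in> sets borel"
    by (intro borel_open open_Collect_less continuous_intros)
  then show "{z::'a. r < norm z} \<in> sets lebesgue"
    by (intro sets_completionI_sets) simp
qed

lemma pv_converges:
  fixes g :: "'a::euclidean_space \<Rightarrow> 'b::{banach, second_countable_topology}"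
  assumes g: "integrable lebesgue g"
  shows "((\<lambda>r. LINT z:{z. r < norm z}|lebesgue. g z) \<longlongrightarrow> (LINT z:{z. 0 < norm z}|lebesgue. g z)) (at_right 0)"
proof -
  note S = norm_gt_sets(2)[where 'a='a]
  have "((\<lambda>t. LINT z|lebesgue. indicator {z. inverse t < norm z} z *\<^sub>R g z) \<longlongrightarrow> (LINT z|lebesgue. indicator {z. 0 < norm z} z *\<^sub>R g z)) at_top"
  proof (rule integral_dominated_convergence_at_top[where w="\<lambda>z. norm (g z)"])
    show "integrable lebesgue (\<lambda>z. norm (g z))" using g by simp
    show "(\<lambda>z. indicator {z. 0 < norm z} z *\<^sub>R g z) \<in> borel_measurable lebesgue" "\<And>t. (\<lambda>z. indicator {z. inverse t < norm z} z *\<^sub>R g z) \<in> borel_measurable lebesgue"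
      using g S by (auto intro!: borel_measurable_scaleR borel_measurable_indicator)
    show "\<forall>\<^sub>F t in at_top. AE z in lebesgue. norm (indicator {z. inverse t < norm z} z *\<^sub>R g z) \<le> norm (g z)"
      by (auto simp: indicator_def)
    show "AE z in lebesgue. ((\<lambda>t. indicator {z. inverse t < norm z} z *\<^sub>R g z) \<longlongrightarrow> indicator {z. 0 < norm z} z *\<^sub>R g z) at_top"
    proof (rule AE_I2)
      fix z :: 'a
      show "((\<lambda>t. indicator {z. inverse t < norm z} z *\<^sub>R g z) \<longlongrightarrow> indicator {z. 0 < norm z} z *\<^sub>R g z) at_top"
      proof (cases "z = 0")
        case True
        have "\<forall>\<^sub>F t in at_top. indicator {z. inverse t < norm z} z *\<^sub>R g z = 0"
          using eventually_gt_at_top[of "0::real"] by eventually_elim (auto simp: True)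
        then show ?thesis using True by (simp add: tendsto_eventually)
      next
        case False
        have "\<forall>\<^sub>F t in at_top. indicator {z. inverse t < norm z} z *\<^sub>R g z = g z"
          using eventually_gt_at_top[of "inverse (norm z)"]
        proof eventually_elim
          case (elim t)
          then have "inverse t < norm z" using False by (metis inverse_inverse_eq inverse_less_iff_less inverse_positive_iff_positive less_trans zero_less_norm_iff)
          then show ?case by simp
        qed
        then show ?thesis using False by (simp add: tendsto_eventually)
      qed
    qed
  qed
  then show ?thesis
    by (subst filterlim_at_right_to_top) (simp add: set_lebesgue_integral_def)
qed

text \<open>The diffusion kernel is only Lebesgue measurable, so the reflection has to preserve the
  completed measure and not just \<open>lborel\<close>.\<close>

lemma lebesgue_reflect:
  fixes g :: "'a::euclidean_space \<Rightarrow> 'b::{banach, second_countable_topology}"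
  assumes g: "g \<in> borel_measurable lebesgue"
  shows "(\<lambda>z. g (- z)) \<in> borel_measurable lebesgue" and "(LINT z|lebesgue. g (- z)) = (LINT z|lebesgue. g z)"
    and "integrable lebesgue (\<lambda>z. g (- z)) \<longleftrightarrow> integrable lebesgue g"
proof -
  have T: "(\<lambda>x::'a. 0 + (\<Sum>j\<in>Basis. ((- 1) * (x \<bullet> j)) *\<^sub>R j)) = uminus"
  proof
    fix x :: 'a
    have "(\<Sum>j\<in>Basis. ((- 1) * (x \<bullet> j)) *\<^sub>R j) = - (\<Sum>j\<in>Basis. (x \<bullet> j) *\<^sub>R j)" by (simp add: sum_negf)
    then show "0 + (\<Sum>j\<in>Basis. ((- 1) * (x \<bullet> j)) *\<^sub>R j) = - x" by (simp add: euclidean_representation)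
  qed
  have m[measurable]: "uminus \<in> lebesgue \<rightarrow>\<^sub>M (lebesgue :: 'a measure)"
    using lebesgue_affine_measurable[of "\<lambda>_::'a. -1" "0::'a"] unfolding T by simp
  have d: "(lebesgue :: 'a measure) = distr lebesgue lebesgue uminus"
    using lebesgue_affine_euclidean[of "\<lambda>_::'a. -1" "0::'a"] unfolding T by (simp add: density_1)
  show 1: "(\<lambda>z. g (- z)) \<in> borel_measurable lebesgue"
    using measurable_compose[OF m g] by simp
  show "(LINT z|lebesgue. g (- z)) = (LINT z|lebesgue. g z)"
    by (subst (2) d) (simp add: integral_distr[OF m g])
  show "integrable lebesgue (\<lambda>z. g (- z)) \<longleftrightarrow> integrable lebesgue g"
    by (subst (2) d) (simp add: integrable_distr_eq[OF m g])
qed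

text \<open>What the principal value of the diffusion uses of \<open>K\<close>: evenness, sign,
  decay of order \<mu> beyond the dimension at infinity, and at the origin at worst the singularity
  of order \<open>DIM + 1\<close>, which is what \<alpha> \<le> 1 permits.\<close>

definition diffusion_kernel :: "real \<Rightarrow> real \<Rightarrow> ('a::euclidean_space \<Rightarrow> real) \<Rightarrow> bool" where
  "diffusion_kernel Q \<mu> K \<longleftrightarrow> 0 < \<mu> \<and> 0 \<le> Q \<and> K \<in> borel_measurable lebesgue \<and>
     (\<forall>z. z \<noteq> 0 \<longrightarrow> K (- z) = K z) \<and> (\<forall>z. z \<noteq> 0 \<longrightarrow> 0 \<le> K z) \<and>
     (\<forall>z. 1 \<le> norm z \<longrightarrow> K z \<le> Q * norm z powr (- (real DIM('a) + \<mu>))) \<and>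
     (\<forall>z. z \<noteq> 0 \<and> norm z \<le> 1 \<longrightarrow> K z \<le> Q / (norm z * norm z ^ DIM('a)))"

lemma integrable_near: "integrable lebesgue (\<lambda>y::'a::euclidean_space. norm y / norm y ^ DIM('a) * indicator {y. norm y \<le> r} y)"
proof (cases "r > 0")
  case True
  have "integrable lborel (\<lambda>y::'a. norm y / norm y ^ DIM('a) * indicator {y. norm y \<le> r} y)"
    using nn_integral_near_finite[OF True, where 'a='a] by (intro integrableI_bounded) auto
  then show ?thesis by (subst integrable_completion) auto
next
  case False
  then have "(\<lambda>y::'a. norm y / norm y ^ DIM('a) * indicator {y. norm y \<le> r} y) = (\<lambda>y. 0)"
    by (auto simp: indicator_def intro!: ext) (metis norm_le_zero_iff norm_zero order_trans linorder_not_less)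
  then show ?thesis by simp
qed

lemma integrable_far:
  assumes "\<mu> > 0" "r > 0"
  shows "integrable lebesgue (\<lambda>y::'a::euclidean_space. norm y powr (- (real DIM('a) + \<mu>)) * indicator {y. r < norm y} y)"
proof -
  have "integrable lborel (\<lambda>y::'a. norm y powr (- (real DIM('a) + \<mu>)) * indicator {y. r < norm y} y)"
    using nn_integral_far_finite[OF assms, where 'a='a] by (intro integrableI_bounded) auto
  then show ?thesis by (subst integrable_completion) auto
qed

lemma diffusion_kernel_integrable:
  fixes K :: "'a::euclidean_space \<Rightarrow> real"
  assumes K: "diffusion_kernel Q \<mu> K" and r: "r > 0"
  shows "integrable lebesgue (\<lambda>z. indicator {z. r < norm z} z *\<^sub>R K z)"
proof -
  have \<mu>: "\<mu> > 0" and Q: "Q \<ge> 0" and Km: "K \<in> borel_measurable lebesgue" using K by (auto simp: diffusion_kernel_def)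
  note S = norm_gt_sets(2)[where 'a='a]
  show ?thesis
  proof (rule Bochner_Integration.integrable_bound)
    show "integrable lebesgue (\<lambda>z::'a. Q * (norm z powr (- (real DIM('a) + \<mu>)) * indicator {z. (1/2::real) < norm z} z) + Q / (r * r) * (norm z / norm z ^ DIM('a) * indicator {z. norm z \<le> 1} z))"
      by (rule Bochner_Integration.integrable_add[OF integrable_mult_right[OF integrable_far[OF \<mu>]] integrable_mult_right[OF integrable_near]]) simp
    show "(\<lambda>z. indicator {z. r < norm z} z *\<^sub>R K z) \<in> borel_measurable lebesgue"
      using S Km by (intro borel_measurable_scaleR borel_measurable_indicator)
    show "AE z in lebesgue. norm (indicator {z. r < norm z} z *\<^sub>R K z) \<le> norm (Q * (norm z powr (- (real DIM('a) + \<mu>)) * indicator {z. (1/2::real) < norm z} z) + Q / (r * r) * (norm z / norm z ^ DIM('a) * indicator {z. norm z \<le> 1} z))"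
    proof (rule AE_I2)
      fix z :: 'a
      have nn: "0 \<le> Q * (norm z powr (- (real DIM('a) + \<mu>)) * indicator {z. (1/2::real) < norm z} z)" "0 \<le> Q / (r * r) * (norm z / norm z ^ DIM('a) * indicator {z. norm z \<le> 1} z)"
        using Q r by auto
      show "norm (indicator {z. r < norm z} z *\<^sub>R K z) \<le> norm (Q * (norm z powr (- (real DIM('a) + \<mu>)) * indicator {z. (1/2::real) < norm z} z) + Q / (r * r) * (norm z / norm z ^ DIM('a) * indicator {z. norm z \<le> 1} z))"
      proof (cases "r < norm z")
        case True
        then have z: "z \<noteq> 0" "norm z > 0" using r by auto
        have K0: "0 \<le> K z" using K z by (auto simp: diffusion_kernel_def)
        have "K z \<le> Q * (norm z powr (- (real DIM('a) + \<mu>)) * indicator {z. (1/2::real) < norm z} z) + Q / (r * r) * (norm z / norm z ^ DIM('a) * indicator {z. norm z \<le> 1} z)"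
        proof (cases "1 \<le> norm z")
          case True
          then have "K z \<le> Q * norm z powr (- (real DIM('a) + \<mu>))" using K by (auto simp: diffusion_kernel_def)
          then show ?thesis using True nn by simp
        next
          case False
          have "K z \<le> Q / (norm z * norm z ^ DIM('a))" using K z False by (auto simp: diffusion_kernel_def)
          also have "\<dots> = Q / (norm z * norm z) * (norm z / norm z ^ DIM('a))" using z by (simp add: field_simps)
          also have "\<dots> \<le> Q / (r * r) * (norm z / norm z ^ DIM('a))"
            using z r True Q by (intro mult_right_mono divide_left_mono mult_mono) auto
          finally show ?thesis using False nn by simp
        qed
        then show ?thesis using True K0 by simp
      qed (use nn in simp)
    qed
  qed
qed

text \<open>Reflection replaces the increment by half a second difference. This is quadratic in
  \<open>z\<close>, so against a singularity of order \<open>DIM + 1\<close> the integrand is of the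
  integrable order \<open>DIM - 1\<close>; far away boundedness of \<open>f\<close>
  suffices.\<close>

lemma diffusion_pv:
  fixes f :: "'a::euclidean_space \<Rightarrow> real"
  assumes K: "diffusion_kernel Q \<mu> K" and fm: "f \<in> borel_measurable borel" and fb: "\<And>w. \<bar>f w\<bar> \<le> M"
    and sd: "\<And>z. norm z \<le> 1 \<Longrightarrow> \<bar>f (x + z) + f (x - z) - 2 * f x\<bar> \<le> L * (norm z)\<^sup>2"
  shows "\<exists>l. ((\<lambda>r. LINT z:{z. r < norm z}|lebesgue. (f x - f (x + z)) * K z) \<longlongrightarrow> l) (at_right 0)"
    and "r > 0 \<Longrightarrow> integrable lebesgue (\<lambda>z. indicator {z. r < norm z} z *\<^sub>R ((f x - f (x + z)) * K z))"
proof -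
  have \<mu>: "\<mu> > 0" and Q: "Q \<ge> 0" and Km: "K \<in> borel_measurable lebesgue" and Kr: "\<And>z. z \<noteq> 0 \<Longrightarrow> K (- z) = K z"
    and K0: "\<And>z. z \<noteq> 0 \<Longrightarrow> 0 \<le> K z"
    using K by (auto simp: diffusion_kernel_def)
  note S = norm_gt_sets(2)[where 'a='a]
  have fmx: "(\<lambda>z. f (x + z)) \<in> borel_measurable lebesgue" "(\<lambda>z. f (x - z)) \<in> borel_measurable lebesgue"
    by (rule measurable_completion, use fm in measurable)+
  have M0: "M \<ge> 0" using order_trans[OF abs_ge_zero fb] .
  have int: "integrable lebesgue (\<lambda>z. indicator {z. r < norm z} z *\<^sub>R (F z * K z))"
    if r: "r > 0" and F: "F \<in> borel_measurable lebesgue" "\<And>z. \<bar>F z\<bar> \<le> 4 * M" for r and F :: "'a \<Rightarrow> real"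
  proof (rule Bochner_Integration.integrable_bound[OF integrable_mult_right[OF diffusion_kernel_integrable[OF K r], of "4 * M"]])
    show "AE z in lebesgue. norm (indicator {z. r < norm z} z *\<^sub>R (F z * K z)) \<le> norm (4 * M * (indicator {z. r < norm z} z *\<^sub>R K z))"
      using F(2) M0 by (intro AE_I2) (auto simp: indicator_def abs_mult intro!: mult_right_mono)
    show "(\<lambda>z. indicator {z. r < norm z} z *\<^sub>R (F z * K z)) \<in> borel_measurable lebesgue"
      using S Km F(1) by (intro borel_measurable_scaleR borel_measurable_indicator borel_measurable_times)
  qed
  have Fb: "\<bar>f x - f (x + z)\<bar> \<le> 4 * M" "\<bar>f x - f (x - z)\<bar> \<le> 4 * M" "\<bar>(2 * f x - f (x + z) - f (x - z)) / 2\<bar> \<le> 4 * M" for z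
    using fb[of x] fb[of "x + z"] fb[of "x - z"] unfolding abs_le_iff by (simp_all add: field_simps)
  show I: "integrable lebesgue (\<lambda>z. indicator {z. r < norm z} z *\<^sub>R ((f x - f (x + z)) * K z))" if "r > 0" for r
    using that fmx by (intro int Fb) auto
  have I': "integrable lebesgue (\<lambda>z. indicator {z. r < norm z} z *\<^sub>R ((f x - f (x - z)) * K z))" if "r > 0" for r
    using that fmx by (intro int Fb) auto
  have sym: "(LINT z:{z. r < norm z}|lebesgue. (f x - f (x + z)) * K z) = (LINT z:{z. r < norm z}|lebesgue. (f x - f (x - z)) * K z)" if "r > 0" for r
    unfolding set_lebesgue_integral_def
  proof (subst lebesgue_reflect(2)[OF borel_measurable_integrable[OF I[OF that]], symmetric], rule Bochner_Integration.integral_cong[OF refl])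
    fix z :: 'a
    show "indicator {z. r < norm z} (- z) *\<^sub>R ((f x - f (x + - z)) * K (- z)) = indicator {z. r < norm z} z *\<^sub>R ((f x - f (x - z)) * K z)"
    proof (cases "r < norm z")
      case True
      then have "z \<noteq> 0" using that by auto
      then show ?thesis using Kr[of z] by (simp add: indicator_def)
    qed (simp add: indicator_def)
  qed
  define g where "g z = (2 * f x - f (x + z) - f (x - z)) / 2 * K z" for z
  have eq: "(LINT z:{z. r < norm z}|lebesgue. (f x - f (x + z)) * K z) = (LINT z:{z. r < norm z}|lebesgue. g z)" if "r > 0" for r
  proof -
    have "2 * (LINT z:{z. r < norm z}|lebesgue. (f x - f (x + z)) * K z) = (LINT z:{z. r < norm z}|lebesgue. (f x - f (x + z)) * K z) + (LINT z:{z. r < norm z}|lebesgue. (f x - f (x - z)) * K z)"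
      using sym[OF that] by simp
    also have "\<dots> = (LINT z|lebesgue. 2 * (indicator {z. r < norm z} z *\<^sub>R g z))"
      unfolding set_lebesgue_integral_def
    proof (subst Bochner_Integration.integral_add[symmetric, OF I[OF that] I'[OF that]], rule Bochner_Integration.integral_cong[OF refl])
      fix z :: 'a
      show "indicator {z. r < norm z} z *\<^sub>R ((f x - f (x + z)) * K z) + indicator {z. r < norm z} z *\<^sub>R ((f x - f (x - z)) * K z) = 2 * (indicator {z. r < norm z} z *\<^sub>R g z)"
        by (cases "r < norm z") (simp_all add: g_def field_simps)
    qed
    also have "\<dots> = 2 * (LINT z:{z. r < norm z}|lebesgue. g z)"
      unfolding set_lebesgue_integral_def by (rule integral_mult_right_zero)
    finally show ?thesis by simp
  qed
  have gI: "integrable lebesgue (\<lambda>z. indicator {z. 0 < norm z} z *\<^sub>R g z)"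
  proof (rule Bochner_Integration.integrable_bound)
    show "integrable lebesgue (\<lambda>z. 4 * M * (indicator {z. 1 / 2 < norm z} z *\<^sub>R K z) + \<bar>L\<bar> * Q * (norm z / norm z ^ DIM('a) * indicator {z. norm z \<le> 1} z))"
      by (intro Bochner_Integration.integrable_add integrable_mult_right diffusion_kernel_integrable[OF K] integrable_near) simp
    show "(\<lambda>z. indicator {z. 0 < norm z} z *\<^sub>R g z) \<in> borel_measurable lebesgue"
      unfolding g_def using S Km fmx by (intro borel_measurable_scaleR borel_measurable_indicator borel_measurable_times borel_measurable_divide borel_measurable_diff) auto
    show "AE z in lebesgue. norm (indicator {z. 0 < norm z} z *\<^sub>R g z) \<le> norm (4 * M * (indicator {z. 1 / 2 < norm z} z *\<^sub>R K z) + \<bar>L\<bar> * Q * (norm z / norm z ^ DIM('a) * indicator {z. norm z \<le> 1} z))"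
    proof (rule AE_I2)
      fix z :: 'a
      show "norm (indicator {z. 0 < norm z} z *\<^sub>R g z) \<le> norm (4 * M * (indicator {z. 1 / 2 < norm z} z *\<^sub>R K z) + \<bar>L\<bar> * Q * (norm z / norm z ^ DIM('a) * indicator {z. norm z \<le> 1} z))"
      proof (cases "z = 0")
        case False
        then have z: "norm z > 0" by simp
        have kz: "0 \<le> K z" by (rule K0[OF False])
        have nn: "0 \<le> 4 * M * (indicator {z. 1 / 2 < norm z} z *\<^sub>R K z)" "0 \<le> \<bar>L\<bar> * Q * (norm z / norm z ^ DIM('a) * indicator {z. norm z \<le> 1} z)"
          using kz M0 Q by auto
        have "\<bar>g z\<bar> \<le> 4 * M * (indicator {z. 1 / 2 < norm z} z *\<^sub>R K z) + \<bar>L\<bar> * Q * (norm z / norm z ^ DIM('a) * indicator {z. norm z \<le> 1} z)"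
        proof (cases "norm z \<le> 1")
          case True
          have "\<bar>2 * f x - f (x + z) - f (x - z)\<bar> = \<bar>f (x + z) + f (x - z) - 2 * f x\<bar>" by (simp add: abs_minus_commute)
          also have "\<dots> \<le> L * (norm z)\<^sup>2" by (rule sd[OF True])
          also have "\<dots> \<le> \<bar>L\<bar> * (norm z)\<^sup>2" by (intro mult_right_mono) auto
          finally have "\<bar>(2 * f x - f (x + z) - f (x - z)) / 2\<bar> \<le> \<bar>L\<bar> * (norm z)\<^sup>2" by simp
          moreover have "K z \<le> Q / (norm z * norm z ^ DIM('a))"
            using K False True by (auto simp: diffusion_kernel_def)
          ultimately have "\<bar>g z\<bar> \<le> (\<bar>L\<bar> * (norm z)\<^sup>2) * (Q / (norm z * norm z ^ DIM('a)))"
            unfolding g_def abs_mult using kz by (intro mult_mono) auto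
          also have "\<dots> = \<bar>L\<bar> * Q * (norm z / norm z ^ DIM('a))"
            using z by (simp add: power2_eq_square field_simps)
          moreover have "\<bar>L\<bar> * Q * (norm z / norm z ^ DIM('a) * indicator {z. norm z \<le> 1} z) = \<bar>L\<bar> * Q * (norm z / norm z ^ DIM('a))"
            using True by simp
          ultimately show ?thesis using nn(1) by linarith
        next
          case nle: False
          have "\<bar>g z\<bar> \<le> 4 * M * K z"
            unfolding g_def abs_mult using Fb(3)[of z] kz by (intro mult_mono) auto
          then show ?thesis using nle by simp
        qed
        then show ?thesis using nn False by simp
      qed simp
    qed
  qed
  have "((\<lambda>r. LINT z:{z. r < norm z}|lebesgue. (indicator {z. 0 < norm z} z *\<^sub>R g z)) \<longlongrightarrow> (LINT z:{z. 0 < norm z}|lebesgue. (indicator {z. 0 < norm z} z *\<^sub>R g z))) (at_right 0)"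
    by (rule pv_converges[OF gI])
  moreover have "\<forall>\<^sub>F r in at_right (0::real). (LINT z:{z. r < norm z}|lebesgue. (indicator {z. 0 < norm z} z *\<^sub>R g z)) = (LINT z:{z. r < norm z}|lebesgue. (f x - f (x + z)) * K z)"
  proof (rule eventually_at_rightI[of 0 1])
    fix r :: real assume "r \<in> {0<..<1}"
    then have r: "r > 0" by simp
    show "(LINT z:{z. r < norm z}|lebesgue. (indicator {z. 0 < norm z} z *\<^sub>R g z)) = (LINT z:{z. r < norm z}|lebesgue. (f x - f (x + z)) * K z)"
      unfolding eq[OF r] unfolding set_lebesgue_integral_def using r by (intro Bochner_Integration.integral_cong) (auto simp: indicator_def)
  qed simp
  ultimately have "((\<lambda>r. LINT z:{z. r < norm z}|lebesgue. (f x - f (x + z)) * K z) \<longlongrightarrow> (LINT z:{z. 0 < norm z}|lebesgue. (indicator {z. 0 < norm z} z *\<^sub>R g z))) (at_right 0)"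
    by (rule Lim_transform_eventually)
  then show "\<exists>l. ((\<lambda>r. LINT z:{z. r < norm z}|lebesgue. (f x - f (x + z)) * K z) \<longlongrightarrow> l) (at_right 0)" by blast
qed

section \<open>Principal value of the velocity\<close>

definition cancelling :: "('a::euclidean_space \<Rightarrow> real) \<Rightarrow> bool" where
  "cancelling k \<longleftrightarrow> (\<forall>r s. 0 < r \<and> r < s \<longrightarrow> (LINT x:{x. r < norm x \<and> norm x < s}|lebesgue. k x) = 0)"

lemma truncate_difference:
  fixes k :: "'a::euclidean_space \<Rightarrow> real"
  assumes k: "hormander_kernel B k" and c: "cancelling k" and rs: "0 < r" "r < s"
  shows "integrable lborel (\<lambda>z. truncate k r z - truncate k s z)" "(LINT z|lborel. truncate k r z - truncate k s z) = 0"
    "truncate k r z - truncate k s z = k z * indicator {z. r < norm z \<and> norm z \<le> s} z"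
proof -
  have km[measurable]: "k \<in> borel_measurable borel" and B: "B \<ge> 0" using k by (auto simp: hormander_kernel_def)
  show e: "truncate k r z - truncate k s z = k z * indicator {z. r < norm z \<and> norm z \<le> s} z" for z
    using rs by (auto simp: truncate_def indicator_def)
  show "integrable lborel (\<lambda>z. truncate k r z - truncate k s z)"
  proof (rule Bochner_Integration.integrable_bound)
    show "integrable lborel (\<lambda>z. B / r ^ DIM('a) * indicator (cball (0::'a) s) z)"
      by (intro integrable_mult_right integrable_real_indicator) (auto simp: emeasure_lborel_cball_finite[simplified])
    show "AE z in lborel. norm (truncate k r z - truncate k s z) \<le> norm (B / r ^ DIM('a) * indicator (cball (0::'a) s) z)"
    proof (rule AE_I2)
      fix z
      show "norm (truncate k r z - truncate k s z) \<le> norm (B / r ^ DIM('a) * indicator (cball (0::'a) s) z)"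
        using truncate_bound[OF k rs(1), of z] rs B by (auto simp: truncate_def indicator_def)
    qed
  qed measurable
  have "(LINT z|lborel. truncate k r z - truncate k s z) = (LINT z|lebesgue. truncate k r z - truncate k s z)"
    by (rule lebesgue_integral_borel[symmetric]) measurable
  also have "\<dots> = (LINT x:{x. r < norm x \<and> norm x < s}|lebesgue. k x)"
    unfolding set_lebesgue_integral_def
  proof (rule integral_cong_AE)
    have "{x::'a. r < norm x \<and> norm x < s} = {x. r < norm x} \<inter> ball 0 s" by auto
    then have bS: "{x::'a. r < norm x \<and> norm x < s} \<in> sets borel" using norm_gt_sets(1)[of r, where 'a='a] by simp
    show "(\<lambda>z. truncate k r z - truncate k s z) \<in> borel_measurable lebesgue"
      by (rule measurable_completion) measurable
    show "(\<lambda>x. indicator {x. r < norm x \<and> norm x < s} x *\<^sub>R k x) \<in> borel_measurable lebesgue"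
      by (rule measurable_completion) (use bS in measurable)
    \<comment> \<open>\<open>cancelling\<close> speaks of the open annulus, while the difference of
      truncations includes the outer sphere.\<close>
    have "negligible (sphere (0::'a) s)" by (rule negligible_sphere)
    then have "AE z in lebesgue. z \<notin> sphere (0::'a) s"
      unfolding negligible_iff_null_sets by (rule AE_not_in)
    then show "AE z in lebesgue. truncate k r z - truncate k s z = indicator {x. r < norm x \<and> norm x < s} z *\<^sub>R k z"
      by eventually_elim (use rs in \<open>auto simp: truncate_def indicator_def\<close>)
  qed
  also have "\<dots> = 0" using c rs by (simp add: cancelling_def)
  finally show "(LINT z|lborel. truncate k r z - truncate k s z) = 0" .
qed

lemma set_integral_truncate:
  fixes k :: "'a::euclidean_space \<Rightarrow> real"
  assumes [measurable]: "k \<in> borel_measurable borel" "f \<in> borel_measurable borel"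
  shows "(LINT z:{z. r < norm z}|lebesgue. f (x + z) * k z) = conv (truncate k r) f x"
proof -
  have [measurable]: "{z::'a. r < norm z} \<in> sets borel" by (rule norm_gt_sets)
  have "(LINT z:{z. r < norm z}|lebesgue. f (x + z) * k z) = (LINT z|lebesgue. truncate k r z * f (x + z))"
    unfolding set_lebesgue_integral_def by (intro Bochner_Integration.integral_cong) (auto simp: truncate_def indicator_def)
  also have "\<dots> = conv (truncate k r) f x"
    unfolding conv_def by (rule lebesgue_integral_borel) measurable
  finally show ?thesis .
qed

text \<open>Cancellation on annuli inside the unit ball allows \<open>f x\<close> to be subtracted
  from \<open>f (x + z)\<close>. The Lipschitz bound then lowers the singularity to the integrable
  order \<open>DIM - 1\<close>.\<close>

lemma velocity_pv:
  fixes f :: "'a::euclidean_space \<Rightarrow> real"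
  assumes k: "hormander_kernel B k" and c: "cancelling k" and fm[measurable]: "f \<in> borel_measurable borel"
    and f2: "integrable lborel (\<lambda>z. (f z)\<^sup>2)"
    and lip: "\<And>z. norm z \<le> 1 \<Longrightarrow> \<bar>f (x + z) - f x\<bar> \<le> L * norm z"
  shows "\<exists>l. ((\<lambda>r. LINT z:{z. r < norm z}|lebesgue. f (x + z) * k z) \<longlongrightarrow> l) (at_right 0)"
proof -
  have km[measurable]: "k \<in> borel_measurable borel" and B: "B \<ge> 0" using k by (auto simp: hormander_kernel_def)
  have [measurable]: "{z::'a. r < norm z} \<in> sets borel" for r by (rule norm_gt_sets)
  \<comment> \<open>\<open>truncate k 0\<close> only removes the origin, so \<open>g\<close> is the
    kernel on the punctured unit ball times the increment of \<open>f\<close>.\<close>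
  define g where "g z = (truncate k 0 z - truncate k 1 z) * (f (x + z) - f x)" for z
  have [measurable]: "g \<in> borel_measurable borel" unfolding g_def by measurable
  have gI: "integrable lborel g"
  proof (rule Bochner_Integration.integrable_bound)
    have "integrable lebesgue (\<lambda>z::'a. norm z / norm z ^ DIM('a) * indicator {y. norm y \<le> 1} z)" by (rule integrable_near)
    then have "integrable lborel (\<lambda>z::'a. norm z / norm z ^ DIM('a) * indicator {y. norm y \<le> 1} z)" by (subst (asm) integrable_completion) auto
    then show "integrable lborel (\<lambda>z::'a. \<bar>L\<bar> * B * (norm z / norm z ^ DIM('a) * indicator {y. norm y \<le> 1} z))" by (rule integrable_mult_right)
    show "AE z in lborel. norm (g z) \<le> norm (\<bar>L\<bar> * B * (norm z / norm z ^ DIM('a) * indicator {y. norm y \<le> 1} z))"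
    proof (rule AE_I2)
      fix z :: 'a
      show "norm (g z) \<le> norm (\<bar>L\<bar> * B * (norm z / norm z ^ DIM('a) * indicator {y. norm y \<le> 1} z))"
      proof (cases "z \<noteq> 0 \<and> norm z \<le> 1")
        case True
        have "\<bar>f (x + z) - f x\<bar> \<le> \<bar>L\<bar> * norm z"
          using lip[of z] True by (intro order_trans[OF lip] mult_right_mono) auto
        moreover have "\<bar>k z\<bar> \<le> B / norm z ^ DIM('a)" using k True by (auto simp: hormander_kernel_def)
        ultimately have "\<bar>k z\<bar> * \<bar>f (x + z) - f x\<bar> \<le> (B / norm z ^ DIM('a)) * (\<bar>L\<bar> * norm z)" using B by (intro mult_mono) auto
        then show ?thesis using True B by (simp add: g_def truncate_def abs_mult mult_ac)
      qed (use B in \<open>auto simp: g_def truncate_def indicator_def\<close>)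
    qed
  qed measurable
  then have gIL: "integrable lebesgue g" by (subst integrable_completion) auto
  have lim: "((\<lambda>r. (LINT z:{z. r < norm z}|lebesgue. g z) + conv (truncate k 1) f x) \<longlongrightarrow> (LINT z:{z. 0 < norm z}|lebesgue. g z) + conv (truncate k 1) f x) (at_right 0)"
    by (intro tendsto_add pv_converges gIL tendsto_const)
  have "\<forall>\<^sub>F r in at_right (0::real). (LINT z:{z. r < norm z}|lebesgue. g z) + conv (truncate k 1) f x = (LINT z:{z. r < norm z}|lebesgue. f (x + z) * k z)"
  proof (rule eventually_at_rightI[of 0 1])
    fix r :: real assume "r \<in> {0<..<1}"
    then have r: "0 < r" "r < 1" by auto
    note td = truncate_difference[OF k c r]
    have i: "integrable lborel (\<lambda>z. truncate k s z * f (x + z))" if "s > 0" for s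
      by (rule integrable_L2_prod(1)[OF _ _ truncate_L2[OF k that] f2]) auto
    have "(LINT z:{z. r < norm z}|lebesgue. g z) = (LINT z|lebesgue. (truncate k r z - truncate k 1 z) * (f (x + z) - f x))"
      unfolding set_lebesgue_integral_def using r by (intro Bochner_Integration.integral_cong) (auto simp: g_def truncate_def indicator_def)
    also have "\<dots> = (LINT z|lborel. (truncate k r z - truncate k 1 z) * (f (x + z) - f x))"
      by (rule lebesgue_integral_borel) measurable
    also have "\<dots> = (LINT z|lborel. (truncate k r z * f (x + z) - truncate k 1 z * f (x + z)) - (truncate k r z - truncate k 1 z) * f x)"
      by (simp add: algebra_simps)
    also have "\<dots> = conv (truncate k r) f x - conv (truncate k 1) f x"
      using i[OF r(1)] i[of 1] td(1,2) by (simp add: conv_def)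
    finally show "(LINT z:{z. r < norm z}|lebesgue. g z) + conv (truncate k 1) f x = (LINT z:{z. r < norm z}|lebesgue. f (x + z) * k z)"
      by (simp add: set_integral_truncate)
  qed simp
  then have "((\<lambda>r. LINT z:{z. r < norm z}|lebesgue. f (x + z) * k z) \<longlongrightarrow> (LINT z:{z. 0 < norm z}|lebesgue. g z) + conv (truncate k 1) f x) (at_right 0)"
    by (rule Lim_transform_eventually[OF lim])
  then show ?thesis by blast
qed

text \<open>If \<open>\<phi>(z) = (f(x) - f(y)) - (f(x + z) - f(y + z)) \<ge> 0\<close> and \<open>h = x - y\<close>, then \<open>\<phi>(z) + \<phi>(z + h)\<close> telescopes and is
  at least \<open>2 W(|h|) - W(2 |h|)\<close>; integrate this over the ball of radius \<open>|h| / 4\<close> around \<open>- h / 2\<close>.\<close>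

lemma diffusion_lower_bound:
  fixes f :: "'a::euclidean_space \<Rightarrow> real"
  assumes K: "diffusion_kernel Q \<mu> K" and fm: "f \<in> borel_measurable borel" and fb: "\<And>w. \<bar>f w\<bar> \<le> M"
    and mod: "\<And>w w'. \<bar>f w - f w'\<bar> \<le> W (norm (w - w'))" and xy: "x \<noteq> y" and touch: "f x - f y = W (norm (x - y))"
    and W2: "W (2 * norm (x - y)) \<le> W (norm (x - y)) + q" and Kl: "\<And>z. z \<noteq> 0 \<Longrightarrow> norm z \<le> norm (x - y) \<Longrightarrow> \<kappa> \<le> K z" and \<kappa>: "\<kappa> \<ge> 0"
    and r: "0 < r" "r < norm (x - y) / 4"
    and I: "integrable lebesgue (\<lambda>z. indicator {z. r < norm z} z *\<^sub>R (((f x - f y) - (f (x + z) - f (y + z))) * K z))"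
  shows "\<kappa> * (unit_ball_vol (real DIM('a)) * (norm (x - y) / 4) ^ DIM('a)) * (W (norm (x - y)) - q)
      \<le> (LINT z:{z. r < norm z}|lebesgue. ((f x - f y) - (f (x + z) - f (y + z))) * K z)"
proof -
  define h where "h = x - y"
  define \<xi> where "\<xi> = norm h"
  define \<phi> where "\<phi> z = (f x - f y) - (f (x + z) - f (y + z))" for z
  have \<xi>: "\<xi> > 0" using xy by (simp add: \<xi>_def h_def)
  have [measurable]: "f \<in> borel_measurable borel" by (rule fm)
  have \<phi>m[measurable]: "\<phi> \<in> borel_measurable borel" unfolding \<phi>_def by measurable
  have \<phi>0: "\<phi> z \<ge> 0" for z
    using mod[of "x + z" "y + z"] touch by (simp add: \<phi>_def)
  have \<phi>b: "\<bar>\<phi> z\<bar> \<le> 4 * M" for z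
    using fb[of x] fb[of y] fb[of "x + z"] fb[of "y + z"] unfolding \<phi>_def abs_le_iff by simp
  have \<phi>b': "\<bar>\<phi> z\<bar> \<le> \<bar>4 * M\<bar>" for z using \<phi>b[of z] by linarith
  \<comment> \<open>The radius \<open>\<xi> / 4\<close> keeps both balls disjoint and inside the
    range from \<open>\<xi> / 4\<close> to \<open>\<xi>\<close>, where the lower bound on
    \<open>K\<close> applies and which the truncation at \<open>r\<close> leaves untouched.
    \<open>E'\<close> is the translate of \<open>E\<close> by \<open>h\<close>.\<close>
  define E where "E = ball (- (1/2) *\<^sub>R h) (\<xi> / 4)"
  define E' where "E' = ball ((1/2) *\<^sub>R h) (\<xi> / 4)"
  have nh: "norm ((1/2) *\<^sub>R h) = \<xi> / 2" by (simp add: \<xi>_def)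
  have nh': "norm (- (1/2) *\<^sub>R h) = \<xi> / 2" by (simp add: \<xi>_def)
  have annE: "r < norm z \<and> norm z \<le> \<xi>" if "z \<in> E \<union> E'" for z
  proof -
    obtain w where w: "norm w = \<xi> / 2" "norm (w - z) < \<xi> / 4"
    proof (cases "z \<in> E")
      case True
      then have "norm (- (1/2) *\<^sub>R h - z) < \<xi> / 4" unfolding E_def mem_ball dist_norm .
      then show ?thesis by (rule that[OF nh'])
    next
      case False
      then have "z \<in> E'" using \<open>z \<in> E \<union> E'\<close> by blast
      then have "norm ((1/2) *\<^sub>R h - z) < \<xi> / 4" unfolding E'_def mem_ball dist_norm .
      then show ?thesis by (rule that[OF nh])
    qed
    have "norm w \<le> norm (w - z) + norm z" using norm_triangle_ineq[of "w - z" z] by simp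
    moreover have "norm z \<le> norm (w - z) + norm w" using norm_triangle_ineq4[of w "w - z"] by simp
    ultimately show ?thesis using w r(2) \<xi> by (simp add: \<xi>_def h_def)
  qed
  have disj: "E \<inter> E' = {}"
  proof -
    have "z \<notin> E'" if "z \<in> E" for z
    proof
      assume "z \<in> E'"
      then have "norm ((1/2) *\<^sub>R h - z) < \<xi> / 4" "norm (- (1/2) *\<^sub>R h - z) < \<xi> / 4"
        using that by (simp_all add: E_def E'_def dist_norm)
      moreover have "norm h \<le> norm ((1/2) *\<^sub>R h - z) + norm (- (1/2) *\<^sub>R h - z)"
        using norm_triangle_ineq4[of "(1/2) *\<^sub>R h - z" "- (1/2) *\<^sub>R h - z"]
        by (simp add: scaleR_left_distrib[symmetric])
      ultimately show False using \<xi> unfolding \<xi>_def by linarith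
    qed
    then show ?thesis by blast
  qed
  have EI: "integrable lborel (\<lambda>z. indicator (ball c s) z * \<phi> z)" for c s
  proof (rule Bochner_Integration.integrable_bound)
    show "integrable lborel (\<lambda>z. 4 * M * indicator (ball c s) z :: real)"
      by (intro integrable_mult_right integrable_real_indicator) (auto simp: emeasure_lborel_ball_finite[simplified])
    show "AE z in lborel. norm (indicator (ball c s) z * \<phi> z) \<le> norm (4 * M * indicator (ball c s) z :: real)"
      using \<phi>b' by (intro AE_I2) (auto simp: indicator_def)
  qed measurable
  have shift: "(LINT z|lborel. indicator E' z * \<phi> z) = (LINT z|lborel. indicator E z * \<phi> (h + z))"
  proof -
    have "(LINT z|lborel. indicator E' (h + z) * \<phi> (h + z)) = (LINT z|lborel. indicator E' z * \<phi> z)"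
      by (rule integral_translate(1)[of "\<lambda>z. indicator E' z * \<phi> z"]) (auto simp: E'_def)
    moreover have "indicator E' (h + z) = (indicator E z :: real)" for z
    proof -
      have "(1/2) *\<^sub>R h - (h + z) = - (1/2) *\<^sub>R h - z"
        by (simp add: algebra_simps) (simp add: scaleR_left_distrib[symmetric])
      then show ?thesis unfolding E_def E'_def indicator_def mem_ball dist_norm by (simp only:)
    qed
    ultimately show ?thesis by simp
  qed
  \<comment> \<open>Because \<open>y + h = x\<close>, the middle terms cancel, and there remains one
    increment over a distance of \<open>2 * \<xi>\<close>.\<close>
  have pair: "W \<xi> - q \<le> \<phi> z + \<phi> (h + z)" for z
  proof -
    have "\<phi> z + \<phi> (h + z) = 2 * W \<xi> - (f (x + h + z) - f (y + z))"
      using touch by (simp add: \<phi>_def h_def \<xi>_def algebra_simps)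
    moreover have "f (x + h + z) - f (y + z) \<le> W (2 * \<xi>)"
    proof -
      have "(x + h + z) - (y + z) = 2 *\<^sub>R h" by (simp add: h_def scaleR_2)
      then have "norm ((x + h + z) - (y + z)) = 2 * \<xi>" by (simp add: \<xi>_def)
      then show ?thesis using mod[of "x + h + z" "y + z"] by simp
    qed
    ultimately show ?thesis using W2 by (simp add: \<xi>_def h_def)
  qed
  have "\<kappa> * (unit_ball_vol (real DIM('a)) * (\<xi> / 4) ^ DIM('a)) * (W \<xi> - q) = \<kappa> * (LINT z|lborel. indicator E z * (W \<xi> - q))"
    using \<xi> by (simp add: E_def content_ball)
  also have "\<dots> \<le> \<kappa> * (LINT z|lborel. indicator E z * (\<phi> z + \<phi> (h + z)))"
  proof (rule mult_left_mono[OF _ \<kappa>], rule integral_mono)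
    show "integrable lborel (\<lambda>z. indicator E z * (W \<xi> - q))" unfolding E_def
      by (intro integrable_mult_left integrable_real_indicator) (auto simp: emeasure_lborel_ball_finite[simplified])
    have "integrable lborel (\<lambda>z. indicator E z * \<phi> (h + z))"
    proof (rule Bochner_Integration.integrable_bound)
      show "integrable lborel (\<lambda>z. 4 * M * indicator E z :: real)" unfolding E_def
        by (intro integrable_mult_right integrable_real_indicator) (auto simp: emeasure_lborel_ball_finite[simplified])
      show "AE z in lborel. norm (indicator E z * \<phi> (h + z)) \<le> norm (4 * M * indicator E z :: real)"
        using \<phi>b' by (intro AE_I2) (auto simp: indicator_def)
      show "(\<lambda>z. indicator E z * \<phi> (h + z)) \<in> borel_measurable lborel" unfolding E_def by measurable
    qed
    then show "integrable lborel (\<lambda>z. indicator E z * (\<phi> z + \<phi> (h + z)))"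
      unfolding distrib_left using EI by (auto simp: E_def)
    show "indicator E z * (W \<xi> - q) \<le> indicator E z * (\<phi> z + \<phi> (h + z))" for z
      using pair[of z] by (intro mult_left_mono) auto
  qed
  also have "(LINT z|lborel. indicator E z * (\<phi> z + \<phi> (h + z))) = (LINT z|lborel. indicator E z * \<phi> z) + (LINT z|lborel. indicator E' z * \<phi> z)"
  proof -
    have "integrable lborel (\<lambda>z. indicator E' z * \<phi> z)" using EI by (simp add: E'_def)
    then have "integrable lborel (\<lambda>z. indicator E' (h + z) * \<phi> (h + z))"
      by (subst integral_translate(3)[of "\<lambda>z. indicator E' z * \<phi> z"]) (auto simp: E'_def)
    moreover have "indicator E' (h + z) = (indicator E z :: real)" for z
    proof -
      have "(1/2) *\<^sub>R h - (h + z) = - (1/2) *\<^sub>R h - z"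
        by (simp add: algebra_simps) (simp add: scaleR_left_distrib[symmetric])
      then show ?thesis unfolding E_def E'_def indicator_def mem_ball dist_norm by (simp only:)
    qed
    ultimately have "integrable lborel (\<lambda>z. indicator E z * \<phi> (h + z))" by simp
    then show ?thesis unfolding shift distrib_left using EI by (simp add: E_def)
  qed
  also have "\<kappa> * ((LINT z|lborel. indicator E z * \<phi> z) + (LINT z|lborel. indicator E' z * \<phi> z)) = (LINT z|lborel. \<kappa> * (indicator E z * \<phi> z + indicator E' z * \<phi> z))"
    using EI by (simp add: E_def E'_def)
  also have "\<dots> = (LINT z|lebesgue. \<kappa> * (indicator E z * \<phi> z + indicator E' z * \<phi> z))"
    by (rule lebesgue_integral_borel[symmetric]) (simp add: E_def E'_def)
  also have "\<dots> \<le> (LINT z|lebesgue. indicator {z. r < norm z} z *\<^sub>R (\<phi> z * K z))"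
  proof (rule integral_mono)
    have "integrable lborel (\<lambda>z. \<kappa> * (indicator E z * \<phi> z + indicator E' z * \<phi> z))" using EI by (simp add: E_def E'_def)
    then show "integrable lebesgue (\<lambda>z. \<kappa> * (indicator E z * \<phi> z + indicator E' z * \<phi> z))"
      by (subst integrable_completion) auto
    show "integrable lebesgue (\<lambda>z. indicator {z. r < norm z} z *\<^sub>R (\<phi> z * K z))" using I by (simp add: \<phi>_def)
    fix z
    show "\<kappa> * (indicator E z * \<phi> z + indicator E' z * \<phi> z) \<le> indicator {z. r < norm z} z *\<^sub>R (\<phi> z * K z)"
    proof (cases "z \<in> E \<union> E'")
      case True
      have a: "r < norm z" "norm z \<le> \<xi>" using annE[OF True] by auto
      then have z: "z \<noteq> 0" using r by auto
      have "\<kappa> \<le> K z" using Kl[OF z] a by (simp add: \<xi>_def h_def)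
      then have "\<kappa> * \<phi> z \<le> \<phi> z * K z" using \<phi>0[of z] by (simp add: mult.commute[of "\<phi> z"] mult_right_mono)
      moreover have "indicator E z * \<phi> z + indicator E' z * \<phi> z = \<phi> z" using True disj by (auto simp: indicator_def)
      ultimately show ?thesis using a by simp
    next
      case False
      have "0 \<le> K z" if "r < norm z"
      proof -
        have "z \<noteq> 0" using that r by auto
        then show ?thesis using K by (auto simp: diffusion_kernel_def)
      qed
      then have "0 \<le> indicator {z. r < norm z} z *\<^sub>R (\<phi> z * K z)" using \<phi>0[of z] r by (auto simp: indicator_def)
      then show ?thesis using False by simp
    qed
  qed
  finally show ?thesis by (simp add: set_lebesgue_integral_def \<phi>_def \<xi>_def h_def)
qed

text \<open>Cancellation inserts the constant \<open>f x - f y\<close>, so the kernel acts on the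
  same nonnegative function that enters the dissipation. The pointwise comparison of
  \<open>k\<close> with \<open>K\<close> then bounds the near drift by the dissipation, with no
  separate estimate of the modulus.\<close>

lemma velocity_near_bound:
  fixes f :: "'a::euclidean_space \<Rightarrow> real"
  assumes k: "hormander_kernel B k" and c: "cancelling k" and fm: "f \<in> borel_measurable borel"
    and f2: "integrable lborel (\<lambda>z. (f z)\<^sup>2)" and K: "diffusion_kernel Q \<mu> K"
    and \<phi>0: "\<And>z. 0 \<le> (f x - f y) - (f (x + z) - f (y + z))"
    and kK: "\<And>z. z \<noteq> 0 \<Longrightarrow> norm z \<le> \<rho> \<Longrightarrow> \<bar>k z\<bar> \<le> \<kappa> * K z" and \<kappa>: "\<kappa> \<ge> 0" and r: "0 < r" "r < \<rho>"
    and I: "integrable lebesgue (\<lambda>z. indicator {z. r < norm z} z *\<^sub>R (((f x - f y) - (f (x + z) - f (y + z))) * K z))"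
  shows "\<bar>(conv (truncate k r) f x - conv (truncate k \<rho>) f x) - (conv (truncate k r) f y - conv (truncate k \<rho>) f y)\<bar>
     \<le> \<kappa> * (LINT z:{z. r < norm z}|lebesgue. ((f x - f y) - (f (x + z) - f (y + z))) * K z)"
proof -
  have km[measurable]: "k \<in> borel_measurable borel" and B: "B \<ge> 0" using k by (auto simp: hormander_kernel_def)
  have [measurable]: "f \<in> borel_measurable borel" by (rule fm)
  define \<phi> where "\<phi> z = (f x - f y) - (f (x + z) - f (y + z))" for z
  have \<phi>m[measurable]: "\<phi> \<in> borel_measurable borel" unfolding \<phi>_def by measurable
  have \<rho>: "\<rho> > 0" using r by simp
  note td = truncate_difference[OF k c r]
  have i: "integrable lborel (\<lambda>z. truncate k s z * f (v + z))" if "s > 0" for s v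
    by (rule integrable_L2_prod(1)[OF _ _ truncate_L2[OF k that] f2]) auto
  have eq1: "(\<lambda>z. (truncate k r z - truncate k \<rho> z) * \<phi> z) = (\<lambda>z. (truncate k r z - truncate k \<rho> z) * (f x - f y) - ((truncate k r z * f (x + z) - truncate k \<rho> z * f (x + z)) - (truncate k r z * f (y + z) - truncate k \<rho> z * f (y + z))))"
    by (auto simp: \<phi>_def algebra_simps)
  have I1: "integrable lborel (\<lambda>z. (truncate k r z - truncate k \<rho> z) * \<phi> z)"
    unfolding eq1
    by (rule Bochner_Integration.integrable_diff[OF integrable_mult_left[OF td(1)]
          Bochner_Integration.integrable_diff[OF Bochner_Integration.integrable_diff[OF i[OF r(1)] i[OF \<rho>]]
            Bochner_Integration.integrable_diff[OF i[OF r(1)] i[OF \<rho>]]]])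
  have "(LINT z|lborel. (truncate k r z - truncate k \<rho> z) * \<phi> z) = - ((conv (truncate k r) f x - conv (truncate k \<rho>) f x) - (conv (truncate k r) f y - conv (truncate k \<rho>) f y))"
    unfolding eq1 conv_def using i[OF r(1)] i[OF \<rho>] td(1,2) by simp
  then have "\<bar>(conv (truncate k r) f x - conv (truncate k \<rho>) f x) - (conv (truncate k r) f y - conv (truncate k \<rho>) f y)\<bar> = norm (LINT z|lborel. (truncate k r z - truncate k \<rho> z) * \<phi> z)"
    by simp
  also have "(LINT z|lborel. (truncate k r z - truncate k \<rho> z) * \<phi> z) = (LINT z|lebesgue. (truncate k r z - truncate k \<rho> z) * \<phi> z)"
    by (rule lebesgue_integral_borel[symmetric]) measurable
  also have "norm \<dots> \<le> (LINT z|lebesgue. \<kappa> * (indicator {z. r < norm z} z *\<^sub>R (\<phi> z * K z)))"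
  proof (rule Bochner_Integration.integral_norm_bound_integral)
    show "integrable lebesgue (\<lambda>z. (truncate k r z - truncate k \<rho> z) * \<phi> z)"
      using I1 by (subst integrable_completion) auto
    show "integrable lebesgue (\<lambda>z. \<kappa> * (indicator {z. r < norm z} z *\<^sub>R (\<phi> z * K z)))"
      using I by (intro integrable_mult_right) (simp add: \<phi>_def)
    fix z
    have p0: "\<phi> z \<ge> 0" using \<phi>0[of z] by (simp add: \<phi>_def)
    show "norm ((truncate k r z - truncate k \<rho> z) * \<phi> z) \<le> \<kappa> * (indicator {z. r < norm z} z *\<^sub>R (\<phi> z * K z))"
    proof (cases "r < norm z \<and> norm z \<le> \<rho>")
      case True
      then have z: "z \<noteq> 0" using r by auto
      have "\<bar>k z\<bar> * \<phi> z \<le> \<kappa> * K z * \<phi> z" using kK[OF z] True p0 by (intro mult_right_mono) auto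
      then show ?thesis using True p0 by (simp add: td(3) abs_mult mult_ac)
    next
      case False
      have "0 \<le> K z" if "r < norm z"
      proof -
        have "z \<noteq> 0" using that r by auto
        then show ?thesis using K by (auto simp: diffusion_kernel_def)
      qed
      then have "0 \<le> \<kappa> * (indicator {z. r < norm z} z *\<^sub>R (\<phi> z * K z))" using p0 r \<kappa> by (auto simp: indicator_def)
      then show ?thesis using False by (auto simp: td(3))
    qed
  qed
  also have "\<dots> = \<kappa> * (LINT z|lebesgue. indicator {z. r < norm z} z *\<^sub>R (\<phi> z * K z))" by (rule integral_mult_right_zero)
  finally show ?thesis by (simp add: set_lebesgue_integral_def \<phi>_def)
qed

section \<open>The operators at a touching point\<close>

lemma pv_integral_eqI:
  assumes "((\<lambda>r. LINT y:{y. r < norm y}|lebesgue. f y) \<longlongrightarrow> l) (at_right 0)"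
  shows "pv_integral f = l"
  unfolding pv_integral_def by (rule tendsto_Lim[OF _ assms]) simp

text \<open>\<open>diffusion_op\<close> is defined through \<open>Lim\<close>, so both limits must
  be known to exist before the difference of the values is the limit of the truncated
  differences.\<close>

lemma diffusion_difference:
  fixes f :: "real^'d::finite \<Rightarrow> real"
  assumes K: "diffusion_kernel Q \<mu> K" and fm: "f \<in> borel_measurable borel" and fb: "\<And>w. \<bar>f w\<bar> \<le> M"
    and sx: "\<And>z. norm z \<le> 1 \<Longrightarrow> \<bar>f (x + z) + f (x - z) - 2 * f x\<bar> \<le> L * (norm z)\<^sup>2"
    and sy: "\<And>z. norm z \<le> 1 \<Longrightarrow> \<bar>f (y + z) + f (y - z) - 2 * f y\<bar> \<le> L * (norm z)\<^sup>2"
  shows "((\<lambda>r. LINT z:{z. r < norm z}|lebesgue. ((f x - f y) - (f (x + z) - f (y + z))) * K z) \<longlongrightarrow> diffusion_op K f x - diffusion_op K f y) (at_right 0)"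
    and "r > 0 \<Longrightarrow> integrable lebesgue (\<lambda>z. indicator {z. r < norm z} z *\<^sub>R (((f x - f y) - (f (x + z) - f (y + z))) * K z))"
proof -
  have px: "integrable lebesgue (\<lambda>z. indicator {z. r < norm z} z *\<^sub>R ((f x - f (x + z)) * K z))" if "r > 0" for r
    by (rule diffusion_pv(2)[OF K fm fb sx]) (use that in auto)
  have py: "integrable lebesgue (\<lambda>z. indicator {z. r < norm z} z *\<^sub>R ((f y - f (y + z)) * K z))" if "r > 0" for r
    by (rule diffusion_pv(2)[OF K fm fb sy]) (use that in auto)
  obtain lx where lx: "((\<lambda>r. LINT z:{z. r < norm z}|lebesgue. (f x - f (x + z)) * K z) \<longlongrightarrow> lx) (at_right 0)" using diffusion_pv(1)[OF K fm fb sx] by blast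
  obtain ly where ly: "((\<lambda>r. LINT z:{z. r < norm z}|lebesgue. (f y - f (y + z)) * K z) \<longlongrightarrow> ly) (at_right 0)" using diffusion_pv(1)[OF K fm fb sy] by blast
  have D: "diffusion_op K f x - diffusion_op K f y = lx - ly"
    unfolding diffusion_op_def using pv_integral_eqI[OF lx] pv_integral_eqI[OF ly] by simp
  have e: "indicator {z. r < norm z} z *\<^sub>R (((f x - f y) - (f (x + z) - f (y + z))) * K z) = indicator {z. r < norm z} z *\<^sub>R ((f x - f (x + z)) * K z) - indicator {z. r < norm z} z *\<^sub>R ((f y - f (y + z)) * K z)" for r z
    by (simp add: algebra_simps)
  show "integrable lebesgue (\<lambda>z. indicator {z. r < norm z} z *\<^sub>R (((f x - f y) - (f (x + z) - f (y + z))) * K z))" if "r > 0" for r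
    unfolding e by (rule Bochner_Integration.integrable_diff[OF px[OF that] py[OF that]])
  have eq: "(LINT z:{z. r < norm z}|lebesgue. (f x - f (x + z)) * K z) - (LINT z:{z. r < norm z}|lebesgue. (f y - f (y + z)) * K z) = (LINT z:{z. r < norm z}|lebesgue. ((f x - f y) - (f (x + z) - f (y + z))) * K z)" if "r > 0" for r
    unfolding set_lebesgue_integral_def e by (rule Bochner_Integration.integral_diff[OF px[OF that] py[OF that], symmetric])
  have "((\<lambda>r. (LINT z:{z. r < norm z}|lebesgue. (f x - f (x + z)) * K z) - (LINT z:{z. r < norm z}|lebesgue. (f y - f (y + z)) * K z)) \<longlongrightarrow> lx - ly) (at_right 0)"
    by (rule tendsto_diff[OF lx ly])
  moreover have "\<forall>\<^sub>F r in at_right (0::real). (LINT z:{z. r < norm z}|lebesgue. (f x - f (x + z)) * K z) - (LINT z:{z. r < norm z}|lebesgue. (f y - f (y + z)) * K z) = (LINT z:{z. r < norm z}|lebesgue. ((f x - f y) - (f (x + z) - f (y + z))) * K z)"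
    by (rule eventually_at_rightI[of 0 1]) (auto intro: eq)
  ultimately show "((\<lambda>r. LINT z:{z. r < norm z}|lebesgue. ((f x - f y) - (f (x + z) - f (y + z))) * K z) \<longlongrightarrow> diffusion_op K f x - diffusion_op K f y) (at_right 0)"
    unfolding D by (rule Lim_transform_eventually)
qed

lemma borel_measurable_off_zero:
  fixes S :: "'a::euclidean_space \<Rightarrow> 'b::euclidean_space"
  assumes "continuous_on (- {0}) S"
  shows "S \<in> borel_measurable borel"
proof -
  have "(\<lambda>x. indicator (- {0}) x *\<^sub>R S x) \<in> borel_measurable borel"
    by (rule borel_measurable_continuous_on_indicator[OF _ assms]) simp
  moreover have "(\<lambda>x::'a. indicator {0} x *\<^sub>R S 0) \<in> borel_measurable borel"
    by (intro borel_measurable_scaleR borel_measurable_indicator borel_measurable_const) auto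
  ultimately have "(\<lambda>x. indicator (- {0}) x *\<^sub>R S x + indicator {0} x *\<^sub>R S 0) \<in> borel_measurable borel" by (rule borel_measurable_add)
  moreover have "(\<lambda>x. indicator (- {0}) x *\<^sub>R S x + indicator {0} x *\<^sub>R S 0) = S" by (auto simp: indicator_def)
  ultimately show ?thesis by simp
qed

lemma velocity_pv_vector:
  fixes f :: "real^'d::finite \<Rightarrow> real" and S :: "real^'d \<Rightarrow> real^'d"
  assumes S: "continuous_on (- {0}) S" and k: "\<And>i. hormander_kernel B (\<lambda>x. S x $ i)" and c: "\<And>i. cancelling (\<lambda>x. S x $ i)"
    and fm: "f \<in> borel_measurable borel" and f2: "integrable lborel (\<lambda>z. (f z)\<^sup>2)"
    and lip: "\<And>z. norm z \<le> 1 \<Longrightarrow> \<bar>f (x + z) - f x\<bar> \<le> L * norm z"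
  shows "((\<lambda>r. conv (truncate (\<lambda>x. S x $ i) r) f x) \<longlongrightarrow> pv_integral (\<lambda>y. f (x + y) *\<^sub>R S y) $ i) (at_right 0)"
proof -
  have Sm[measurable]: "S \<in> borel_measurable borel" by (rule borel_measurable_off_zero[OF S])
  have km[measurable]: "(\<lambda>x. S x $ i) \<in> borel_measurable borel" for i using k by (auto simp: hormander_kernel_def)
  have [measurable]: "f \<in> borel_measurable borel" by (rule fm)
  have [measurable]: "{z::real^'d. r < norm z} \<in> sets borel" for r by (rule norm_gt_sets)
  have "\<exists>l. ((\<lambda>r. conv (truncate (\<lambda>x. S x $ i) r) f x) \<longlongrightarrow> l) (at_right 0)" for i
    using velocity_pv[OF k c fm f2 lip] unfolding set_integral_truncate[OF km fm] .
  then obtain l where l: "\<And>i. ((\<lambda>r. conv (truncate (\<lambda>x. S x $ i) r) f x) \<longlongrightarrow> l i) (at_right 0)" by metis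
  have comp: "(LINT y:{y. r < norm y}|lebesgue. f (x + y) *\<^sub>R S y) $ i = conv (truncate (\<lambda>x. S x $ i) r) f x" if r: "r > 0" for r i
  proof -
    have i: "integrable lborel (\<lambda>z. truncate (\<lambda>x. S x $ i) r z * f (x + z))" for i
      by (rule integrable_L2_prod(1)[OF _ _ truncate_L2[OF k r] f2]) auto
    have "integrable lborel (\<lambda>y. indicator {y. r < norm y} y *\<^sub>R (f (x + y) *\<^sub>R S y))"
    proof (rule Bochner_Integration.integrable_bound)
      show "integrable lborel (\<lambda>z. \<Sum>i\<in>UNIV. \<bar>truncate (\<lambda>x. S x $ i) r z * f (x + z)\<bar>)"
        using i by (intro Bochner_Integration.integrable_sum) auto
      show "AE y in lborel. norm (indicator {y. r < norm y} y *\<^sub>R (f (x + y) *\<^sub>R S y)) \<le> norm (\<Sum>i\<in>UNIV. \<bar>truncate (\<lambda>x. S x $ i) r y * f (x + y)\<bar>)"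
      proof (rule AE_I2)
        fix y
        have "norm (indicator {y. r < norm y} y *\<^sub>R (f (x + y) *\<^sub>R S y)) \<le> (\<Sum>i\<in>UNIV. \<bar>(indicator {y. r < norm y} y *\<^sub>R (f (x + y) *\<^sub>R S y)) $ i\<bar>)"
          by (rule norm_le_l1_cart)
        also have "\<dots> = (\<Sum>i\<in>UNIV. \<bar>truncate (\<lambda>x. S x $ i) r y * f (x + y)\<bar>)"
          by (intro sum.cong) (auto simp: truncate_def mult_ac)
        finally show "norm (indicator {y. r < norm y} y *\<^sub>R (f (x + y) *\<^sub>R S y)) \<le> norm (\<Sum>i\<in>UNIV. \<bar>truncate (\<lambda>x. S x $ i) r y * f (x + y)\<bar>)"
          by (simp add: sum_nonneg)
      qed
    qed measurable
    then have vi: "integrable lebesgue (\<lambda>y. indicator {y. r < norm y} y *\<^sub>R (f (x + y) *\<^sub>R S y))"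
      by (subst integrable_completion) auto
    have "(LINT y:{y. r < norm y}|lebesgue. f (x + y) *\<^sub>R S y) $ i = (LINT y|lebesgue. (indicator {y. r < norm y} y *\<^sub>R (f (x + y) *\<^sub>R S y)) $ i)"
      unfolding set_lebesgue_integral_def by (rule integral_bounded_linear[OF bounded_linear_vec_nth vi, symmetric])
    also have "\<dots> = (LINT y:{y. r < norm y}|lebesgue. f (x + y) * S y $ i)"
      unfolding set_lebesgue_integral_def by (simp add: mult.assoc)
    also have "\<dots> = conv (truncate (\<lambda>x. S x $ i) r) f x"
      by (rule set_integral_truncate[OF km fm])
    finally show ?thesis .
  qed
  have "((\<lambda>r. LINT y:{y. r < norm y}|lebesgue. f (x + y) *\<^sub>R S y) \<longlongrightarrow> (\<chi> i. l i)) (at_right 0)"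
  proof (rule vec_tendstoI)
    fix i
    have "\<forall>\<^sub>F r in at_right (0::real). conv (truncate (\<lambda>x. S x $ i) r) f x = (LINT y:{y. r < norm y}|lebesgue. f (x + y) *\<^sub>R S y) $ i"
      by (rule eventually_at_rightI[of 0 1]) (auto simp: comp)
    then show "((\<lambda>r. (LINT y:{y. r < norm y}|lebesgue. f (x + y) *\<^sub>R S y) $ i) \<longlongrightarrow> (\<chi> i. l i) $ i) (at_right 0)"
      using Lim_transform_eventually[OF l[of i]] by simp
  qed
  then have "pv_integral (\<lambda>y. f (x + y) *\<^sub>R S y) = (\<chi> i. l i)" by (rule pv_integral_eqI)
  then show ?thesis using l[of i] by simp
qed

text \<open>All estimates are made for truncated integrals, and then the truncation is removed. Of
  the velocity difference, the part within \<open>norm (x - y)\<close> is charged to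
  \<open>D\<close>, the rest to the dyadic sum, and the local term with coefficient \<open>a\<close>
  contributes a multiple of \<open>W (norm (x - y))\<close>.\<close>

lemma touching_estimates:
  fixes f :: "real^'d::finite \<Rightarrow> real" and \<Psi> :: "real^'d \<Rightarrow> real^'d"
  assumes S: "continuous_on (- {0}) (velocity_kernel \<Psi>)"
    and k: "\<And>i. hormander_kernel B (\<lambda>x. velocity_kernel \<Psi> x $ i)" and c: "\<And>i. cancelling (\<lambda>x. velocity_kernel \<Psi> x $ i)"
    and K: "diffusion_kernel Q \<mu> K" and f: "mod_class W M N f" and W: "mono_on {0..} W" "0 \<le> W 0"
    and xy: "x \<noteq> y" and touch: "f x - f y = W (norm (x - y))"
    and sm: "summable (\<lambda>j. W (2 ^ j * norm (x - y)) / 2 ^ j)"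
    and W2: "W (2 * norm (x - y)) \<le> W (norm (x - y)) + p * norm (x - y)"
    and lip: "\<And>w z. w \<in> {x, y} \<Longrightarrow> norm z \<le> 1 \<Longrightarrow> \<bar>f (w + z) - f w\<bar> \<le> L * norm z"
    and sd: "\<And>w z. w \<in> {x, y} \<Longrightarrow> norm z \<le> 1 \<Longrightarrow> \<bar>f (w + z) + f (w - z) - 2 * f w\<bar> \<le> L * (norm z)\<^sup>2"
    and Kl: "\<And>z. z \<noteq> 0 \<Longrightarrow> norm z \<le> norm (x - y) \<Longrightarrow> \<kappa>0 \<le> K z" and \<kappa>0: "\<kappa>0 \<ge> 0"
    and kK: "\<And>i z. z \<noteq> 0 \<Longrightarrow> norm z \<le> norm (x - y) \<Longrightarrow> \<bar>velocity_kernel \<Psi> z $ i\<bar> \<le> \<kappa> * K z" and \<kappa>: "\<kappa> \<ge> 0"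
  defines "D \<equiv> diffusion_op K f x - diffusion_op K f y"
  shows "\<kappa>0 * (unit_ball_vol (real CARD('d)) * (norm (x - y) / 4) ^ CARD('d)) * (W (norm (x - y)) - p * norm (x - y)) \<le> D"
    and "\<bar>(velocity_op a \<Psi> f x - velocity_op a \<Psi> f y) \<bullet> g\<bar> \<le> norm g * ((\<Sum>i\<in>UNIV. \<bar>a $ i\<bar>) * W (norm (x - y))
        + real CARD('d) * (\<kappa> * D + far_const TYPE(real^'d) B * (\<Sum>j. W (2 ^ j * norm (x - y)) / 2 ^ j)))"
proof -
  define \<xi> where "\<xi> = norm (x - y)"
  have \<xi>: "\<xi> > 0" using xy by (simp add: \<xi>_def)
  have fm: "f \<in> borel_measurable borel" and fb: "\<And>w. \<bar>f w\<bar> \<le> M" and mod: "\<And>w w'. \<bar>f w - f w'\<bar> \<le> W (norm (w - w'))"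
    using f by (auto simp: mod_class_def)
  have f2: "integrable lborel (\<lambda>z. (f z)\<^sup>2)" by (rule mod_class_L2[OF f])
  define Dr where "Dr r = (LINT z:{z. r < norm z}|lebesgue. ((f x - f y) - (f (x + z) - f (y + z))) * K z)" for r
  have Dlim: "(Dr \<longlongrightarrow> D) (at_right 0)" and DI: "\<And>r. r > 0 \<Longrightarrow> integrable lebesgue (\<lambda>z. indicator {z. r < norm z} z *\<^sub>R (((f x - f y) - (f (x + z) - f (y + z))) * K z))"
    unfolding Dr_def D_def
    using diffusion_difference[OF K fm fb, of x L y] sd by auto
  show "\<kappa>0 * (unit_ball_vol (real CARD('d)) * (norm (x - y) / 4) ^ CARD('d)) * (W (norm (x - y)) - p * norm (x - y)) \<le> D"
  proof (rule tendsto_lowerbound[OF Dlim])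
    show "\<forall>\<^sub>F r in at_right 0. \<kappa>0 * (unit_ball_vol (real CARD('d)) * (norm (x - y) / 4) ^ CARD('d)) * (W (norm (x - y)) - p * norm (x - y)) \<le> Dr r"
    proof (rule eventually_at_rightI[of 0 "\<xi> / 4"])
      fix r assume "r \<in> {0<..<\<xi> / 4}"
      then have r: "0 < r" "r < norm (x - y) / 4" by (auto simp: \<xi>_def)
      show "\<kappa>0 * (unit_ball_vol (real CARD('d)) * (norm (x - y) / 4) ^ CARD('d)) * (W (norm (x - y)) - p * norm (x - y)) \<le> Dr r"
        using diffusion_lower_bound[OF K fm fb mod xy touch W2 Kl \<kappa>0 r DI[OF r(1)]] by (simp add: Dr_def)
    qed (use \<xi> in simp)
  qed simp
  have comp: "\<bar>(velocity_op a \<Psi> f x - velocity_op a \<Psi> f y) $ i\<bar> \<le> \<bar>a $ i\<bar> * W \<xi> + (\<kappa> * D + far_const TYPE(real^'d) B * (\<Sum>j. W (2 ^ j * \<xi>) / 2 ^ j))" for i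
  proof -
    let ?k = "\<lambda>x. velocity_kernel \<Psi> x $ i"
    let ?lx = "pv_integral (\<lambda>z. f (x + z) *\<^sub>R velocity_kernel \<Psi> z) $ i" and ?ly = "pv_integral (\<lambda>z. f (y + z) *\<^sub>R velocity_kernel \<Psi> z) $ i"
    have lx: "((\<lambda>r. conv (truncate ?k r) f x) \<longlongrightarrow> ?lx) (at_right 0)"
      by (rule velocity_pv_vector[OF S k c fm f2 lip]) auto
    have ly: "((\<lambda>r. conv (truncate ?k r) f y) \<longlongrightarrow> ?ly) (at_right 0)"
      by (rule velocity_pv_vector[OF S k c fm f2 lip]) auto
    have far: "\<bar>conv (truncate ?k \<xi>) f x - conv (truncate ?k \<xi>) f y\<bar> \<le> far_const TYPE(real^'d) B * (\<Sum>j. W (2 ^ j * \<xi>) / 2 ^ j)"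
      by (rule truncate_conv_far[OF k \<xi> _ f W]) (use sm in \<open>auto simp: \<xi>_def\<close>)
    have "\<bar>?lx - ?ly\<bar> \<le> \<kappa> * D + far_const TYPE(real^'d) B * (\<Sum>j. W (2 ^ j * \<xi>) / 2 ^ j)"
    proof (rule tendsto_le[OF _ tendsto_add[OF tendsto_mult[OF tendsto_const Dlim] tendsto_const] tendsto_rabs[OF tendsto_diff[OF lx ly]]])
      show "\<forall>\<^sub>F r in at_right 0. \<bar>conv (truncate ?k r) f x - conv (truncate ?k r) f y\<bar> \<le> \<kappa> * Dr r + far_const TYPE(real^'d) B * (\<Sum>j. W (2 ^ j * \<xi>) / 2 ^ j)"
      proof (rule eventually_at_rightI[of 0 \<xi>])
        fix r assume "r \<in> {0<..<\<xi>}"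
        then have r: "0 < r" "r < \<xi>" by auto
        have ph: "0 \<le> (f x - f y) - (f (x + z) - f (y + z))" for z
          using mod[of "x + z" "y + z"] touch by simp
        have "\<bar>(conv (truncate ?k r) f x - conv (truncate ?k \<xi>) f x) - (conv (truncate ?k r) f y - conv (truncate ?k \<xi>) f y)\<bar> \<le> \<kappa> * Dr r"
          unfolding Dr_def by (rule velocity_near_bound[OF k c fm f2 K ph _ \<kappa> r DI[OF r(1)]]) (auto simp: \<xi>_def intro: kK)
        then show "\<bar>conv (truncate ?k r) f x - conv (truncate ?k r) f y\<bar> \<le> \<kappa> * Dr r + far_const TYPE(real^'d) B * (\<Sum>j. W (2 ^ j * \<xi>) / 2 ^ j)"
          using far by linarith
      qed (use \<xi> in simp)
    qed simp
    moreover have "(velocity_op a \<Psi> f x - velocity_op a \<Psi> f y) $ i = a $ i * W \<xi> + (?lx - ?ly)"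
    proof -
      have "(velocity_op a \<Psi> f x - velocity_op a \<Psi> f y) $ i = a $ i * (f x - f y) + (?lx - ?ly)"
        by (simp add: velocity_op_def algebra_simps)
      then show ?thesis using touch by (simp add: \<xi>_def)
    qed
    moreover have "\<bar>a $ i * W \<xi>\<bar> = \<bar>a $ i\<bar> * W \<xi>"
      using mono_onD[OF W(1), of 0 \<xi>] W(2) \<xi> by (simp add: abs_mult)
    ultimately show ?thesis using abs_triangle_ineq[of "a $ i * W \<xi>" "?lx - ?ly"] by linarith
  qed
  have "\<bar>(velocity_op a \<Psi> f x - velocity_op a \<Psi> f y) \<bullet> g\<bar> \<le> (\<Sum>i\<in>UNIV. \<bar>(velocity_op a \<Psi> f x - velocity_op a \<Psi> f y) $ i\<bar> * norm g)"
    unfolding inner_vec_def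
    by (rule order_trans[OF sum_abs]) (auto intro!: sum_mono mult_left_mono component_le_norm_cart simp: abs_mult simp del: vector_minus_component)
  also have "\<dots> \<le> (\<Sum>i\<in>UNIV. (\<bar>a $ i\<bar> * W \<xi> + (\<kappa> * D + far_const TYPE(real^'d) B * (\<Sum>j. W (2 ^ j * \<xi>) / 2 ^ j))) * norm g)"
    by (intro sum_mono mult_right_mono comp) auto
  also have "\<dots> = norm g * ((\<Sum>i\<in>UNIV. \<bar>a $ i\<bar>) * W \<xi> + real CARD('d) * (\<kappa> * D + far_const TYPE(real^'d) B * (\<Sum>j. W (2 ^ j * \<xi>) / 2 ^ j)))"
    by (subst sum_distrib_right[symmetric], subst sum.distrib, subst sum_distrib_right[symmetric]) (simp add: mult.commute)
  finally show "\<bar>(velocity_op a \<Psi> f x - velocity_op a \<Psi> f y) \<bullet> g\<bar> \<le> norm g * ((\<Sum>i\<in>UNIV. \<bar>a $ i\<bar>) * W (norm (x - y))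
        + real CARD('d) * (\<kappa> * D + far_const TYPE(real^'d) B * (\<Sum>j. W (2 ^ j * norm (x - y)) / 2 ^ j)))"
    by (simp add: \<xi>_def)
qed

subsection \<open>First and second order conditions at a touching point\<close>

lemma frechet_derivative_partial:
  fixes f :: "real^'d::finite \<Rightarrow> real"
  assumes "f differentiable at x"
  shows "frechet_derivative f (at x) h = (\<Sum>i\<in>UNIV. h $ i * partial i f x)"
proof -
  have lin: "linear (frechet_derivative f (at x))" by (rule linear_frechet_derivative[OF assms])
  have "h = (\<Sum>i\<in>UNIV. h $ i *\<^sub>R axis i 1)" by (simp add: vec_eq_iff axis_def if_distrib cong: if_cong)
  then have "frechet_derivative f (at x) h = (\<Sum>i\<in>UNIV. frechet_derivative f (at x) (h $ i *\<^sub>R axis i 1))"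
    using linear_sum[OF lin, of "\<lambda>i. h $ i *\<^sub>R axis i 1" UNIV] by simp
  then show ?thesis by (simp add: linear_cmul[OF lin] partial_def)
qed

lemma partial_bound_norm:
  fixes f :: "real^'d::finite \<Rightarrow> real"
  assumes "f differentiable at x" and b: "\<And>i. \<bar>partial i f x\<bar> \<le> b i"
  shows "\<bar>frechet_derivative f (at x) h\<bar> \<le> (\<Sum>i\<in>UNIV. b i) * norm h"
proof -
  have "\<bar>frechet_derivative f (at x) h\<bar> \<le> (\<Sum>i\<in>UNIV. \<bar>h $ i * partial i f x\<bar>)"
    unfolding frechet_derivative_partial[OF assms(1)] by (rule sum_abs)
  also have "\<dots> \<le> (\<Sum>i\<in>UNIV. norm h * b i)"
    unfolding abs_mult by (intro sum_mono mult_mono b component_le_norm_cart) auto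
  finally show ?thesis by (simp add: sum_distrib_left mult.commute)
qed

lemma C1_Lipschitz_ball:
  fixes f :: "real^'d::finite \<Rightarrow> real"
  assumes d: "\<And>w. f differentiable at w" and c: "\<And>i. continuous_on UNIV (partial i f)"
  shows "\<exists>L\<ge>0. \<forall>w\<in>cball x 1. \<forall>w'\<in>cball x 1. \<bar>f w - f w'\<bar> \<le> L * norm (w - w')"
proof -
  have "\<exists>b. \<forall>w\<in>cball x 1. \<bar>partial i f w\<bar> \<le> b" for i
  proof -
    have "compact (partial i f ` cball x 1)"
      by (rule compact_continuous_image[OF continuous_on_subset[OF c]]) auto
    then show ?thesis using compact_imp_bounded[of "partial i f ` cball x 1"] by (auto simp: bounded_iff)
  qed
  then obtain b where b: "\<And>i w. w \<in> cball x 1 \<Longrightarrow> \<bar>partial i f w\<bar> \<le> b i" by metis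
  have b0: "b i \<ge> 0" for i using order_trans[OF abs_ge_zero b[of x i]] by simp
  have "norm (f w - f w') \<le> (\<Sum>i\<in>UNIV. b i) * norm (w - w')" if "w \<in> cball x 1" "w' \<in> cball x 1" for w w'
  proof (rule differentiable_bound[OF _ _ _ that(1,2)])
    show "convex (cball x 1)" by simp
    fix v assume v: "v \<in> cball x 1"
    show "(f has_derivative frechet_derivative f (at v)) (at v within cball x 1)"
      by (rule has_derivative_at_withinI[OF frechet_derivative_works[THEN iffD1, OF d]])
    show "onorm (frechet_derivative f (at v)) \<le> (\<Sum>i\<in>UNIV. b i)"
    proof (rule onorm_le)
      show "norm (frechet_derivative f (at v) h) \<le> (\<Sum>i\<in>UNIV. b i) * norm h" for h
        unfolding real_norm_def by (rule partial_bound_norm[OF d b[OF v]])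
    qed
  qed
  moreover have "0 \<le> (\<Sum>i\<in>UNIV. b i)" using b0 by (intro sum_nonneg)
  ultimately show ?thesis unfolding real_norm_def by blast
qed

text \<open>The even function \<open>v \<mapsto> f (x + v) + f (x - v)\<close> has as derivative a
  difference of derivatives of \<open>f\<close> at two points \<open>2 * v\<close> apart, hence of
  order \<open>norm v\<close>; the mean value inequality supplies the second factor.\<close>

lemma C2_second_difference:
  fixes f :: "real^'d::finite \<Rightarrow> real"
  assumes d: "\<And>w. f differentiable at w" and d2: "\<And>i w. partial i f differentiable at w"
    and c: "\<And>i j. continuous_on UNIV (partial j (partial i f))"
  shows "\<exists>L\<ge>0. \<forall>z. norm z \<le> 1 \<longrightarrow> \<bar>f (x + z) + f (x - z) - 2 * f x\<bar> \<le> L * (norm z)\<^sup>2"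
proof -
  have "\<exists>L\<ge>0. \<forall>w\<in>cball x 1. \<forall>w'\<in>cball x 1. \<bar>partial i f w - partial i f w'\<bar> \<le> L * norm (w - w')" for i
    by (rule C1_Lipschitz_ball[OF d2 c])
  then obtain L where L: "\<And>i. L i \<ge> 0" "\<And>i w w'. w \<in> cball x 1 \<Longrightarrow> w' \<in> cball x 1 \<Longrightarrow> \<bar>partial i f w - partial i f w'\<bar> \<le> L i * norm (w - w')"
    by metis
  define S where "S = (\<Sum>i\<in>UNIV. L i)"
  have S0: "S \<ge> 0" unfolding S_def using L by (intro sum_nonneg) auto
  have main: "\<bar>f (x + z) + f (x - z) - 2 * f x\<bar> \<le> 2 * S * (norm z)\<^sup>2" if z: "norm z \<le> 1" for z
  proof -
    define g where "g v = f (x + v) + f (x - v)" for v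
    let ?g' = "\<lambda>v h. frechet_derivative f (at (x + v)) h - frechet_derivative f (at (x - v)) h"
    have fd: "(f has_derivative frechet_derivative f (at w)) (at w)" for w
      by (rule frechet_derivative_works[THEN iffD1, OF d])
    have gd: "(g has_derivative ?g' v) (at v)" for v
    proof -
      have "((\<lambda>v. f (x + v)) has_derivative (\<lambda>h. frechet_derivative f (at (x + v)) h)) (at v)"
        by (rule has_derivative_compose[where f="\<lambda>v. x + v" and g=f, OF _ fd]) (auto intro!: derivative_eq_intros)
      moreover have "((\<lambda>v. f (x - v)) has_derivative (\<lambda>h. frechet_derivative f (at (x - v)) (- h))) (at v)"
        by (rule has_derivative_compose[where f="\<lambda>v. x - v" and g=f, OF _ fd]) (auto intro!: derivative_eq_intros)
      ultimately have "(g has_derivative (\<lambda>h. frechet_derivative f (at (x + v)) h + frechet_derivative f (at (x - v)) (- h))) (at v)"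
        unfolding g_def by (rule has_derivative_add)
      moreover have "frechet_derivative f (at (x - v)) (- h) = - frechet_derivative f (at (x - v)) h" for h
        by (rule linear_neg[OF linear_frechet_derivative[OF d]])
      ultimately show ?thesis by simp
    qed
    have "norm (g z - g 0) \<le> (2 * S * norm z) * norm (z - 0)"
    proof (rule differentiable_bound[where f'="\<lambda>v. ?g' v" and S="cball 0 (norm z)"])
      fix v :: "real^'d" assume v: "v \<in> cball 0 (norm z)"
      show "(g has_derivative ?g' v) (at v within cball 0 (norm z))" by (rule has_derivative_at_withinI[OF gd])
      show "onorm (?g' v) \<le> 2 * S * norm z"
      proof (rule onorm_le)
        fix h
        have in1: "x + v \<in> cball x 1" "x - v \<in> cball x 1" using v z by (auto simp: dist_norm)
        have "?g' v h = (\<Sum>i\<in>UNIV. h $ i * (partial i f (x + v) - partial i f (x - v)))"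
          unfolding frechet_derivative_partial[OF d] by (simp add: sum_subtractf right_diff_distrib)
        then have "norm (?g' v h) \<le> (\<Sum>i\<in>UNIV. \<bar>h $ i\<bar> * \<bar>partial i f (x + v) - partial i f (x - v)\<bar>)"
          using sum_abs[of "\<lambda>i. h $ i * (partial i f (x + v) - partial i f (x - v))" UNIV] by (simp add: abs_mult)
        also have "\<dots> \<le> (\<Sum>i\<in>UNIV. norm h * (L i * (2 * norm z)))"
        proof (intro sum_mono mult_mono component_le_norm_cart)
          fix i
          have "\<bar>partial i f (x + v) - partial i f (x - v)\<bar> \<le> L i * norm ((x + v) - (x - v))" by (rule L(2)[OF in1])
          also have "(x + v) - (x - v) = 2 *\<^sub>R v" by (simp add: scaleR_2)
          also have "L i * norm (2 *\<^sub>R v) \<le> L i * (2 * norm z)" using v L(1) by (intro mult_left_mono) auto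
          finally show "\<bar>partial i f (x + v) - partial i f (x - v)\<bar> \<le> L i * (2 * norm z)" .
        qed auto
        also have "\<dots> = 2 * S * norm z * norm h"
          unfolding S_def sum_distrib_left[symmetric] sum_distrib_right[symmetric] by simp
        finally show "norm (?g' v h) \<le> 2 * S * norm z * norm h" .
      qed
    qed auto
    then show ?thesis by (simp add: g_def power2_eq_square mult.assoc)
  qed
  show ?thesis using main S0 by (intro exI[of _ "2 * S"]) auto
qed

lemma second_derivative_at_max:
  fixes g :: "real \<Rightarrow> real"
  assumes g: "\<And>h. (g has_real_derivative g' h) (at h)" and g': "(g' has_real_derivative c) (at 0)"
    and max: "\<And>h. g h \<le> g 0"
  shows "c \<le> 0"
proof (rule ccontr)
  assume "\<not> c \<le> 0"
  then have c: "c > 0" by simp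
  have g0: "g' 0 = 0"
    by (rule DERIV_local_max[OF g[of 0], of 1]) (use max in auto)
  obtain d where d: "d > 0" "\<And>h. 0 < h \<Longrightarrow> h < d \<Longrightarrow> g' 0 < g' (0 + h)"
    using DERIV_pos_inc_right[OF g' c] by auto
  obtain z where z: "0 < z" "z < d / 2" "g (d / 2) - g 0 = (d / 2 - 0) * g' z"
    using MVT2[of 0 "d / 2" g g'] g d(1) by auto
  have "g' z > 0" using d(2)[of z] z g0 d(1) by simp
  then have "g (d / 2) > g 0" using z(3) d(1) by (smt (verit) mult_pos_pos half_gt_zero)
  then show False using max[of "d / 2"] by simp
qed

lemma directional_has_real_derivative:
  fixes f :: "real^'d::finite \<Rightarrow> real"
  assumes "f differentiable at (x + h *\<^sub>R axis i 1)"
  shows "((\<lambda>h. f (x + h *\<^sub>R axis i 1)) has_real_derivative partial i f (x + h *\<^sub>R axis i 1)) (at h)"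
proof -
  let ?w = "x + h *\<^sub>R axis i 1"
  have fd: "(f has_derivative frechet_derivative f (at ?w)) (at ?w)"
    by (rule frechet_derivative_works[THEN iffD1, OF assms])
  have "((\<lambda>h. f (x + h *\<^sub>R axis i 1)) has_derivative (\<lambda>s. frechet_derivative f (at ?w) (s *\<^sub>R axis i 1))) (at h)"
    by (rule has_derivative_compose[where f="\<lambda>h. x + h *\<^sub>R axis i 1" and g=f, OF _ fd]) (auto intro!: derivative_eq_intros)
  moreover have "frechet_derivative f (at ?w) (s *\<^sub>R axis i 1) = partial i f ?w * s" for s
    using linear_cmul[OF linear_frechet_derivative[OF assms]] by (simp add: partial_def)
  ultimately show ?thesis by (simp add: has_field_derivative_def)
qed

text \<open>Both points are moved by the same vector. Then \<open>f (x + h) - f (y + h)\<close> is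
  maximal at \<open>h = 0\<close>, and its pure second derivatives there are nonpositive.\<close>

lemma laplacian_difference_nonpos:
  fixes f :: "real^'d::finite \<Rightarrow> real"
  assumes d: "\<And>w. f differentiable at w" and d2: "\<And>i w. partial i f differentiable at w"
    and max: "\<And>h. f (x + h) - f (y + h) \<le> f x - f y"
  shows "laplacian f x \<le> laplacian f y"
  unfolding laplacian_def
proof (rule sum_mono)
  fix i :: 'd
  let ?e = "axis i (1::real)"
  have "partial i (partial i f) x - partial i (partial i f) y \<le> 0"
  proof (rule second_derivative_at_max)
    show "((\<lambda>h. f (x + h *\<^sub>R ?e) - f (y + h *\<^sub>R ?e)) has_real_derivative partial i f (x + h *\<^sub>R ?e) - partial i f (y + h *\<^sub>R ?e)) (at h)" for h
      by (intro DERIV_diff directional_has_real_derivative d)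
    show "((\<lambda>h. partial i f (x + h *\<^sub>R ?e) - partial i f (y + h *\<^sub>R ?e)) has_real_derivative partial i (partial i f) x - partial i (partial i f) y) (at 0)"
      using DERIV_diff[OF directional_has_real_derivative[of "partial i f" x 0 i] directional_has_real_derivative[of "partial i f" y 0 i]] d2 by simp
    show "f (x + h *\<^sub>R ?e) - f (y + h *\<^sub>R ?e) \<le> f (x + 0 *\<^sub>R ?e) - f (y + 0 *\<^sub>R ?e)" for h
      using max by simp
  qed
  then show "partial i (partial i f) x \<le> partial i (partial i f) y" by simp
qed

text \<open>The modulus enters only through a supporting line of slope \<open>p\<close>: with
  \<open>y\<close> fixed, \<open>f w - p * norm (w - y)\<close> is maximal at \<open>x\<close>, and
  symmetrically at \<open>y\<close>. The norm is differentiable there because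
  \<open>x \<noteq> y\<close>.\<close>

lemma gradient_at_touching:
  fixes f :: "real^'d::finite \<Rightarrow> real"
  assumes d: "\<And>w. f differentiable at w" and xy: "x \<noteq> y"
    and max: "\<And>w w'. f w - f w' \<le> (f x - f y) + p * (norm (w - w') - norm (x - y))"
  shows "gradient f x = p *\<^sub>R sgn (x - y)" "gradient f y = p *\<^sub>R sgn (x - y)"
proof -
  have fd: "(f has_derivative frechet_derivative f (at w)) (at w)" for w
    by (rule frechet_derivative_works[THEN iffD1, OF d])
  have nd: "((\<lambda>w. norm (w - v)) has_derivative (\<lambda>h. sgn (u - v) \<bullet> h)) (at u)" if "u \<noteq> v" for u v :: "real^'d"
  proof -
    have "((\<lambda>w. norm w) has_derivative (\<lambda>h. sgn (u - v) \<bullet> h)) (at (u - v))"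
      using has_derivative_norm[of "u - v"] that by (simp add: inner_commute)
    then show ?thesis
      by (rule has_derivative_compose[where f="\<lambda>w. w - v" and g=norm, rotated]) (auto intro!: derivative_eq_intros)
  qed
  have "((\<lambda>w. f w - p * norm (w - y)) has_derivative (\<lambda>h. frechet_derivative f (at x) h - p * (sgn (x - y) \<bullet> h))) (at x)"
    by (intro has_derivative_diff fd has_derivative_mult_right nd xy)
  then have "(\<lambda>h. frechet_derivative f (at x) h - p * (sgn (x - y) \<bullet> h)) = (\<lambda>h. 0)"
    by (rule differential_zero_maxmin[of x UNIV, rotated 2]) (use max[of _ y] in \<open>auto simp: algebra_simps\<close>)
  then have "frechet_derivative f (at x) h = p * (sgn (x - y) \<bullet> h)" for h by (metis eq_iff_diff_eq_0)
  then show "gradient f x = p *\<^sub>R sgn (x - y)"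
    by (simp add: gradient_def partial_def vec_eq_iff inner_axis)
  have "((\<lambda>w. - f w - p * norm (w - x)) has_derivative (\<lambda>h. - frechet_derivative f (at y) h - p * (sgn (y - x) \<bullet> h))) (at y)"
    using xy by (intro has_derivative_diff has_derivative_minus fd has_derivative_mult_right nd) auto
  then have "(\<lambda>h. - frechet_derivative f (at y) h - p * (sgn (y - x) \<bullet> h)) = (\<lambda>h. 0)"
    by (rule differential_zero_maxmin[of y UNIV, rotated 2]) (use max[of x] in \<open>auto simp: algebra_simps norm_minus_commute\<close>)
  then have "frechet_derivative f (at y) h = - (p * (sgn (y - x) \<bullet> h))" for h
    by (smt (verit, del_insts))
  moreover have "sgn (y - x) = - sgn (x - y)" by (metis minus_diff_eq sgn_minus)
  ultimately have "frechet_derivative f (at y) h = p * (sgn (x - y) \<bullet> h)" for h by simp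
  then show "gradient f y = p *\<^sub>R sgn (x - y)"
    by (simp add: gradient_def partial_def vec_eq_iff inner_axis)
qed

section \<open>Regularity, decay and time continuity of one solution\<close>

lemma slice_derivative:
  fixes G :: "real \<times> (real^'d::finite) \<Rightarrow> real"
  assumes G: "G differentiable at (t, x)"
  shows "((\<lambda>x. G (t, x)) has_derivative (\<lambda>h. frechet_derivative G (at (t, x)) (0, h))) (at x)"
    and "((\<lambda>s. G (s, x)) has_real_derivative frechet_derivative G (at (t, x)) (1, 0)) (at t)"
proof -
  have Gd: "(G has_derivative frechet_derivative G (at (t, x))) (at (t, x))"
    by (rule frechet_derivative_works[THEN iffD1, OF G])
  show "((\<lambda>x. G (t, x)) has_derivative (\<lambda>h. frechet_derivative G (at (t, x)) (0, h))) (at x)"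
    by (rule has_derivative_compose[where f="\<lambda>x. (t, x)" and g=G, OF _ Gd]) (auto intro!: derivative_eq_intros)
  have "((\<lambda>s. G (s, x)) has_derivative (\<lambda>s. frechet_derivative G (at (t, x)) (s, 0))) (at t)"
    by (rule has_derivative_compose[where f="\<lambda>s. (s, x)" and g=G, OF _ Gd]) (auto intro!: derivative_eq_intros)
  moreover have "(\<lambda>s. frechet_derivative G (at (t, x)) (s, 0)) = (*) (frechet_derivative G (at (t, x)) (1, 0))"
  proof
    fix s :: real
    show "frechet_derivative G (at (t, x)) (s, 0) = frechet_derivative G (at (t, x)) (1, 0) * s"
      using linear_cmul[OF linear_frechet_derivative[OF G], of s "(1, 0)"] by simp
  qed
  ultimately show "((\<lambda>s. G (s, x)) has_real_derivative frechet_derivative G (at (t, x)) (1, 0)) (at t)"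
    by (simp only: has_field_derivative_def)
qed

lemma slice_Ck:
  fixes G :: "real \<times> (real^'d::finite) \<Rightarrow> real"
  assumes G: "Ck_on (Suc k) ({0<..} \<times> UNIV) G" and t: "t > 0"
  shows "(\<lambda>x. G (t, x)) differentiable at x" "G differentiable at (t, x)"
    "partial i (\<lambda>x. G (t, x)) = (\<lambda>x. frechet_derivative G (at (t, x)) (0, axis i 1))"
    "Ck_on k ({0<..} \<times> UNIV) (\<lambda>z. frechet_derivative G (at z) v)"
proof -
  have o: "open ({0<..} \<times> UNIV :: (real \<times> (real^'d)) set)" by (intro open_Times) auto
  show d: "G differentiable at (t, x)" for x
    using G t by (simp add: differentiable_on_eq_differentiable_at[OF o])
  show "(\<lambda>x. G (t, x)) differentiable at x" using slice_derivative(1)[OF d] unfolding differentiable_def by blast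
  show "partial i (\<lambda>x. G (t, x)) = (\<lambda>x. frechet_derivative G (at (t, x)) (0, axis i 1))"
    unfolding partial_def frechet_derivative_at[OF slice_derivative(1)[OF d], symmetric] by simp
  show "Ck_on k ({0<..} \<times> UNIV) (\<lambda>z. frechet_derivative G (at z) v)" using G unfolding Ck_on.simps(2) by blast
qed

lemma smooth_slice:
  fixes \<theta> :: "real \<Rightarrow> real^'d::finite \<Rightarrow> real"
  assumes sm: "smooth_on ({0<..} \<times> UNIV) (\<lambda>(t, x). \<theta> t x)" and t: "t > 0"
  shows "\<theta> t differentiable at w" "partial i (\<theta> t) differentiable at w" "continuous_on UNIV (partial i (\<theta> t))"
    "continuous_on UNIV (partial j (partial i (\<theta> t)))"
    "((\<lambda>s. \<theta> s w) has_real_derivative deriv (\<lambda>s. \<theta> s w) t) (at t)"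
proof -
  define F where "F = (\<lambda>(t, x). \<theta> t x)"
  have F: "Ck_on (Suc (Suc 0)) ({0<..} \<times> UNIV) F" using sm by (simp only: smooth_on_def F_def)
  have Ft: "(\<lambda>x. F (t, x)) = \<theta> t" by (simp add: F_def)
  define Fi where "Fi = (\<lambda>z. frechet_derivative F (at z) (0, axis i 1))"
  have Fi: "Ck_on (Suc 0) ({0<..} \<times> UNIV) Fi" unfolding Fi_def by (rule slice_Ck(4)[OF F t])
  have pi: "partial i (\<theta> t) = (\<lambda>x. Fi (t, x))" using slice_Ck(3)[OF F t] unfolding Ft Fi_def .
  show "\<theta> t differentiable at w" using slice_Ck(1)[OF F t] unfolding Ft .
  show pd: "partial i (\<theta> t) differentiable at w" for w unfolding pi by (rule slice_Ck(1)[OF Fi t])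
  show "continuous_on UNIV (partial i (\<theta> t))"
    using pd by (intro differentiable_imp_continuous_on) (simp add: differentiable_on_def)
  have pj: "partial j (partial i (\<theta> t)) = (\<lambda>x. frechet_derivative Fi (at (t, x)) (0, axis j 1))"
    unfolding pi by (rule slice_Ck(3)[OF Fi t])
  have "continuous_on ({0<..} \<times> UNIV) (\<lambda>z. frechet_derivative Fi (at z) (0, axis j 1))"
    using slice_Ck(4)[OF Fi t] by simp
  then have "continuous_on UNIV (\<lambda>x. (\<lambda>z. frechet_derivative Fi (at z) (0, axis j 1)) (t, x))"
    by (rule continuous_on_compose2) (use t in \<open>auto intro!: continuous_intros\<close>)
  then show "continuous_on UNIV (partial j (partial i (\<theta> t)))" unfolding pj by simp
  have "((\<lambda>s. \<theta> s w) has_real_derivative frechet_derivative F (at (t, w)) (1, 0)) (at t)"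
    using slice_derivative(2)[OF slice_Ck(2)[OF F t]] by (simp add: F_def)
  then show "((\<lambda>s. \<theta> s w) has_real_derivative deriv (\<lambda>s. \<theta> s w) t) (at t)"
    by (simp add: DERIV_imp_deriv)
qed

lemma L2_diff:
  fixes f g :: "'a::euclidean_space \<Rightarrow> real"
  assumes f: "f \<in> L2" and g: "g \<in> L2"
  shows "(\<lambda>x. f x - g x) \<in> L2"
proof -
  have m: "f \<in> borel_measurable lebesgue" "g \<in> borel_measurable lebesgue" using f g by (auto simp: L2_def)
  have "(\<integral>\<^sup>+x. ennreal ((f x - g x)\<^sup>2) \<partial>lebesgue) \<le> (\<integral>\<^sup>+x. 2 * ennreal ((f x)\<^sup>2) + 2 * ennreal ((g x)\<^sup>2) \<partial>lebesgue)"
  proof (rule nn_integral_mono)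
    fix x
    have "(f x - g x)\<^sup>2 \<le> 2 * (f x)\<^sup>2 + 2 * (g x)\<^sup>2"
      using zero_le_power2[of "f x + g x"] by (simp add: power2_sum power2_diff)
    then have "ennreal ((f x - g x)\<^sup>2) \<le> ennreal (2 * (f x)\<^sup>2 + 2 * (g x)\<^sup>2)" by (rule ennreal_leI)
    also have "\<dots> = 2 * ennreal ((f x)\<^sup>2) + 2 * ennreal ((g x)\<^sup>2)" by (simp add: ennreal_mult')
    finally show "ennreal ((f x - g x)\<^sup>2) \<le> 2 * ennreal ((f x)\<^sup>2) + 2 * ennreal ((g x)\<^sup>2)" .
  qed
  also have "\<dots> = 2 * (\<integral>\<^sup>+x. ennreal ((f x)\<^sup>2) \<partial>lebesgue) + 2 * (\<integral>\<^sup>+x. ennreal ((g x)\<^sup>2) \<partial>lebesgue)"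
    using m by (subst nn_integral_add) (auto simp: nn_integral_cmult)
  also have "\<dots> < \<infinity>" using f g by (auto simp: L2_def ennreal_mult_less_top ennreal_add_less_top)
  finally show ?thesis using m by (simp add: L2_def)
qed

text \<open>The embedding is applied to \<open>\<theta> t\<close> and to the differences
  \<open>\<theta> t' - \<theta> t\<close>; the latter turn continuity into H^s into continuity in
  the sup norm. Apart from the last bound, which is uniform in \<epsilon>, these facts are
  qualitative and do not enter the final constants.\<close>

lemma solution_C0:
  fixes \<theta> :: "real \<Rightarrow> real^'d::finite \<Rightarrow> real"
  assumes sol: "regularized_solution a \<Psi> K \<theta>\<^sub>0 \<epsilon> \<theta>" and th0: "\<theta>\<^sub>0 \<in> Linf" and eps: "\<epsilon> > 0"
  shows "t \<ge> 0 \<Longrightarrow> continuous_on UNIV (\<theta> t)"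
    and "t \<ge> 0 \<Longrightarrow> integrable lborel (\<lambda>x. (\<theta> t x)\<^sup>2)"
    and "t \<ge> 0 \<Longrightarrow> \<exists>M. \<forall>x. \<bar>\<theta> t x\<bar> \<le> M"
    and "t \<ge> 0 \<Longrightarrow> e > 0 \<Longrightarrow> \<exists>N. \<forall>x. norm x \<ge> N \<longrightarrow> \<bar>\<theta> t x\<bar> < e"
    and "t \<ge> 0 \<Longrightarrow> e > 0 \<Longrightarrow> \<exists>d>0. \<forall>t'\<ge>0. \<bar>t' - t\<bar> < d \<longrightarrow> (\<forall>x. \<bar>\<theta> t' x - \<theta> t x\<bar> \<le> e)"
    and "\<bar>\<theta> 0 x\<bar> \<le> Linf_norm \<theta>\<^sub>0"
proof -
  obtain s where s: "s > 1 + real CARD('d) / 2" and cs: "continuous_into_sobolev s \<theta>"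
    using sol by (auto simp: regularized_solution_def)
  have sm: "smooth_on ({0<..} \<times> UNIV) (\<lambda>(t, x). \<theta> t x)" and th00: "\<theta> 0 = regularized_datum \<epsilon> \<theta>\<^sub>0"
    using sol by (auto simp: regularized_solution_def)
  show "\<bar>\<theta> 0 x\<bar> \<le> Linf_norm \<theta>\<^sub>0" unfolding th00 by (rule regularized_datum_bound(1)[OF th0 eps])
  have c: "continuous_on UNIV (\<theta> t)" if "t \<ge> 0" for t
  \<comment> \<open>Smoothness is available for positive times only; at time 0 continuity is that of
    the mollified datum.\<close>
  proof (cases "t = 0")
    case True
    then show ?thesis unfolding th00[symmetric] True using regularized_datum_bound(2)[OF th0 eps] th00 by simp
  next
    case False
    then show ?thesis using that smooth_slice(1)[OF sm]
      by (intro differentiable_imp_continuous_on) (auto simp: differentiable_on_def)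
  qed
  then show "t \<ge> 0 \<Longrightarrow> continuous_on UNIV (\<theta> t)" .
  have sob: "\<theta> t \<in> sobolev s" if "t \<ge> 0" for t using cs that by (simp add: continuous_into_sobolev_def)
  show l2: "integrable lborel (\<lambda>x. (\<theta> t x)\<^sup>2)" if "t \<ge> 0" for t
  proof (rule integrableI_bounded)
    have "\<theta> t \<in> borel_measurable borel" by (rule borel_measurable_continuous_onI[OF c[OF that]])
    then show "(\<lambda>x. (\<theta> t x)\<^sup>2) \<in> borel_measurable lborel" by measurable
    show "(\<integral>\<^sup>+x. ennreal (norm ((\<theta> t x)\<^sup>2)) \<partial>lborel) < \<infinity>"
      using sob[OF that] by (simp add: sobolev_def L2_def nn_integral_completion)
  qed
  have s': "s > 1 + real DIM(real^'d) / 2" using s by simp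
  obtain C where C: "C > 0"
    and Cb: "\<And>f A x. \<lbrakk>continuous_on UNIV (f::real^'d \<Rightarrow> real); f \<in> sobolev s; A > 0; sobolev_sqnorm s f \<le> ennreal A\<rbrakk> \<Longrightarrow> \<bar>f x\<bar> \<le> C * sqrt A"
    and Cl: "\<And>f A x y. \<lbrakk>continuous_on UNIV (f::real^'d \<Rightarrow> real); f \<in> sobolev s; A > 0; sobolev_sqnorm s f \<le> ennreal A\<rbrakk> \<Longrightarrow> \<bar>f x - f y\<bar> \<le> C * sqrt A * norm (x - y)"
    using sobolev_embedding[OF s'] by blast
  have A: "\<exists>A>0. sobolev_sqnorm s (\<theta> t) \<le> ennreal A" if "t \<ge> 0" for t
  proof -
    have "sobolev_sqnorm s (\<theta> t) < \<infinity>" using sob[OF that] by (simp add: sobolev_def)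
    then have "sobolev_sqnorm s (\<theta> t) = ennreal (enn2real (sobolev_sqnorm s (\<theta> t)))" by simp
    also have "\<dots> \<le> ennreal (enn2real (sobolev_sqnorm s (\<theta> t)) + 1)" by (rule ennreal_leI) simp
    finally show ?thesis by (intro exI[of _ "enn2real (sobolev_sqnorm s (\<theta> t)) + 1"]) (simp add: add_nonneg_pos)
  qed
  show "\<exists>M. \<forall>x. \<bar>\<theta> t x\<bar> \<le> M" if t: "t \<ge> 0"
    using A[OF t] Cb[OF c[OF t] sob[OF t]] by blast
  show "\<exists>N. \<forall>x. norm x \<ge> N \<longrightarrow> \<bar>\<theta> t x\<bar> < e" if t: "t \<ge> 0" and e: "e > 0"
  proof -
    obtain A where "A > 0" "sobolev_sqnorm s (\<theta> t) \<le> ennreal A" using A[OF t] by blast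
    then show ?thesis by (intro Lipschitz_L2_decay[OF _ l2[OF t] e, of "C * sqrt A"] Cl[OF c[OF t] sob[OF t]])
  qed
  show "\<exists>d>0. \<forall>t'\<ge>0. \<bar>t' - t\<bar> < d \<longrightarrow> (\<forall>x. \<bar>\<theta> t' x - \<theta> t x\<bar> \<le> e)" if t: "t \<ge> 0" and e: "e > 0"
  proof -
    define \<eta> where "\<eta> = (e / C)\<^sup>2"
    have \<eta>: "\<eta> > 0" "C * sqrt \<eta> = e" using e C by (auto simp: \<eta>_def)
    have "((\<lambda>t'. sobolev_sqnorm s (\<lambda>x. \<theta> t' x - \<theta> t x)) \<longlongrightarrow> 0) (at t within {0..})"
      using cs t by (simp add: continuous_into_sobolev_def)
    then have "\<forall>\<^sub>F t' in at t within {0..}. sobolev_sqnorm s (\<lambda>x. \<theta> t' x - \<theta> t x) < ennreal \<eta>"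
      by (rule order_tendstoD) (use \<eta> in simp)
    then obtain d where d: "d > 0" "\<And>t'. t' \<ge> 0 \<Longrightarrow> t' \<noteq> t \<Longrightarrow> dist t' t < d \<Longrightarrow> sobolev_sqnorm s (\<lambda>x. \<theta> t' x - \<theta> t x) < ennreal \<eta>"
      unfolding eventually_at by auto
    have "\<bar>\<theta> t' x - \<theta> t x\<bar> \<le> e" if t': "t' \<ge> 0" "\<bar>t' - t\<bar> < d" for t' x
    proof (cases "t' = t")
      case True
      then show ?thesis using e by simp
    next
      case False
      have sq: "sobolev_sqnorm s (\<lambda>x. \<theta> t' x - \<theta> t x) < ennreal \<eta>" using d(2)[OF t'(1) False] t'(2) by (simp add: dist_real_def)
      have "(\<lambda>x. \<theta> t' x - \<theta> t x) \<in> sobolev s"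
        using sq sob[OF t] sob[OF t'(1)] by (auto simp: sobolev_def intro!: L2_diff intro: less_trans)
      then have "\<bar>\<theta> t' x - \<theta> t x\<bar> \<le> C * sqrt \<eta>"
        using sq by (intro Cb[of "\<lambda>x. \<theta> t' x - \<theta> t x"] continuous_on_diff c t t'(1) \<eta>(1)) (auto intro: less_imp_le)
      then show ?thesis by (simp add: \<eta>)
    qed
    then show ?thesis using d(1) by blast
  qed
qed

text \<open>Continuity in the sup norm carries a bound and a decay radius from one time to nearby
  times, and finitely many such times cover the compact interval.\<close>

lemma solution_uniform:
  fixes \<theta> :: "real \<Rightarrow> real^'d::finite \<Rightarrow> real"
  assumes sol: "regularized_solution a \<Psi> K \<theta>\<^sub>0 \<epsilon> \<theta>" and th0: "\<theta>\<^sub>0 \<in> Linf" and eps: "\<epsilon> > 0" and e: "e > 0"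
  shows "\<exists>N M. \<forall>t\<in>{0..T}. (\<forall>x. \<bar>\<theta> t x\<bar> \<le> M) \<and> (\<forall>x. norm x \<ge> N \<longrightarrow> \<bar>\<theta> t x\<bar> < e)"
proof -
  note C0 = solution_C0[OF sol th0 eps]
  have "\<forall>t\<in>{0..T}. \<exists>d N M. d > 0 \<and> (\<forall>t'\<ge>0. \<bar>t' - t\<bar> < d \<longrightarrow> (\<forall>x. \<bar>\<theta> t' x\<bar> \<le> M) \<and> (\<forall>x. norm x \<ge> N \<longrightarrow> \<bar>\<theta> t' x\<bar> < e))"
  proof
    fix t assume "t \<in> {0..T}"
    then have t: "t \<ge> 0" by simp
    obtain M where M: "\<And>x. \<bar>\<theta> t x\<bar> \<le> M" using C0(3)[OF t] by blast
    have e2: "e / 2 > 0" "e / 3 > 0" using e by auto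
    obtain N where N: "\<And>x. norm x \<ge> N \<Longrightarrow> \<bar>\<theta> t x\<bar> < e / 2" using C0(4)[OF t e2(1)] by blast
    obtain d where d: "d > 0" "\<And>t' x. t' \<ge> 0 \<Longrightarrow> \<bar>t' - t\<bar> < d \<Longrightarrow> \<bar>\<theta> t' x - \<theta> t x\<bar> \<le> e / 3" using C0(5)[OF t e2(2)] by blast
    have "\<bar>\<theta> t' x\<bar> \<le> M + e" if "t' \<ge> 0" "\<bar>t' - t\<bar> < d" for t' x
      using M[of x] d(2)[OF that, of x] e by linarith
    moreover have "\<bar>\<theta> t' x\<bar> < e" if "t' \<ge> 0" "\<bar>t' - t\<bar> < d" "norm x \<ge> N" for t' x
      using N[OF that(3)] d(2)[OF that(1,2), of x] e by linarith
    ultimately show "\<exists>d N M. d > 0 \<and> (\<forall>t'\<ge>0. \<bar>t' - t\<bar> < d \<longrightarrow> (\<forall>x. \<bar>\<theta> t' x\<bar> \<le> M) \<and> (\<forall>x. norm x \<ge> N \<longrightarrow> \<bar>\<theta> t' x\<bar> < e))"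
      using d(1) by blast
  qed
  then obtain d N M where d: "\<And>t. t \<in> {0..T} \<Longrightarrow> d t > 0"
    and M: "\<And>t t' x. t \<in> {0..T} \<Longrightarrow> t' \<ge> 0 \<Longrightarrow> \<bar>t' - t\<bar> < d t \<Longrightarrow> \<bar>\<theta> t' x\<bar> \<le> M t"
    and N: "\<And>t t' x. t \<in> {0..T} \<Longrightarrow> t' \<ge> 0 \<Longrightarrow> \<bar>t' - t\<bar> < d t \<Longrightarrow> norm x \<ge> N t \<Longrightarrow> \<bar>\<theta> t' x\<bar> < e"
    by metis
  have "{0..T} \<subseteq> (\<Union>t\<in>{0..T}. ball t (d t))" using d by force
  then obtain F where F: "F \<subseteq> {0..T}" "finite F" "{0..T} \<subseteq> (\<Union>t\<in>F. ball t (d t))"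
    by (rule compactE_image[OF compact_Icc, rotated]) auto
  have "(\<forall>x. \<bar>\<theta> t x\<bar> \<le> (\<Sum>u\<in>F. \<bar>M u\<bar>)) \<and> (\<forall>x. norm x \<ge> (\<Sum>u\<in>F. \<bar>N u\<bar>) \<longrightarrow> \<bar>\<theta> t x\<bar> < e)" if t: "t \<in> {0..T}" for t
  proof -
    obtain u where u: "u \<in> F" "\<bar>t - u\<bar> < d u" using F(3) t by (force simp: dist_real_def)
    have "\<bar>M u\<bar> \<le> (\<Sum>u\<in>F. \<bar>M u\<bar>)" "\<bar>N u\<bar> \<le> (\<Sum>u\<in>F. \<bar>N u\<bar>)"
      using u(1) F(2) by (auto intro: member_le_sum)
    moreover have ut: "u \<in> {0..T}" "0 \<le> t" using u(1) F(1) t by auto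
    moreover note M[OF ut u(2)] N[OF ut u(2)]
    ultimately show ?thesis by (meson abs_ge_self order_trans)
  qed
  then show ?thesis by blast
qed

lemma solution_jointly_continuous:
  fixes \<theta> :: "real \<Rightarrow> real^'d::finite \<Rightarrow> real"
  assumes sol: "regularized_solution a \<Psi> K \<theta>\<^sub>0 \<epsilon> \<theta>" and th0: "\<theta>\<^sub>0 \<in> Linf" and eps: "\<epsilon> > 0"
  shows "continuous_on ({0..} \<times> UNIV) (\<lambda>(t, x). \<theta> t x)"
  unfolding continuous_on_iff
proof (intro ballI allI impI)
  note C0 = solution_C0[OF sol th0 eps]
  fix z :: "real \<times> (real^'d)" and e :: real assume z: "z \<in> {0..} \<times> UNIV" and e: "0 < e"
  obtain t x where zt: "z = (t, x)" by (cases z)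
  have t: "0 \<le> t" using z by (simp add: zt)
  have e3: "e / 3 > 0" using e by simp
  obtain d1 where d1: "d1 > 0" "\<And>t' x. t' \<ge> 0 \<Longrightarrow> \<bar>t' - t\<bar> < d1 \<Longrightarrow> \<bar>\<theta> t' x - \<theta> t x\<bar> \<le> e / 3" using C0(5)[OF t e3] by blast
  obtain d2 where d2: "d2 > 0" "\<And>x'. dist x' x < d2 \<Longrightarrow> dist (\<theta> t x') (\<theta> t x) < e / 3"
    using C0(1)[OF t] e3 unfolding continuous_on_iff by (metis UNIV_I)
  show "\<exists>d>0. \<forall>z'\<in>{0..} \<times> UNIV. dist z' z < d \<longrightarrow> dist (case z' of (t, x) \<Rightarrow> \<theta> t x) (case z of (t, x) \<Rightarrow> \<theta> t x) < e"
  proof (intro exI[of _ "min d1 d2"] conjI ballI impI)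
    fix z' :: "real \<times> (real^'d)" assume z': "z' \<in> {0..} \<times> UNIV" "dist z' z < min d1 d2"
    obtain t' x' where zt': "z' = (t', x')" by (cases z')
    have t': "0 \<le> t'" and d: "dist (t', x') (t, x) < min d1 d2" using z' by (auto simp: zt zt')
    have "dist t' t < d1" "dist x' x < d2"
      using d dist_fst_le[of "(t', x')" "(t, x)"] dist_snd_le[of "(t', x')" "(t, x)"] by auto
    then have "dist (\<theta> t' x') (\<theta> t x) < e"
      using d1(2)[OF t', of x'] d2(2)[of x'] e unfolding dist_real_def by linarith
    then show "dist (case z' of (t, x) \<Rightarrow> \<theta> t x) (case z of (t, x) \<Rightarrow> \<theta> t x) < e" by (simp add: zt zt')
  qed (use d1 d2 in auto)
qed

subsection \<open>Propagation of a modulus of continuity\<close>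

text \<open>The bounds on \<open>deriv m\<close> say that \<open>m r / r powr \<alpha>\<close> is
  non-increasing and \<open>m r / r powr (\<alpha> - \<sigma>)\<close> non-decreasing. These are the
  forms in which they are used.\<close>

lemma case_I_growth:
  assumes c: "case_I K m c\<^sub>1 \<alpha> \<sigma>"
  shows "0 < r \<Longrightarrow> m differentiable at r"
    and "0 < r \<Longrightarrow> r \<le> s \<Longrightarrow> m s * r powr \<alpha> \<le> m r * s powr \<alpha>"
    and "0 < r \<Longrightarrow> r \<le> s \<Longrightarrow> m r * s powr (\<alpha> - \<sigma>) \<le> m s * r powr (\<alpha> - \<sigma>)"
    and "0 < r \<Longrightarrow> r \<le> s \<Longrightarrow> m r \<le> m s"
    and "0 < r \<Longrightarrow> 0 < m r"
proof -
  have mono: "mono_on {0..} m" and m0: "m 0 = 0" and top: "filterlim m at_top at_top"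
    and d: "\<And>r. r > 0 \<Longrightarrow> (\<alpha> - \<sigma>) * (m r / r) \<le> deriv m r" "\<And>r. r > 0 \<Longrightarrow> deriv m r \<le> \<alpha> * (m r / r)"
    and sm: "smooth_on {0<..} m"
    using c by (auto simp: case_I_def)
  show "m differentiable at r" if "0 < r" for r
  proof -
    have "m differentiable_on {0<..}" using sm unfolding smooth_on_def by (metis Ck_on.simps(2))
    then show ?thesis using that by (simp add: differentiable_on_eq_differentiable_at)
  qed
  then have md: "(m has_real_derivative deriv m r) (at r)" if "0 < r" for r
    using that by (metis DERIV_deriv_iff_real_differentiable)
  have pw: "((\<lambda>r. m r * r powr (- a)) has_real_derivative (deriv m r - a * (m r / r)) * r powr (- a)) (at r)" if "0 < r" for r a
    using that by (auto intro!: derivative_eq_intros md simp: powr_diff field_simps)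
  have conv: "m r * r powr (- a) \<le> m s * s powr (- a) \<longleftrightarrow> m r * s powr a \<le> m s * r powr a" if "0 < r" "0 < s" for r s a
    using that by (simp add: powr_minus field_simps)
  show up: "m s * r powr \<alpha> \<le> m r * s powr \<alpha>" if "0 < r" "r \<le> s" for r s
  proof -
    have "s powr (- \<alpha>) * m s \<le> r powr (- \<alpha>) * m r"
    proof (rule DERIV_nonpos_imp_nonincreasing[OF that(2)])
      fix x assume "r \<le> x" "x \<le> s"
      then have x: "x > 0" using that by simp
      show "\<exists>y. ((\<lambda>r. r powr (- \<alpha>) * m r) has_real_derivative y) (at x) \<and> y \<le> 0"
        using pw[OF x, of \<alpha>] d(2)[OF x] x by (intro exI[of _ "(deriv m x - \<alpha> * (m x / x)) * x powr (- \<alpha>)"]) (auto simp: mult.commute intro: mult_nonneg_nonpos)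
    qed
    then show ?thesis using conv[of s r \<alpha>] that by (simp add: mult.commute)
  qed
  show "m r * s powr (\<alpha> - \<sigma>) \<le> m s * r powr (\<alpha> - \<sigma>)" if "0 < r" "r \<le> s" for r s
  proof -
    have "r powr (- (\<alpha> - \<sigma>)) * m r \<le> s powr (- (\<alpha> - \<sigma>)) * m s"
    proof (rule DERIV_nonneg_imp_nondecreasing[OF that(2)])
      fix x assume "r \<le> x" "x \<le> s"
      then have x: "x > 0" using that by simp
      show "\<exists>y. ((\<lambda>r. r powr (- (\<alpha> - \<sigma>)) * m r) has_real_derivative y) (at x) \<and> 0 \<le> y"
        using pw[OF x, of "\<alpha> - \<sigma>"] d(1)[OF x] x by (intro exI[of _ "(deriv m x - (\<alpha> - \<sigma>) * (m x / x)) * x powr (- (\<alpha> - \<sigma>))"]) (auto simp: mult.commute intro: mult_nonneg_nonneg)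
    qed
    then show ?thesis using conv[of r s "\<alpha> - \<sigma>"] that by (simp add: mult.commute)
  qed
  show "m r \<le> m s" if "0 < r" "r \<le> s" for r s using that mono_onD[OF mono, of r s] by simp
  \<comment> \<open>If \<open>m\<close> vanished at \<open>r\<close>, the upper growth bound would
    make it vanish on all of \<open>[r, \<infinity>)\<close>, against its divergence.\<close>
  show "0 < m r" if r: "0 < r" for r
  proof (rule ccontr)
    assume "\<not> 0 < m r"
    then have z: "m r = 0" using mono_onD[OF mono, of 0 r] m0 r by simp
    have "eventually (\<lambda>s. m s \<ge> 1) at_top" using top by (simp add: filterlim_at_top)
    then obtain s where s: "s \<ge> r" "m s \<ge> 1" by (metis eventually_at_top_linorder linear max.cobounded1 max.cobounded2)
    have "m s * r powr \<alpha> \<le> 0" using up[OF r s(1)] z by simp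
    then show False using s(2) r by (simp add: mult_le_0_iff)
  qed
qed

text \<open>The lower growth of \<open>m\<close> gives the decay \<mu> = \<alpha> - \<sigma> at
  infinity; the upper growth with \<alpha> \<le> 1 gives the singularity at the origin. The last
  claim is monotonicity of \<open>m\<close>, since
  \<open>1 / \<xi> \<le> 1 / norm z\<close>.\<close>

lemma case_I_kernel:
  fixes K :: "real^'d::finite \<Rightarrow> real"
  assumes c: "case_I K m c\<^sub>1 \<alpha> \<sigma>" and al: "0 < \<alpha>" "\<alpha> \<le> 1" "\<sigma> < \<alpha>"
  shows "diffusion_kernel (c\<^sub>1 * m 1) (\<alpha> - \<sigma>) K" and "c\<^sub>1 \<ge> 1"
    and "z \<noteq> 0 \<Longrightarrow> norm z \<le> \<xi> \<Longrightarrow> m (1 / \<xi>) / c\<^sub>1 / norm z ^ CARD('d) \<le> K z"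
proof -
  note g = case_I_growth[OF c]
  show c1: "c\<^sub>1 \<ge> 1" using c by (simp add: case_I_def)
  have Kb: "m (1 / norm z) / c\<^sub>1 / norm z ^ CARD('d) \<le> K z" "K z \<le> c\<^sub>1 * m (1 / norm z) / norm z ^ CARD('d)" if "z \<noteq> 0" for z
  proof -
    have "inverse c\<^sub>1 * (m (inverse (norm z)) / norm z ^ CARD('d)) \<le> K z \<and> K z \<le> c\<^sub>1 * (m (inverse (norm z)) / norm z ^ CARD('d))"
      using c that unfolding case_I_def by blast
    then show "m (1 / norm z) / c\<^sub>1 / norm z ^ CARD('d) \<le> K z" "K z \<le> c\<^sub>1 * m (1 / norm z) / norm z ^ CARD('d)"
      by (simp_all add: inverse_eq_divide mult.commute)
  qed
  have lower: "m (1 / \<xi>) / c\<^sub>1 / norm z ^ CARD('d) \<le> K z" if "z \<noteq> 0" "norm z \<le> \<xi>" for z \<xi>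
  proof -
    have "norm z > 0" using that by simp
    moreover from this have "\<xi> > 0" using that(2) by linarith
    ultimately have "0 < 1 / \<xi>" "1 / \<xi> \<le> 1 / norm z" using that(2) by (auto intro!: divide_left_mono mult_pos_pos)
    then have "m (1 / \<xi>) / c\<^sub>1 / norm z ^ CARD('d) \<le> m (1 / norm z) / c\<^sub>1 / norm z ^ CARD('d)"
      using c1 by (intro divide_right_mono g(4)) auto
    then show ?thesis using Kb(1)[OF that(1)] by simp
  qed
  then show "z \<noteq> 0 \<Longrightarrow> norm z \<le> \<xi> \<Longrightarrow> m (1 / \<xi>) / c\<^sub>1 / norm z ^ CARD('d) \<le> K z" .
  have m1: "m 1 > 0" by (rule g(5)) simp
  have K0: "0 \<le> K z" if "z \<noteq> 0" for z
  proof -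
    have "0 \<le> m (1 / norm z) / c\<^sub>1 / norm z ^ CARD('d)" using g(5)[of "1 / norm z"] that c1 by simp
    then show ?thesis using lower[OF that order_refl] by simp
  qed
  have far: "K z \<le> c\<^sub>1 * m 1 * norm z powr (- (real CARD('d) + (\<alpha> - \<sigma>)))" if "1 \<le> norm z" for z
  proof -
    have z: "z \<noteq> 0" "norm z > 0" using that by auto
    have "m (1 / norm z) * 1 powr (\<alpha> - \<sigma>) \<le> m 1 * (1 / norm z) powr (\<alpha> - \<sigma>)"
      using that z by (intro g(3)) auto
    then have "m (1 / norm z) \<le> m 1 * norm z powr (- (\<alpha> - \<sigma>))"
      using z by (simp add: powr_divide powr_minus_divide del: minus_diff_eq)
    then have "c\<^sub>1 * m (1 / norm z) / norm z ^ CARD('d) \<le> c\<^sub>1 * (m 1 * norm z powr (- (\<alpha> - \<sigma>))) / norm z ^ CARD('d)"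
      using c1 by (intro divide_right_mono mult_left_mono) auto
    also have "\<dots> = c\<^sub>1 * m 1 * norm z powr (- (real CARD('d) + (\<alpha> - \<sigma>)))"
    proof -
      have "norm z powr (- (real CARD('d) + (\<alpha> - \<sigma>))) = norm z powr (- (\<alpha> - \<sigma>)) / norm z ^ CARD('d)"
        unfolding minus_add_distrib powr_add powr_minus[of _ "real CARD('d)"] powr_realpow[OF z(2)] by (simp add: divide_inverse)
      then show ?thesis by simp
    qed
    finally show ?thesis using Kb(2)[OF z(1)] by simp
  qed
  have near: "K z \<le> c\<^sub>1 * m 1 / (norm z * norm z ^ CARD('d))" if "z \<noteq> 0" "norm z \<le> 1" for z
  proof -
    have z: "norm z > 0" "1 / norm z \<ge> 1" using that by auto
    have "m (1 / norm z) * 1 powr \<alpha> \<le> m 1 * (1 / norm z) powr \<alpha>"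
      using z by (intro g(2)) auto
    also have "\<dots> \<le> m 1 * (1 / norm z) powr 1"
      using z al m1 by (intro mult_left_mono powr_mono) auto
    finally have "m (1 / norm z) \<le> m 1 / norm z" using z by simp
    then have "c\<^sub>1 * m (1 / norm z) / norm z ^ CARD('d) \<le> c\<^sub>1 * (m 1 / norm z) / norm z ^ CARD('d)"
      using c1 by (intro divide_right_mono mult_left_mono) auto
    then show ?thesis using Kb(2)[OF that(1)] by simp
  qed
  have sym: "K (- z) = K z" if "z \<noteq> 0" for z
  proof -
    have "\<forall>x y. x \<noteq> 0 \<and> norm x = norm y \<longrightarrow> K x = K y" using c unfolding case_I_def by blast
    then have "K z = K (- z)" using that norm_minus_cancel[of z] by metis
    then show ?thesis ..
  qed
  have meas: "K \<in> borel_measurable lebesgue" using c unfolding case_I_def by blast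
  have c0: "0 \<le> c\<^sub>1 * m 1" using c1 m1 by simp
  show "diffusion_kernel (c\<^sub>1 * m 1) (\<alpha> - \<sigma>) K"
    unfolding diffusion_kernel_def DIM_cart DIM_real mult_1_right
    using al(3) c0 K0 far near meas sym by auto
qed

section \<open>Concave moduli and their extension by a tangent near the origin\<close>

definition lin_ext :: "(real \<Rightarrow> real) \<Rightarrow> (real \<Rightarrow> real) \<Rightarrow> real \<Rightarrow> real \<Rightarrow> real" where
  "lin_ext \<omega> p r \<xi> = \<omega> (max \<xi> r) - p r * max 0 (r - \<xi>)"

text \<open>\<open>gap\<close> says that the tangent at \<open>r\<close> meets the axis at a
  positive height. This is the room that a bounded datum fits into, and it keeps touching points off
  the diagonal. \<open>dyadic_summable\<close> makes the bound on the far drift finite.\<close>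

locale concave_modulus =
  fixes \<omega> p :: "real \<Rightarrow> real"
  assumes cont_\<omega>: "continuous_on {0<..} \<omega>" and cont_p: "continuous_on {0<..} p"
    and p_nonneg: "0 < r \<Longrightarrow> 0 \<le> p r"
    and supergradient: "0 < r \<Longrightarrow> 0 < s \<Longrightarrow> \<omega> s \<le> \<omega> r + p r * (s - r)"
    and unbounded: "filterlim \<omega> at_top at_top"
    and gap: "0 < r \<Longrightarrow> r * p r < \<omega> r"
    and dyadic_summable: "0 < r \<Longrightarrow> summable (\<lambda>j. \<omega> (2 ^ j * r) / 2 ^ j)"
begin

lemma p_antimono: "0 < r \<Longrightarrow> r \<le> s \<Longrightarrow> p s \<le> p r"
proof (cases "r = s")
  case False
  assume r: "0 < r" "r \<le> s"
  have "0 \<le> (p r - p s) * (s - r)"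
    using supergradient[of r s] supergradient[of s r] r by (simp add: algebra_simps)
  then show ?thesis using False r by (simp add: zero_le_mult_iff)
qed simp

lemma lin_ext_cases:
  "\<xi> \<le> r \<Longrightarrow> lin_ext \<omega> p r \<xi> = \<omega> r + p r * (\<xi> - r)" "r \<le> \<xi> \<Longrightarrow> lin_ext \<omega> p r \<xi> = \<omega> \<xi>"
  by (simp_all add: lin_ext_def max_def algebra_simps)

lemma lin_ext_supergradient:
  assumes r: "0 < r"
  shows "lin_ext \<omega> p r s \<le> lin_ext \<omega> p r \<xi> + p (max \<xi> r) * (s - \<xi>)"
proof -
  consider "\<xi> \<le> r" "s \<le> r" | "\<xi> \<le> r" "r \<le> s" | "r \<le> \<xi>" "r \<le> s" | "r \<le> \<xi>" "s \<le> r" by linarith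
  then show ?thesis
  proof cases
    case 1
    then show ?thesis using lin_ext_cases(1)[of \<xi> r] lin_ext_cases(1)[of s r] by (simp add: max_def algebra_simps)
  next
    case 2
    then show ?thesis using lin_ext_cases(1)[of \<xi> r] lin_ext_cases(2)[of r s] supergradient[of r s] r by (auto simp: max_def algebra_simps)
  next
    case 3
    then show ?thesis using lin_ext_cases(2)[of r \<xi>] lin_ext_cases(2)[of r s] supergradient[of \<xi> s] r by (simp add: max_def)
  next
    case 4
    have "p r * (s - r) \<le> p \<xi> * (s - r)" using 4 p_antimono[of r \<xi>] r by (intro mult_right_mono_neg) auto
    then show ?thesis using 4 lin_ext_cases(2)[of r \<xi>] lin_ext_cases(1)[of s r] supergradient[of \<xi> r] r by (simp add: max_def algebra_simps)
  qed
qed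

lemma lin_ext_mono: "0 < r \<Longrightarrow> s \<le> \<xi> \<Longrightarrow> lin_ext \<omega> p r s \<le> lin_ext \<omega> p r \<xi>"
proof -
  assume "0 < r" "s \<le> \<xi>"
  moreover from this have "p (max \<xi> r) * (s - \<xi>) \<le> 0" by (intro mult_nonneg_nonpos p_nonneg) auto
  ultimately show ?thesis using lin_ext_supergradient[of r s \<xi>] by simp
qed

text \<open>The tangent of the extension at \<open>\<xi>\<close> is the tangent of \<omega> at
  \<open>max \<xi> r\<close>, so the two have the same intercept. Hence only quantities at
  \<open>max \<xi> r\<close> occur in the touching argument.\<close>

lemma lin_ext_gap: "lin_ext \<omega> p r \<xi> - p (max \<xi> r) * \<xi> = \<omega> (max \<xi> r) - max \<xi> r * p (max \<xi> r)"
  by (simp add: lin_ext_def max_def algebra_simps)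

lemma lin_ext_pos: "0 < r \<Longrightarrow> 0 \<le> \<xi> \<Longrightarrow> \<omega> r - r * p r \<le> lin_ext \<omega> p r \<xi>" "0 < r \<Longrightarrow> 0 \<le> \<xi> \<Longrightarrow> 0 < lin_ext \<omega> p r \<xi>"
proof -
  show 1: "\<omega> r - r * p r \<le> lin_ext \<omega> p r \<xi>" if "0 < r" "0 \<le> \<xi>"
    using lin_ext_mono[of r 0 \<xi>] lin_ext_cases(1)[of 0 r] that by (simp add: mult.commute)
  show "0 < r \<Longrightarrow> 0 \<le> \<xi> \<Longrightarrow> 0 < lin_ext \<omega> p r \<xi>" using 1 gap[of r] by simp
qed

text \<open>Beyond \<open>r'\<close> the two extensions agree. To the left their slopes differ by at
  most \<open>p r - p r'\<close>, and the distance covered from \<open>r'\<close> is at most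
  \<open>r'\<close>.\<close>

lemma lin_ext_time:
  assumes r: "0 < r" "r \<le> r'" and \<xi>: "0 \<le> \<xi>"
  shows "lin_ext \<omega> p r' \<xi> - lin_ext \<omega> p r \<xi> \<le> (p r - p r') * r'"
proof -
  have pp: "p r' \<le> p r" by (rule p_antimono[OF r])
  consider "\<xi> \<le> r" | "r \<le> \<xi>" "\<xi> \<le> r'" | "r' \<le> \<xi>" by linarith
  then show ?thesis
  proof cases
    case 1
    have "lin_ext \<omega> p r' \<xi> - lin_ext \<omega> p r \<xi> \<le> (p r - p r') * (r' - \<xi>)"
      using supergradient[of r r'] r lin_ext_cases(1)[of \<xi> r] lin_ext_cases(1)[of \<xi> r'] 1 by (simp add: algebra_simps)
    also have "\<dots> \<le> (p r - p r') * r'" using pp \<xi> by (intro mult_left_mono) auto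
    finally show ?thesis .
  next
    case 2
    have "lin_ext \<omega> p r' \<xi> - lin_ext \<omega> p r \<xi> \<le> (p \<xi> - p r') * (r' - \<xi>)"
      using supergradient[of \<xi> r'] r lin_ext_cases(2)[of r \<xi>] lin_ext_cases(1)[of \<xi> r'] 2 by (simp add: algebra_simps)
    also have "\<dots> \<le> (p r - p r') * r'"
      using pp \<xi> p_antimono[of r \<xi>] p_antimono[of \<xi> r'] 2 r by (intro mult_mono) auto
    finally show ?thesis .
  next
    case 3
    then show ?thesis using pp r lin_ext_cases(2)[of r \<xi>] lin_ext_cases(2)[of r' \<xi>] by simp
  qed
qed

lemma lin_ext_dyadic:
  assumes r: "0 < r" and \<xi>: "0 < \<xi>"
  shows "summable (\<lambda>j. lin_ext \<omega> p r (2 ^ j * \<xi>) / 2 ^ j)"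
    and "(\<Sum>j. lin_ext \<omega> p r (2 ^ j * \<xi>) / 2 ^ j) \<le> (\<Sum>j. \<omega> (2 ^ j * max \<xi> r) / 2 ^ j)"
    and "lin_ext \<omega> p r \<xi> \<le> (\<Sum>j. \<omega> (2 ^ j * max \<xi> r) / 2 ^ j)"
proof -
  have R: "max \<xi> r > 0" using r by simp
  have le: "lin_ext \<omega> p r (2 ^ j * \<xi>) / 2 ^ j \<le> \<omega> (2 ^ j * max \<xi> r) / 2 ^ j" for j
  proof -
    have "1 * r \<le> 2 ^ j * max \<xi> r" using r by (intro mult_mono) auto
    then have "lin_ext \<omega> p r (2 ^ j * max \<xi> r) = \<omega> (2 ^ j * max \<xi> r)" by (intro lin_ext_cases) simp
    moreover have "lin_ext \<omega> p r (2 ^ j * \<xi>) \<le> lin_ext \<omega> p r (2 ^ j * max \<xi> r)"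
      by (rule lin_ext_mono[OF r]) simp
    ultimately show ?thesis by (simp add: divide_right_mono)
  qed
  have pos0: "0 \<le> lin_ext \<omega> p r (2 ^ j * \<xi>)" for j
    using lin_ext_pos(2)[OF r, of "2 ^ j * \<xi>"] \<xi> by simp
  have pos: "0 \<le> lin_ext \<omega> p r (2 ^ j * \<xi>) / 2 ^ j" for j using lin_ext_pos(2)[OF r, of "2 ^ j * \<xi>"] \<xi> by simp
  show s: "summable (\<lambda>j. lin_ext \<omega> p r (2 ^ j * \<xi>) / 2 ^ j)"
    by (rule summable_comparison_test'[OF dyadic_summable[OF R], of 0]) (use le pos0 in \<open>simp add: abs_of_nonneg\<close>)
  show le2: "(\<Sum>j. lin_ext \<omega> p r (2 ^ j * \<xi>) / 2 ^ j) \<le> (\<Sum>j. \<omega> (2 ^ j * max \<xi> r) / 2 ^ j)"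
    by (rule suminf_le[OF le s dyadic_summable[OF R]])
  have "(\<Sum>j<1. lin_ext \<omega> p r (2 ^ j * \<xi>) / 2 ^ j) \<le> (\<Sum>j. lin_ext \<omega> p r (2 ^ j * \<xi>) / 2 ^ j)"
    by (rule sum_le_suminf[OF s]) (use pos in auto)
  then show "lin_ext \<omega> p r \<xi> \<le> (\<Sum>j. \<omega> (2 ^ j * max \<xi> r) / 2 ^ j)" using le2 by simp
qed

text \<open>A tangent of a concave function lies above it, so the extension dominates \<omega> for
  every \<open>r\<close>, and the bound is uniform in \<open>r\<close>.\<close>

lemma lin_ext_tends_to_infinity: "\<exists>N. \<forall>\<xi>\<ge>N. \<forall>r>0. C < lin_ext \<omega> p r \<xi>"
proof -
  obtain N where N: "\<And>\<xi>. \<xi> \<ge> N \<Longrightarrow> C + 1 \<le> \<omega> \<xi>" using unbounded unfolding filterlim_at_top eventually_at_top_linorder by blast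
  have "C < lin_ext \<omega> p r \<xi>" if "\<xi> \<ge> max N 1" "r > 0" for r \<xi>
  proof -
    have "lin_ext \<omega> p r \<xi> \<ge> \<omega> \<xi>"
    proof (cases "\<xi> \<le> r")
      case True
      then show ?thesis using lin_ext_cases(1)[of \<xi> r] supergradient[of r \<xi>] that by simp
    qed (use lin_ext_cases(2)[of r \<xi>] in simp)
    then show ?thesis using N[of \<xi>] that by simp
  qed
  then show ?thesis by blast
qed

end

text \<open>The local term with coefficient \<open>a\<close>, plus the far bound once for each
  component of the velocity.\<close>

definition drift_const :: "real^'d::finite \<Rightarrow> real \<Rightarrow> real" where
  "drift_const a B = (\<Sum>i\<in>UNIV. \<bar>a $ i\<bar>) + real CARD('d) * far_const TYPE(real^'d) B"

text \<open>From \<open>diffusion_lower_bound\<close> with \<open>K\<close> at least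
  \<open>m (1 / \<xi>) / c / \<xi> ^ d\<close>: the ball of radius \<open>\<xi> / 4\<close> has
  volume \<open>unit_ball_vol d * (\<xi> / 4) ^ d\<close>, and the powers of \<open>\<xi>\<close>
  cancel.\<close>

definition dissipation_const :: "nat \<Rightarrow> real \<Rightarrow> real" where
  "dissipation_const d c = unit_ball_vol (real d) / 4 ^ d / c"

section \<open>The equation at a touching point\<close>

lemma derivative_lower_bound:
  fixes h :: "real \<Rightarrow> real"
  assumes "(h has_real_derivative D) (at t)" and "\<forall>\<^sub>F s in at_left t. h s \<le> h t + v * (t - s)"
  shows "- v \<le> D"
proof (rule tendsto_lowerbound)
  show "((\<lambda>s. (h s - h t) / (s - t)) \<longlongrightarrow> D) (at_left t)"
    using has_field_derivative_at_within[OF assms(1), of "{..<t}"] by (simp add: has_field_derivative_iff)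
  show "\<forall>\<^sub>F s in at_left t. - v \<le> (h s - h t) / (s - t)"
    using assms(2) eventually_at_left_real[of "t - 1" t, simplified]
  proof eventually_elim
    case (elim s)
    then have "h s - h t \<le> (- v) * (s - t)" by (simp add: algebra_simps)
    then show ?case using elim by (simp add: neg_le_divide_eq)
  qed
qed simp

locale drift_diffusion =
  fixes a :: "real^'d::finite" and \<Psi> :: "real^'d \<Rightarrow> real^'d" and K :: "real^'d \<Rightarrow> real"
    and m :: "real \<Rightarrow> real" and c\<^sub>1 \<alpha> \<sigma> B :: real
  assumes kernel_continuous: "continuous_on (- {0}) (velocity_kernel \<Psi>)"
    and kernel_hormander: "\<And>i. hormander_kernel B (\<lambda>x. velocity_kernel \<Psi> x $ i)"
    and kernel_cancelling: "\<And>i. cancelling (\<lambda>x. velocity_kernel \<Psi> x $ i)"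
    and diffusion: "case_I K m c\<^sub>1 \<alpha> \<sigma>"
    and exponents: "0 < \<alpha>" "\<alpha> \<le> 1" "\<sigma> < \<alpha>"

text \<open>\<open>slope_small\<close> lets half of the dissipation absorb the near drift, and
  \<open>drift_small\<close> lets a further quarter absorb the local term and the far drift.\<close>

locale drift_diffusion_modulus = drift_diffusion a \<Psi> K m c\<^sub>1 \<alpha> \<sigma> B + concave_modulus \<omega> p
  for a :: "real^'d::finite" and \<Psi> :: "real^'d \<Rightarrow> real^'d" and K :: "real^'d \<Rightarrow> real"
    and m :: "real \<Rightarrow> real" and c\<^sub>1 \<alpha> \<sigma> B :: real and \<omega> p :: "real \<Rightarrow> real" +
  assumes slope_small: "0 < r \<Longrightarrow> p r * (real CARD('d) * B * c\<^sub>1) \<le> m (1 / r) / 2"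
    and drift_small: "0 < r \<Longrightarrow> p r * drift_const a B * (\<Sum>j. \<omega> (2 ^ j * r) / 2 ^ j)
      \<le> dissipation_const CARD('d) c\<^sub>1 / 4 * m (1 / r) * (\<omega> r - r * p r)"
begin

text \<open>The equations at \<open>x\<close> and \<open>y\<close> are subtracted. The gradients
  coincide, so only the difference of the velocities remains, and it uses up three quarters of
  \<open>D\<close>. Thus the time derivative of \<open>\<theta> t x - \<theta> t y\<close> is at
  most \<open>- D / 4\<close>, while \<open>past\<close> bounds it below by
  \<open>- v\<close>.\<close>

lemma no_touching:
  fixes \<theta> :: "real \<Rightarrow> real^'d \<Rightarrow> real"
  assumes sol: "regularized_solution a \<Psi> K \<theta>\<^sub>0 \<epsilon> \<theta>" and th0: "\<theta>\<^sub>0 \<in> Linf" and eps: "\<epsilon> > 0"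
    and t: "t > 0" and r: "r > 0" and xy: "x \<noteq> y"
    and mod: "\<And>w w'. \<theta> t w - \<theta> t w' \<le> lin_ext \<omega> p r (norm (w - w'))"
    and touch: "\<theta> t x - \<theta> t y = lin_ext \<omega> p r (norm (x - y))"
    and past: "\<forall>\<^sub>F s in at_left t. \<theta> s x - \<theta> s y \<le> \<theta> t x - \<theta> t y + v * (t - s)"
  defines "R \<equiv> max (norm (x - y)) r"
  shows "dissipation_const CARD('d) c\<^sub>1 / 4 * m (1 / R) * (\<omega> R - R * p R) \<le> v"
proof -
  define W where "W = lin_ext \<omega> p r"
  define \<xi> where "\<xi> = norm (x - y)"
  define P where "P = p R"
  define f where "f = \<theta> t"
  have \<xi>: "\<xi> > 0" using xy by (simp add: \<xi>_def)
  have R: "R > 0" "\<xi> \<le> R" "R = max \<xi> r" using \<xi> r by (auto simp: R_def \<xi>_def less_max_iff_disj)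
  have P0: "P \<ge> 0" unfolding P_def by (rule p_nonneg[OF R(1)])
  have sm: "smooth_on ({0<..} \<times> UNIV) (\<lambda>(t, x). \<theta> t x)" using sol by (auto simp: regularized_solution_def)
  note sl = smooth_slice[OF sm t, folded f_def]
  note C0 = solution_C0[OF sol th0 eps]
  note g = case_I_growth[OF diffusion]
  note k = case_I_kernel[OF diffusion exponents]
  have t0: "t \<ge> 0" using t by simp
  obtain M where M: "\<And>w. \<bar>f w\<bar> \<le> M" using C0(3)[OF t0] unfolding f_def by blast
  have modf: "f w - f w' \<le> W (norm (w - w'))" for w w' using mod unfolding f_def W_def .
  define N where "N = (LINT z|lborel. (f z)\<^sup>2)"
  have cl: "mod_class W M N f"
    unfolding mod_class_def
  proof (intro conjI allI)
    show "f \<in> borel_measurable borel" using borel_measurable_continuous_onI[OF C0(1)[OF t0]] unfolding f_def .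
    show "\<bar>f w\<bar> \<le> M" for w by (rule M)
    show "\<bar>f w - f w'\<bar> \<le> W (norm (w - w'))" for w w'
      using modf[of w w'] modf[of w' w] by (simp add: abs_le_iff norm_minus_commute)
    show "(\<integral>\<^sup>+ x. ennreal ((f x)\<^sup>2) \<partial>lborel) \<le> ennreal N"
      using nn_integral_eq_integral[OF C0(2)[OF t0]] by (simp add: N_def f_def)
  qed
  have W0: "mono_on {0..} W" "0 \<le> W 0"
    using lin_ext_mono[OF r] lin_ext_pos(2)[OF r, of 0] by (auto simp: W_def mono_on_def)
  have touchf: "f x - f y = W (norm (x - y))" using touch unfolding f_def W_def .
  have sg: "W s \<le> W \<xi> + P * (s - \<xi>)" for s
    using lin_ext_supergradient[OF r, of s \<xi>] unfolding W_def P_def R(3) .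
  have sumW: "summable (\<lambda>j. W (2 ^ j * norm (x - y)) / 2 ^ j)"
    using lin_ext_dyadic(1)[OF r \<xi>] unfolding W_def \<xi>_def .
  have W2: "W (2 * norm (x - y)) \<le> W (norm (x - y)) + P * norm (x - y)" using sg[of "2 * \<xi>"] by (simp add: \<xi>_def)
  have "\<exists>L\<ge>0. \<forall>z. norm z \<le> 1 \<longrightarrow> \<bar>f (w + z) - f w\<bar> \<le> L * norm z" for w
  proof -
    obtain L where "L \<ge> 0" and L: "\<And>u u'. u \<in> cball w 1 \<Longrightarrow> u' \<in> cball w 1 \<Longrightarrow> \<bar>f u - f u'\<bar> \<le> L * norm (u - u')"
      using C1_Lipschitz_ball[OF sl(1) sl(3), of w] by metis
    then show ?thesis using L[of "w + _" w] by (intro exI[of _ L]) (auto simp: dist_norm)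
  qed
  then obtain L1 where L1: "\<And>w. L1 w \<ge> 0" "\<And>w z. norm z \<le> 1 \<Longrightarrow> \<bar>f (w + z) - f w\<bar> \<le> L1 w * norm z" by metis
  have "\<forall>w. \<exists>L\<ge>0. \<forall>z. norm z \<le> 1 \<longrightarrow> \<bar>f (w + z) + f (w - z) - 2 * f w\<bar> \<le> L * (norm z)\<^sup>2"
    using C2_second_difference[OF sl(1) sl(2) sl(4)] by blast
  then obtain L2 where L2: "\<And>w. L2 w \<ge> 0" "\<And>w z. norm z \<le> 1 \<Longrightarrow> \<bar>f (w + z) + f (w - z) - 2 * f w\<bar> \<le> L2 w * (norm z)\<^sup>2" by metis
  define L where "L = L1 x + L1 y + L2 x + L2 y"
  have LL: "L1 w \<le> L" "L2 w \<le> L" if "w \<in> {x, y}" for w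
    using that L1(1)[of x] L1(1)[of y] L2(1)[of x] L2(1)[of y] unfolding L_def by auto
  have lip: "\<bar>f (w + z) - f w\<bar> \<le> L * norm z" if "w \<in> {x, y}" "norm z \<le> 1" for w z
    using L1(2)[OF that(2), of w] mult_right_mono[OF LL(1)[OF that(1)], of "norm z"] by simp
  have sd: "\<bar>f (w + z) + f (w - z) - 2 * f w\<bar> \<le> L * (norm z)\<^sup>2" if "w \<in> {x, y}" "norm z \<le> 1" for w z
    using L2(2)[OF that(2), of w] mult_right_mono[OF LL(2)[OF that(1)], of "(norm z)\<^sup>2"] by simp
  \<comment> \<open>\<open>\<kappa>0\<close> is the value at \<open>norm z = \<xi>\<close> of the
    lower bound for \<open>K\<close>, and \<open>\<kappa>\<close> is the ratio between the size
    bound of the velocity kernel and that lower bound; both carry the same power of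
    \<open>norm z\<close>.\<close>
  define \<kappa>0 where "\<kappa>0 = m (1 / \<xi>) / c\<^sub>1 / \<xi> ^ CARD('d)"
  define \<kappa> where "\<kappa> = B * c\<^sub>1 / m (1 / \<xi>)"
  have m\<xi>: "m (1 / \<xi>) > 0" using g(5)[of "1 / \<xi>"] \<xi> by simp
  have mR: "m (1 / R) > 0" using g(5)[of "1 / R"] R by simp
  have m\<xi>R: "m (1 / R) \<le> m (1 / \<xi>)" using R \<xi> by (intro g(4)) (auto intro: divide_left_mono)
  have B0: "B \<ge> 0" using kernel_hormander by (simp add: hormander_kernel_def)
  have c1: "c\<^sub>1 \<ge> 1" by (rule k(2))
  have Kz: "m (1 / \<xi>) / c\<^sub>1 / norm z ^ CARD('d) \<le> K z" if "z \<noteq> 0" "norm z \<le> norm (x - y)" for z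
    using k(3)[OF that(1), of \<xi>] that(2) by (simp add: \<xi>_def)
  have Kl: "\<kappa>0 \<le> K z" if "z \<noteq> 0" "norm z \<le> norm (x - y)" for z
  proof -
    have "\<kappa>0 \<le> m (1 / \<xi>) / c\<^sub>1 / norm z ^ CARD('d)" unfolding \<kappa>0_def
      using that m\<xi> c1 xy by (intro divide_left_mono power_mono mult_pos_pos) (auto simp: \<xi>_def intro!: zero_less_power)
    then show ?thesis using Kz[OF that] by simp
  qed
  have kK: "\<bar>velocity_kernel \<Psi> z $ i\<bar> \<le> \<kappa> * K z" if "z \<noteq> 0" "norm z \<le> norm (x - y)" for i z
  proof -
    have "\<bar>velocity_kernel \<Psi> z $ i\<bar> \<le> B / norm z ^ CARD('d)" using kernel_hormander[of i] that by (simp add: hormander_kernel_def)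
    also have "\<dots> = \<kappa> * (m (1 / \<xi>) / c\<^sub>1 / norm z ^ CARD('d))" using m\<xi> c1 by (simp add: \<kappa>_def)
    also have "\<dots> \<le> \<kappa> * K z" using Kz[OF that] B0 c1 m\<xi> by (intro mult_left_mono) (auto simp: \<kappa>_def)
    finally show ?thesis .
  qed
  have \<kappa>s: "\<kappa>0 \<ge> 0" "\<kappa> \<ge> 0" using m\<xi> c1 B0 \<xi> by (auto simp: \<kappa>0_def \<kappa>_def)
  define D where "D = diffusion_op K f x - diffusion_op K f y"
  define Q where "Q = (\<Sum>j. \<omega> (2 ^ j * R) / 2 ^ j)"
  define G where "G = \<omega> R - R * p R"
  define a1 where "a1 = (\<Sum>i\<in>UNIV. \<bar>a $ i\<bar>)"
  define F where "F = far_const TYPE(real^'d) B"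
  define c0 where "c0 = dissipation_const CARD('d) c\<^sub>1"
  note te = touching_estimates[OF kernel_continuous kernel_hormander kernel_cancelling k(1) cl W0 xy touchf sumW W2 lip sd Kl \<kappa>s(1) kK \<kappa>s(2), folded D_def \<xi>_def a1_def F_def]
  have GW: "W \<xi> - P * \<xi> = G" unfolding W_def P_def R(3) G_def by (rule lin_ext_gap)
  have G0: "G > 0" using gap[OF R(1)] by (simp add: G_def)
  have c00: "c0 \<ge> 0" using c1 by (simp add: c0_def dissipation_const_def)
  have "\<kappa>0 * (unit_ball_vol (real CARD('d)) * (\<xi> / 4) ^ CARD('d)) = c0 * m (1 / \<xi>)"
    using \<xi> c1 by (simp add: \<kappa>0_def c0_def dissipation_const_def power_divide field_simps)
  then have D1: "c0 * m (1 / \<xi>) * G \<le> D" using te(1) GW by simp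
  have D2: "c0 * m (1 / R) * G \<le> D"
    using D1 mult_right_mono[OF mult_left_mono[OF m\<xi>R c00], of G] G0 by simp
  have D0: "D \<ge> 0" using D2 c00 mR G0 by (meson less_imp_le mult_nonneg_nonneg order_trans)
  have Q: "W \<xi> \<le> Q" "(\<Sum>j. W (2 ^ j * \<xi>) / 2 ^ j) \<le> Q"
    using lin_ext_dyadic(2,3)[OF r \<xi>] unfolding W_def Q_def R(3) by auto
  have F0: "F \<ge> 0" unfolding F_def far_const_def hormander_const_def using B0 dim_const_pos[where 'a="real^'d"] by simp
  have a10: "a1 \<ge> 0" unfolding a1_def by (intro sum_nonneg) auto
  have A: "drift_const a B = a1 + real CARD('d) * F" by (simp add: drift_const_def a1_def F_def)
  have gr: "gradient f x = P *\<^sub>R sgn (x - y)" "gradient f y = P *\<^sub>R sgn (x - y)"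
  proof -
    have mx: "f w - f w' \<le> (f x - f y) + P * (norm (w - w') - norm (x - y))" for w w'
      using modf[of w w'] sg[of "norm (w - w')"] touchf by (simp add: \<xi>_def)
    show "gradient f x = P *\<^sub>R sgn (x - y)" "gradient f y = P *\<^sub>R sgn (x - y)"
      using gradient_at_touching[OF sl(1) xy mx] by blast+
  qed
  define gg where "gg = P *\<^sub>R sgn (x - y)"
  have ng: "norm gg = P" using P0 xy by (simp add: gg_def norm_sgn)
  have lap: "laplacian f x \<le> laplacian f y"
  proof (rule laplacian_difference_nonpos[OF sl(1) sl(2)])
    show "f (x + h) - f (y + h) \<le> f x - f y" for h using modf[of "x + h" "y + h"] touchf by simp
  qed
  define ux where "ux = velocity_op a \<Psi> f x"
  define uy where "uy = velocity_op a \<Psi> f y"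
  have pde: "deriv (\<lambda>\<tau>. \<theta> \<tau> w) t + velocity_op a \<Psi> f w \<bullet> gradient f w + diffusion_op K f w - \<epsilon> * laplacian f w = 0" for w
    using sol t unfolding regularized_solution_def f_def by blast
  have e: "deriv (\<lambda>\<tau>. \<theta> \<tau> x) t - deriv (\<lambda>\<tau>. \<theta> \<tau> y) t = - ((ux - uy) \<bullet> gg) - D + \<epsilon> * (laplacian f x - laplacian f y)"
    using pde[of x] pde[of y] unfolding gr gg_def[symmetric] ux_def[symmetric] uy_def[symmetric] D_def by (simp add: algebra_simps)
  have el: "\<epsilon> * (laplacian f x - laplacian f y) \<le> 0" using lap eps by (simp add: mult_le_0_iff)
  have u: "\<bar>(ux - uy) \<bullet> gg\<bar> \<le> P * (a1 * W \<xi> + real CARD('d) * (\<kappa> * D + F * (\<Sum>j. W (2 ^ j * \<xi>) / 2 ^ j)))"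
    using te(2)[where a=a and g=gg] unfolding ng ux_def uy_def a1_def .
  have u2: "P * (a1 * W \<xi> + real CARD('d) * (\<kappa> * D + F * (\<Sum>j. W (2 ^ j * \<xi>) / 2 ^ j)))
      \<le> P * (a1 * Q + real CARD('d) * (\<kappa> * D + F * Q))"
    using P0 a10 F0 Q \<kappa>s D0 by (intro mult_left_mono add_mono) auto
  \<comment> \<open>The smallness conditions are imposed at \<open>R\<close>, whereas
    \<open>\<kappa>\<close> involves \<open>m (1 / \<xi>)\<close>; monotonicity of \<open>m\<close>
    and \<open>\<xi> \<le> R\<close> connect the two.\<close>
  have "P * (real CARD('d) * B * c\<^sub>1) \<le> m (1 / \<xi>) / 2" using slope_small[OF R(1)] m\<xi>R unfolding P_def by linarith
  then have "P * real CARD('d) * \<kappa> \<le> 1 / 2" using m\<xi> by (simp add: \<kappa>_def divide_simps mult.assoc)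
  then have u3: "P * real CARD('d) * \<kappa> * D \<le> D / 2" using mult_right_mono[OF _ D0] by fastforce
  have "P * drift_const a B * Q \<le> c0 / 4 * m (1 / R) * G"
    using drift_small[OF R(1)] unfolding P_def Q_def c0_def G_def .
  then have u4: "P * (a1 + real CARD('d) * F) * Q \<le> D / 4" using D2 unfolding A by simp
  have "P * (a1 * Q + real CARD('d) * (\<kappa> * D + F * Q)) = P * real CARD('d) * \<kappa> * D + P * (a1 + real CARD('d) * F) * Q"
    by (simp add: algebra_simps)
  then have "- ((ux - uy) \<bullet> gg) \<le> D / 2 + D / 4" using u u2 u3 u4 by linarith
  then have e2: "deriv (\<lambda>\<tau>. \<theta> \<tau> x) t - deriv (\<lambda>\<tau>. \<theta> \<tau> y) t \<le> - (D / 4)" using e el by linarith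
  have "((\<lambda>s. \<theta> s x - \<theta> s y) has_real_derivative deriv (\<lambda>\<tau>. \<theta> \<tau> x) t - deriv (\<lambda>\<tau>. \<theta> \<tau> y) t) (at t)"
    by (intro DERIV_diff sl(5))
  from derivative_lower_bound[OF this past] have "- v \<le> deriv (\<lambda>\<tau>. \<theta> \<tau> x) t - deriv (\<lambda>\<tau>. \<theta> \<tau> y) t" .
  then have "c0 * m (1 / R) * G \<le> 4 * v" using e2 D2 by linarith
  then show ?thesis by (simp add: c0_def G_def)
qed

end

section \<open>Persistence of the moving modulus and arrival at \<omega>\<close>

context drift_diffusion_modulus
begin

lemma gap_mono: "0 < r \<Longrightarrow> r \<le> s \<Longrightarrow> \<omega> r - r * p r \<le> \<omega> s - s * p s"
proof -
  assume r: "0 < r" "r \<le> s"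
  have "r * p s \<le> r * p r" using p_antimono[OF r] r by (intro mult_left_mono) auto
  moreover have "\<omega> r \<le> \<omega> s + r * p s - s * p s" using supergradient[of s r] r by (simp add: algebra_simps)
  ultimately show ?thesis by linarith
qed

lemma dissipation_pos: "r > 0 \<Longrightarrow> 0 < dissipation_const CARD('d) c\<^sub>1 / 4 * m (1 / r) * (\<omega> r - r * p r)"
  using case_I_kernel(2)[OF diffusion exponents] case_I_growth(5)[OF diffusion, of "1 / r"] gap[of r]
  by (simp add: dissipation_const_def)

text \<open>The set of violating times and pairs of points is compact, so if it is nonempty it
  contains an earliest one. \<open>init\<close> excludes time 0, and \<open>speed\<close> makes
  \<open>no_touching\<close> contradictory at any later time.\<close>

theorem modulus_preserved:
  fixes \<theta> :: "real \<Rightarrow> real^'d \<Rightarrow> real"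
  assumes sol: "regularized_solution a \<Psi> K \<theta>\<^sub>0 \<epsilon> \<theta>" and th0: "\<theta>\<^sub>0 \<in> Linf" and eps: "\<epsilon> > 0"
    and cont_\<rho>: "continuous_on {0..T} \<rho>" and pos_\<rho>: "\<And>t. t \<in> {0..T} \<Longrightarrow> 0 < \<rho> t"
    and anti_\<rho>: "\<And>s t. 0 \<le> s \<Longrightarrow> s \<le> t \<Longrightarrow> t \<le> T \<Longrightarrow> \<rho> t \<le> \<rho> s"
    and speed: "\<And>t. 0 < t \<Longrightarrow> t \<le> T \<Longrightarrow> \<exists>v. v < dissipation_const CARD('d) c\<^sub>1 / 4 * m (1 / \<rho> t) * (\<omega> (\<rho> t) - \<rho> t * p (\<rho> t))
      \<and> (\<forall>\<^sub>F s in at_left t. (p (\<rho> t) - p (\<rho> s)) * \<rho> s \<le> v * (t - s))"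
    and init: "2 * Linf_norm \<theta>\<^sub>0 < \<omega> (\<rho> 0) - \<rho> 0 * p (\<rho> 0)"
    and t: "t \<in> {0..T}"
  shows "\<theta> t x - \<theta> t y < lin_ext \<omega> p (\<rho> t) (norm (x - y))"
proof (rule ccontr)
  assume viol: "\<not> ?thesis"
  have T: "0 \<le> T" using t by simp
  define Dom where "Dom = {0..T} \<times> (UNIV :: ((real^'d) \<times> (real^'d)) set)"
  define h where "h z = lin_ext \<omega> p (\<rho> (fst z)) (norm (fst (snd z) - snd (snd z))) - (\<theta> (fst z) (fst (snd z)) - \<theta> (fst z) (snd (snd z)))" for z :: "real \<times> (real^'d) \<times> (real^'d)"
  have jc: "continuous_on ({0..} \<times> UNIV) (\<lambda>(t, x). \<theta> t x)" by (rule solution_jointly_continuous[OF sol th0 eps])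
  have th1: "continuous_on Dom (\<lambda>z. \<theta> (fst z) (fst (snd z)))"
  proof -
    have "continuous_on Dom (\<lambda>z. (fst z, fst (snd z)))" "(\<lambda>z. (fst z, fst (snd z))) ` Dom \<subseteq> {0..} \<times> UNIV"
      by (auto simp: Dom_def intro!: continuous_intros)
    from continuous_on_compose2[OF jc this] show ?thesis by simp
  qed
  have th2: "continuous_on Dom (\<lambda>z. \<theta> (fst z) (snd (snd z)))"
  proof -
    have "continuous_on Dom (\<lambda>z. (fst z, snd (snd z)))" "(\<lambda>z. (fst z, snd (snd z))) ` Dom \<subseteq> {0..} \<times> UNIV"
      by (auto simp: Dom_def intro!: continuous_intros)
    from continuous_on_compose2[OF jc this] show ?thesis by simp
  qed
  have \<rho>c: "continuous_on Dom (\<lambda>z. \<rho> (fst z))"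
    by (rule continuous_on_compose2[OF cont_\<rho>]) (auto simp: Dom_def intro!: continuous_intros)
  have \<rho>0: "0 < \<rho> (fst z)" if "z \<in> Dom" for z using that pos_\<rho> by (auto simp: Dom_def)
  \<comment> \<open>The formula of \<open>lin_ext\<close> with \<open>max\<close> makes joint
    continuity in time and both points immediate: \<omega> and \<open>p\<close> are only evaluated
    at positive arguments.\<close>
  have hc: "continuous_on Dom h"
    unfolding h_def lin_ext_def
    by (intro continuous_intros th1 th2 \<rho>c continuous_on_compose2[OF cont_\<omega>] continuous_on_compose2[OF cont_p])
       (auto simp: less_max_iff_disj dest: \<rho>0)
  define S where "S = Dom \<inter> h -` {..0}"
  have "closed Dom" unfolding Dom_def by (intro closed_Times) auto
  then have clS: "closed S" unfolding S_def by (intro continuous_closed_preimage hc) auto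
  have \<rho>T: "\<rho> T > 0" using pos_\<rho> T by simp
  \<comment> \<open>A common positive floor for all extensions on \<open>{0..T}\<close>: the
    intercept does not decrease as the radius grows, and \<open>\<rho>\<close> is smallest at
    \<open>T\<close>.\<close>
  define o_min where "o_min = \<omega> (\<rho> T) - \<rho> T * p (\<rho> T)"
  have o_min: "o_min > 0" using gap[OF \<rho>T] by (simp add: o_min_def)
  have low: "o_min \<le> lin_ext \<omega> p (\<rho> s) (norm w)" if "s \<in> {0..T}" for s and w :: "real^'d"
    using lin_ext_pos(1)[OF pos_\<rho>[OF that], of "norm w"] gap_mono[OF \<rho>T anti_\<rho>[of s T]] that by (auto simp: o_min_def)
  have "o_min / 2 > 0" using o_min by simp
  from solution_uniform[OF sol th0 eps this, of T] obtain N M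
    where NM: "\<And>s w. s \<in> {0..T} \<Longrightarrow> \<bar>\<theta> s w\<bar> \<le> M" "\<And>s w. s \<in> {0..T} \<Longrightarrow> norm w \<ge> N \<Longrightarrow> \<bar>\<theta> s w\<bar> < o_min / 2" by blast
  obtain N' where N': "\<And>\<xi> r. \<xi> \<ge> N' \<Longrightarrow> r > 0 \<Longrightarrow> 2 * M < lin_ext \<omega> p r \<xi>" using lin_ext_tends_to_infinity by blast
  define R where "R = \<bar>N\<bar> + \<bar>N'\<bar>"
  \<comment> \<open>If both points are far out, both values of the solution are below half the
    floor. Otherwise one point is far out and the other not, so their distance is large and the
    extension exceeds twice the sup bound.\<close>
  have far: "h (s, w, w') > 0" if s: "s \<in> {0..T}" and w: "norm w > R \<or> norm w' > R" for s w w'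
  proof (cases "norm w \<ge> N \<and> norm w' \<ge> N")
    case True
    then show ?thesis using NM(2)[OF s, of w] NM(2)[OF s, of w'] low[OF s, of "w - w'"] by (simp add: h_def)
  next
    case False
    then have "norm (w - w') \<ge> N'" using w norm_triangle_ineq2[of w w'] norm_triangle_ineq2[of w' w] unfolding R_def norm_minus_commute[of w' w] by linarith
    then have "2 * M < lin_ext \<omega> p (\<rho> s) (norm (w - w'))" using pos_\<rho>[OF s] by (rule N')
    then show ?thesis using NM(1)[OF s, of w] NM(1)[OF s, of w'] by (simp add: h_def)
  qed
  have "S \<subseteq> {0..T} \<times> cball 0 R \<times> cball 0 R"
  proof
    fix z assume z: "z \<in> S"
    obtain s w w' where zz: "z = (s, w, w')" by (cases z)
    have "s \<in> {0..T}" "h (s, w, w') \<le> 0" using z by (auto simp: S_def Dom_def zz)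
    moreover from this have "\<not> (norm w > R \<or> norm w' > R)" using far[of s w w'] by linarith
    ultimately show "z \<in> {0..T} \<times> cball 0 R \<times> cball 0 R" by (simp add: zz)
  qed
  moreover have "compact ({0..T} \<times> cball (0::real^'d) R \<times> cball (0::real^'d) R)" by (intro compact_Times) auto
  ultimately have cS: "compact S" using clS by (meson bounded_subset compact_eq_bounded_closed)
  have "(t, x, y) \<in> S" using viol t by (auto simp: S_def Dom_def h_def)
  then have "S \<noteq> {}" by blast
  moreover have "continuous_on S fst" by (intro continuous_intros)
  ultimately obtain z where z: "z \<in> S" "\<And>z'. z' \<in> S \<Longrightarrow> fst z \<le> fst z'"
    using continuous_attains_inf[OF cS, of fst] by blast
  obtain \<tau> u w where zz: "z = (\<tau>, u, w)" by (cases z)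
  have \<tau>: "0 \<le> \<tau>" "\<tau> \<le> T" and h0: "h (\<tau>, u, w) \<le> 0" using z(1) by (auto simp: S_def Dom_def zz)
  have past: "h (s, v, v') > 0" if "0 \<le> s" "s < \<tau>" for s v v'
    using z(2)[of "(s, v, v')"] that \<tau> by (force simp: S_def Dom_def zz)
  have "\<tau> \<noteq> 0"
  proof
    assume "\<tau> = 0"
    then have "lin_ext \<omega> p (\<rho> 0) (norm (u - w)) \<le> 2 * Linf_norm \<theta>\<^sub>0"
      using h0 solution_C0(6)[OF sol th0 eps, of u] solution_C0(6)[OF sol th0 eps, of w] by (simp add: h_def)
    then show False using init lin_ext_pos(1)[of "\<rho> 0" "norm (u - w)"] pos_\<rho>[of 0] T by simp
  qed
  then have \<tau>0: "\<tau> > 0" using \<tau> by simp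
  have now: "h (\<tau>, v, v') \<ge> 0" for v v'
  proof (rule tendsto_lowerbound)
    have "continuous_on {0..T} (\<lambda>s. h (s, v, v'))"
      by (rule continuous_on_compose2[OF hc]) (auto simp: Dom_def intro!: continuous_intros)
    then have "((\<lambda>s. h (s, v, v')) \<longlongrightarrow> h (\<tau>, v, v')) (at \<tau> within {0..T})"
      using \<tau> by (simp add: continuous_on_def)
    then show "((\<lambda>s. h (s, v, v')) \<longlongrightarrow> h (\<tau>, v, v')) (at \<tau> within {0..<\<tau>})"
      by (rule tendsto_within_subset) (use \<tau> in auto)
    show "\<forall>\<^sub>F s in at \<tau> within {0..<\<tau>}. 0 \<le> h (s, v, v')"
      using past by (auto simp: eventually_at_filter less_imp_le)
    show "at \<tau> within {0..<\<tau>} \<noteq> bot"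
      using islimpt_greaterThanLessThan2[OF \<tau>0] by (auto simp: trivial_limit_within intro: islimpt_subset)
  qed
  have r: "\<rho> \<tau> > 0" using pos_\<rho> \<tau> by simp
  have touch: "\<theta> \<tau> u - \<theta> \<tau> w = lin_ext \<omega> p (\<rho> \<tau>) (norm (u - w))"
    using now[of u w] h0 by (simp add: h_def)
  have uw: "u \<noteq> w" using touch lin_ext_pos(2)[OF r, of 0] by auto
  have mod: "\<theta> \<tau> v - \<theta> \<tau> v' \<le> lin_ext \<omega> p (\<rho> \<tau>) (norm (v - v'))" for v v' using now[of v v'] by (simp add: h_def)
  note nt = no_touching[OF sol th0 eps \<tau>0 r uw mod touch]
  have ev: "\<forall>\<^sub>F s in at_left \<tau>. s \<in> {0<..<\<tau>}" by (rule eventually_at_left_real[OF \<tau>0])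
  show False
  \<comment> \<open>Within the linear part the extension falls in time, at a rate controlled by
    \<open>speed\<close>. Beyond it, continuity of \<open>\<rho>\<close> shows that shortly before
    \<open>\<tau>\<close> the extension at this distance is already \<omega> and does not move, so
    \<open>v = 0\<close> contradicts the positivity of the dissipation.\<close>
  proof (cases "norm (u - w) \<le> \<rho> \<tau>")
    case True
    obtain v where v: "v < dissipation_const CARD('d) c\<^sub>1 / 4 * m (1 / \<rho> \<tau>) * (\<omega> (\<rho> \<tau>) - \<rho> \<tau> * p (\<rho> \<tau>))"
      and evv: "\<forall>\<^sub>F s in at_left \<tau>. (p (\<rho> \<tau>) - p (\<rho> s)) * \<rho> s \<le> v * (\<tau> - s)" using speed[OF \<tau>0 \<tau>(2)] by blast
    have "\<forall>\<^sub>F s in at_left \<tau>. \<theta> s u - \<theta> s w \<le> \<theta> \<tau> u - \<theta> \<tau> w + v * (\<tau> - s)"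
      using ev evv
    proof eventually_elim
      case (elim s)
      then have s: "0 < s" "s < \<tau>" by auto
      have "lin_ext \<omega> p (\<rho> s) (norm (u - w)) - lin_ext \<omega> p (\<rho> \<tau>) (norm (u - w)) \<le> (p (\<rho> \<tau>) - p (\<rho> s)) * \<rho> s"
        by (rule lin_ext_time[OF r anti_\<rho>]) (use s \<tau> in auto)
      moreover have "\<theta> s u - \<theta> s w < lin_ext \<omega> p (\<rho> s) (norm (u - w))" using past[of s u w] s by (simp add: h_def)
      ultimately show ?case using elim(2) touch by simp
    qed
    from nt[OF this] v True show False by (simp add: max_def split: if_splits)
  next
    case False
    have "(\<rho> \<longlongrightarrow> \<rho> \<tau>) (at \<tau> within {0..T})" using cont_\<rho> \<tau> by (simp add: continuous_on_def)
    then have "(\<rho> \<longlongrightarrow> \<rho> \<tau>) (at \<tau> within {0<..<\<tau>})" by (rule tendsto_within_subset) (use \<tau> in auto)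
    moreover have "at \<tau> within {0<..<\<tau>} = at_left \<tau>"
      by (rule at_within_nhd[of \<tau> "{0<..}"]) (use \<tau>0 in auto)
    ultimately have "\<forall>\<^sub>F s in at_left \<tau>. \<rho> s < norm (u - w)" using False by (intro order_tendstoD(2)[of \<rho> "\<rho> \<tau>"]) auto
    with ev have "\<forall>\<^sub>F s in at_left \<tau>. \<theta> s u - \<theta> s w \<le> \<theta> \<tau> u - \<theta> \<tau> w + 0 * (\<tau> - s)"
    proof eventually_elim
      case (elim s)
      have "\<theta> s u - \<theta> s w < lin_ext \<omega> p (\<rho> s) (norm (u - w))" using past[of s u w] elim by (simp add: h_def)
      also have "lin_ext \<omega> p (\<rho> s) (norm (u - w)) = lin_ext \<omega> p (\<rho> \<tau>) (norm (u - w))"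
        using lin_ext_cases(2)[of "\<rho> s" "norm (u - w)"] lin_ext_cases(2)[of "\<rho> \<tau>" "norm (u - w)"] elim False by simp
      finally show ?case using touch by simp
    qed
    from nt[OF this] dissipation_pos[of "norm (u - w)"] uw False show False by (simp add: max_def split: if_splits)
  qed
qed

end

lemma powr_diff_le:
  fixes x y q :: real
  assumes "0 < y" "y \<le> x" "1 \<le> q"
  shows "x powr q - y powr q \<le> q * x powr (q - 1) * (x - y)"
proof (cases "x = y")
  case False
  then have "y < x" using assms by simp
  moreover have "((\<lambda>z. z powr q) has_real_derivative q * z powr (q - 1)) (at z)" if "y \<le> z" for z
    using that assms by (auto intro!: derivative_eq_intros)
  ultimately obtain z where z: "y < z" "z < x" "x powr q - y powr q = (x - y) * (q * z powr (q - 1))"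
    using MVT2[of y x "\<lambda>z. z powr q" "\<lambda>z. q * z powr (q - 1)"] by blast
  have "z powr (q - 1) \<le> x powr (q - 1)" using z assms by (intro powr_mono2) auto
  then have "(x - y) * (q * z powr (q - 1)) \<le> (x - y) * (q * x powr (q - 1))"
    using assms by (intro mult_left_mono) auto
  then show ?thesis using z(3) by (simp add: mult.commute)
qed simp

context drift_diffusion_modulus
begin

text \<open>For a given pair of points the radius travels from \<open>R\<close> to a value at most
  \<open>norm (x - y)\<close>, where the extension equals \<omega>. The path depends on the pair,
  but the travel time is at most \<open>R powr \<mu> / k\<close>, the left-hand side of the
  hypothesis on \<open>t\<close>. \<open>L\<close> bounds the growth of the slope as the radius
  shrinks, and so the rate at which the extension falls.\<close>

theorem eventual_modulus:
  fixes \<theta> :: "real \<Rightarrow> real^'d \<Rightarrow> real"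
  assumes sol: "regularized_solution a \<Psi> K \<theta>\<^sub>0 \<epsilon> \<theta>" and th0: "\<theta>\<^sub>0 \<in> Linf" and eps: "\<epsilon> > 0"
    and \<sigma>: "\<sigma> \<ge> 0"
    and L: "L > 0" "\<And>r s. 0 < r \<Longrightarrow> r \<le> s \<Longrightarrow> p r - p s \<le> L * (\<omega> r - r * p r) / r\<^sup>2 * (s - r)"
    and R: "R > 0" and init: "2 * Linf_norm \<theta>\<^sub>0 < \<omega> R - R * p R"
    and t: "8 * L / (dissipation_const CARD('d) c\<^sub>1 * (\<alpha> - \<sigma>) * m (1 / R)) \<le> t"
    and xy: "x \<noteq> y"
  shows "\<theta> t x - \<theta> t y \<le> \<omega> (norm (x - y))"
proof -
  define \<mu> where "\<mu> = \<alpha> - \<sigma>"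
  define c0 where "c0 = dissipation_const CARD('d) c\<^sub>1"
  \<comment> \<open>\<open>\<rho> powr \<mu>\<close> decreases at the rate \<open>k\<close>; since \<open>m (1 / r) * r powr \<mu>\<close> is non-increasing in \<open>r\<close>, the rate
    admissible at \<open>R\<close> is admissible at all smaller radii.\<close>
  define k where "k = c0 * \<mu> * m (1 / R) * R powr \<mu> / (8 * L)"
  \<comment> \<open>The path stops at a positive radius, as \<open>modulus_preserved\<close>
    requires; any radius not exceeding \<open>norm (x - y)\<close> will do.\<close>
  define \<eta> where "\<eta> = min R (norm (x - y))"
  define Y where "Y t = max (R powr \<mu> - k * t) (\<eta> powr \<mu>)" for t
  define \<rho> where "\<rho> t = Y t powr (1 / \<mu>)" for t
  have \<mu>: "0 < \<mu>" "\<mu> \<le> 1" using exponents \<sigma> by (auto simp: \<mu>_def)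
  have \<eta>: "0 < \<eta>" "\<eta> \<le> R" using R xy by (auto simp: \<eta>_def)
  have c0: "c0 > 0" using case_I_kernel(2)[OF diffusion exponents] by (simp add: c0_def dissipation_const_def)
  have mR: "m (1 / R) > 0" using case_I_growth(5)[OF diffusion] R by simp
  have k: "k > 0" using c0 \<mu> mR R L by (simp add: k_def)
  have T: "t \<ge> R powr \<mu> / k" "t \<ge> 0"
  proof -
    have "R powr \<mu> / k = 8 * L / (c0 * \<mu> * m (1 / R))" using R by (simp add: k_def)
    then show 1: "t \<ge> R powr \<mu> / k" using t by (simp add: c0_def \<mu>_def)
    show "t \<ge> 0" using 1 k R by (meson divide_nonneg_pos order_trans powr_ge_zero)
  qed
  have Y: "Y s > 0" for s using \<eta> by (auto simp: Y_def less_max_iff_disj)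
  have Yc: "continuous_on A Y" for A unfolding Y_def by (intro continuous_intros)
  have Ya: "Y u \<le> Y s" "Y s - Y u \<le> k * (u - s)" if "s \<le> u" for s u
  proof -
    have "k * s \<le> k * u" using that k by simp
    then show "Y u \<le> Y s" "Y s - Y u \<le> k * (u - s)" unfolding Y_def right_diff_distrib by linarith+
  qed
  have \<rho>0: "\<rho> 0 = R" using \<eta> \<mu> R powr_mono2[of \<mu> \<eta> R] by (simp add: \<rho>_def Y_def max_def powr_powr)
  have \<rho>t: "\<rho> t = \<eta>"
  proof -
    have "R powr \<mu> \<le> k * t" using T(1) k by (simp add: pos_divide_le_eq mult.commute)
    moreover have "0 \<le> \<eta> powr \<mu>" by simp
    ultimately have "Y t = \<eta> powr \<mu>" unfolding Y_def by linarith
    then show ?thesis using \<eta> \<mu> by (simp add: \<rho>_def powr_powr)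
  qed
  have \<rho>pos: "\<rho> s > 0" for s using Y[of s] by (simp add: \<rho>_def)
  have \<rho>c: "continuous_on A \<rho>" for A unfolding \<rho>_def
    by (intro continuous_on_powr Yc continuous_on_const) (metis Y less_irrefl)
  have \<rho>a: "\<rho> u \<le> \<rho> s" if "s \<le> u" for s u
    unfolding \<rho>_def using Ya(1)[OF that] Y[of u] \<mu> by (intro powr_mono2) auto
  have \<rho>d: "\<rho> s - \<rho> u \<le> k / \<mu> * \<rho> s powr (1 - \<mu>) * (u - s)" if "s \<le> u" for s u
  proof -
    have "\<rho> s - \<rho> u \<le> 1 / \<mu> * Y s powr (1 / \<mu> - 1) * (Y s - Y u)"
      unfolding \<rho>_def by (rule powr_diff_le[OF Y Ya(1)[OF that]]) (use \<mu> in simp)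
    also have "\<dots> \<le> 1 / \<mu> * Y s powr (1 / \<mu> - 1) * (k * (u - s))"
      using \<mu> by (intro mult_left_mono Ya(2)[OF that]) auto
    also have "Y s powr (1 / \<mu> - 1) = \<rho> s powr (1 - \<mu>)"
      using \<mu> by (simp add: \<rho>_def powr_powr diff_divide_distrib)
    finally show ?thesis by (simp add: mult_ac)
  qed
  have main: "\<theta> t x - \<theta> t y < lin_ext \<omega> p (\<rho> t) (norm (x - y))"
  proof (rule modulus_preserved[OF sol th0 eps, where T=t])
    show "continuous_on {0..t} \<rho>" by (rule \<rho>c)
    show "0 < \<rho> s" for s by (rule \<rho>pos)
    show "\<rho> u \<le> \<rho> s" if "s \<le> u" for s u by (rule \<rho>a[OF that])
    show "2 * Linf_norm \<theta>\<^sub>0 < \<omega> (\<rho> 0) - \<rho> 0 * p (\<rho> 0)" using init by (simp add: \<rho>0)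
    show "t \<in> {0..t}" using T by simp
    fix u :: real assume u: "0 < u" "u \<le> t"
    define r where "r = \<rho> u"
    define G where "G = \<omega> r - r * p r"
    have r: "r > 0" "r \<le> R" using \<rho>pos \<rho>a[of 0 u] u by (auto simp: r_def \<rho>0)
    have G: "G > 0" using gap[OF r(1)] by (simp add: G_def)
    have mr: "m (1 / r) > 0" using case_I_growth(5)[OF diffusion] r by simp
    have grow: "m (1 / R) * R powr \<mu> \<le> m (1 / r) * r powr \<mu>"
    proof -
      have "m (1 / R) * (1 / r) powr (\<alpha> - \<sigma>) \<le> m (1 / r) * (1 / R) powr (\<alpha> - \<sigma>)"
        using r R by (intro case_I_growth(3)[OF diffusion]) (auto intro: divide_left_mono)
      then show ?thesis using r R by (simp add: \<mu>_def[symmetric] powr_divide divide_simps mult_ac)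
    qed
    have "((\<lambda>s. \<rho> s powr (2 - \<mu>)) \<longlongrightarrow> r powr (2 - \<mu>)) (at_left u)"
    proof -
      have "(\<rho> \<longlongrightarrow> \<rho> u) (at u)" using \<rho>c[of UNIV] by (simp add: continuous_on_def)
      then have "(\<rho> \<longlongrightarrow> \<rho> u) (at_left u)" by (rule tendsto_within_subset) simp
      then show ?thesis unfolding r_def by (rule tendsto_powr) (use \<rho>pos[of u] in auto)
    qed
    moreover have "r powr (2 - \<mu>) < 3 / 2 * r powr (2 - \<mu>)" using r by simp
    ultimately have ev: "\<forall>\<^sub>F s in at_left u. \<rho> s powr (2 - \<mu>) < 3 / 2 * r powr (2 - \<mu>)" by (rule order_tendstoD(2))
    \<comment> \<open>\<open>\<rho> s powr (2 - \<mu>)\<close> is replaced by its value at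
      \<open>u\<close> at the price of a factor 3/2, which continuity allows shortly before
      \<open>u\<close>. With the 1/8 in \<open>k\<close> this gives 3/16, strictly below the
      permitted 1/4.\<close>
    define v where "v = 3 / 16 * c0 * m (1 / r) * G"
    have "\<forall>\<^sub>F s in at_left u. (p r - p (\<rho> s)) * \<rho> s \<le> v * (u - s)"
      using ev eventually_at_left_real[of "u - 1" u, simplified]
    proof eventually_elim
      case (elim s)
      then have s: "s < u" by simp
      define w where "w = \<rho> s"
      have w: "w > 0" "r \<le> w" using \<rho>pos \<rho>a[of s u] s by (auto simp: w_def r_def)
      have "(p r - p w) * w \<le> L * G / r\<^sup>2 * (w - r) * w"
        using L(2)[OF r(1) w(2)] w unfolding G_def by (intro mult_right_mono) auto
      also have "\<dots> = L * G / r\<^sup>2 * w * (w - r)" by simp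
      also have "\<dots> \<le> L * G / r\<^sup>2 * w * (k / \<mu> * w powr (1 - \<mu>) * (u - s))"
        using \<rho>d[of s u] s L(1) G w by (intro mult_left_mono) (auto simp: w_def r_def)
      also have "\<dots> = L * G / r\<^sup>2 * (k / \<mu>) * w powr (2 - \<mu>) * (u - s)"
      proof -
        have "w powr (2 - \<mu>) = w * w powr (1 - \<mu>)" using w powr_add[of w 1 "1 - \<mu>"] by simp
        then show ?thesis by simp
      qed
      also have "\<dots> \<le> L * G / r\<^sup>2 * (k / \<mu>) * (3 / 2 * r powr (2 - \<mu>)) * (u - s)"
        using elim s L(1) G k \<mu> by (intro mult_right_mono mult_left_mono) (auto simp: w_def)
      also have "\<dots> = 3 / 16 * c0 * G * (m (1 / R) * R powr \<mu> * (r powr (2 - \<mu>) / r\<^sup>2)) * (u - s)"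
        using L(1) \<mu> by (simp add: k_def)
      also have "r powr (2 - \<mu>) / r\<^sup>2 = r powr - \<mu>"
        using r by (simp add: powr_diff powr_minus_divide)
      also have "3 / 16 * c0 * G * (m (1 / R) * R powr \<mu> * r powr - \<mu>) * (u - s) \<le> 3 / 16 * c0 * G * (m (1 / r) * r powr \<mu> * r powr - \<mu>) * (u - s)"
        using grow c0 G s by (intro mult_right_mono mult_left_mono) auto
      also have "m (1 / r) * r powr \<mu> * r powr - \<mu> = m (1 / r)" using r by (simp add: powr_minus)
      finally show ?case by (simp add: v_def w_def mult_ac)
    qed
    moreover have "v < c0 / 4 * m (1 / r) * G" using c0 mr G by (simp add: v_def)
    ultimately show "\<exists>v. v < dissipation_const CARD('d) c\<^sub>1 / 4 * m (1 / \<rho> u) * (\<omega> (\<rho> u) - \<rho> u * p (\<rho> u))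
      \<and> (\<forall>\<^sub>F s in at_left u. (p (\<rho> u) - p (\<rho> s)) * \<rho> s \<le> v * (u - s))"
      unfolding c0_def r_def G_def by blast
  qed
  have "lin_ext \<omega> p (\<rho> t) (norm (x - y)) = \<omega> (norm (x - y))" by (rule lin_ext_cases(2)) (simp add: \<rho>t \<eta>_def)
  then show ?thesis using main by simp
qed

end

subsection \<open>The moduli\<close>

text \<open>The reciprocal of a sum that dominates both demands: with \<open>c2\<close> for this
  constant, \<open>8 * c2 * drift_const\<close> is at most \<open>dissipation_const\<close> and
  \<open>2 * c2 * (d * B * c\<^sub>1)\<close> is at most 1. The summand 1 keeps the denominator
  positive.\<close>

definition modulus_const :: "real^'d::finite \<Rightarrow> real \<Rightarrow> real \<Rightarrow> real" where
  "modulus_const a B c\<^sub>1 = 1 / (8 * drift_const a B / dissipation_const CARD('d) c\<^sub>1 + 2 * (real CARD('d) * B * c\<^sub>1) + 1)"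

section \<open>A smallness criterion for moduli\<close>

lemma powr_two_bound:
  fixes b :: real
  assumes "0 \<le> b" "b \<le> 1"
  shows "2 powr b \<le> 1 + b"
  using convex_onD[OF exp_convex, of b 0 "ln 2"] assms by (simp add: powr_def)

lemma power_growth_bound:
  fixes \<omega> p :: "real \<Rightarrow> real"
  assumes d: "\<And>r. 0 < r \<Longrightarrow> (\<omega> has_real_derivative p r) (at r)"
    and r: "0 < r" "r \<le> s" and growth: "\<And>s. r \<le> s \<Longrightarrow> s * p s \<le> b * \<omega> s"
  shows "\<omega> s * r powr b \<le> \<omega> r * s powr b"
proof -
  have "\<omega> s * s powr (- b) \<le> \<omega> r * r powr (- b)"
  proof (rule DERIV_nonpos_imp_nonincreasing[OF r(2)])
    fix x assume "r \<le> x" "x \<le> s"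
    then have x: "x > 0" using r by simp
    have "((\<lambda>s. \<omega> s * s powr (- b)) has_real_derivative (x * p x - b * \<omega> x) * x powr (- b - 1)) (at x)"
      using x by (auto intro!: derivative_eq_intros d simp: powr_diff field_simps)
    moreover have "(x * p x - b * \<omega> x) * x powr (- b - 1) \<le> 0"
      using growth[OF \<open>r \<le> x\<close>] by (intro mult_nonpos_nonneg) auto
    ultimately show "\<exists>y. ((\<lambda>s. \<omega> s * s powr (- b)) has_real_derivative y) (at x) \<and> y \<le> 0" by blast
  qed
  then show ?thesis using r by (simp add: powr_minus field_simps)
qed

text \<open>The growth condition makes \<open>\<omega> s / s powr b\<close> non-increasing, so the
  terms decay at least like a geometric series of ratio \<open>2 powr b / 2\<close>. By convexity
  this is at most \<open>(1 + b) / 2\<close>, whence the factor \<open>2 / (1 - b)\<close>.\<close>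

lemma dyadic_growth_bound:
  fixes \<omega> p :: "real \<Rightarrow> real"
  assumes d: "\<And>r. 0 < r \<Longrightarrow> (\<omega> has_real_derivative p r) (at r)"
    and r: "0 < r" and growth: "\<And>s. r \<le> s \<Longrightarrow> s * p s \<le> b * \<omega> s"
    and pos: "\<And>r. 0 < r \<Longrightarrow> 0 < \<omega> r" and b: "0 \<le> b" "b < 1"
  shows "summable (\<lambda>j. \<omega> (2 ^ j * r) / 2 ^ j)" and "(\<Sum>j. \<omega> (2 ^ j * r) / 2 ^ j) \<le> 2 * \<omega> r / (1 - b)"
proof -
  define c where "c = 2 powr b / 2"
  have "2 powr b \<le> 1 + b" using powr_two_bound[of b] b by simp
  then have c: "0 \<le> c" "2 * c \<le> 1 + b" "c < 1" using b unfolding c_def by (simp, argo, argo)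
  have le: "\<omega> (2 ^ j * r) / 2 ^ j \<le> \<omega> r * c ^ j" for j
  proof -
    have "1 * r \<le> 2 ^ j * r" using r by (intro mult_right_mono) auto
    then have "\<omega> (2 ^ j * r) * r powr b \<le> \<omega> r * (2 ^ j * r) powr b"
      using power_growth_bound[OF d r _ growth] by simp
    also have "(2 ^ j * r) powr b = (2 powr b) ^ j * r powr b"
      using r by (simp add: powr_mult powr_power powr_powr powr_realpow[symmetric] mult.commute)
    finally have "\<omega> (2 ^ j * r) \<le> \<omega> r * (2 powr b) ^ j" using r by simp
    then show ?thesis by (simp add: c_def power_divide divide_right_mono)
  qed
  have gs: "summable (\<lambda>j. \<omega> r * c ^ j)" using c by (intro summable_mult summable_geometric) auto
  have nn: "0 \<le> \<omega> (2 ^ j * r)" for j using pos[of "2 ^ j * r"] r by simp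
  show s: "summable (\<lambda>j. \<omega> (2 ^ j * r) / 2 ^ j)"
    by (rule summable_comparison_test'[OF gs, of 0]) (use le nn in simp)
  have "(\<Sum>j. \<omega> (2 ^ j * r) / 2 ^ j) \<le> (\<Sum>j. \<omega> r * c ^ j)" by (rule suminf_le[OF le s gs])
  also have "\<dots> = \<omega> r / (1 - c)" using c by (simp add: suminf_mult suminf_geometric)
  also have "\<dots> \<le> \<omega> r / ((1 - b) / 2)" using c b pos[OF r] by (intro divide_left_mono) auto
  finally show "(\<Sum>j. \<omega> (2 ^ j * r) / 2 ^ j) \<le> 2 * \<omega> r / (1 - b)" by (simp add: mult.commute)
qed

lemma drift_const_nonneg: "0 \<le> B \<Longrightarrow> 0 \<le> drift_const (a::real^'d::finite) B"
  unfolding drift_const_def far_const_def hormander_const_def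
  using dim_const_pos[where 'a="real^'d"] by (intro add_nonneg_nonneg sum_nonneg mult_nonneg_nonneg) auto

lemma modulus_const_pos: "0 \<le> B \<Longrightarrow> 1 \<le> c\<^sub>1 \<Longrightarrow> 0 < modulus_const (a::real^'d::finite) B c\<^sub>1"
  unfolding modulus_const_def using drift_const_nonneg[of B a]
  by (intro divide_pos_pos add_nonneg_pos add_nonneg_nonneg) (auto simp: dissipation_const_def)

text \<open>The square in \<open>small\<close> is shared: one factor \<open>1 - b r\<close> cancels
  the denominator of the dyadic sum, the other turns \<open>\<omega> r\<close> into a lower bound
  for \<open>\<omega> r - r * p r\<close>. The exponent \<open>b\<close> may vary with
  \<open>r\<close> because the dyadic sum at \<open>r\<close> only sees arguments beyond
  \<open>r\<close>.\<close>

lemma (in drift_diffusion) drift_diffusion_modulusI: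
  assumes d: "\<And>r. 0 < r \<Longrightarrow> (\<omega> has_real_derivative p r) (at r)" and cont_p: "continuous_on {0<..} p"
    and p0: "\<And>r. 0 < r \<Longrightarrow> 0 \<le> p r" and anti: "\<And>r s. 0 < r \<Longrightarrow> r \<le> s \<Longrightarrow> p s \<le> p r"
    and pos: "\<And>r. 0 < r \<Longrightarrow> 0 < \<omega> r" and unb: "filterlim \<omega> at_top at_top"
    and b: "\<And>r. 0 < r \<Longrightarrow> 0 \<le> b r" "\<And>r. 0 < r \<Longrightarrow> b r < 1"
    and growth: "\<And>r s. 0 < r \<Longrightarrow> r \<le> s \<Longrightarrow> s * p s \<le> b r * \<omega> s"
    and small: "\<And>r. 0 < r \<Longrightarrow> p r \<le> modulus_const a B c\<^sub>1 * (1 - b r)\<^sup>2 * m (1 / r)"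
  shows "drift_diffusion_modulus a \<Psi> K m c\<^sub>1 \<alpha> \<sigma> B \<omega> p"
proof -
  have B0: "B \<ge> 0" using kernel_hormander by (simp add: hormander_kernel_def)
  have c1: "c\<^sub>1 \<ge> 1" by (rule case_I_kernel(2)[OF diffusion exponents])
  have gapb: "(1 - b r) * \<omega> r \<le> \<omega> r - r * p r" if "0 < r" for r
    using growth[OF that order_refl] by (simp add: algebra_simps)
  note dy = dyadic_growth_bound[OF d _ growth pos b]
  define c0 where "c0 = dissipation_const CARD('d) c\<^sub>1"
  define A where "A = drift_const a B"
  define E where "E = real CARD('d) * B * c\<^sub>1"
  define c2 where "c2 = modulus_const a B c\<^sub>1"
  have c0: "c0 > 0" using c1 by (simp add: c0_def dissipation_const_def)
  have A: "A \<ge> 0" unfolding A_def by (rule drift_const_nonneg[OF B0])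
  have E: "E \<ge> 0" using B0 c1 by (simp add: E_def)
  have c2: "c2 > 0" unfolding c2_def by (rule modulus_const_pos[OF B0 c1])
  have c2_eq: "c2 = 1 / (8 * A / c0 + 2 * E + 1)" unfolding c2_def modulus_const_def A_def E_def c0_def ..
  have den: "8 * A / c0 + 2 * E + 1 > 0" using A c0 E by (intro add_nonneg_pos add_nonneg_nonneg) auto
  have c2x: "c2 * x \<le> 1" if "x \<le> 8 * A / c0 + 2 * E + 1" for x
    using mult_left_mono[OF that less_imp_le[OF c2]] den unfolding c2_eq by simp
  have c2A: "8 * c2 * A \<le> c0"
  proof -
    have "c2 * (8 * A / c0) \<le> 1" using E by (intro c2x) simp
    then show ?thesis using c0 by (simp add: field_simps)
  qed
  have c2E: "2 * c2 * E \<le> 1"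
  proof -
    have "c2 * (2 * E) \<le> 1" using A c0 by (intro c2x) simp
    then show ?thesis by simp
  qed
  have m0: "m (1 / r) > 0" if "r > 0" for r using case_I_growth(5)[OF diffusion, of "1 / r"] that by simp
  show ?thesis
  proof unfold_locales
    show "continuous_on {0<..} \<omega>" using d by (auto intro!: continuous_at_imp_continuous_on DERIV_isCont)
    show "continuous_on {0<..} p" "filterlim \<omega> at_top at_top" by fact+
    show "0 \<le> p r" if "0 < r" for r using p0[OF that] .
    show "r * p r < \<omega> r" if "0 < r" for r
    proof -
      have "0 < (1 - b r) * \<omega> r" using b(2)[OF that] pos[OF that] by simp
      then show ?thesis using gapb[OF that] by linarith
    qed
    show "summable (\<lambda>j. \<omega> (2 ^ j * r) / 2 ^ j)" if "0 < r" for r by (rule dy(1)) (use that in auto)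
    show "\<omega> s \<le> \<omega> r + p r * (s - r)" if rs: "0 < r" "0 < s" for r s
    proof (cases r s rule: linorder_cases)
      case less
      then obtain z where z: "r < z" "z < s" "\<omega> s - \<omega> r = (s - r) * p z"
        using MVT2[of r s \<omega> p] d rs by fastforce
      have "(s - r) * p z \<le> (s - r) * p r" using anti[of r z] z rs less by (intro mult_left_mono) auto
      then show ?thesis using z(3) unfolding mult.commute[of "p r"] by linarith
    next
      case greater
      then obtain z where z: "s < z" "z < r" "\<omega> r - \<omega> s = (r - s) * p z"
        using MVT2[of s r \<omega> p] d rs by fastforce
      have "(r - s) * p r \<le> (r - s) * p z" using anti[of z r] z rs greater by (intro mult_left_mono) auto
      moreover have "p r * (s - r) = - ((r - s) * p r)" by (simp add: algebra_simps)
      ultimately show ?thesis using z(3) by linarith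
    qed simp
    fix r :: real assume r: "0 < r"
    have u: "0 < 1 - b r" "1 - b r \<le> 1" using b[OF r] by auto
    have pr: "p r \<le> c2 * (1 - b r)\<^sup>2 * m (1 / r)" using small[OF r] by (simp add: c2_def)
    have "(1 - b r)\<^sup>2 \<le> 1" using u by (simp add: power_le_one)
    then have "c2 * (1 - b r)\<^sup>2 * m (1 / r) \<le> c2 * 1 * m (1 / r)"
      using c2 m0[OF r] by (intro mult_right_mono mult_left_mono) auto
    then have "p r * E \<le> c2 * m (1 / r) * E" using pr E by (intro mult_right_mono) auto
    also have "\<dots> = (2 * c2 * E) * (m (1 / r) / 2)" by simp
    also have "\<dots> \<le> 1 * (m (1 / r) / 2)" using c2E m0[OF r] by (intro mult_right_mono) auto
    finally show "p r * (real CARD('d) * B * c\<^sub>1) \<le> m (1 / r) / 2" by (simp add: E_def)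
    define Q where "Q = (\<Sum>j. \<omega> (2 ^ j * r) / 2 ^ j)"
    have Q: "Q \<le> 2 * \<omega> r / (1 - b r)" unfolding Q_def by (rule dy(2)) (use r in auto)
    have "p r * A * Q \<le> p r * A * (2 * \<omega> r / (1 - b r))"
      using Q p0[OF r] A by (intro mult_left_mono) auto
    also have "\<dots> \<le> (c2 * (1 - b r)\<^sup>2 * m (1 / r)) * A * (2 * \<omega> r / (1 - b r))"
      using pr A pos[OF r] u by (intro mult_right_mono) auto
    also have "\<dots> = (8 * c2 * A) * (m (1 / r) * ((1 - b r) * \<omega> r) / 4)"
      using u by (simp add: power2_eq_square)
    also have "\<dots> \<le> c0 * (m (1 / r) * ((1 - b r) * \<omega> r) / 4)"
      using c2A m0[OF r] u pos[OF r] by (intro mult_right_mono) auto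
    also have "\<dots> = c0 / 4 * m (1 / r) * ((1 - b r) * \<omega> r)" by simp
    also have "\<dots> \<le> c0 / 4 * m (1 / r) * (\<omega> r - r * p r)"
      using c0 m0[OF r] gapb[OF r] by (intro mult_left_mono) auto
    finally show "p r * drift_const a B * (\<Sum>j. \<omega> (2 ^ j * r) / 2 ^ j)
      \<le> dissipation_const CARD('d) c\<^sub>1 / 4 * m (1 / r) * (\<omega> r - r * p r)"
      by (simp add: A_def Q_def c0_def)
  qed
qed

text \<open>Since \<open>p s\<close> is at least \<open>p r * (r / s) powr \<alpha>\<close>, it
  suffices that \<open>(r / s) powr \<alpha> \<ge> 1 - \<alpha> * (s - r) / r\<close>. This follows
  from \<open>exp u \<ge> 1 + u\<close> and \<open>ln u \<le> u - 1\<close>.\<close>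

lemma powr_ratio_slope:
  fixes p :: "real \<Rightarrow> real"
  assumes r: "0 < r" "r \<le> s" and p0: "0 \<le> p r" and al: "0 \<le> \<alpha>" "\<alpha> \<le> 1" and mono: "p r * r powr \<alpha> \<le> p s * s powr \<alpha>"
  shows "p r - p s \<le> \<alpha> * p r / r * (s - r)"
proof -
  have "(r / s) powr \<alpha> \<ge> 1 - \<alpha> * (s - r) / r"
  proof -
    have "\<alpha> * ln (s / r) \<le> \<alpha> * (s / r - 1)" using r al by (intro mult_left_mono ln_le_minus_one) auto
    moreover have "1 + (- (\<alpha> * ln (s / r))) \<le> exp (- (\<alpha> * ln (s / r)))" by (rule exp_ge_add_one_self)
    moreover have "(r / s) powr \<alpha> = exp (- (\<alpha> * ln (s / r)))" using r by (simp add: powr_def ln_div algebra_simps)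
    moreover have "\<alpha> * (s / r - 1) = \<alpha> * (s - r) / r" using r by (simp add: field_simps)
    ultimately show ?thesis by linarith
  qed
  then have "p r * (1 - \<alpha> * (s - r) / r) \<le> p r * (r / s) powr \<alpha>" using p0 by (intro mult_left_mono)
  also have "\<dots> \<le> p s" using mono r by (simp add: powr_divide pos_divide_le_eq)
  finally show ?thesis by (simp add: algebra_simps)
qed

section \<open>The power modulus of the explicit estimate\<close>

lemma DERIV_glue:
  fixes f g :: "real \<Rightarrow> real"
  assumes f: "(f has_real_derivative D) (at x)" and g: "(g has_real_derivative D) (at x)" and fg: "f x = g x"
  shows "((\<lambda>s. if s \<le> x then f s else g s) has_real_derivative D) (at x)"
proof -
  let ?h = "\<lambda>s. if s \<le> x then f s else g s"
  have "((\<lambda>y. (?h y - ?h x) / (y - x)) \<longlongrightarrow> D) (at_left x)"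
    using has_field_derivative_at_within[OF f, of "{..<x}"] unfolding has_field_derivative_iff
    by (rule Lim_transform_eventually) (auto simp: eventually_at_filter)
  moreover have "((\<lambda>y. (?h y - ?h x) / (y - x)) \<longlongrightarrow> D) (at_right x)"
    using has_field_derivative_at_within[OF g, of "{x<..}"] unfolding has_field_derivative_iff
    by (rule Lim_transform_eventually) (auto simp: eventually_at_filter fg)
  ultimately show ?thesis unfolding has_field_derivative_iff by (rule filterlim_split_at_real)
qed

text \<open>Below \<delta> the slope of a multiple of \<open>\<xi> powr \<beta>\<close>, which
  yields the Hoelder bound; above \<delta> a multiple of \<open>\<xi> powr (- \<alpha>)\<close>, the
  size that \<open>m (1 / \<xi>)\<close> admits. The factor
  \<open>\<delta> powr (1 - \<alpha> - \<beta>)\<close> makes the two match at \<delta>.\<close>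

definition power_slope :: "real \<Rightarrow> real \<Rightarrow> real \<Rightarrow> real \<Rightarrow> real \<Rightarrow> real" where
  "power_slope \<kappa> \<delta> \<alpha> \<beta> \<xi> = (if \<xi> \<le> \<delta> then \<beta> * \<kappa> * \<delta> powr (1 - \<alpha> - \<beta>) * \<xi> powr (\<beta> - 1) else \<beta> * \<kappa> * \<xi> powr (- \<alpha>))"

definition power_modulus :: "real \<Rightarrow> real \<Rightarrow> real \<Rightarrow> real \<Rightarrow> real \<Rightarrow> real" where
  "power_modulus \<kappa> \<delta> \<alpha> \<beta> \<xi> = (if \<xi> \<le> \<delta> then \<kappa> * \<delta> powr (1 - \<alpha> - \<beta>) * \<xi> powr \<beta>
     else \<kappa> * (\<delta> powr (1 - \<alpha>) + \<beta> / (1 - \<alpha>) * (\<xi> powr (1 - \<alpha>) - \<delta> powr (1 - \<alpha>))))"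

lemma power_modulus:
  fixes \<alpha> \<beta> \<kappa> \<delta> :: real
  assumes \<alpha>: "0 < \<alpha>" "\<alpha> < 1" and \<beta>: "1 - \<alpha> < \<beta>" "\<beta> < 1" and \<kappa>: "\<kappa> > 0" and \<delta>: "\<delta> > 0"
  defines "\<omega> \<equiv> power_modulus \<kappa> \<delta> \<alpha> \<beta>" and "p \<equiv> power_slope \<kappa> \<delta> \<alpha> \<beta>"
  shows "\<And>r. 0 < r \<Longrightarrow> (\<omega> has_real_derivative p r) (at r)"
    and "continuous_on {0<..} p"
    and "\<And>r. 0 < r \<Longrightarrow> 0 < p r"
    and "\<And>r s. 0 < r \<Longrightarrow> r \<le> s \<Longrightarrow> p r * r powr \<alpha> \<le> p s * s powr \<alpha>"
    and "\<And>r s. 0 < r \<Longrightarrow> r \<le> s \<Longrightarrow> p s \<le> p r"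
    and "\<And>r. 0 < r \<Longrightarrow> 0 < \<omega> r"
    and "\<And>r. 0 < r \<Longrightarrow> r * p r \<le> \<beta> * \<omega> r"
    and "\<And>r. 0 < r \<Longrightarrow> p r \<le> \<kappa> * r powr (- \<alpha>)"
    and "filterlim \<omega> at_top at_top"
    and "\<And>r. 0 < r \<Longrightarrow> \<omega> r \<le> \<kappa> * \<delta> powr (1 - \<alpha> - \<beta>) * r powr \<beta>"
proof -
  define H where "H = \<kappa> * \<delta> powr (1 - \<alpha> - \<beta>)"
  have H: "H > 0" using \<kappa> \<delta> by (simp add: H_def)
  have b0: "\<beta> > 0" using \<alpha> \<beta> by simp
  define far where "far \<xi> = \<kappa> * (\<delta> powr (1 - \<alpha>) + \<beta> / (1 - \<alpha>) * (\<xi> powr (1 - \<alpha>) - \<delta> powr (1 - \<alpha>)))" for \<xi>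
  have om: "\<omega> = (\<lambda>\<xi>. if \<xi> \<le> \<delta> then H * \<xi> powr \<beta> else far \<xi>)"
    by (auto simp: \<omega>_def power_modulus_def far_def H_def)
  have p: "p = (\<lambda>\<xi>. if \<xi> \<le> \<delta> then \<beta> * H * \<xi> powr (\<beta> - 1) else \<beta> * \<kappa> * \<xi> powr (- \<alpha>))"
    by (auto simp: p_def power_slope_def H_def)
  have dn: "((\<lambda>\<xi>. H * \<xi> powr \<beta>) has_real_derivative \<beta> * H * r powr (\<beta> - 1)) (at r)" if "0 < r" for r
    using that by (auto intro!: derivative_eq_intros)
  have df: "(far has_real_derivative \<beta> * \<kappa> * r powr (- \<alpha>)) (at r)" if "0 < r" for r
    unfolding far_def using that \<alpha> by (auto intro!: derivative_eq_intros)
  have eq1: "H * \<delta> powr \<beta> = far \<delta>" using \<delta> by (simp add: H_def far_def powr_add[symmetric])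
  have eq2: "\<beta> * H * \<delta> powr (\<beta> - 1) = \<beta> * \<kappa> * \<delta> powr (- \<alpha>)" using \<delta> by (simp add: H_def powr_add[symmetric])
  show d: "(\<omega> has_real_derivative p r) (at r)" if r: "0 < r" for r
  proof -
    consider "r < \<delta>" | "r = \<delta>" | "\<delta> < r" by linarith
    then show ?thesis
    proof cases
      case 1
      have "\<forall>\<^sub>F s in nhds r. \<omega> s = H * s powr \<beta>"
        using eventually_nhds_in_open[of "{..<\<delta>}" r] 1 by (auto elim!: eventually_mono simp: om)
      then show ?thesis using dn[OF r] 1 by (simp add: p DERIV_cong_ev)
    next
      case 2
      have "((\<lambda>\<xi>. if \<xi> \<le> \<delta> then H * \<xi> powr \<beta> else far \<xi>) has_real_derivative \<beta> * H * \<delta> powr (\<beta> - 1)) (at \<delta>)"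
        using dn[OF \<delta>] df[OF \<delta>] eq1 unfolding eq2[symmetric] by (rule DERIV_glue)
      then show ?thesis unfolding om p 2 by simp
    next
      case 3
      have "\<forall>\<^sub>F s in nhds r. \<omega> s = far s"
        using eventually_nhds_in_open[of "{\<delta><..}" r] 3 by (auto elim!: eventually_mono simp: om)
      then show ?thesis using df[OF r] 3 by (simp add: p DERIV_cong_ev)
    qed
  qed
  show "continuous_on {0<..} p"
    unfolding p
    by (rule continuous_on_cases_le) (use \<delta> eq2 in \<open>auto intro!: continuous_intros\<close>)
  show ppos: "0 < p r" if "0 < r" for r using that b0 H \<kappa> by (simp add: p)
  \<comment> \<open>One formula for both branches. Because
    \<open>\<alpha> + \<beta> - 1 > 0\<close>, it shows at once that
    \<open>p r * r powr \<alpha>\<close> is non-decreasing and at most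
    \<open>\<beta> * \<kappa>\<close>.\<close>
  have pa: "p r * r powr \<alpha> = \<beta> * \<kappa> * (min r \<delta> / \<delta>) powr (\<alpha> + \<beta> - 1)" if "0 < r" for r
    using that \<delta> by (auto simp: p H_def powr_add[symmetric] powr_divide min_def powr_minus_divide powr_diff algebra_simps)
  show inc: "p r * r powr \<alpha> \<le> p s * s powr \<alpha>" if "0 < r" "r \<le> s" for r s
    using that \<delta> \<beta> b0 \<kappa> unfolding pa[OF that(1)] pa[OF less_le_trans[OF that]]
    by (intro mult_left_mono powr_mono2 divide_right_mono) auto
  have pb: "p r * r powr \<alpha> \<le> \<beta> * \<kappa>" if "0 < r" for r
  proof -
    have "(min r \<delta> / \<delta>) powr (\<alpha> + \<beta> - 1) \<le> 1" using that \<delta> \<beta> by (intro powr_le1) auto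
    then show ?thesis unfolding pa[OF that] using b0 \<kappa> mult_left_mono[of _ 1 "\<beta> * \<kappa>"] by simp
  qed
  show "p s \<le> p r" if rs: "0 < r" "r \<le> s" for r s
  proof -
    consider "s \<le> \<delta>" | "r \<le> \<delta>" "\<delta> < s" | "\<delta> < r" by linarith
    then show ?thesis
    proof cases
      case 1
      then show ?thesis using rs b0 H \<beta> by (auto simp: p intro!: powr_mono2')
    next
      case 2
      have "s powr (- \<alpha>) \<le> \<delta> powr (- \<alpha>)" "\<delta> powr (\<beta> - 1) \<le> r powr (\<beta> - 1)"
        using 2 rs \<alpha> \<beta> \<delta> by (auto intro!: powr_mono2')
      then have "\<beta> * \<kappa> * s powr (- \<alpha>) \<le> \<beta> * \<kappa> * \<delta> powr (- \<alpha>)" "\<beta> * H * \<delta> powr (\<beta> - 1) \<le> \<beta> * H * r powr (\<beta> - 1)"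
        using b0 \<kappa> H by auto
      then show ?thesis using 2 eq2 by (simp add: p)
    next
      case 3
      then show ?thesis using rs b0 \<kappa> \<alpha> by (auto simp: p intro!: powr_mono2')
    qed
  qed
  show growth: "r * p r \<le> \<beta> * \<omega> r" if r: "0 < r" for r
  proof (cases "r \<le> \<delta>")
    case True
    then show ?thesis using r powr_add[of r 1 "\<beta> - 1"] by (simp add: om p)
  next
    case False
    have "\<delta> powr (1 - \<alpha>) \<le> r powr (1 - \<alpha>)" using False \<delta> \<alpha> by (intro powr_mono2) auto
    moreover have "1 \<le> \<beta> / (1 - \<alpha>)" using \<alpha> \<beta> by simp
    ultimately have "1 * (r powr (1 - \<alpha>) - \<delta> powr (1 - \<alpha>)) \<le> \<beta> / (1 - \<alpha>) * (r powr (1 - \<alpha>) - \<delta> powr (1 - \<alpha>))"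
      by (intro mult_right_mono) auto
    then have "\<beta> * \<kappa> * r powr (1 - \<alpha>) \<le> \<beta> * far r"
      using b0 \<kappa> by (simp add: far_def)
    moreover have "r * r powr (- \<alpha>) = r powr (1 - \<alpha>)" using r powr_add[of r 1 "- \<alpha>"] by simp
    ultimately show ?thesis using False by (simp add: om p mult_ac)
  qed
  show opos: "0 < \<omega> r" if r: "0 < r" for r
  proof -
    have "0 < \<beta> * \<omega> r" using growth[OF r] ppos[OF r] r by (meson less_le_trans mult_pos_pos)
    then show ?thesis using b0 by (simp add: zero_less_mult_iff)
  qed
  show "p r \<le> \<kappa> * r powr (- \<alpha>)" if r: "0 < r" for r
  proof -
    have "\<beta> * \<kappa> \<le> \<kappa>" using b0 \<beta> \<kappa> by (intro mult_left_le_one_le) auto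
    then have "p r * r powr \<alpha> \<le> \<kappa>" using pb[OF r] by linarith
    then show ?thesis using r by (simp add: powr_minus field_simps)
  qed
  have "filterlim far at_top at_top" unfolding far_def using \<alpha> b0 \<kappa> by real_asymp
  moreover have "\<forall>\<^sub>F r in at_top. far r = \<omega> r" using eventually_gt_at_top[of \<delta>] by eventually_elim (simp add: om)
  ultimately show "filterlim \<omega> at_top at_top" by (simp add: filterlim_cong)
  show "\<omega> r \<le> \<kappa> * \<delta> powr (1 - \<alpha> - \<beta>) * r powr \<beta>" if r: "0 < r" for r
  proof (cases "r \<le> \<delta>")
    case False
    have "\<omega> r * \<delta> powr \<beta> \<le> \<omega> \<delta> * r powr \<beta>"
      using power_growth_bound[of \<omega> p \<delta> r \<beta>] d \<delta> False growth by auto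
    also have "\<omega> \<delta> = H * \<delta> powr \<beta>" by (simp add: om)
    finally show ?thesis using \<delta> by (simp add: H_def)
  qed (simp add: om H_def)
qed

context drift_diffusion
begin

text \<open>Runs \<open>eventual_modulus\<close> on the power modulus with constant exponent
  \<open>b = \<beta>\<close>, where \<open>\<kappa>\<close> is the largest coefficient that
  \<open>p r \<le> \<kappa> * r powr (- \<alpha>)\<close> lets the smallness criterion accept. A
  larger datum needs a larger \<delta>, and the Hoelder constant is
  \<open>\<kappa> * \<delta> powr (1 - \<alpha> - \<beta>)\<close> with a negative exponent; hence
  the negative power of the norm.\<close>

theorem power_case_estimate:
  fixes \<theta> :: "real \<Rightarrow> real^'d \<Rightarrow> real" and C\<^sub>0 \<beta> \<epsilon> :: real
  assumes sol: "regularized_solution a \<Psi> K \<theta>\<^sub>0 \<epsilon> \<theta>" and th0: "\<theta>\<^sub>0 \<in> Linf" and eps: "\<epsilon> > 0"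
    and \<sigma>0: "\<sigma> = 0" and \<alpha>1: "\<alpha> < 1" and C0: "C\<^sub>0 > 0" and m_eq: "\<And>r. r > 0 \<Longrightarrow> m r = C\<^sub>0 * r powr \<alpha>"
    and \<beta>: "1 - \<alpha> < \<beta>" "\<beta> < 1" and M0: "Linf_norm \<theta>\<^sub>0 > 0"
  defines "c2 \<equiv> modulus_const a B c\<^sub>1 * C\<^sub>0"
  defines "\<gamma> \<equiv> 1 / (2 / c2) * min ((1 - \<beta>) ^ 3 * \<alpha>) (\<beta> * (1 - \<beta>)\<^sup>2)"
  assumes t: "8 / (dissipation_const CARD('d) c\<^sub>1 * C\<^sub>0) / (1 - \<beta>) * (4 * (1 - \<alpha>) / (\<alpha> * \<gamma>)) powr (\<alpha> / (1 - \<alpha>))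
      * Linf_norm \<theta>\<^sub>0 powr (\<alpha> / (1 - \<alpha>)) \<le> t"
    and xy: "x \<noteq> y"
  shows "\<theta> t x - \<theta> t y \<le> (1 - \<beta>)\<^sup>2 / (1 / c2) * ((1 - \<alpha>) / (\<alpha> * \<gamma>)) powr (- ((\<beta> - 1 + \<alpha>) / (1 - \<alpha>)))
      * Linf_norm \<theta>\<^sub>0 powr (- ((\<beta> - 1 + \<alpha>) / (1 - \<alpha>))) * norm (x - y) powr \<beta>"
proof -
  define M where "M = Linf_norm \<theta>\<^sub>0"
  define X where "X = (1 - \<alpha>) / (\<alpha> * \<gamma>)"
  define \<kappa> where "\<kappa> = c2 * (1 - \<beta>)\<^sup>2"
  \<comment> \<open>Chosen so that \<open>\<delta> powr (1 - \<alpha>)\<close> is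
    \<open>X * M\<close> and \<open>R powr (1 - \<alpha>)\<close> is four times that. The difference
    \<open>3 * X * M\<close> will put at least \<open>3 * M\<close> into the intercept at
    \<open>R\<close>, above the required \<open>2 * M\<close>.\<close>
  define \<delta> where "\<delta> = (X * M) powr (1 / (1 - \<alpha>))"
  define R where "R = (4 * X * M) powr (1 / (1 - \<alpha>))"
  define \<omega> where "\<omega> = power_modulus \<kappa> \<delta> \<alpha> \<beta>"
  define p where "p = power_slope \<kappa> \<delta> \<alpha> \<beta>"
  have M: "M > 0" using M0 by (simp add: M_def)
  have \<alpha>: "0 < \<alpha>" by (rule exponents(1))
  have b0: "\<beta> > 0" using \<alpha>1 \<beta> by simp
  have B0: "B \<ge> 0" using kernel_hormander by (simp add: hormander_kernel_def)
  have c1: "c\<^sub>1 \<ge> 1" by (rule case_I_kernel(2)[OF diffusion exponents])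
  have c2: "c2 > 0" using modulus_const_pos[OF B0 c1, of a] C0 by (simp add: c2_def)
  have \<gamma>: "\<gamma> > 0" unfolding \<gamma>_def using c2 \<alpha> \<beta> b0 by simp
  have X: "X > 0" using \<alpha> \<alpha>1 \<gamma> by (simp add: X_def)
  have \<kappa>: "\<kappa> > 0" using c2 \<beta> by (simp add: \<kappa>_def)
  have \<delta>: "\<delta> > 0" "\<delta> powr (1 - \<alpha>) = X * M" using X M \<alpha>1 by (auto simp: \<delta>_def powr_powr)
  have R: "R > 0" "R powr (1 - \<alpha>) = 4 * (X * M)" using X M \<alpha>1 by (auto simp: R_def powr_powr)
  have R\<delta>: "\<delta> < R" unfolding R_def \<delta>_def using X M \<alpha>1 by (intro powr_less_mono2) auto
  note pm = power_modulus[OF \<alpha> \<alpha>1 \<beta> \<kappa> \<delta>(1), folded \<omega>_def p_def]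
  have growth: "s * p s \<le> \<beta> * \<omega> s" if "0 < r" "r \<le> s" for r s using pm(7)[of s] that by simp
  have "drift_diffusion_modulus a \<Psi> K m c\<^sub>1 \<alpha> \<sigma> B \<omega> p"
  proof (rule drift_diffusion_modulusI[where b="\<lambda>_. \<beta>", OF pm(1,2) less_imp_le[OF pm(3)] pm(5,6,9) _ _ growth])
    show "p r \<le> modulus_const a B c\<^sub>1 * (1 - \<beta>)\<^sup>2 * m (1 / r)" if r: "0 < r" for r
      using pm(8)[OF r] r by (simp add: m_eq \<kappa>_def c2_def powr_divide powr_minus_divide mult_ac)
  qed (use b0 \<beta> in auto)
  then interpret dm: drift_diffusion_modulus a \<Psi> K m c\<^sub>1 \<alpha> \<sigma> B \<omega> p .
  \<comment> \<open>The constant \<open>\<alpha> / (1 - \<beta>)\<close> combines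
    \<open>powr_ratio_slope\<close> with
    \<open>r * p r \<le> (\<omega> r - r * p r) / (1 - \<beta>)\<close>, the growth condition solved
    for the slope.\<close>
  have slope: "p r - p s \<le> \<alpha> / (1 - \<beta>) * (\<omega> r - r * p r) / r\<^sup>2 * (s - r)" if rs: "0 < r" "r \<le> s" for r s
  proof -
    have g: "r * p r \<le> \<beta> * \<omega> r" by (rule pm(7)[OF rs(1)])
    have "\<beta> * \<omega> r \<le> \<omega> r" using pm(6)[OF rs(1)] b0 \<beta> by (intro mult_left_le_one_le) auto
    then have "(1 - \<beta>) * (r * p r) \<le> (1 - \<beta>) * \<omega> r" using g \<beta> by (intro mult_left_mono) auto
    also have "\<dots> \<le> \<omega> r - r * p r" using g by (simp add: algebra_simps)
    finally have "p r * r \<le> (\<omega> r - r * p r) / (1 - \<beta>)" using \<beta> by (simp add: pos_le_divide_eq mult_ac)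
    then have "p r * r / r\<^sup>2 \<le> (\<omega> r - r * p r) / (1 - \<beta>) / r\<^sup>2" by (intro divide_right_mono) auto
    then have "p r / r \<le> (\<omega> r - r * p r) / (1 - \<beta>) / r\<^sup>2" using rs by (simp add: power2_eq_square)
    then have "\<alpha> * (p r / r) * (s - r) \<le> \<alpha> * ((\<omega> r - r * p r) / (1 - \<beta>) / r\<^sup>2) * (s - r)"
      using rs \<alpha> by (intro mult_right_mono mult_left_mono) auto
    moreover have "p r - p s \<le> \<alpha> * p r / r * (s - r)"
      using powr_ratio_slope[OF rs, of p \<alpha>] pm(3)[OF rs(1)] pm(4)[OF rs] exponents by simp
    ultimately show ?thesis by simp
  qed
  \<comment> \<open>This is what determines \<gamma>. One of \<beta> and 1 - \<beta> is at least
    1/2, so one of the two terms of the minimum is at most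
    \<open>2 * \<beta> * (1 - \<beta>) ^ 3\<close>; that 2 is the numerator in
    \<open>2 / c2\<close>.\<close>
  have key: "\<alpha> * \<gamma> \<le> (1 - \<beta>) * \<kappa> * \<beta>"
  proof -
    have u: "0 < 1 - \<beta>" "0 < (1 - \<beta>)\<^sup>2" "0 < (1 - \<beta>) ^ 3" using \<beta> by auto
    define q where "q = min ((1 - \<beta>) ^ 3 * \<alpha>) (\<beta> * (1 - \<beta>)\<^sup>2)"
    have "(1 - \<beta>) ^ 3 * \<alpha> \<le> (1 - \<beta>) ^ 3" using \<alpha> \<alpha>1 u(3) by simp
    then have q: "q \<le> (1 - \<beta>) ^ 3" "q \<le> \<beta> * (1 - \<beta>)\<^sup>2" by (simp_all add: q_def min.coboundedI1)
    have "q \<ge> 0" using u \<alpha> b0 by (simp add: q_def)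
    then have "\<alpha> * q \<le> q" using \<alpha> \<alpha>1 by (intro mult_left_le_one_le) auto
    also have "q \<le> 2 * \<beta> * (1 - \<beta>) ^ 3"
    proof (cases "1 / 2 \<le> \<beta>")
      case True
      then have "1 * (1 - \<beta>) ^ 3 \<le> 2 * \<beta> * (1 - \<beta>) ^ 3" using u(3) by (intro mult_right_mono) auto
      then show ?thesis using q(1) by simp
    next
      case False
      then have "1 * (\<beta> * (1 - \<beta>)\<^sup>2) \<le> 2 * (1 - \<beta>) * (\<beta> * (1 - \<beta>)\<^sup>2)"
        using b0 by (intro mult_right_mono) auto
      also have "\<dots> = 2 * \<beta> * (1 - \<beta>) ^ 3" by (simp add: power2_eq_square power3_eq_cube)
      finally show ?thesis using q(2) by simp
    qed
    finally have "\<alpha> * min ((1 - \<beta>) ^ 3 * \<alpha>) (\<beta> * (1 - \<beta>)\<^sup>2) \<le> 2 * \<beta> * (1 - \<beta>) ^ 3" unfolding q_def .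
    then have "c2 / 2 * (\<alpha> * min ((1 - \<beta>) ^ 3 * \<alpha>) (\<beta> * (1 - \<beta>)\<^sup>2)) \<le> c2 / 2 * (2 * \<beta> * (1 - \<beta>) ^ 3)"
      using c2 by (intro mult_left_mono) auto
    then show ?thesis by (simp add: \<gamma>_def \<kappa>_def power2_eq_square power3_eq_cube mult_ac)
  qed
  \<comment> \<open>The outer branch gives \<open>\<omega> R \<ge> 3 * \<kappa> * \<beta> * M /
    (\<alpha> * \<gamma>)\<close>. The intercept is at least \<open>1 - \<beta>\<close> times this,
    and \<open>key\<close> makes it at least \<open>3 * M\<close>.\<close>
  have init: "2 * Linf_norm \<theta>\<^sub>0 < \<omega> R - R * p R"
  proof -
    have "\<omega> R = \<kappa> * (X * M + \<beta> / (1 - \<alpha>) * (4 * (X * M) - X * M))"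
      using R\<delta> R \<delta> by (simp add: \<omega>_def power_modulus_def)
    also have "4 * (X * M) - X * M = 3 * (X * M)" by simp
    also have "\<beta> / (1 - \<alpha>) * (3 * (X * M)) = 3 * \<beta> * M / (\<alpha> * \<gamma>)" using \<alpha>1 by (simp add: X_def)
    also have "\<kappa> * (X * M + 3 * \<beta> * M / (\<alpha> * \<gamma>)) = \<kappa> * (X * M) + 3 * \<kappa> * \<beta> * M / (\<alpha> * \<gamma>)"
      by (simp add: distrib_left mult_ac)
    finally have "3 * \<kappa> * \<beta> * M / (\<alpha> * \<gamma>) \<le> \<omega> R" using \<kappa> X M by simp
    then have 1: "(1 - \<beta>) * (3 * \<kappa> * \<beta> * M / (\<alpha> * \<gamma>)) \<le> (1 - \<beta>) * \<omega> R" using \<beta> by (intro mult_left_mono) auto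
    have "1 \<le> (1 - \<beta>) * \<kappa> * \<beta> / (\<alpha> * \<gamma>)" using key \<alpha> \<gamma> by simp
    then have "3 * M * 1 \<le> 3 * M * ((1 - \<beta>) * \<kappa> * \<beta> / (\<alpha> * \<gamma>))" using M by (intro mult_left_mono) auto
    then have "3 * M \<le> (1 - \<beta>) * \<omega> R" using 1 by (simp add: mult_ac)
    moreover have "(1 - \<beta>) * \<omega> R \<le> \<omega> R - R * p R" using pm(7)[OF R(1)] by (simp add: algebra_simps)
    ultimately show ?thesis using M by (simp add: M_def)
  qed
  have time: "8 * (\<alpha> / (1 - \<beta>)) / (dissipation_const CARD('d) c\<^sub>1 * (\<alpha> - \<sigma>) * m (1 / R)) \<le> t"
  proof -
    have "R powr \<alpha> = (4 * X * M) powr (\<alpha> / (1 - \<alpha>))" by (simp add: R_def powr_powr)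
    also have "\<dots> = (4 * X) powr (\<alpha> / (1 - \<alpha>)) * M powr (\<alpha> / (1 - \<alpha>))" by (rule powr_mult)
    finally have Ra: "R powr \<alpha> = (4 * X) powr (\<alpha> / (1 - \<alpha>)) * M powr (\<alpha> / (1 - \<alpha>))" .
    have "m (1 / R) = C\<^sub>0 / R powr \<alpha>" using R by (simp add: m_eq powr_divide)
    then have "8 * (\<alpha> / (1 - \<beta>)) / (dissipation_const CARD('d) c\<^sub>1 * (\<alpha> - \<sigma>) * m (1 / R))
        = 8 / (dissipation_const CARD('d) c\<^sub>1 * C\<^sub>0) / (1 - \<beta>) * R powr \<alpha>"
      using \<alpha> by (simp add: \<sigma>0 mult_ac)
    also have "\<dots> = 8 / (dissipation_const CARD('d) c\<^sub>1 * C\<^sub>0) / (1 - \<beta>) * (4 * (1 - \<alpha>) / (\<alpha> * \<gamma>)) powr (\<alpha> / (1 - \<alpha>))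
      * Linf_norm \<theta>\<^sub>0 powr (\<alpha> / (1 - \<alpha>))"
      unfolding Ra by (simp add: X_def M_def)
    finally show ?thesis using t by simp
  qed
  have L: "\<alpha> / (1 - \<beta>) > 0" using \<alpha> \<beta> by simp
  have \<sigma>nn: "\<sigma> \<ge> 0" by (simp add: \<sigma>0)
  have "\<theta> t x - \<theta> t y \<le> \<omega> (norm (x - y))"
    by (rule dm.eventual_modulus[OF sol th0 eps \<sigma>nn L slope R(1) init time xy])
  also have "\<dots> \<le> \<kappa> * \<delta> powr (1 - \<alpha> - \<beta>) * norm (x - y) powr \<beta>" using xy by (intro pm(10)) simp
  also have "\<delta> powr (1 - \<alpha> - \<beta>) = (X * M) powr (- ((\<beta> - 1 + \<alpha>) / (1 - \<alpha>)))"
    by (simp add: \<delta>_def powr_powr minus_divide_left algebra_simps)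
  also have "\<dots> = X powr (- ((\<beta> - 1 + \<alpha>) / (1 - \<alpha>))) * M powr (- ((\<beta> - 1 + \<alpha>) / (1 - \<alpha>)))"
    by (rule powr_mult)
  finally show ?thesis by (simp add: \<kappa>_def X_def M_def mult_ac)
qed

end

text \<open>For general \<open>m\<close> the modulus is Lipschitz at the origin, so that one modulus and one time serve all \<open>\<beta>\<close>.
  The correction \<open>\<xi> powr q\<close> makes \<open>1 - b\<close> comparable with \<open>\<xi> powr q\<close> near the origin; with \<open>2 * q = \<alpha> - \<sigma>\<close> the
  requirement \<open>p r \<le> c * (1 - b r)\<^sup>2 * m (1 / r)\<close> holds there because \<open>m (1 / r) * r powr (\<alpha> - \<sigma>) \<ge> m 1\<close>.\<close>

definition lipschitz_slope :: "(real \<Rightarrow> real) \<Rightarrow> real \<Rightarrow> real \<Rightarrow> real \<Rightarrow> real" where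
  "lipschitz_slope m q P \<xi> = (if \<xi> \<le> 1 then P * (1 - \<xi> powr q / 2) else P / 2 * (m (1 / \<xi>) / m 1))"

definition lipschitz_modulus :: "(real \<Rightarrow> real) \<Rightarrow> real \<Rightarrow> real \<Rightarrow> real \<Rightarrow> real" where
  "lipschitz_modulus m q P \<xi> = integral {0..\<xi>} (lipschitz_slope m q P)"

definition lipschitz_exponent :: "real \<Rightarrow> real \<Rightarrow> real" where
  "lipschitz_exponent q r = 1 - q / 3 * min r 1 powr q"

text \<open>On \<open>[0, 1]\<close> the modulus is explicit and \<open>\<omega> s - s * p s\<close>
  equals \<open>P / 2 * s * s powr q * (q / (1 + q))\<close>. Beyond 1 only the growth bounds on
  \<open>m\<close> are available, and inequalities are carried outward from 1 by
  monotonicity.\<close>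

lemma lipschitz_modulus:
  fixes K :: "real^'d::finite \<Rightarrow> real"
  assumes cI: "case_I K m c\<^sub>1 \<alpha> \<sigma>" and exponents: "0 < \<alpha>" "\<alpha> \<le> 1" "0 \<le> \<sigma>" "\<sigma> < \<alpha>" and P: "P > 0"
  defines "q \<equiv> (\<alpha> - \<sigma>) / 2"
  defines "\<omega> \<equiv> lipschitz_modulus m q P" and "p \<equiv> lipschitz_slope m q P" and "b \<equiv> lipschitz_exponent q"
  shows "\<And>r. 0 < r \<Longrightarrow> (\<omega> has_real_derivative p r) (at r)"
    and "continuous_on {0<..} p"
    and "\<And>r. 0 < r \<Longrightarrow> 0 < p r"
    and "\<And>r s. 0 < r \<Longrightarrow> r \<le> s \<Longrightarrow> p s \<le> p r"
    and "\<And>r. 0 < r \<Longrightarrow> 0 < \<omega> r"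
    and "filterlim \<omega> at_top at_top"
    and "\<And>r. 0 < r \<Longrightarrow> 0 \<le> b r \<and> b r < 1"
    and "\<And>r s. 0 < r \<Longrightarrow> r \<le> s \<Longrightarrow> s * p s \<le> b r * \<omega> s"
    and "\<And>r. 0 < r \<Longrightarrow> p r \<le> 9 * P / (q\<^sup>2 * m 1) * (1 - b r)\<^sup>2 * m (1 / r)"
    and "\<And>r s. 0 < r \<Longrightarrow> r \<le> s \<Longrightarrow> p r - p s \<le> 3 / q * (\<omega> r - r * p r) / r\<^sup>2 * (s - r)"
    and "\<And>r \<beta>. 0 < r \<Longrightarrow> 1 - \<alpha> + \<sigma> < \<beta> \<Longrightarrow> \<beta> < 1 \<Longrightarrow> \<omega> r \<le> P / \<beta> * r powr \<beta>"
proof -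
  define \<mu> where "\<mu> = \<alpha> - \<sigma>"
  note g = case_I_growth[OF cI]
  have \<mu>: "0 < \<mu>" "\<mu> \<le> 1" "\<mu> \<le> \<alpha>" using exponents by (auto simp: \<mu>_def)
  have q: "0 < q" "q \<le> 1 / 2" "2 * q = \<mu>" using \<mu> by (auto simp: q_def \<mu>_def)
  have m1: "m 1 > 0" by (rule g(5)) simp
  define far where "far \<xi> = P / 2 * (m (1 / \<xi>) / m 1)" for \<xi>
  have p: "p = (\<lambda>\<xi>. if \<xi> \<le> 1 then P * (1 - \<xi> powr q / 2) else far \<xi>)"
    by (auto simp: p_def lipschitz_slope_def far_def)
  have far1: "far 1 = P / 2" using m1 by (simp add: far_def)
  have p1: "p 1 = P / 2" by (simp add: p)
  have pge: "p s = far s" if "1 \<le> s" for s using that far1 by (auto simp: p)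
  have ple: "p s = P * (1 - s powr q / 2)" if "s \<le> 1" for s using that by (simp add: p)
  have md: "(m has_real_derivative deriv m r) (at r)" if "0 < r" for r
    using g(1)[OF that] by (metis DERIV_deriv_iff_real_differentiable)
  have dfar: "(far has_real_derivative P / 2 * (deriv m (1 / r) * (- (1 / r\<^sup>2)) / m 1)) (at r)" if "0 < r" for r
  proof -
    have "((\<lambda>\<xi>. 1 / \<xi>) has_real_derivative - (1 / r\<^sup>2)) (at r)"
      using that by (auto intro!: derivative_eq_intros simp: power2_eq_square)
    moreover have "(m has_real_derivative deriv m (1 / r)) (at (1 / r))" using that by (intro md) simp
    ultimately have "((\<lambda>\<xi>. m (1 / \<xi>)) has_real_derivative deriv m (1 / r) * (- (1 / r\<^sup>2))) (at r)"
      by (rule DERIV_chain2[rotated])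
    then show ?thesis unfolding far_def by (intro DERIV_cmult DERIV_cdivide)
  qed
  have pc: "continuous_on {0..} p"
    unfolding p
  proof (rule continuous_on_cases_le)
    show "continuous_on {t \<in> {0..}. 1 \<le> t} far"
      by (intro continuous_at_imp_continuous_on ballI DERIV_isCont[OF dfar]) auto
    show "continuous_on {t \<in> {0..}. t \<le> 1} (\<lambda>\<xi>. P * (1 - \<xi> powr q / 2))"
      using q by (intro continuous_intros continuous_on_powr') auto
  qed (use far1 in \<open>auto intro: continuous_intros\<close>)
  then show "continuous_on {0<..} p" by (rule continuous_on_subset) auto
  have om: "\<omega> s = integral {0..s} p" for s by (simp add: \<omega>_def p_def lipschitz_modulus_def)
  show d: "(\<omega> has_real_derivative p r) (at r)" if r: "0 < r" for r
  proof -
    have "((\<lambda>s. integral {0..s} p) has_real_derivative p r) (at r within {0..r + 1})"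
      by (rule integral_has_real_derivative[OF continuous_on_subset[OF pc]]) (use r in auto)
    moreover have "at r within {0..r + 1} = at r" using r by (intro at_within_interior) simp
    moreover have "\<omega> = (\<lambda>s. integral {0..s} p)" by (rule ext) (rule om)
    ultimately show ?thesis by (simp only:)
  qed
  show ppos: "0 < p r" if r: "0 < r" for r
  proof (cases "r \<le> 1")
    case True
    have "r powr q \<le> 1" using True r q by (intro powr_le1) auto
    then show ?thesis using True P by (simp add: ple)
  next
    case False
    then show ?thesis using g(5)[of "1 / r"] m1 P by (simp add: pge far_def)
  qed
  have near_anti: "p s \<le> p r" if "0 \<le> r" "r \<le> s" "s \<le> 1" for r s
    using that P powr_mono2[of q r s] q by (simp add: ple)
  have far_anti: "p s \<le> p r" if "1 \<le> r" "r \<le> s" for r s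
    using that P m1 g(4)[of "1 / s" "1 / r"] by (simp add: pge far_def divide_right_mono frac_le)
  show anti: "p s \<le> p r" if rs: "0 < r" "r \<le> s" for r s
  proof -
    consider "s \<le> 1" | "r \<le> 1" "1 \<le> s" | "1 \<le> r" by linarith
    then show ?thesis
      using rs near_anti[of r s] near_anti[of r 1] far_anti[of 1 s] far_anti[of r s] by cases auto
  qed
  have near: "\<omega> s = P * s * (1 - s powr q / (2 * (1 + q)))" if s: "0 \<le> s" "s \<le> 1" for s
  proof -
    have "(p has_integral (P * (s - s powr (1 + q) / (2 * (1 + q)))) - P * (0 - 0 powr (1 + q) / (2 * (1 + q)))) {0..s}"
    proof (rule fundamental_theorem_of_calculus_interior)
      show "continuous_on {0..s} (\<lambda>s. P * (s - s powr (1 + q) / (2 * (1 + q))))"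
        using q by (intro continuous_intros continuous_on_powr') auto
      show "((\<lambda>s. P * (s - s powr (1 + q) / (2 * (1 + q)))) has_vector_derivative p x) (at x)" if "x \<in> {0<..<s}" for x
      proof -
        have "((\<lambda>s. P * (s - s powr (1 + q) / (2 * (1 + q)))) has_real_derivative P * (1 - (1 + q) * x powr (1 + q - 1) / (2 * (1 + q)))) (at x)"
          using that by (intro DERIV_cmult DERIV_diff DERIV_ident DERIV_cdivide has_real_derivative_powr) auto
        moreover have "(1 + q) * x powr (1 + q - 1) / (2 * (1 + q)) = x powr q / 2"
          using q mult_divide_mult_cancel_left[of "1 + q" "x powr q" 2] by (simp add: mult.commute)
        moreover have "p x = P * (1 - x powr q / 2)" using that s by (intro ple) auto
        ultimately show ?thesis
          by (simp only: has_real_derivative_iff_has_vector_derivative)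
      qed
    qed (use s in simp)
    then have "\<omega> s = P * (s - s powr (1 + q) / (2 * (1 + q)))" unfolding om by (simp add: integral_unique)
    moreover have "s powr (1 + q) = s * s powr q" using s by (cases "s = 0") (auto simp: powr_add)
    ultimately show ?thesis by (simp add: algebra_simps)
  qed
  have mono: "\<omega> r \<le> \<omega> s" if rs: "0 < r" "r \<le> s" for r s
  proof (rule DERIV_nonneg_imp_nondecreasing[OF rs(2)])
    fix x assume "r \<le> x" "x \<le> s"
    then have "x > 0" using rs by simp
    then show "\<exists>y. (\<omega> has_real_derivative y) (at x) \<and> 0 \<le> y" using d ppos less_imp_le by blast
  qed
  have pow1: "0 < s powr q" "s powr q \<le> 1" if "0 < s" "s \<le> 1" for s using that q by (auto intro: powr_le1)
  have nearpos: "0 < \<omega> s" if s: "0 < s" "s \<le> 1" for s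
  proof -
    have "s powr q / (2 * (1 + q)) \<le> 1 / (2 * (1 + q))" using pow1[OF s] q by (intro divide_right_mono) auto
    also have "\<dots> < 1" using q by simp
    finally show ?thesis using s P by (simp add: near)
  qed
  show opos: "0 < \<omega> r" if r: "0 < r" for r
    using less_le_trans[OF nearpos[of "min r 1"] mono[of "min r 1" r]] r by simp
  have neargap: "\<omega> s - s * p s = P / 2 * s * s powr q * (q / (1 + q))" if s: "0 < s" "s \<le> 1" for s
    using s q(1) by (simp add: near ple field_simps)
  show b01: "0 \<le> b r \<and> b r < 1" if r: "0 < r" for r
  proof -
    have "q / 3 * min r 1 powr q \<le> 1 * 1" using pow1[of "min r 1"] r q by (intro mult_mono) auto
    moreover have "0 < q / 3 * min r 1 powr q" using r q by simp
    ultimately show ?thesis by (simp add: b_def lipschitz_exponent_def)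
  qed
  have near_growth: "s * p s \<le> (1 - q / 3 * s powr q) * \<omega> s" if s: "0 < s" "s \<le> 1" for s
  proof -
    have "\<omega> s \<le> P * s" using s P q by (simp add: near mult_left_le)
    then have "q / 3 * s powr q * \<omega> s \<le> q / 3 * s powr q * (P * s)" using q by (intro mult_left_mono) auto
    also have "\<dots> = (P * s * s powr q) * (q / 3)" by simp
    \<comment> \<open>The constant 1/3 in \<open>lipschitz_exponent\<close> comes from here:
      \<open>1 / 3 \<le> 1 / (2 * (1 + q))\<close> is the same as
      \<open>q \<le> 1 / 2\<close>.\<close>
    also have "\<dots> \<le> (P * s * s powr q) * (1 / 2 * (q / (1 + q)))"
      using P s q by (intro mult_left_mono) (auto simp: field_simps)
    also have "\<dots> = \<omega> s - s * p s" using neargap[OF s] by simp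
    finally show ?thesis by (simp add: algebra_simps)
  qed
  have deriv_m_lower: "\<mu> * m r \<le> r * deriv m r" if "0 < r" for r
  proof -
    have "(\<alpha> - \<sigma>) * (m r / r) \<le> deriv m r" using cI that unfolding case_I_def by blast
    then show ?thesis using that by (simp add: \<mu>_def field_simps)
  qed
  \<comment> \<open>\<open>(1 - q / 3) * \<omega> s - s * far s\<close> is non-decreasing: the lower
    bound on the derivative of \<open>m\<close> makes \<open>- x\<close> times the derivative of
    \<open>far\<close> at least \<open>\<mu> * far x\<close>, which exceeds the loss
    \<open>q / 3 * far x\<close>.\<close>
  have far_growth: "s * p s \<le> (1 - q / 3) * \<omega> s" if s: "1 \<le> s" for s
  proof -
    have "(1 - q / 3) * \<omega> 1 - 1 * far 1 \<le> (1 - q / 3) * \<omega> s - s * far s"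
    proof (rule DERIV_nonneg_imp_nondecreasing[OF s])
      fix x :: real assume x: "1 \<le> x" "x \<le> s"
      define D where "D = P / 2 * (deriv m (1 / x) * (- (1 / x\<^sup>2)) / m 1)"
      have "((\<lambda>s. (1 - q / 3) * \<omega> s - s * far s) has_real_derivative (1 - q / 3) * p x - (1 * far x + D * x)) (at x)"
        using x dfar[of x] unfolding D_def[symmetric]
        by (intro DERIV_diff DERIV_cmult DERIV_mult DERIV_ident d) auto
      moreover have "0 \<le> (1 - q / 3) * p x - (1 * far x + D * x)"
      proof -
        have "\<mu> * m (1 / x) \<le> 1 / x * deriv m (1 / x)" using x by (intro deriv_m_lower) simp
        then have "P / (2 * m 1) * (\<mu> * m (1 / x)) \<le> P / (2 * m 1) * (1 / x * deriv m (1 / x))"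
          using P m1 by (intro mult_left_mono) auto
        then have "\<mu> * far x \<le> - (D * x)" using x by (simp add: far_def D_def power2_eq_square mult_ac)
        moreover have "q / 3 * far x \<le> \<mu> * far x" using q ppos[of x] x by (intro mult_right_mono) (auto simp: pge)
        moreover have "(1 - q / 3) * p x = far x - q / 3 * far x" using x by (simp add: pge algebra_simps)
        ultimately show ?thesis by linarith
      qed
      ultimately show "\<exists>y. ((\<lambda>s. (1 - q / 3) * \<omega> s - s * far s) has_real_derivative y) (at x) \<and> 0 \<le> y" by blast
    qed
    moreover have "1 * p 1 \<le> (1 - q / 3) * \<omega> 1" using near_growth[of 1] by simp
    ultimately show ?thesis using pge[of 1] pge[OF s] by simp
  qed
  show growth: "s * p s \<le> b r * \<omega> s" if rs: "0 < r" "r \<le> s" for r s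
  proof -
    have "q / 3 * min r 1 powr q \<le> q / 3 * min s 1 powr q" using rs q by (intro mult_left_mono powr_mono2) auto
    then have "b s \<le> b r" by (simp add: b_def lipschitz_exponent_def)
    then have "b s * \<omega> s \<le> b r * \<omega> s" using opos[of s] rs by (intro mult_right_mono) auto
    moreover have "s * p s \<le> b s * \<omega> s"
      using near_growth[of s] far_growth[of s] rs by (cases "s \<le> 1") (auto simp: b_def lipschitz_exponent_def)
    ultimately show ?thesis by linarith
  qed
  have m_lower: "m 1 \<le> m (1 / r) * r powr \<mu>" if "0 < r" "r \<le> 1" for r
    using g(3)[of 1 "1 / r"] that by (simp add: \<mu>_def[symmetric] powr_divide field_simps)
  have m_upper: "m (1 / r) * r powr \<mu> \<le> m 1" if "1 \<le> r" for r
    using g(3)[of "1 / r" 1] that by (simp add: \<mu>_def[symmetric] powr_divide field_simps)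
  \<comment> \<open>The factor \<open>9 / q^2\<close> undoes the square of \<open>q / 3\<close>.
    Near the origin the right-hand side becomes \<open>P * m (1 / r) * r powr (2 * q) / m 1\<close>,
    at least \<open>P\<close> because \<open>2 * q = \<mu>\<close>; beyond 1 it is exactly twice the
    slope.\<close>
  show "p r \<le> 9 * P / (q\<^sup>2 * m 1) * (1 - b r)\<^sup>2 * m (1 / r)" if r: "0 < r" for r
  proof (cases "r \<le> 1")
    case True
    have "(r powr q)\<^sup>2 = r powr \<mu>" using r q(3) by (simp add: power2_eq_square powr_add[symmetric])
    then have "9 * P / (q\<^sup>2 * m 1) * (1 - b r)\<^sup>2 * m (1 / r) = P * (m (1 / r) * r powr \<mu> / m 1)"
      using True q by (simp add: b_def lipschitz_exponent_def power_mult_distrib power_divide)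
    moreover have "1 \<le> m (1 / r) * r powr \<mu> / m 1" using m_lower[OF r True] m1 by simp
    then have "P * 1 \<le> P * (m (1 / r) * r powr \<mu> / m 1)" using P by (intro mult_left_mono) auto
    moreover have "p r \<le> P" using True P by (simp add: ple mult_left_le)
    ultimately show ?thesis by linarith
  next
    case False
    have "9 * P / (q\<^sup>2 * m 1) * (1 - b r)\<^sup>2 * m (1 / r) = 2 * far r"
      using False q by (simp add: b_def lipschitz_exponent_def far_def power_divide)
    then show ?thesis using ppos[OF r] False by (simp add: pge)
  qed
  have slope_far: "p r - p s \<le> \<alpha> * p r / r * (s - r)" if rs: "1 \<le> r" "r \<le> s" for r s
  proof (rule powr_ratio_slope)
    have "m (1 / r) * (1 / s) powr \<alpha> \<le> m (1 / s) * (1 / r) powr \<alpha>" using rs by (intro g(2)) (auto intro: frac_le)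
    then have "m (1 / r) * r powr \<alpha> \<le> m (1 / s) * s powr \<alpha>" using rs by (simp add: powr_divide field_simps)
    then show "p r * r powr \<alpha> \<le> p s * s powr \<alpha>" using rs P m1 by (simp add: pge far_def field_simps)
  qed (use rs ppos[of r] exponents in auto)
  have slope_near: "p r - p s \<le> P / 2 * q * r powr (q - 1) * (s - r)" if rs: "0 < r" "r \<le> s" "s \<le> 1" for r s
  proof (cases "r = s")
    case False
    then have "r < s" using rs by simp
    moreover have "((\<lambda>z. z powr q) has_real_derivative q * z powr (q - 1)) (at z)" if "r \<le> z" for z
      using that rs by (auto intro!: derivative_eq_intros)
    ultimately obtain z where z: "r < z" "z < s" "s powr q - r powr q = (s - r) * (q * z powr (q - 1))"
      using MVT2[of r s "\<lambda>z. z powr q" "\<lambda>z. q * z powr (q - 1)"] by blast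
    have "z powr (q - 1) \<le> r powr (q - 1)" using z rs q by (intro powr_mono2') auto
    then have "(s - r) * (q * z powr (q - 1)) \<le> (s - r) * (q * r powr (q - 1))" using rs q by (intro mult_left_mono) auto
    then have "P / 2 * (s powr q - r powr q) \<le> P / 2 * ((s - r) * (q * r powr (q - 1)))"
      unfolding z(3) by (rule mult_left_mono) (use P in auto)
    moreover have "p r - p s = P / 2 * (s powr q - r powr q)" using rs by (simp add: ple algebra_simps)
    moreover have "P / 2 * ((s - r) * (q * r powr (q - 1))) = P / 2 * q * r powr (q - 1) * (s - r)" by simp
    ultimately show ?thesis by linarith
  qed simp
  \<comment> \<open>Beyond 1 the gap is at least \<open>q / 3\<close> times \<omega>, which gives
    \<open>3 / q\<close>. For \<open>r < 1\<close> the gap divided by \<open>r^2\<close> is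
    \<open>S / (1 + q)\<close>, where \<open>S\<close> is the rate at which the slope drops at
    \<open>r\<close>. An interval that crosses 1 is split there, and both pieces are compared with
    the gap at \<open>r\<close>.\<close>
  show "p r - p s \<le> 3 / q * (\<omega> r - r * p r) / r\<^sup>2 * (s - r)" if rs: "0 < r" "r \<le> s" for r s
  proof (cases "1 \<le> r")
    case True
    have br: "b r = 1 - q / 3" using True by (simp add: b_def lipschitz_exponent_def)
    have "b r * \<omega> r \<le> \<omega> r" using opos[OF rs(1)] b01[OF rs(1)] by (intro mult_left_le_one_le) auto
    then have "r * p r \<le> \<omega> r" using growth[OF rs(1) order_refl] by linarith
    then have "q / 3 * (r * p r) \<le> q / 3 * \<omega> r" using q by (intro mult_left_mono) auto
    also have "\<dots> \<le> \<omega> r - r * p r" using growth[OF rs(1) order_refl] by (simp add: br algebra_simps)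
    finally have "r * p r \<le> 3 / q * (\<omega> r - r * p r)" using q by (simp add: field_simps)
    then have "r * p r / r\<^sup>2 * (s - r) \<le> 3 / q * (\<omega> r - r * p r) / r\<^sup>2 * (s - r)"
      using rs by (intro mult_right_mono divide_right_mono) auto
    moreover have "\<alpha> * p r / r * (s - r) \<le> p r / r * (s - r)"
    proof -
      have "\<alpha> * p r \<le> p r" using ppos[OF rs(1)] exponents by (intro mult_left_le_one_le) auto
      then show ?thesis using rs by (intro mult_right_mono divide_right_mono) auto
    qed
    ultimately show ?thesis using slope_far[OF True rs(2)] rs by (simp add: power2_eq_square)
  next
    case False
    define S where "S = P / 2 * q * r powr (q - 1)"
    have S: "S > 0" using P q rs by (simp add: S_def)
    have G: "(\<omega> r - r * p r) / r\<^sup>2 = S / (1 + q)"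
      using neargap[of r] False rs q(1) by (simp add: S_def powr_diff power2_eq_square mult_ac del: distrib_left_numeral)
    have "1 \<le> 3 / (q * (1 + q))" "1 \<le> 3 / (1 + q)"
    proof -
      have "q * (1 + q) \<le> 1 * 2" using q by (intro mult_mono) auto
      then show "1 \<le> 3 / (q * (1 + q))" "1 \<le> 3 / (1 + q)" using q by simp_all
    qed
    have rhs: "3 / q * (\<omega> r - r * p r) / r\<^sup>2 = 3 / (q * (1 + q)) * S"
      unfolding times_divide_eq_right[symmetric] G by simp
    have c1: "S \<le> 3 / q * (\<omega> r - r * p r) / r\<^sup>2"
      unfolding rhs using mult_right_mono[OF \<open>1 \<le> 3 / (q * (1 + q))\<close>, of S] S by simp
    have c2: "P / 2 \<le> 3 / q * (\<omega> r - r * p r) / r\<^sup>2"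
    proof -
      have "1 \<le> r powr (q - 1)" using powr_mono2'[of "q - 1" r 1] rs False q by simp
      then have "P / 2 * q * 1 \<le> S" unfolding S_def using P q by (intro mult_left_mono) auto
      then have "P / 2 \<le> S / q" using q by (simp add: field_simps)
      also have "\<dots> = 1 * (S / q)" by simp
      also have "\<dots> \<le> 3 / (1 + q) * (S / q)" using S q by (intro mult_right_mono \<open>1 \<le> 3 / (1 + q)\<close>) auto
      also have "\<dots> = 3 / (q * (1 + q)) * S" using q by simp
      finally show ?thesis unfolding rhs .
    qed
    show ?thesis
    proof (cases "s \<le> 1")
      case True
      have "S * (s - r) \<le> 3 / q * (\<omega> r - r * p r) / r\<^sup>2 * (s - r)" using c1 rs by (intro mult_right_mono) auto
      then show ?thesis using slope_near[OF rs True] by (simp add: S_def)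
    next
      case s1: False
      have "p r - p 1 \<le> S * (1 - r)" using slope_near[of r 1] False rs by (simp add: S_def)
      also have "\<dots> \<le> 3 / q * (\<omega> r - r * p r) / r\<^sup>2 * (1 - r)" using c1 False by (intro mult_right_mono) auto
      finally have 1: "p r - p 1 \<le> 3 / q * (\<omega> r - r * p r) / r\<^sup>2 * (1 - r)" .
      have "p 1 - p s \<le> \<alpha> * (P / 2) * (s - 1)" using slope_far[of 1 s] s1 by (simp add: p1)
      also have "\<dots> \<le> 1 * (P / 2) * (s - 1)" using exponents P s1 by (intro mult_right_mono) auto
      also have "\<dots> \<le> 3 / q * (\<omega> r - r * p r) / r\<^sup>2 * (s - 1)" using c2 s1 by (intro mult_right_mono) auto
      finally have 2: "p 1 - p s \<le> 3 / q * (\<omega> r - r * p r) / r\<^sup>2 * (s - 1)" .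
      have "3 / q * (\<omega> r - r * p r) / r\<^sup>2 * (s - r) = 3 / q * (\<omega> r - r * p r) / r\<^sup>2 * (1 - r) + 3 / q * (\<omega> r - r * p r) / r\<^sup>2 * (s - 1)"
        unfolding distrib_left[symmetric] by simp
      then show ?thesis using 1 2 by linarith
    qed
  qed
  \<comment> \<open>Beyond 1 the slope decays at least like \<open>r powr (- \<mu>)\<close>, and
    \<open>- \<mu> \<le> \<beta> - 1\<close> is the condition \<beta> > 1 - \<alpha> + \<sigma>.
    Integration then gives the bound on \<omega> for every admissible \<beta>.\<close>
  have p_upper: "p r \<le> P * r powr (\<beta> - 1)" if r: "0 < r" and \<beta>: "1 - \<alpha> + \<sigma> < \<beta>" "\<beta> < 1" for r \<beta>
  proof (cases "r \<le> 1")
    case True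
    have "1 \<le> r powr (\<beta> - 1)" using powr_mono2'[of "\<beta> - 1" r 1] r True \<beta> by simp
    then have "P * 1 \<le> P * r powr (\<beta> - 1)" using P by (intro mult_left_mono) auto
    moreover have "p r \<le> P" using True P by (simp add: ple mult_left_le)
    ultimately show ?thesis by simp
  next
    case False
    have "m (1 / r) / m 1 \<le> r powr (- \<mu>)" using m_upper[of r] False m1 by (simp add: powr_minus field_simps)
    also have "\<dots> \<le> r powr (\<beta> - 1)" using False \<beta> by (intro powr_mono) (auto simp: \<mu>_def)
    finally have "P / 2 * (m (1 / r) / m 1) \<le> P * r powr (\<beta> - 1)" using P m1 g(5)[of "1 / r"] r by (intro mult_mono) auto
    then show ?thesis using False by (simp add: pge far_def)
  qed
  show "\<omega> r \<le> P / \<beta> * r powr \<beta>" if r: "0 < r" and \<beta>: "1 - \<alpha> + \<sigma> < \<beta>" "\<beta> < 1" for r \<beta>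
  proof -
    have \<beta>0: "\<beta> > 0" using \<beta> exponents by simp
    have small: "\<omega> r \<le> P / \<beta> * r powr \<beta>" if "0 < r" "r \<le> 1" for r
    proof -
      have "\<omega> r \<le> P * r" using that P q by (simp add: near mult_left_le)
      also have "\<dots> \<le> P * r powr \<beta>" using that P \<beta> powr_mono'[of \<beta> 1 r] by simp
      also have "\<dots> \<le> P / \<beta> * r powr \<beta>" using P \<beta> \<beta>0 by (intro mult_right_mono) (auto simp: field_simps)
      finally show ?thesis .
    qed
    show ?thesis
    proof (cases "r \<le> 1")
      case False
      have "P / \<beta> * 1 powr \<beta> - \<omega> 1 \<le> P / \<beta> * r powr \<beta> - \<omega> r"
      proof (rule DERIV_nonneg_imp_nondecreasing[of 1 r "\<lambda>r. P / \<beta> * r powr \<beta> - \<omega> r"])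
        show "1 \<le> r" using False by simp
        fix x :: real assume "1 \<le> x" "x \<le> r"
        then have x: "x > 0" by simp
        have "((\<lambda>r. P / \<beta> * r powr \<beta> - \<omega> r) has_real_derivative P * x powr (\<beta> - 1) - p x) (at x)"
          using x \<beta>0 by (auto intro!: derivative_eq_intros d)
        then show "\<exists>y. ((\<lambda>r. P / \<beta> * r powr \<beta> - \<omega> r) has_real_derivative y) (at x) \<and> 0 \<le> y"
          using p_upper[OF x \<beta>] by (intro exI[of _ "P * x powr (\<beta> - 1) - p x"]) simp
      qed
      then show ?thesis using small[of 1] by simp
    qed (use small r in auto)
  qed
  \<comment> \<open>Since \<alpha> \<le> 1, \<open>m (1 / x) \<ge> m 1 / x\<close> for
    \<open>x \<ge> 1\<close>, so the slope is at least \<open>P / (2 * x)\<close> and the growth at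
    least logarithmic.\<close>
  show "filterlim \<omega> at_top at_top"
  proof (rule filterlim_at_top_mono)
    show "filterlim (\<lambda>s::real. P / 2 * ln s) at_top at_top" using P by real_asymp
    show "\<forall>\<^sub>F s in at_top. P / 2 * ln s \<le> \<omega> s"
      using eventually_ge_at_top[of 1]
    proof eventually_elim
      case (elim s)
      have "\<omega> 1 - P / 2 * ln 1 \<le> \<omega> s - P / 2 * ln s"
      proof (rule DERIV_nonneg_imp_nondecreasing[OF elim])
        fix x :: real assume x: "1 \<le> x" "x \<le> s"
        have "((\<lambda>s. \<omega> s - P / 2 * ln s) has_real_derivative p x - P / 2 * (1 / x)) (at x)"
          using x by (intro DERIV_diff d DERIV_cmult DERIV_ln_divide) auto
        moreover have "0 \<le> p x - P / 2 * (1 / x)"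
        proof -
          have "m 1 * (1 / x) powr \<alpha> \<le> m (1 / x) * 1 powr \<alpha>" using x by (intro g(2)) auto
          moreover have "m 1 * (1 / x) powr 1 \<le> m 1 * (1 / x) powr \<alpha>"
            using x m1 exponents by (intro mult_left_mono powr_mono') auto
          ultimately have "m 1 * (1 / x) \<le> m (1 / x)" using x by simp
          then have "1 / x \<le> m (1 / x) / m 1" using m1 by (simp add: pos_le_divide_eq mult.commute)
          then have "P / 2 * (1 / x) \<le> P / 2 * (m (1 / x) / m 1)" using P by (intro mult_left_mono) auto
          then show ?thesis using x by (simp add: pge far_def)
        qed
        ultimately show "\<exists>y. ((\<lambda>s. \<omega> s - P / 2 * ln s) has_real_derivative y) (at x) \<and> 0 \<le> y" by blast
      qed
      then show ?case using opos[of 1] by simp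
    qed
  qed
qed

subsection \<open>The regularity estimates\<close>

lemma admissible_velocity_common_constant:
  fixes \<Psi> :: "real^'d::finite \<Rightarrow> real^'d"
  assumes adm: "admissible_velocity \<Psi>"
  shows "\<exists>B. (\<forall>i. hormander_kernel B (\<lambda>x. velocity_kernel \<Psi> x $ i)) \<and> (\<forall>i. cancelling (\<lambda>x. velocity_kernel \<Psi> x $ i))"
proof -
  have c: "continuous_on (- {0}) (velocity_kernel \<Psi>)" using adm by (simp add: admissible_velocity_def)
  define k where "k i x = velocity_kernel \<Psi> x $ i" for i x
  define cz where "cz i B \<longleftrightarrow>
     (\<forall>x. x \<noteq> 0 \<longrightarrow> \<bar>k i x\<bar> \<le> B / norm x ^ CARD('d)) \<and>
     (\<forall>y. y \<noteq> 0 \<longrightarrow> (\<integral>\<^sup>+ x\<in>{x. 2 * norm y < norm x}. ennreal \<bar>k i x - k i (x - y)\<bar> \<partial>lebesgue) \<le> ennreal B) \<and>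
     cancelling (k i)" for i B
  have "\<exists>B. cz i B" for i
    using adm unfolding admissible_velocity_def cz_kernel_def cz_def cancelling_def k_def by blast
  then obtain b where "\<And>i. cz i (b i)" by metis
  then have b: "\<And>i x. x \<noteq> 0 \<Longrightarrow> \<bar>k i x\<bar> \<le> b i / norm x ^ CARD('d)"
    "\<And>i y. y \<noteq> 0 \<Longrightarrow> (\<integral>\<^sup>+ x\<in>{x. 2 * norm y < norm x}. ennreal \<bar>k i x - k i (x - y)\<bar> \<partial>lebesgue) \<le> ennreal (b i)"
    "\<And>i. cancelling (k i)"
    unfolding cz_def by blast+
  note b = b[unfolded k_def]
  define B where "B = (\<Sum>i\<in>UNIV. \<bar>b i\<bar>)"
  have bB: "b i \<le> B" for i
  proof -
    have "\<bar>b i\<bar> \<le> B" unfolding B_def by (rule member_le_sum) auto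
    then show ?thesis by simp
  qed
  have "hormander_kernel B (\<lambda>x. velocity_kernel \<Psi> x $ i)" for i
    unfolding hormander_kernel_def
  proof (intro conjI allI impI)
    show "0 \<le> B" unfolding B_def by (intro sum_nonneg) auto
    have "velocity_kernel \<Psi> \<in> borel_measurable borel" by (rule borel_measurable_off_zero[OF c])
    then show "(\<lambda>x. velocity_kernel \<Psi> x $ i) \<in> borel_measurable borel"
      by (intro borel_measurable_continuous_on[where f="\<lambda>v. v $ i"] continuous_intros)
    show "\<bar>velocity_kernel \<Psi> x $ i\<bar> \<le> B / norm x ^ DIM(real^'d)" if "x \<noteq> 0" for x
      using b(1)[OF that, of i] divide_right_mono[OF bB[of i], of "norm x ^ CARD('d)"] by simp
    show "(\<integral>\<^sup>+ x\<in>{x. 2 * norm y < norm x}. ennreal \<bar>velocity_kernel \<Psi> x $ i - velocity_kernel \<Psi> (x - y) $ i\<bar> \<partial>lborel) \<le> ennreal B" if "y \<noteq> 0" for y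
      using order_trans[OF b(2)[OF that, of i] ennreal_leI[OF bB]] by (simp add: nn_integral_completion)
  qed
  then show ?thesis using b(3) by blast
qed

lemma holder_seminorm_le:
  assumes "\<And>x y. x \<noteq> y \<Longrightarrow> f x - f y \<le> C * norm (x - y) powr \<beta>"
  shows "holder_seminorm \<beta> f \<le> ereal C"
  unfolding holder_seminorm_def
proof (rule SUP_least, clarify)
  fix x y :: 'a assume xy: "x \<noteq> y"
  have "\<bar>f x - f y\<bar> \<le> C * norm (x - y) powr \<beta>"
    using assms[OF xy] assms[OF xy[symmetric]] by (simp add: abs_le_iff norm_minus_commute)
  then show "ereal (\<bar>f x - f y\<bar> / norm (x - y) powr \<beta>) \<le> ereal C" using xy by (simp add: pos_divide_le_eq)
qed

text \<open>\<open>P\<close> is the value for which \<open>9 * P / (q^2 * m 1)\<close> equals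
  \<open>modulus_const\<close>, so the modulus depends on the operators alone. The datum only
  decides the starting radius \<open>R\<close>, and with it the time.\<close>

theorem (in drift_diffusion) lipschitz_case_estimate:
  assumes \<sigma>: "0 \<le> \<sigma>" and th0: "\<theta>\<^sub>0 \<in> Linf"
  defines "P \<equiv> modulus_const a B c\<^sub>1 * ((\<alpha> - \<sigma>) / 2)\<^sup>2 * m 1 / 9"
  shows "\<exists>t\<^sub>1>0. \<forall>\<beta>\<in>{1 - \<alpha> + \<sigma><..<1}. \<forall>\<epsilon>>0. \<forall>\<theta>. regularized_solution a \<Psi> K \<theta>\<^sub>0 \<epsilon> \<theta> \<longrightarrow>
    (SUP t\<in>{t\<^sub>1..}. holder_seminorm \<beta> (\<theta> t)) \<le> ereal (P / \<beta>)"
proof -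
  define M where "M = Linf_norm \<theta>\<^sub>0"
  define q where "q = (\<alpha> - \<sigma>) / 2"
  define \<omega> where "\<omega> = lipschitz_modulus m q P"
  define p where "p = lipschitz_slope m q P"
  define b where "b = lipschitz_exponent q"
  have B0: "B \<ge> 0" using kernel_hormander by (simp add: hormander_kernel_def)
  have c1: "c\<^sub>1 \<ge> 1" by (rule case_I_kernel(2)[OF diffusion exponents])
  have c2: "modulus_const a B c\<^sub>1 > 0" by (rule modulus_const_pos[OF B0 c1])
  have c0: "dissipation_const CARD('d) c\<^sub>1 > 0" using c1 by (simp add: dissipation_const_def)
  have q: "q > 0" using exponents by (simp add: q_def)
  have m1: "m 1 > 0" by (rule case_I_growth(5)[OF diffusion]) simp
  have P: "P > 0" using c2 q m1 by (simp add: P_def q_def)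
  have Pq: "9 * P / (q\<^sup>2 * m 1) = modulus_const a B c\<^sub>1"
    using q m1 unfolding P_def q_def[symmetric] by simp
  note lm = lipschitz_modulus[OF diffusion exponents(1,2) \<sigma> exponents(3) P, folded q_def, folded \<omega>_def p_def b_def, unfolded Pq]
  interpret dm: drift_diffusion_modulus a \<Psi> K m c\<^sub>1 \<alpha> \<sigma> B \<omega> p
    by (rule drift_diffusion_modulusI[of \<omega> p b, OF lm(1,2) less_imp_le[OF lm(3)] lm(4,5,6) lm(7)[THEN conjunct1] lm(7)[THEN conjunct2] lm(8,9)])
  \<comment> \<open>Beyond 1 the intercept is at least \<open>q / 3\<close> times \<omega>; the
    threshold makes that at least \<open>2 * \<bar>M\<bar> + q / 3\<close>, strictly above
    \<open>2 * M\<close>.\<close>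
  have "\<forall>\<^sub>F r in at_top. 1 \<le> r \<and> 6 * \<bar>M\<bar> / q + 1 \<le> \<omega> r"
    using eventually_ge_at_top lm(6) by (intro eventually_conj) (auto simp: filterlim_at_top)
  then obtain R where R: "1 \<le> R" "6 * \<bar>M\<bar> / q + 1 \<le> \<omega> R" by (metis (lifting) eventually_at_top_linorder order_refl)
  have init: "2 * M < \<omega> R - R * p R"
  proof -
    have "q / 3 * (6 * \<bar>M\<bar> / q + 1) \<le> q / 3 * \<omega> R" using R q by (intro mult_left_mono) auto
    moreover have "R * p R \<le> (1 - q / 3) * \<omega> R" using lm(8)[of R R] R by (simp add: b_def lipschitz_exponent_def)
    moreover have "q / 3 * (6 * \<bar>M\<bar> / q + 1) = 2 * \<bar>M\<bar> + q / 3" using q by (simp add: field_simps)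
    moreover have "(1 - q / 3) * \<omega> R = \<omega> R - q / 3 * \<omega> R" by (simp add: algebra_simps)
    ultimately show ?thesis using q by linarith
  qed
  define t1 where "t1 = 8 * (3 / q) / (dissipation_const CARD('d) c\<^sub>1 * (\<alpha> - \<sigma>) * m (1 / R))"
  have "m (1 / R) > 0" using R by (intro case_I_growth(5)[OF diffusion]) simp
  then have "t1 > 0" using q c0 exponents by (simp add: t1_def)
  moreover have "\<theta> t x - \<theta> t y \<le> P / \<beta> * norm (x - y) powr \<beta>"
    if "\<beta> \<in> {1 - \<alpha> + \<sigma><..<1}" "\<epsilon> > 0" "regularized_solution a \<Psi> K \<theta>\<^sub>0 \<epsilon> \<theta>" "t1 \<le> t" "x \<noteq> y"
    for \<beta> \<epsilon> \<theta> t x y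
  proof -
    have "\<theta> t x - \<theta> t y \<le> \<omega> (norm (x - y))"
    proof (rule dm.eventual_modulus[OF that(3) th0 that(2) \<sigma> _ lm(10) _ _ _ that(5)])
      show "8 * (3 / q) / (dissipation_const CARD('d) c\<^sub>1 * (\<alpha> - \<sigma>) * m (1 / R)) \<le> t"
        using that(4) by (simp only: t1_def)
    qed (use q R init in \<open>auto simp: M_def\<close>)
    also have "\<dots> \<le> P / \<beta> * norm (x - y) powr \<beta>" using that(1,5) by (intro lm(11)) auto
    finally show ?thesis .
  qed
  ultimately show ?thesis
    by (intro exI[of _ t1] conjI ballI allI impI SUP_least holder_seminorm_le) auto
qed

theorem proposition1p3:
  fixes a :: "real^'d::finite" and \<Psi> :: "real^'d \<Rightarrow> real^'d" and c\<^sub>1 :: real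
  assumes "admissible_velocity \<Psi>"
  shows
    "(\<forall>(\<alpha>::real) (\<sigma>::real) (K :: real^'d \<Rightarrow> real) m.
        0 < \<alpha> \<and> \<alpha> \<le> 1 \<and> 0 \<le> \<sigma> \<and> \<sigma> < 1 \<and> \<sigma> < \<alpha> \<and> case_I K m c\<^sub>1 \<alpha> \<sigma> \<longrightarrow>
        (\<exists>C :: real \<Rightarrow> real \<Rightarrow> real. \<forall>\<theta>\<^sub>0\<in>Linf. \<exists>t\<^sub>1>0. \<forall>\<beta>\<in>{1 - \<alpha> + \<sigma><..<1}.
           \<forall>\<epsilon>>0. \<forall>\<theta>. regularized_solution a \<Psi> K \<theta>\<^sub>0 \<epsilon> \<theta> \<longrightarrow>
             (SUP t\<in>{t\<^sub>1..}. holder_seminorm \<beta> (\<theta> t)) \<le> ereal (C (Linf_norm \<theta>\<^sub>0) \<beta>)))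
     \<and>
     (\<forall>C\<^sub>0>0. \<exists>C>0. \<exists>C'>0. \<exists>C''>0. \<forall>(\<alpha>::real) (K :: real^'d \<Rightarrow> real) m.
        0 < \<alpha> \<and> \<alpha> < 1 \<and> case_I K m c\<^sub>1 \<alpha> 0 \<and> (\<forall>r>0. m r = C\<^sub>0 * r powr \<alpha>) \<longrightarrow>
        (\<forall>\<theta>\<^sub>0\<in>Linf. Linf_norm \<theta>\<^sub>0 \<noteq> 0 \<longrightarrow> (\<forall>\<beta>\<in>{1 - \<alpha><..<1}.
           let \<gamma> = 1 / C * min ((1 - \<beta>) ^ 3 * \<alpha>) (\<beta> * (1 - \<beta>)\<^sup>2) in
           \<exists>t\<^sub>1>0.
             t\<^sub>1 \<le> C' / (1 - \<beta>) * (4 * (1 - \<alpha>) / (\<alpha> * \<gamma>)) powr (\<alpha> / (1 - \<alpha>))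
                     * Linf_norm \<theta>\<^sub>0 powr (\<alpha> / (1 - \<alpha>)) \<and>
             (\<forall>\<epsilon>>0. \<forall>\<theta>. regularized_solution a \<Psi> K \<theta>\<^sub>0 \<epsilon> \<theta> \<longrightarrow>
                (SUP t\<in>{t\<^sub>1..}. holder_seminorm \<beta> (\<theta> t))
                  \<le> ereal ((1 - \<beta>)\<^sup>2 / C''
                       * ((1 - \<alpha>) / (\<alpha> * \<gamma>)) powr (- ((\<beta> - 1 + \<alpha>) / (1 - \<alpha>)))
                       * Linf_norm \<theta>\<^sub>0 powr (- ((\<beta> - 1 + \<alpha>) / (1 - \<alpha>))))))))"
proof -
  obtain B where B: "\<And>i. hormander_kernel B (\<lambda>x. velocity_kernel \<Psi> x $ i)" "\<And>i. cancelling (\<lambda>x. velocity_kernel \<Psi> x $ i)"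
    using admissible_velocity_common_constant[OF assms] by blast
  have c: "continuous_on (- {0}) (velocity_kernel \<Psi>)" using assms by (simp add: admissible_velocity_def)
  have B0: "B \<ge> 0" using B(1) by (simp add: hormander_kernel_def)
  have dd: "drift_diffusion \<Psi> K m c\<^sub>1 \<alpha> \<sigma> B" if "0 < \<alpha>" "\<alpha> \<le> 1" "\<sigma> < \<alpha>" "case_I K m c\<^sub>1 \<alpha> \<sigma>" for K m \<alpha> \<sigma>
    using that c B by unfold_locales auto
  show ?thesis
  proof (intro conjI allI impI)
    fix \<alpha> \<sigma> :: real and K :: "real^'d \<Rightarrow> real" and m
    assume h: "0 < \<alpha> \<and> \<alpha> \<le> 1 \<and> 0 \<le> \<sigma> \<and> \<sigma> < 1 \<and> \<sigma> < \<alpha> \<and> case_I K m c\<^sub>1 \<alpha> \<sigma>"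
    interpret drift_diffusion a \<Psi> K m c\<^sub>1 \<alpha> \<sigma> B using dd h by blast
    define P where "P = modulus_const a B c\<^sub>1 * ((\<alpha> - \<sigma>) / 2)\<^sup>2 * m 1 / 9"
    have \<sigma>: "0 \<le> \<sigma>" using h by simp
    show "\<exists>C :: real \<Rightarrow> real \<Rightarrow> real. \<forall>\<theta>\<^sub>0\<in>Linf. \<exists>t\<^sub>1>0. \<forall>\<beta>\<in>{1 - \<alpha> + \<sigma><..<1}.
           \<forall>\<epsilon>>0. \<forall>\<theta>. regularized_solution a \<Psi> K \<theta>\<^sub>0 \<epsilon> \<theta> \<longrightarrow>
             (SUP t\<in>{t\<^sub>1..}. holder_seminorm \<beta> (\<theta> t)) \<le> ereal (C (Linf_norm \<theta>\<^sub>0) \<beta>)"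
    \<comment> \<open>The witness ignores its first argument: the Hoelder constant comes from the
      modulus, and the size of the datum affects only the time.\<close>
    proof (intro exI[of _ "\<lambda>_ \<beta>. P / \<beta>"] ballI)
      fix \<theta>\<^sub>0 :: "real^'d \<Rightarrow> real" assume th0: "\<theta>\<^sub>0 \<in> Linf"
      show "\<exists>t\<^sub>1>0. \<forall>\<beta>\<in>{1 - \<alpha> + \<sigma><..<1}. \<forall>\<epsilon>>0. \<forall>\<theta>. regularized_solution a \<Psi> K \<theta>\<^sub>0 \<epsilon> \<theta> \<longrightarrow>
             (SUP t\<in>{t\<^sub>1..}. holder_seminorm \<beta> (\<theta> t)) \<le> ereal (P / \<beta>)"
        by (rule lipschitz_case_estimate[OF \<sigma> th0, folded P_def])
    qed
  next
    fix C\<^sub>0 :: real assume C0: "0 < C\<^sub>0"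
    define c2 where "c2 = modulus_const a B c\<^sub>1 * C\<^sub>0"
    define C' where "C' = 8 / (dissipation_const CARD('d) c\<^sub>1 * C\<^sub>0)"
    show "\<exists>C>0. \<exists>C'>0. \<exists>C''>0. \<forall>(\<alpha>::real) (K :: real^'d \<Rightarrow> real) m.
        0 < \<alpha> \<and> \<alpha> < 1 \<and> case_I K m c\<^sub>1 \<alpha> 0 \<and> (\<forall>r>0. m r = C\<^sub>0 * r powr \<alpha>) \<longrightarrow>
        (\<forall>\<theta>\<^sub>0\<in>Linf. Linf_norm \<theta>\<^sub>0 \<noteq> 0 \<longrightarrow> (\<forall>\<beta>\<in>{1 - \<alpha><..<1}.
           let \<gamma> = 1 / C * min ((1 - \<beta>) ^ 3 * \<alpha>) (\<beta> * (1 - \<beta>)\<^sup>2) in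
           \<exists>t\<^sub>1>0.
             t\<^sub>1 \<le> C' / (1 - \<beta>) * (4 * (1 - \<alpha>) / (\<alpha> * \<gamma>)) powr (\<alpha> / (1 - \<alpha>))
                     * Linf_norm \<theta>\<^sub>0 powr (\<alpha> / (1 - \<alpha>)) \<and>
             (\<forall>\<epsilon>>0. \<forall>\<theta>. regularized_solution a \<Psi> K \<theta>\<^sub>0 \<epsilon> \<theta> \<longrightarrow>
                (SUP t\<in>{t\<^sub>1..}. holder_seminorm \<beta> (\<theta> t))
                  \<le> ereal ((1 - \<beta>)\<^sup>2 / C''
                       * ((1 - \<alpha>) / (\<alpha> * \<gamma>)) powr (- ((\<beta> - 1 + \<alpha>) / (1 - \<alpha>)))
                       * Linf_norm \<theta>\<^sub>0 powr (- ((\<beta> - 1 + \<alpha>) / (1 - \<alpha>)))))))"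
    \<comment> \<open>The constants are chosen before any kernel satisfying \<open>case_I\<close> is
      given, so their positivity needs \<open>c\<^sub>1 \<ge> 1\<close> as a separate case;
      otherwise \<open>case_I\<close> fails and the claim is vacuous.\<close>
    proof (cases "1 \<le> c\<^sub>1")
      case False
      then have "\<not> case_I K m c\<^sub>1 \<alpha> 0" for K :: "real^'d \<Rightarrow> real" and m \<alpha> unfolding case_I_def by blast
      then show ?thesis by (intro exI[of _ "1::real"] conjI) auto
    next
      case c1: True
      have c2: "c2 > 0" using modulus_const_pos[OF B0 c1, of a] C0 by (simp add: c2_def)
      have C': "C' > 0" using c1 C0 by (simp add: C'_def dissipation_const_def)
      show ?thesis
      \<comment> \<open>\<open>2 / c2\<close> is forced by the inequality \<open>key\<close> of the
        power case and \<open>1 / c2\<close> by \<open>\<kappa> = c2 * (1 - \<beta>)^2\<close>.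
        \<open>C'\<close> is the travel time of \<open>eventual_modulus\<close> with slope constant
        \<open>\<alpha> / (1 - \<beta>)\<close>, whose \<alpha> cancels against \<alpha> - \<sigma>
        = \<alpha>.\<close>
      proof (rule exI[of _ "2 / c2"], rule conjI, use c2 in simp, rule exI[of _ C'], rule conjI[OF C'],
          rule exI[of _ "1 / c2"], rule conjI, use c2 in simp, intro allI impI ballI)
        fix \<alpha> :: real and K :: "real^'d \<Rightarrow> real" and m and \<theta>\<^sub>0 :: "real^'d \<Rightarrow> real" and \<beta> :: real
        assume h: "0 < \<alpha> \<and> \<alpha> < 1 \<and> case_I K m c\<^sub>1 \<alpha> 0 \<and> (\<forall>r>0. m r = C\<^sub>0 * r powr \<alpha>)"
          and th0: "\<theta>\<^sub>0 \<in> Linf" and M0: "Linf_norm \<theta>\<^sub>0 \<noteq> 0" and \<beta>: "\<beta> \<in> {1 - \<alpha><..<1}"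
        interpret drift_diffusion a \<Psi> K m c\<^sub>1 \<alpha> 0 B using dd[of \<alpha> 0] h by simp
        have M: "Linf_norm \<theta>\<^sub>0 > 0" using M0 Linf_AE_bound(2)[OF th0] by simp
        define \<gamma> where "\<gamma> = 1 / (2 / c2) * min ((1 - \<beta>) ^ 3 * \<alpha>) (\<beta> * (1 - \<beta>)\<^sup>2)"
        define t1 where "t1 = C' / (1 - \<beta>) * (4 * (1 - \<alpha>) / (\<alpha> * \<gamma>)) powr (\<alpha> / (1 - \<alpha>)) * Linf_norm \<theta>\<^sub>0 powr (\<alpha> / (1 - \<alpha>))"
        have "\<gamma> > 0" unfolding \<gamma>_def using c2 h \<beta> by simp
        then have t1: "t1 > 0" unfolding t1_def using C' \<beta> h M by simp
        have ab: "\<alpha> < 1" "1 - \<alpha> < \<beta>" "\<beta> < 1" and me: "\<And>r. r > 0 \<Longrightarrow> m r = C\<^sub>0 * r powr \<alpha>" using h \<beta> by auto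
        note est = power_case_estimate[OF _ th0 _ refl ab(1) C0 me ab(2,3) M, folded c2_def C'_def, folded \<gamma>_def, folded t1_def]
        show "let \<gamma> = 1 / (2 / c2) * min ((1 - \<beta>) ^ 3 * \<alpha>) (\<beta> * (1 - \<beta>)\<^sup>2) in
           \<exists>t\<^sub>1>0.
             t\<^sub>1 \<le> C' / (1 - \<beta>) * (4 * (1 - \<alpha>) / (\<alpha> * \<gamma>)) powr (\<alpha> / (1 - \<alpha>))
                     * Linf_norm \<theta>\<^sub>0 powr (\<alpha> / (1 - \<alpha>)) \<and>
             (\<forall>\<epsilon>>0. \<forall>\<theta>. regularized_solution a \<Psi> K \<theta>\<^sub>0 \<epsilon> \<theta> \<longrightarrow>
                (SUP t\<in>{t\<^sub>1..}. holder_seminorm \<beta> (\<theta> t))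
                  \<le> ereal ((1 - \<beta>)\<^sup>2 / (1 / c2)
                       * ((1 - \<alpha>) / (\<alpha> * \<gamma>)) powr (- ((\<beta> - 1 + \<alpha>) / (1 - \<alpha>)))
                       * Linf_norm \<theta>\<^sub>0 powr (- ((\<beta> - 1 + \<alpha>) / (1 - \<alpha>)))))"
          unfolding Let_def \<gamma>_def[symmetric] t1_def[symmetric]
        proof (intro exI[of _ t1] conjI t1 order_refl allI impI SUP_least holder_seminorm_le)
          fix \<epsilon> :: real and \<theta> :: "real \<Rightarrow> real^'d \<Rightarrow> real" and t :: real and x y :: "real^'d"
          assume "\<epsilon> > 0" "regularized_solution a \<Psi> K \<theta>\<^sub>0 \<epsilon> \<theta>" "t \<in> {t1..}" "x \<noteq> y"
          then show "\<theta> t x - \<theta> t y \<le> (1 - \<beta>)\<^sup>2 / (1 / c2)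
                       * ((1 - \<alpha>) / (\<alpha> * \<gamma>)) powr (- ((\<beta> - 1 + \<alpha>) / (1 - \<alpha>)))
                       * Linf_norm \<theta>\<^sub>0 powr (- ((\<beta> - 1 + \<alpha>) / (1 - \<alpha>))) * norm (x - y) powr \<beta>"
            by (intro est) auto
        qed
      qed
    qed
  qed
qed

end
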